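(* Let $a,b>0$ be constants with $a+b<\tfrac12$. There exists $\varepsilon_0>0$ such that for every fixed $0<\varepsilon<\varepsilon_0$ the following holds. Consider data $m,n,\boldsymbol{s},\boldsymbol{t},H$ (as in the context) with $m,n\to\infty$, such that, uniformly over $1\le j\le m$, $1\le k\le n$: $s_j-s$, $x_j$, $t_k-t$ and $y_k$ are $O(n^{1/2+\varepsilon})$; $X=O(n^{1+2\varepsilon})$; $n=o(m^{1+\varepsilon})$ and $m=o(n^{1+\varepsilon})$; and \[ \frac{(1-2\lambda)^2}{8A}\Bigl(1+\frac{5m}{6n}+\frac{5n}{6m}\Bigr)\le a\log n. \] Then \[ |\mathcal{B}(\boldsymbol{s},\boldsymbol{t},H)| = \binom{mn-X}{\lambda mn}^{-1}\prod_{j=1}^m\binom{n-x_j}{s_j}\prod_{k=1}^n\binom{m-y_k}{t_k}\,\exp\Bigl(-\frac12\Bigl(1-\frac{R}{2Amn}\Bigr)\Bigl(1-\frac{C}{2Amn}\Bigr)-\frac{Y}{2Amn}+O(n^{-b})\Bigr). \]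
   Context: Let $\boldsymbol{s}=(s_1,\dots,s_m)$ and $\boldsymbol{t}=(t_1,\dots,t_n)$ be vectors of positive integers with $\sum_j s_j=\sum_k t_k$. $\mathcal{B}(\boldsymbol{s},\boldsymbol{t})$ is the set of simple bipartite graphs on vertex set $\{u_1,\dots,u_m\}\cup\{v_1,\dots,v_n\}$ (all edges join some $u_j$ to some $v_k$) in which $u_j$ has degree $s_j$ and $v_k$ has degree $t_k$ for all $j,k$ (equivalently $m\times n$ 0-1 matrices with row sums $\boldsymbol{s}$ and column sums $\boldsymbol{t}$). $H$ is a fixed bipartite graph on the same vertex set (edges only between $u$'s and $v$'s); $x_j$ and $y_k$ are the degrees of $u_j$ and $v_k$ in $H$. $\mathcal{B}(\boldsymbol{s},\boldsymbol{t},H)$ is the set of graphs in $\mathcal{B}(\boldsymbol{s},\boldsymbol{t})$ that are edge-disjoint from $H$. Define $s=m^{-1}\sum_j s_j$, $t=n^{-1}\sum_k t_k$, $\lambda=s/n=t/m$, $A=\tfrac12\lambda(1-\lambda)$, $\delta_j=s_j-s+\lambda x_j$, $\eta_k=t_k-t+\lambda y_k$, $X=\sum_j x_j=\sum_k y_k$, $Y=\sum_{u_jv_k\in E(H)}\delta_j\eta_k$, $R=\sum_{j=1}^m(s_j-s)^2$, $C=\sum_{k=1}^n(t_k-t)^2$. All asymptotic notation refers to $m,n\to\infty$; constants implicit in the hypotheses are arbitrary but fixed. *)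

theory Defs
  imports Complex_Main "HOL-Library.Landau_Symbols"
begin

text \<open>Vertices u_1..u_m are encoded as row indices j < m, vertices v_1..v_n as
column indices k < n; a bipartite graph is a set of pairs (j,k), i.e. an edge u_j v_k.\<close>

definition bip_graphs ::
  "nat \<Rightarrow> nat \<Rightarrow> (nat \<Rightarrow> nat) \<Rightarrow> (nat \<Rightarrow> nat) \<Rightarrow> (nat \<times> nat) set \<Rightarrow> (nat \<times> nat) set set"
  where "bip_graphs m n s t H =
    {G. G \<subseteq> {..<m} \<times> {..<n}
        \<and> (\<forall>j<m. card {k. (j, k) \<in> G} = s j)
        \<and> (\<forall>k<n. card {j. (j, k) \<in> G} = t k)
        \<and> G \<inter> H = {}}"

definition degU :: "(nat \<times> nat) set \<Rightarrow> nat \<Rightarrow> nat"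
  where "degU H j = card {k. (j, k) \<in> H}"

definition degV :: "(nat \<times> nat) set \<Rightarrow> nat \<Rightarrow> nat"
  where "degV H k = card {j. (j, k) \<in> H}"

definition avg_s :: "nat \<Rightarrow> (nat \<Rightarrow> nat) \<Rightarrow> real"
  where "avg_s m s = (\<Sum>j<m. real (s j)) / real m"

definition dens :: "nat \<Rightarrow> nat \<Rightarrow> (nat \<Rightarrow> nat) \<Rightarrow> real"
  where "dens m n s = avg_s m s / real n"

definition Acoef :: "nat \<Rightarrow> nat \<Rightarrow> (nat \<Rightarrow> nat) \<Rightarrow> real"
  where "Acoef m n s = dens m n s * (1 - dens m n s) / 2"

definition Xtot :: "(nat \<times> nat) set \<Rightarrow> nat"
  where "Xtot H = card H"

definition Ysum :: "nat \<Rightarrow> nat \<Rightarrow> (nat \<Rightarrow> nat) \<Rightarrow> (nat \<Rightarrow> nat) \<Rightarrow> (nat \<times> nat) set \<Rightarrow> real"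
  where "Ysum m n s t H =
    (\<Sum>(j, k)\<in>H. (real (s j) - avg_s m s + dens m n s * real (degU H j))
               * (real (t k) - avg_s n t + dens m n s * real (degV H k)))"

definition Rsum :: "nat \<Rightarrow> (nat \<Rightarrow> nat) \<Rightarrow> real"
  where "Rsum m s = (\<Sum>j<m. (real (s j) - avg_s m s)\<^sup>2)"

end

theory Submission
  imports Defs "HOL-Library.FuncSet"
begin

text \<open>
  Let \<open>Th t\<close> be the number of graphs with column sums \<open>t\<close>, divided by the product of the column
  binomials and by the exponential factor \<open>exp (phi t)\<close> of the claimed formula. Counting
  the ways to move an entry from one column to another expresses the effect on \<open>Th\<close> of moving one
  unit between two column sums through the joint moments of codegrees in a random graph. Those moments
  are found by resampling the free entries of two columns uniformly, which preserves the uniform measure.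
  The factors cancel to the order that matters, so \<open>Th\<close> is almost constant over all typical column sums.

  The constant is found by averaging. Summed over all \<open>t\<close>, the graphs with row sums \<open>s\<close> are counted by
  the product of the row binomials, and the products of column binomials add up to the single binomial
  coefficient which counts all graphs with the right number of edges. In both models almost all
  graphs have typical column sums, and \<open>phi\<close> of the column sums is close to 0: its mean and
  its variance vanish asymptotically.
\<close>

section \<open>Averages over finite sets\<close>

text \<open>Two admissible vectors of column sums may differ by order r in each of n = r^2 columns,
  so a path of unit moves between them has order r^3 steps, and each step must be known to relative
  accuracy r^-4 for a total error of r^-1. This fixes the precision needed elsewhere: edge
  probabilities up to r^-2, mean codegrees up to r^-1, their second moments up to r. The obstacle is
  H. One column may contain order r forbidden entries, which spoils these accuracies, but all
  columns together contain only order n. Errors therefore carry a weight 1 + y k that is summed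
  along the path, and moves are routed through a column with few forbidden entries, so that weights
  add instead of multiplying. Absolute values come from comparisons: an exchange compares two
  columns, the row sums fix the total over all columns, and averaging the comparisons isolates one
  column. Powers of Q are bookkeeping for factors n^(O(epsilon)). One factor r pays for 100 of them,
  and the last error is Q^75 / r; with Q = n^(7 epsilon) this limits epsilon.\<close>

definition mean :: "'a set \<Rightarrow> ('a \<Rightarrow> real) \<Rightarrow> real"
  where "mean A f = (\<Sum>x\<in>A. f x) / real (card A)"

lemma mean_add: "mean A (\<lambda>x. f x + g x) = mean A f + mean A g"
  by (simp add: mean_def sum.distrib add_divide_distrib)

lemma mean_diff: "mean A (\<lambda>x. f x - g x) = mean A f - mean A g"
  by (simp add: mean_def sum_subtractf diff_divide_distrib)

lemma mean_cmult: "mean A (\<lambda>x. c * f x) = c * mean A f"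
  by (simp add: mean_def sum_distrib_left)

lemma mean_multc: "mean A (\<lambda>x. f x * c) = mean A f * c"
  by (simp add: mean_def sum_distrib_right)

lemma mean_divc: "mean A (\<lambda>x. f x / c) = mean A f / c"
  by (simp add: mean_def sum_divide_distrib[symmetric])

lemma mean_const: "finite A \<Longrightarrow> A \<noteq> {} \<Longrightarrow> mean A (\<lambda>x. c) = c"
  by (simp add: mean_def)

lemma mean_sum: "mean A (\<lambda>x. \<Sum>i\<in>I. f i x) = (\<Sum>i\<in>I. mean A (f i))"
  unfolding mean_def by (subst sum.swap) (simp add: sum_divide_distrib)

lemma mean_cong: "(\<And>x. x \<in> A \<Longrightarrow> f x = g x) \<Longrightarrow> mean A f = mean A g"
  by (simp add: mean_def)

lemma mean_mono: "(\<And>x. x \<in> A \<Longrightarrow> f x \<le> g x) \<Longrightarrow> mean A f \<le> mean A g"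
  by (simp add: mean_def divide_right_mono sum_mono)

lemma mean_nonneg: "(\<And>x. x \<in> A \<Longrightarrow> 0 \<le> f x) \<Longrightarrow> 0 \<le> mean A f"
  by (simp add: mean_def sum_nonneg)

lemma mean_abs_le: "\<bar>mean A f\<bar> \<le> mean A (\<lambda>x. \<bar>f x\<bar>)"
  by (simp add: mean_def divide_right_mono)

lemma mean_abs_bound:
  assumes "\<And>x. x \<in> A \<Longrightarrow> \<bar>f x\<bar> \<le> c" "0 \<le> c"
  shows "\<bar>mean A f\<bar> \<le> c"
proof (cases "finite A \<and> A \<noteq> {}")
  case True
  have "\<bar>mean A f\<bar> \<le> mean A (\<lambda>x. \<bar>f x\<bar>)" by (rule mean_abs_le)
  also have "\<dots> \<le> mean A (\<lambda>x. c)" by (rule mean_mono) (use assms in auto)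
  finally show ?thesis using True by (simp add: mean_const)
next
  \<comment> \<open>On an empty or infinite set the denominator is 0, and hence so is the
    mean.\<close>
  case False
  then show ?thesis using assms by (auto simp: mean_def)
qed

section \<open>Uniformly random subsets of given size\<close>

definition nsub :: "'a set \<Rightarrow> nat \<Rightarrow> 'a set set"
  where "nsub F B = {S. S \<subseteq> F \<and> card S = B}"

lemma finite_nsub: "finite F \<Longrightarrow> finite (nsub F B)"
  by (simp add: nsub_def)

lemma card_nsub: "finite F \<Longrightarrow> card (nsub F B) = card F choose B"
  by (simp add: nsub_def n_subsets)

lemma nsub_nonempty: "finite F \<Longrightarrow> B \<le> card F \<Longrightarrow> nsub F B \<noteq> {}"
  using obtain_subset_with_card_n[of B F] by (auto simp: nsub_def)

lemma card_nsub_superset: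
  assumes "finite F" "T \<subseteq> F" "card T \<le> B"
  shows "card {S \<in> nsub F B. T \<subseteq> S} = (card F - card T) choose (B - card T)"
proof -
  have fT: "finite T" using assms finite_subset by auto
  have "card {S \<in> nsub F B. T \<subseteq> S} = card (nsub (F - T) (B - card T))"
  proof (rule bij_betw_same_card[of "\<lambda>S. S - T"], rule bij_betw_byWitness[where f' = "\<lambda>S. S \<union> T"])
    show "(\<lambda>S. S - T) ` {S \<in> nsub F B. T \<subseteq> S} \<subseteq> nsub (F - T) (B - card T)"
      using fT by (auto simp: nsub_def card_Diff_subset)
    show "(\<lambda>S. S \<union> T) ` nsub (F - T) (B - card T) \<subseteq> {S \<in> nsub F B. T \<subseteq> S}"
    proof safe
      fix S assume S: "S \<in> nsub (F - T) (B - card T)"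
      then have "finite S" using assms(1) by (auto simp: nsub_def intro: finite_subset)
      then have "card (S \<union> T) = card S + card T"
        using S fT by (intro card_Un_disjoint) (auto simp: nsub_def)
      then show "S \<union> T \<in> nsub F B" using S assms by (auto simp: nsub_def)
    qed
  qed (auto simp: nsub_def)
  also have "\<dots> = (card F - card T) choose (B - card T)"
    using assms fT by (simp add: card_nsub card_Diff_subset)
  finally show ?thesis .
qed

lemma binomial_step_down:
  assumes "0 < B" "B \<le> D"
  shows "real ((D - 1) choose (B - 1)) = real (D choose B) * (real B / real D)"
proof -
  obtain b d where bd: "B = Suc b" "D = Suc d" using assms by (metis Suc_le_D gr0_implies_Suc)
  have "Suc b * (Suc d choose Suc b) = Suc d * (d choose b)" by (rule Suc_times_binomial)
  then have "real (Suc b) * real (Suc d choose Suc b) = real (Suc d) * real (d choose b)"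
    by (metis of_nat_mult)
  then show ?thesis unfolding bd by (simp add: field_simps)
qed

lemma mean_nsub_mem:
  assumes "finite F" "B \<le> card F" "i \<in> F"
  shows "mean (nsub F B) (\<lambda>S. of_bool (i \<in> S)) = real B / real (card F)"
proof -
  have *: "(\<Sum>S\<in>nsub F B. of_bool (i \<in> S) :: real) = real (card {S \<in> nsub F B. {i} \<subseteq> S})"
    using finite_nsub[OF assms(1)] by (simp add: Int_def)
  have pos: "card F choose B > 0" using assms by simp
  show ?thesis
  proof (cases "B = 0")
    case True
    then have "{S \<in> nsub F B. {i} \<subseteq> S} = {}"
      using assms(1) by (auto simp: nsub_def dest: finite_subset)
    then show ?thesis using True * by (simp add: mean_def)
  next
    case False
    then have "card {S \<in> nsub F B. {i} \<subseteq> S} = (card F - 1) choose (B - 1)"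
      using card_nsub_superset[of F "{i}" B] assms by simp
    then show ?thesis
      using binomial_step_down[of B "card F"] False assms pos *
      by (simp add: mean_def card_nsub)
  qed
qed

lemma mean_nsub_mem2:
  assumes "finite F" "B \<le> card F" "i \<in> F" "j \<in> F" "i \<noteq> j"
  shows "mean (nsub F B) (\<lambda>S. of_bool (i \<in> S) * of_bool (j \<in> S))
       = real B * (real B - 1) / (real (card F) * (real (card F) - 1))"
proof -
  have "(\<Sum>S\<in>nsub F B. of_bool (i \<in> S) * of_bool (j \<in> S) :: real)
      = (\<Sum>S\<in>nsub F B. of_bool ({i,j} \<subseteq> S))"
    by (intro sum.cong) auto
  also have "\<dots> = real (card {S \<in> nsub F B. {i,j} \<subseteq> S})"
    using finite_nsub[OF assms(1)] by (simp add: Int_def)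
  finally have *: "(\<Sum>S\<in>nsub F B. of_bool (i \<in> S) * of_bool (j \<in> S) :: real) = real (card {S \<in> nsub F B. {i,j} \<subseteq> S})" .
  have pos: "card F choose B > 0" using assms by simp
  have D2: "card F \<ge> 2" using card_mono[of F "{i,j}"] assms by simp
  show ?thesis
  \<comment> \<open>A set with at most one element contains no pair, and the claimed value is 0
    because of the factor B * (B - 1). For larger B the superset count applies and B - 2 is not
    truncated.\<close>
  proof (cases "B \<le> 1")
    case True
    have "{S \<in> nsub F B. {i,j} \<subseteq> S} = {}"
    proof (rule ccontr)
      assume "\<not> ?thesis"
      then obtain S where S: "S \<subseteq> F" "card S = B" "{i,j} \<subseteq> S" by (auto simp: nsub_def)
      then have "card {i,j} \<le> card S" using assms(1) by (metis card_mono finite_subset)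
      then show False using S True assms by simp
    qed
    then have "(\<Sum>S\<in>nsub F B. of_bool (i \<in> S) * of_bool (j \<in> S) :: real) = 0"
      unfolding * by (simp only: card.empty of_nat_0)
    then have "mean (nsub F B) (\<lambda>S. of_bool (i \<in> S) * of_bool (j \<in> S)) = 0"
      unfolding mean_def by simp
    moreover have "real B = 0 \<or> real B = 1" using True by (auto simp: le_Suc_eq)
    ultimately show ?thesis by auto
  next
    case False
    then have "card {S \<in> nsub F B. {i,j} \<subseteq> S} = (card F - 2) choose (B - 2)"
      using card_nsub_superset[of F "{i,j}" B] assms by (simp add: numeral_2_eq_2)
    moreover have "real ((card F - 2) choose (B - 2))
        = real (card F choose B) * (real B / real (card F)) * (real (B - 1) / real (card F - 1))"
      using binomial_step_down[of B "card F"] binomial_step_down[of "B - 1" "card F - 1"] False assms D2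
      by (simp add: numeral_2_eq_2)
    ultimately show ?thesis
      using * pos False D2 assms by (simp add: mean_def card_nsub of_nat_diff)
  qed
qed

lemma sum_subset_of_bool:
  assumes "finite F" "S \<subseteq> F"
  shows "(\<Sum>i\<in>S. w i) = (\<Sum>i\<in>F. of_bool (i \<in> S) * (w i :: real))"
proof -
  have "(\<Sum>i\<in>F. of_bool (i \<in> S) * w i) = (\<Sum>i\<in>F. if i \<in> S then w i else 0)"
    by (intro sum.cong) auto
  also have "\<dots> = (\<Sum>i\<in>S. w i)" using assms by (simp add: sum.If_cases Int_absorb1)
  finally show ?thesis ..
qed

lemma mean_nsub_sum:
  assumes "finite F" "B \<le> card F"
  shows "mean (nsub F B) (\<lambda>S. \<Sum>i\<in>S. w i) = real B / real (card F) * (\<Sum>i\<in>F. w i)"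
proof -
  have "mean (nsub F B) (\<lambda>S. \<Sum>i\<in>S. w i) = mean (nsub F B) (\<lambda>S. \<Sum>i\<in>F. of_bool (i \<in> S) * w i)"
    by (intro mean_cong sum_subset_of_bool) (use assms in \<open>auto simp: nsub_def\<close>)
  also have "\<dots> = (\<Sum>i\<in>F. mean (nsub F B) (\<lambda>S. of_bool (i \<in> S)) * w i)"
    by (simp only: mean_sum mean_multc)
  also have "\<dots> = (\<Sum>i\<in>F. real B / real (card F) * w i)"
    by (intro sum.cong) (simp_all add: mean_nsub_mem assms)
  finally show ?thesis by (simp add: sum_distrib_left)
qed

text \<open>Expanding both sums over pairs of elements of F leaves two kinds of terms: diagonal
  pairs with the inclusion probability B / D, and pairs of distinct elements with their joint
  probability. This is the source of the covariance \<open>fcov\<close> below.\<close>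

lemma mean_nsub_sum_mult:
  assumes "finite F" "B \<le> card F"
  defines "D \<equiv> real (card F)"
  shows "mean (nsub F B) (\<lambda>S. (\<Sum>i\<in>S. u i) * (\<Sum>i\<in>S. w i))
    = real B / D * (\<Sum>i\<in>F. u i * w i)
      + real B * (real B - 1) / (D * (D - 1)) * ((\<Sum>i\<in>F. u i) * (\<Sum>i\<in>F. w i) - (\<Sum>i\<in>F. u i * w i))"
proof -
  let ?c = "real B * (real B - 1) / (D * (D - 1))"
  have "mean (nsub F B) (\<lambda>S. (\<Sum>i\<in>S. u i) * (\<Sum>i\<in>S. w i))
      = mean (nsub F B) (\<lambda>S. \<Sum>i\<in>F. \<Sum>j\<in>F. of_bool (i \<in> S) * of_bool (j \<in> S) * (u i * w j))"
  proof (intro mean_cong)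
    fix S assume "S \<in> nsub F B"
    then have S: "S \<subseteq> F" by (simp add: nsub_def)
    show "(\<Sum>i\<in>S. u i) * (\<Sum>i\<in>S. w i) = (\<Sum>i\<in>F. \<Sum>j\<in>F. of_bool (i \<in> S) * of_bool (j \<in> S) * (u i * w j))"
      unfolding sum_subset_of_bool[OF assms(1) S, of u] sum_subset_of_bool[OF assms(1) S, of w] sum_product
      by (intro sum.cong) auto
  qed
  also have "\<dots> = (\<Sum>i\<in>F. \<Sum>j\<in>F. mean (nsub F B) (\<lambda>S. of_bool (i \<in> S) * of_bool (j \<in> S)) * (u i * w j))"
    by (simp only: mean_sum mean_multc)
  \<comment> \<open>The joint probability of distinct elements is used for every pair, so that the
    main part factorizes; the diagonal is corrected afterwards.\<close>
  also have "\<dots> = (\<Sum>i\<in>F. \<Sum>j\<in>F. ?c * (u i * w j) + (if i = j then (real B / D - ?c) * (u i * w j) else 0))"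
  proof (intro sum.cong refl)
    fix i j assume ij: "i \<in> F" "j \<in> F"
    show "mean (nsub F B) (\<lambda>S. of_bool (i \<in> S) * of_bool (j \<in> S)) * (u i * w j)
       = ?c * (u i * w j) + (if i = j then (real B / D - ?c) * (u i * w j) else 0)"
    proof (cases "i = j")
      case True
      have "mean (nsub F B) (\<lambda>S. of_bool (i \<in> S) * of_bool (j \<in> S)) = mean (nsub F B) (\<lambda>S. of_bool (i \<in> S))"
        by (intro mean_cong) (use True in auto)
      then show ?thesis using True mean_nsub_mem[OF assms(1,2) ij(1)] by (simp add: D_def algebra_simps)
    next
      case False
      then show ?thesis using mean_nsub_mem2[OF assms(1,2) ij] by (simp add: D_def)
    qed
  qed
  also have "\<dots> = ?c * ((\<Sum>i\<in>F. u i) * (\<Sum>i\<in>F. w i)) + (real B / D - ?c) * (\<Sum>i\<in>F. u i * w i)"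
  proof -
    have "(\<Sum>i\<in>F. \<Sum>j\<in>F. ?c * (u i * w j)) = ?c * ((\<Sum>i\<in>F. u i) * (\<Sum>i\<in>F. w i))"
      unfolding sum_product by (simp only: sum_distrib_left)
    moreover have "(\<Sum>i\<in>F. \<Sum>j\<in>F. if i = j then (real B / D - ?c) * (u i * w j) else 0)
        = (real B / D - ?c) * (\<Sum>i\<in>F. u i * w i)"
      using assms(1) by (simp add: sum.delta sum_distrib_left)
    ultimately show ?thesis by (simp only: sum.distrib)
  qed
  finally show ?thesis by (simp only: algebra_simps)
qed

section \<open>Joint inclusion bounds and exponential tails for random subsets\<close>

lemma binomial_ratio_le:
  assumes "c \<le> B" "B \<le> D" "0 < D"
  shows "real ((D - c) choose (B - c)) \<le> real (D choose B) * (real B / real D) ^ c"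
  using assms
proof (induction c)
  case (Suc c)
  have "real ((D - c - 1) choose (B - c - 1)) = real ((D - c) choose (B - c)) * (real (B - c) / real (D - c))"
    by (rule binomial_step_down) (use Suc in auto)
  also have "\<dots> \<le> real ((D - c) choose (B - c)) * (real B / real D)"
  proof (rule mult_left_mono)
    have "real c * real B \<le> real c * real D" using Suc by (intro mult_left_mono) auto
    then show "real (B - c) / real (D - c) \<le> real B / real D"
      using Suc by (simp add: of_nat_diff divide_simps algebra_simps)
  qed simp
  also have "\<dots> \<le> real (D choose B) * (real B / real D) ^ c * (real B / real D)"
    by (rule mult_right_mono) (use Suc in auto)
  finally show ?case by (simp add: mult_ac)
qed simp

lemma prod_one_plus:
  assumes "finite S"
  shows "(\<Prod>i\<in>S. 1 + v i) = (\<Sum>T\<in>Pow S. \<Prod>i\<in>T. (v i :: real))"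
  using assms
proof (induction S)
  case (insert x S)
  have inj: "inj_on (insert x) (Pow S)" using insert by (auto simp: inj_on_def)
  have dis: "Pow S \<inter> insert x ` Pow S = {}" using insert by auto
  have e: "(\<Prod>i\<in>insert x T. v i) = v x * (\<Prod>i\<in>T. v i)" if "T \<in> Pow S" for T
    using that insert by (subst prod.insert) (auto dest: finite_subset)
  have "(\<Sum>T\<in>Pow (insert x S). \<Prod>i\<in>T. v i)
      = (\<Sum>T\<in>Pow S. \<Prod>i\<in>T. v i) + (\<Sum>T\<in>insert x ` Pow S. \<Prod>i\<in>T. v i)"
    unfolding Pow_insert using insert dis by (intro sum.union_disjoint) auto
  also have "(\<Sum>T\<in>insert x ` Pow S. \<Prod>i\<in>T. v i) = (\<Sum>T\<in>Pow S. v x * (\<Prod>i\<in>T. v i))"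
    by (simp add: sum.reindex[OF inj] e)
  finally show ?case using insert by (simp add: sum_distrib_left[symmetric] algebra_simps)
qed simp

text \<open>Negative dependence: a random subset has smaller joint inclusion probabilities than
  independent inclusions.\<close>

lemma mean_nsub_prod_le:
  assumes "finite F" "B \<le> card F" "\<And>i. i \<in> F \<Longrightarrow> 0 \<le> v i"
  shows "mean (nsub F B) (\<lambda>S. \<Prod>i\<in>S. 1 + v i) \<le> (\<Prod>i\<in>F. 1 + real B / real (card F) * v i)"
proof (cases "F = {}")
  case True
  then have "nsub F B = {{}}" using assms by (auto simp: nsub_def)
  then show ?thesis using True by (simp add: mean_def)
next
  case False
  define D where "D = card F"
  have D: "0 < D" using False assms by (auto simp: D_def card_gt_0_iff)
  have pos: "real (D choose B) > 0" using assms by (simp add: D_def)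
  have "(\<Sum>S\<in>nsub F B. \<Prod>i\<in>S. 1 + v i) = (\<Sum>S\<in>nsub F B. \<Sum>T\<in>Pow F. of_bool (T \<subseteq> S) * (\<Prod>i\<in>T. v i))"
  proof (intro sum.cong refl)
    fix S assume S: "S \<in> nsub F B"
    then have fS: "finite S" "S \<subseteq> F" using assms by (auto simp: nsub_def intro: finite_subset)
    have "(\<Sum>T\<in>Pow F. of_bool (T \<subseteq> S) * (\<Prod>i\<in>T. v i)) = (\<Sum>T\<in>Pow F. if T \<in> Pow S then (\<Prod>i\<in>T. v i) else 0)"
      by (intro sum.cong) auto
    also have "\<dots> = (\<Sum>T\<in>Pow S. \<Prod>i\<in>T. v i)"
      using assms(1) fS by (subst sum.If_cases) (auto intro!: sum.cong)
    finally show "(\<Prod>i\<in>S. 1 + v i) = (\<Sum>T\<in>Pow F. of_bool (T \<subseteq> S) * (\<Prod>i\<in>T. v i))"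
      by (simp add: prod_one_plus[OF fS(1)])
  qed
  also have "\<dots> = (\<Sum>T\<in>Pow F. real (card {S \<in> nsub F B. T \<subseteq> S}) * (\<Prod>i\<in>T. v i))"
    using finite_nsub[OF assms(1)]
    by (subst sum.swap) (simp add: sum_distrib_right[symmetric] Int_def)
  also have "\<dots> \<le> (\<Sum>T\<in>Pow F. real (D choose B) * (\<Prod>i\<in>T. real B / real D * v i))"
  proof (intro sum_mono)
    fix T assume T: "T \<in> Pow F"
    have nn: "0 \<le> (\<Prod>i\<in>T. v i)" using T assms by (intro prod_nonneg) auto
    have "real (card {S \<in> nsub F B. T \<subseteq> S}) \<le> real (D choose B) * (real B / real D) ^ card T"
    proof (cases "card T \<le> B")
      case True
      then show ?thesis
        using card_nsub_superset[of F T B] binomial_ratio_le[of "card T" B D] D T assms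
        by (simp add: D_def)
    next
      case False
      have "{S \<in> nsub F B. T \<subseteq> S} = {}"
        using False assms(1) by (auto simp: nsub_def dest: card_mono[rotated] finite_subset)
      then show ?thesis by (simp only: card.empty of_nat_0) simp
    qed
    then have "real (card {S \<in> nsub F B. T \<subseteq> S}) * (\<Prod>i\<in>T. v i)
        \<le> real (D choose B) * (real B / real D) ^ card T * (\<Prod>i\<in>T. v i)"
      by (rule mult_right_mono[OF _ nn])
    then show "real (card {S \<in> nsub F B. T \<subseteq> S}) * (\<Prod>i\<in>T. v i)
        \<le> real (D choose B) * (\<Prod>i\<in>T. real B / real D * v i)"
      by (simp only: prod.distrib prod_constant mult.assoc)
  qed
  also have "\<dots> = real (D choose B) * (\<Prod>i\<in>F. 1 + real B / real D * v i)"
    by (simp only: prod_one_plus[OF assms(1)] sum_distrib_left)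
  finally show ?thesis using pos unfolding mean_def card_nsub[OF assms(1)] D_def[symmetric]
    by (simp add: pos_divide_le_eq mult.commute)
qed

lemma exp_minus_one_le:
  fixes x :: real
  assumes "0 \<le> x" "x \<le> 1"
  shows "exp x - 1 \<le> x + x\<^sup>2"
  using exp_bound[OF assms] by simp

text \<open>The exponential is the product of 1 + (exp (w i) - 1) over the subset, so negative
  dependence reduces it to independent inclusions, where exp x - 1 <= x + x^2 on [0,1] suffices. In
  the quadratic term the factor B / card F is simply bounded by 1.\<close>

lemma mean_nsub_exp_le:
  assumes "finite F" "B \<le> card F" "\<And>i. i \<in> F \<Longrightarrow> 0 \<le> w i" "\<And>i. i \<in> F \<Longrightarrow> w i \<le> 1"
  shows "mean (nsub F B) (\<lambda>S. exp (\<Sum>i\<in>S. w i))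
    \<le> exp (real B / real (card F) * (\<Sum>i\<in>F. w i) + (\<Sum>i\<in>F. (w i)\<^sup>2))"
proof -
  let ?q = "real B / real (card F)"
  have q: "0 \<le> ?q" "?q \<le> 1" using assms(2) by (auto simp: divide_simps)
  have "mean (nsub F B) (\<lambda>S. exp (\<Sum>i\<in>S. w i)) = mean (nsub F B) (\<lambda>S. \<Prod>i\<in>S. 1 + (exp (w i) - 1))"
    by (intro mean_cong) (use assms(1) in \<open>auto simp: nsub_def exp_sum dest: finite_subset\<close>)
  also have "\<dots> \<le> (\<Prod>i\<in>F. 1 + ?q * (exp (w i) - 1))"
    by (rule mean_nsub_prod_le) (use assms in auto)
  also have "\<dots> \<le> (\<Prod>i\<in>F. exp (?q * w i + (w i)\<^sup>2))"
  proof (rule prod_mono, intro conjI)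
    fix i assume i: "i \<in> F"
    show "0 \<le> 1 + ?q * (exp (w i) - 1)" using q assms i by (intro add_nonneg_nonneg mult_nonneg_nonneg) auto
    have "?q * (exp (w i) - 1) \<le> ?q * (w i + (w i)\<^sup>2)"
      using exp_minus_one_le[of "w i"] assms i q by (intro mult_left_mono) auto
    also have "\<dots> \<le> ?q * w i + (w i)\<^sup>2"
      using mult_right_mono[OF q(2), of "(w i)\<^sup>2"] by (simp add: algebra_simps)
    finally show "1 + ?q * (exp (w i) - 1) \<le> exp (?q * w i + (w i)\<^sup>2)"
      using exp_ge_add_one_self[of "?q * w i + (w i)\<^sup>2"] by linarith
  qed
  also have "\<dots> = exp (?q * (\<Sum>i\<in>F. w i) + (\<Sum>i\<in>F. (w i)\<^sup>2))"
    using assms(1) by (simp add: exp_sum[symmetric] sum.distrib sum_distrib_left)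
  finally show ?thesis .
qed

lemma mean_markov_exp:
  "mean A (\<lambda>x. of_bool (c < f x)) \<le> exp (- c) * mean A (\<lambda>x. exp (f x))"
proof -
  have "mean A (\<lambda>x. of_bool (c < f x)) \<le> mean A (\<lambda>x. exp (- c) * exp (f x))"
    by (rule mean_mono) (auto simp: exp_add[symmetric] of_bool_def)
  then show ?thesis by (simp add: mean_cmult)
qed

text \<open>Exponential Markov inequality with parameter 1. Any other parameter is obtained by
  rescaling w, which is what the callers do.\<close>

lemma mean_nsub_tail:
  assumes "finite F" "B \<le> card F" "\<And>i. i \<in> F \<Longrightarrow> 0 \<le> w i" "\<And>i. i \<in> F \<Longrightarrow> w i \<le> 1"
  shows "mean (nsub F B) (\<lambda>S. of_bool (real B / real (card F) * (\<Sum>i\<in>F. w i) + c < (\<Sum>i\<in>S. w i)))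
      \<le> exp ((\<Sum>i\<in>F. (w i)\<^sup>2) - c)"
proof -
  let ?M = "real B / real (card F) * (\<Sum>i\<in>F. w i)"
  have "mean (nsub F B) (\<lambda>S. of_bool (?M + c < (\<Sum>i\<in>S. w i)))
     \<le> exp (- (?M + c)) * mean (nsub F B) (\<lambda>S. exp (\<Sum>i\<in>S. w i))"
    by (rule mean_markov_exp)
  also have "\<dots> \<le> exp (- (?M + c)) * exp (?M + (\<Sum>i\<in>F. (w i)\<^sup>2))"
    by (rule mult_left_mono[OF mean_nsub_exp_le]) (use assms in auto)
  also have "\<dots> = exp ((\<Sum>i\<in>F. (w i)\<^sup>2) - c)"
    by (simp add: exp_add[symmetric])
  finally show ?thesis .
qed

text \<open>Both tails at once: a weight in $[-1/2,1/2]$ is shifted up, or reflected and shifted up, into $[0,1]$.\<close>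

lemma mean_nsub_two_tails:
  assumes "finite F" "B \<le> card F" "\<And>i. i \<in> F \<Longrightarrow> \<bar>w i\<bar> \<le> e" "e \<le> 1/2"
  shows "mean (nsub F B) (\<lambda>S. of_bool (c < \<bar>(\<Sum>i\<in>S. w i) - real B / real (card F) * (\<Sum>i\<in>F. w i)\<bar>))
      \<le> 2 * exp (4 * real (card F) * e\<^sup>2 - c)"
proof -
  let ?q = "real B / real (card F)"
  have q: "?q * real (card F) = real B" if "F \<noteq> {}" using that assms(1) by simp
  have B0: "B = 0" if "F = {}" using that assms(2) by simp
  have one: "mean (nsub F B) (\<lambda>S. of_bool (c < (\<Sum>i\<in>S. v i) - ?q * (\<Sum>i\<in>F. v i)))
      \<le> exp (4 * real (card F) * e\<^sup>2 - c)" if v: "\<And>i. i \<in> F \<Longrightarrow> \<bar>v i\<bar> \<le> e" for v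
  proof -
    have "mean (nsub F B) (\<lambda>S. of_bool (c < (\<Sum>i\<in>S. v i) - ?q * (\<Sum>i\<in>F. v i)))
      = mean (nsub F B) (\<lambda>S. of_bool (?q * (\<Sum>i\<in>F. v i + e) + c < (\<Sum>i\<in>S. v i + e)))"
    proof (intro mean_cong)
      fix S assume "S \<in> nsub F B"
      then have S: "card S = B" by (auto simp: nsub_def)
      \<comment> \<open>All sets in \<open>nsub F B\<close> have B elements, so the shift by e moves
        the sum and its mean by the same amount B * e.\<close>
      have "?q * (\<Sum>i\<in>F. v i + e) = ?q * (\<Sum>i\<in>F. v i) + real B * e"
        using q B0 by (cases "F = {}") (auto simp: sum.distrib distrib_left)
      then show "of_bool (c < (\<Sum>i\<in>S. v i) - ?q * (\<Sum>i\<in>F. v i))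
         = (of_bool (?q * (\<Sum>i\<in>F. v i + e) + c < (\<Sum>i\<in>S. v i + e)) :: real)"
        using S by (simp add: sum.distrib algebra_simps)
    qed
    also have "\<dots> \<le> exp ((\<Sum>i\<in>F. (v i + e)\<^sup>2) - c)"
      by (rule mean_nsub_tail) (use assms v in \<open>force+\<close>)
    also have "(\<Sum>i\<in>F. (v i + e)\<^sup>2) \<le> (\<Sum>i\<in>F. (2 * e)\<^sup>2)"
      by (intro sum_mono power_mono) (use v in \<open>force+\<close>)
    finally show ?thesis by (simp add: power2_eq_square mult_ac)
  qed
  have "mean (nsub F B) (\<lambda>S. of_bool (c < \<bar>(\<Sum>i\<in>S. w i) - ?q * (\<Sum>i\<in>F. w i)\<bar>))
    \<le> mean (nsub F B) (\<lambda>S. of_bool (c < (\<Sum>i\<in>S. w i) - ?q * (\<Sum>i\<in>F. w i))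
        + of_bool (c < (\<Sum>i\<in>S. - w i) - ?q * (\<Sum>i\<in>F. - w i)))"
    by (rule mean_mono) (auto simp: sum_negf abs_if)
  also have "\<dots> \<le> exp (4 * real (card F) * e\<^sup>2 - c) + exp (4 * real (card F) * e\<^sup>2 - c)"
    unfolding mean_add by (intro add_mono one) (use assms in auto)
  finally show ?thesis by simp
qed

section \<open>Exchanging two columns\<close>

definition col :: "(nat \<times> nat) set \<Rightarrow> nat \<Rightarrow> nat set"
  where "col G k = {j. (j, k) \<in> G}"

text \<open>The rows whose entries in columns k and l may be exchanged: both positions avoid H and
  exactly one of them is occupied. In every other row the two entries are frozen.\<close>

definition free :: "(nat \<times> nat) set \<Rightarrow> (nat \<times> nat) set \<Rightarrow> nat \<Rightarrow> nat \<Rightarrow> nat set"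
  where "free H G k l = {j. (j,k) \<notin> H \<and> (j,l) \<notin> H \<and> ((j,k) \<in> G) \<noteq> ((j,l) \<in> G)}"

text \<open>S lists the free rows whose entry goes to column k; the remaining free rows get it in
  column l.\<close>

definition put :: "(nat \<times> nat) set \<Rightarrow> (nat \<times> nat) set \<Rightarrow> nat \<Rightarrow> nat \<Rightarrow> nat set \<Rightarrow> (nat \<times> nat) set"
  where "put H G k l S = (G - free H G k l \<times> {k,l}) \<union> S \<times> {k} \<union> (free H G k l - S) \<times> {l}"

lemma degV_col: "degV H k = card (col H k)"
  by (simp add: degV_def col_def)

lemma finite_bip_graphs: "finite (bip_graphs m n s t H)"
  by (rule finite_subset[of _ "Pow ({..<m} \<times> {..<n})"]) (auto simp: bip_graphs_def)

lemma bip_sub: "G \<in> bip_graphs m n s t H \<Longrightarrow> G \<subseteq> {..<m} \<times> {..<n}"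
  by (simp add: bip_graphs_def)

lemma bip_disj: "G \<in> bip_graphs m n s t H \<Longrightarrow> (j,k) \<in> G \<Longrightarrow> (j,k) \<notin> H"
  by (auto simp: bip_graphs_def)

lemma bip_col_card: "G \<in> bip_graphs m n s t H \<Longrightarrow> k < n \<Longrightarrow> card (col G k) = t k"
  by (simp add: bip_graphs_def col_def)

lemma bip_row_card: "G \<in> bip_graphs m n s t H \<Longrightarrow> j < m \<Longrightarrow> card {k. (j,k) \<in> G} = s j"
  by (simp add: bip_graphs_def)

lemma col_sub: "G \<subseteq> {..<m} \<times> {..<n} \<Longrightarrow> col G k \<subseteq> {..<m}"
  by (auto simp: col_def)

lemma finite_col: "G \<subseteq> {..<m} \<times> {..<n} \<Longrightarrow> finite (col G k)"
  by (rule finite_subset[OF col_sub finite_lessThan])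

lemma finite_row: "(G :: (nat \<times> nat) set) \<subseteq> {..<m} \<times> {..<n} \<Longrightarrow> finite {i. (j, i) \<in> G}"
  by (rule finite_subset[of _ "{..<n}"]) auto

lemma free_sub: "G \<subseteq> {..<m} \<times> {..<n} \<Longrightarrow> free H G k l \<subseteq> {..<m}"
  by (auto simp: free_def)

lemma finite_free: "G \<subseteq> {..<m} \<times> {..<n} \<Longrightarrow> finite (free H G k l)"
  by (rule finite_subset[OF free_sub finite_lessThan])

lemma free_commute: "free H G k l = free H G l k"
  by (auto simp: free_def)

lemma mem_put:
  assumes "S \<subseteq> free H G k l" "k \<noteq> l"
  shows "(j,i) \<in> put H G k l S \<longleftrightarrow>
    (if j \<in> free H G k l \<and> i = k then j \<in> S else if j \<in> free H G k l \<and> i = l then j \<notin> S else (j,i) \<in> G)"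
  using assms by (auto simp: put_def)

lemma free_put:
  assumes S: "S \<subseteq> free H G k l" and kl: "k \<noteq> l"
  shows "free H (put H G k l S) k l = free H G k l"
proof (rule set_eqI)
  fix j
  define F where "F = free H G k l"
  have 1: "(j,k) \<in> put H G k l S \<longleftrightarrow> (if j \<in> F then j \<in> S else (j,k) \<in> G)"
    and 2: "(j,l) \<in> put H G k l S \<longleftrightarrow> (if j \<in> F then j \<notin> S else (j,l) \<in> G)"
    using mem_put[OF S kl, of j] kl by (auto simp: F_def)
  have 3: "j \<in> F \<longleftrightarrow> (j,k) \<notin> H \<and> (j,l) \<notin> H \<and> ((j,k) \<in> G) \<noteq> ((j,l) \<in> G)"
    by (simp add: F_def free_def)
  have "j \<in> free H (put H G k l S) k l \<longleftrightarrow> (j,k) \<notin> H \<and> (j,l) \<notin> H \<and> ((j,k) \<in> put H G k l S) \<noteq> ((j,l) \<in> put H G k l S)"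
    by (simp add: free_def[of H "put H G k l S"])
  also have "\<dots> \<longleftrightarrow> j \<in> F" unfolding 1 2 using 3 by (cases "j \<in> F") auto
  finally show "j \<in> free H (put H G k l S) k l \<longleftrightarrow> j \<in> free H G k l" by (simp add: F_def)
qed

lemma col_put_other: "k' \<noteq> k \<Longrightarrow> k' \<noteq> l \<Longrightarrow> col (put H G k l S) k' = col G k'"
  by (auto simp: col_def put_def)

lemma col_put_fst: "S \<subseteq> free H G k l \<Longrightarrow> k \<noteq> l \<Longrightarrow> col (put H G k l S) k = (col G k - free H G k l) \<union> S"
  by (auto simp: col_def mem_put)

lemma col_put_snd:
  "S \<subseteq> free H G k l \<Longrightarrow> k \<noteq> l \<Longrightarrow> col (put H G k l S) l = (col G l - free H G k l) \<union> (free H G k l - S)"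
  by (auto simp: col_def mem_put)

lemma put_self: "k \<noteq> l \<Longrightarrow> put H G k l (free H G k l \<inter> col G k) = G"
proof -
  assume kl: "k \<noteq> l"
  have "(j,i) \<in> put H G k l (free H G k l \<inter> col G k) \<longleftrightarrow> (j,i) \<in> G" for j i
    using kl mem_put[of "free H G k l \<inter> col G k" H G k l j i] by (auto simp: col_def free_def split: if_splits)
  then show ?thesis by (auto simp: set_eq_iff)
qed

lemma put_put:
  assumes S: "S \<subseteq> free H G k l" and S': "S' \<subseteq> free H G k l" and kl: "k \<noteq> l"
  shows "put H (put H G k l S) k l S' = put H G k l S'"
proof -
  define P where "P = put H G k l S"
  have f: "free H P k l = free H G k l" unfolding P_def by (rule free_put[OF S kl])
  have "(j,i) \<in> put H P k l S' \<longleftrightarrow> (j,i) \<in> put H G k l S'" for j i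
  proof (cases "j \<in> free H G k l \<and> (i = k \<or> i = l)")
    case True
    then show ?thesis using mem_put[of S' H P k l j i] mem_put[of S' H G k l j i] f S' kl by auto
  next
    case False
    then have "(j,i) \<in> P \<longleftrightarrow> (j,i) \<in> G" unfolding P_def using mem_put[OF S kl, of j i] by auto
    then show ?thesis using False mem_put[of S' H P k l j i] mem_put[of S' H G k l j i] f S' kl by auto
  qed
  then show ?thesis unfolding P_def by (auto simp: set_eq_iff)
qed

lemma free_minus_col: "free H G k l - col G k = free H G k l \<inter> col G l"
  by (auto simp: free_def col_def)

lemma free_cap_put_fst: "S \<subseteq> free H G k l \<Longrightarrow> k \<noteq> l \<Longrightarrow> free H G k l \<inter> col (put H G k l S) k = S"
  by (auto simp: col_put_fst)

text \<open>A free row has exactly one entry in the two columns before and after, which keeps the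
  row sums. Fixing the size of S keeps both column sums, and free positions avoid H by
  definition.\<close>

lemma put_in_bip:
  assumes G: "G \<in> bip_graphs m n s t H" and kl: "k \<noteq> l" "k < n" "l < n"
    and S: "S \<in> nsub (free H G k l) (card (free H G k l \<inter> col G k))"
  shows "put H G k l S \<in> bip_graphs m n s t H"
proof -
  let ?F = "free H G k l" and ?P = "put H G k l S"
  have SF: "S \<subseteq> ?F" "card S = card (?F \<inter> col G k)" using S by (auto simp: nsub_def)
  note Gs = bip_sub[OF G]
  have fin: "finite ?F" "finite S" using finite_free[OF Gs] finite_subset[OF SF(1)] by auto
  have sub: "?P \<subseteq> {..<m} \<times> {..<n}"
    using Gs kl SF free_sub[OF Gs, of H k l] by (auto simp: put_def)
  have disj: "?P \<inter> H = {}"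
    using SF bip_disj[OF G] by (auto simp: put_def free_def)
  have row: "card {i. (j,i) \<in> ?P} = s j" if j: "j < m" for j
  proof (cases "j \<in> ?F")
    case False
    then show ?thesis using bip_row_card[OF G j] mem_put[OF SF(1) kl(1)] by simp
  next
    case True
    have f: "finite {i. (j,i) \<in> G}" using finite_row[OF Gs] .
    have "{i. (j,i) \<in> ?P} = insert (if j \<in> S then k else l) ({i. (j,i) \<in> G} - {k,l})"
      using True mem_put[OF SF(1) kl(1)] kl by auto
    then have "card {i. (j,i) \<in> ?P} = Suc (card ({i. (j,i) \<in> G} - {k,l}))"
      using f by simp
    moreover have e: "{i. (j,i) \<in> G} = insert (if (j,k) \<in> G then k else l) ({i. (j,i) \<in> G} - {k,l})"
      using True kl by (auto simp: free_def)
    have "card {i. (j,i) \<in> G} = Suc (card ({i. (j,i) \<in> G} - {k,l}))"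
      by (rule trans[OF arg_cong[OF e, of card]], rule card_insert_disjoint) (use f in auto)
    ultimately show ?thesis using bip_row_card[OF G j] by simp
  qed
  have cols: "card (col ?P i) = t i" if i: "i < n" for i
  proof -
    have fc: "finite (col G i)" using finite_col[OF Gs] .
    consider "i = k" | "i = l" | "i \<noteq> k" "i \<noteq> l" by blast
    then show ?thesis
    proof cases
      case 1
      have "card (col ?P k) = card (col G k - ?F) + card S"
        unfolding col_put_fst[OF SF(1) kl(1)] using SF fin fc 1 by (intro card_Un_disjoint) auto
      also have "\<dots> = card (col G k)"
        using SF(2) fc 1 card_Diff_subset_Int[of "col G k" ?F] card_mono[of "col G k" "?F \<inter> col G k"]
        by (simp add: Int_commute)
      finally show ?thesis using 1 bip_col_card[OF G i] by simp
    next
      case 2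
      have "card (col ?P l) = card (col G l - ?F) + card (?F - S)"
        unfolding col_put_snd[OF SF(1) kl(1)] using SF fin fc 2 by (intro card_Un_disjoint) auto
      also have "card (?F - S) = card (?F - col G k)"
        using SF fin by (simp add: card_Diff_subset card_Diff_subset_Int)
      also have "\<dots> = card (?F \<inter> col G l)" by (simp add: free_minus_col)
      also have "card (col G l - ?F) + \<dots> = card (col G l)"
        using fc 2 card_Diff_subset_Int[of "col G l" ?F] card_mono[of "col G l" "?F \<inter> col G l"]
        by (simp add: Int_commute)
      finally show ?thesis using 2 bip_col_card[OF G i] by simp
    next
      case 3
      then show ?thesis using bip_col_card[OF G i] by (simp add: col_put_other)
    qed
  qed
  show ?thesis using sub disj row cols by (simp add: bip_graphs_def col_def)
qed

text \<open>Resampling: exchanging a graph together with a candidate subset is an involution, so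
  replacing the free entries of two columns by a uniformly random choice preserves averages.\<close>

lemma class_average:
  fixes m n k l :: nat and s t :: "nat \<Rightarrow> nat" and H :: "(nat \<times> nat) set"
  assumes kl: "k \<noteq> l" "k < n" "l < n"
  defines "\<Omega> \<equiv> bip_graphs m n s t H"
  shows "mean \<Omega> f =
    mean \<Omega> (\<lambda>G. mean (nsub (free H G k l) (card (free H G k l \<inter> col G k))) (\<lambda>S. f (put H G k l S)))"
proof -
  define N where "N G = nsub (free H G k l) (card (free H G k l \<inter> col G k))" for G
  have fin: "finite (free H G k l)" if "G \<in> \<Omega>" for G
    using finite_free[OF bip_sub[of G m n s t H]] that by (simp add: \<Omega>_def)
  have fN: "finite (N G)" if "G \<in> \<Omega>" for G
    unfolding N_def by (rule finite_nsub[OF fin[OF that]])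
  have Npos: "card (N G) > 0" if "G \<in> \<Omega>" for G
    unfolding N_def card_nsub[OF fin[OF that]]
    using fin[OF that] by (simp add: card_mono)
  have NP: "N (put H G k l S) = N G" if "G \<in> \<Omega>" "S \<in> N G" for G S
  proof -
    have S: "S \<subseteq> free H G k l" "card S = card (free H G k l \<inter> col G k)"
      using that by (auto simp: N_def nsub_def)
    show ?thesis unfolding N_def free_put[OF S(1) kl(1)] free_cap_put_fst[OF S(1) kl(1)] S(2) ..
  qed
  let ?\<phi> = "\<lambda>(G,S). (put H G k l S, free H G k l \<inter> col G k)"
  have inv: "?\<phi> x \<in> Sigma \<Omega> N \<and> ?\<phi> (?\<phi> x) = x" if x: "x \<in> Sigma \<Omega> N" for x
  proof -
    obtain G S where GS: "x = (G,S)" "G \<in> \<Omega>" "S \<in> N G" using x by auto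
    have S: "S \<subseteq> free H G k l" "card S = card (free H G k l \<inter> col G k)"
      using GS by (auto simp: N_def nsub_def)
    have "put H G k l S \<in> \<Omega>" using put_in_bip[of G m n s t H k l S] GS kl by (simp add: \<Omega>_def N_def)
    moreover have "free H G k l \<inter> col G k \<in> N (put H G k l S)"
      unfolding NP[OF GS(2,3)] by (simp add: N_def nsub_def)
    moreover have "put H (put H G k l S) k l (free H G k l \<inter> col G k) = G"
      using put_put[OF S(1) _ kl(1), of "free H G k l \<inter> col G k"] put_self[OF kl(1)] by simp
    moreover have "free H (put H G k l S) k l \<inter> col (put H G k l S) k = S"
      unfolding free_put[OF S(1) kl(1)] by (rule free_cap_put_fst[OF S(1) kl(1)])
    ultimately show ?thesis using GS by simp
  qed
  have fO: "finite \<Omega>" unfolding \<Omega>_def by (rule finite_bip_graphs)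
  have "(\<Sum>G\<in>\<Omega>. mean (N G) (\<lambda>S. f (put H G k l S)))
     = (\<Sum>(G,S)\<in>Sigma \<Omega> N. f (put H G k l S) / real (card (N G)))"
    using fO fN by (simp add: mean_def sum_divide_distrib sum.Sigma)
  \<comment> \<open>The involution turns the resampled graph into the original one. By
    \<open>NP\<close> both have the same set of candidates, so the weight of a pair does not
    change.\<close>
  also have "\<dots> = (\<Sum>(G,S)\<in>Sigma \<Omega> N. f G / real (card (N G)))"
  proof (rule sum.reindex_bij_witness[where i = ?\<phi> and j = ?\<phi>])
    fix x assume x: "x \<in> Sigma \<Omega> N"
    then obtain G S where GS: "x = (G,S)" "G \<in> \<Omega>" "S \<in> N G" by auto
    show "(case ?\<phi> x of (G, S) \<Rightarrow> f G / real (card (N G)))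
        = (case x of (G, S) \<Rightarrow> f (put H G k l S) / real (card (N G)))"
      using NP GS by simp
  qed (use inv in blast)+
  also have "\<dots> = (\<Sum>G\<in>\<Omega>. \<Sum>S\<in>N G. f G / real (card (N G)))"
    by (rule sum.Sigma[symmetric]) (use fO fN in auto)
  also have "\<dots> = (\<Sum>G\<in>\<Omega>. f G)"
    using Npos by (intro sum.cong) auto
  finally show ?thesis unfolding N_def by (simp add: mean_def)
qed

section \<open>Conditional mean and covariance of column statistics under an exchange\<close>

lemma col_split:
  assumes G: "G \<in> bip_graphs m n s t H" and kl: "k \<noteq> l"
  shows "col G k = (free H G k l \<inter> col G k) \<union> (col G k \<inter> col G l) \<union> (col G k \<inter> col H l)"
    and "(free H G k l \<inter> col G k) \<inter> (col G k \<inter> col G l) = {}"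
    and "((free H G k l \<inter> col G k) \<union> (col G k \<inter> col G l)) \<inter> (col G k \<inter> col H l) = {}"
  using bip_disj[OF G] by (auto simp: free_def col_def)

lemma sum_col_split:
  assumes G: "G \<in> bip_graphs m n s t H" and kl: "k \<noteq> l"
  shows "(\<Sum>j\<in>col G k. w j) = (\<Sum>j\<in>free H G k l \<inter> col G k. w j)
    + (\<Sum>j\<in>col G k \<inter> col G l. w j) + (\<Sum>j\<in>col G k \<inter> col H l. (w j :: real))"
proof -
  have f: "finite (col G k)" using finite_col[OF bip_sub[OF G]] .
  show ?thesis
    by (subst col_split(1)[OF G kl])
      (simp add: sum.union_disjoint col_split(2,3)[OF G kl] f)
qed

lemma sum_free_split:
  assumes G: "G \<in> bip_graphs m n s t H"
  shows "(\<Sum>j\<in>free H G k l. w j) = (\<Sum>j\<in>free H G k l \<inter> col G k. w j) + (\<Sum>j\<in>free H G k l \<inter> col G l. (w j :: real))"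
proof -
  have f: "finite (free H G k l)" using finite_free[OF bip_sub[OF G]] .
  have "(\<Sum>j\<in>free H G k l. w j) = (\<Sum>j\<in>free H G k l \<inter> col G k. w j) + (\<Sum>j\<in>free H G k l - col G k. w j)"
    using sum.Int_Diff[OF f, of w "col G k"] .
  then show ?thesis by (simp add: free_minus_col)
qed

definition colsum :: "(nat \<times> nat) set \<Rightarrow> nat \<Rightarrow> (nat \<Rightarrow> real) \<Rightarrow> real"
  where "colsum G k w = (\<Sum>j\<in>col G k. w j)"

definition bnd :: "(nat \<times> nat) set \<Rightarrow> (nat \<times> nat) set \<Rightarrow> nat \<Rightarrow> nat \<Rightarrow> (nat \<Rightarrow> real) \<Rightarrow> real"
  where "bnd H G k l w = (\<Sum>j\<in>col G k \<inter> col H l. w j) - (\<Sum>j\<in>col G l \<inter> col H k. w j)"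

text \<open>Equals 2 * B - D for B free entries in column k among D free rows. It is fixed by the
  column sums up to boundary counts, see \<open>bal_eq\<close>.\<close>

definition bal :: "(nat \<times> nat) set \<Rightarrow> (nat \<times> nat) set \<Rightarrow> nat \<Rightarrow> nat \<Rightarrow> real"
  where "bal H G k l = real (card (free H G k l \<inter> col G k)) - real (card (free H G k l \<inter> col G l))"

text \<open>The conditional mean of \<open>colsum G k w - colsum G l w\<close> when the free entries
  are resampled: a random B-subset has mean weight B / D times the total, and 2 * B / D - 1 is
  \<open>bal\<close> divided by D.\<close>

definition drift :: "(nat \<times> nat) set \<Rightarrow> (nat \<times> nat) set \<Rightarrow> nat \<Rightarrow> nat \<Rightarrow> (nat \<Rightarrow> real) \<Rightarrow> real"
  where "drift H G k l w = bnd H G k l w + bal H G k l / real (card (free H G k l)) * (\<Sum>j\<in>free H G k l. w j)"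

text \<open>Twice the covariance of the u-sum and the w-sum over a uniform B-subset of the free
  rows. The factor 2 appears because a row leaving column l enters column k.\<close>

definition fcov :: "(nat \<times> nat) set \<Rightarrow> (nat \<times> nat) set \<Rightarrow> nat \<Rightarrow> nat \<Rightarrow> (nat \<Rightarrow> real) \<Rightarrow> (nat \<Rightarrow> real) \<Rightarrow> real"
  where "fcov H G k l u w = (let F = free H G k l; D = real (card F); B = real (card (F \<inter> col G k)) in
     2 * (B * (D - B) / (D * (D - 1))) * ((\<Sum>j\<in>F. u j * w j) - (\<Sum>j\<in>F. u j) * (\<Sum>j\<in>F. w j) / D))"

lemma card_free_split:
  assumes "G \<in> bip_graphs m n s t H"
  shows "real (card (free H G k l)) = real (card (free H G k l \<inter> col G k)) + real (card (free H G k l \<inter> col G l))"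
  using sum_free_split[OF assms, where k=k and l=l and w="\<lambda>_. 1"] by (simp only: sum_constant mult_1_right)

lemma card_col_split:
  assumes G: "G \<in> bip_graphs m n s t H" and kl: "k \<noteq> l" "k < n"
  shows "real (t k) = real (card (free H G k l \<inter> col G k))
    + real (card (col G k \<inter> col G l)) + real (card (col G k \<inter> col H l))"
  using sum_col_split[OF G kl(1), where w="\<lambda>_. 1"] bip_col_card[OF G kl(2)]
  by (simp only: sum_constant mult_1_right)

lemma bal_eq:
  assumes G: "G \<in> bip_graphs m n s t H" and kl: "k \<noteq> l" "k < n" "l < n"
  shows "bal H G k l = real (t k) - real (t l) - real (card (col G k \<inter> col H l)) + real (card (col G l \<inter> col H k))"
  using card_col_split[OF G kl(1,2)] card_col_split[OF G kl(1)[symmetric] kl(3)]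
  unfolding bal_def free_commute[of H G l k] Int_commute[of "col G l" "col G k"] by linarith

lemma colsum_diff:
  assumes G: "G \<in> bip_graphs m n s t H" and kl: "k \<noteq> l"
  shows "colsum G k w - colsum G l w
    = bnd H G k l w + 2 * (\<Sum>j\<in>free H G k l \<inter> col G k. w j) - (\<Sum>j\<in>free H G k l. w j)"
  unfolding colsum_def bnd_def
  using sum_col_split[OF G kl, where w=w] sum_col_split[OF G kl[symmetric], where w=w] sum_free_split[OF G, where k=k and l=l and w=w]
  unfolding free_commute[of H G l k] Int_commute[of "col G l" "col G k"] by linarith

text \<open>Within a class of graphs that differ only in the free entries of columns k and l, X is a
  constant plus the u-sum over a random subset, and the difference of the column sums is affine in
  the w-sum over the same subset. The mean of a product is the product of the means plus the
  covariance. Since \<open>drift\<close> and \<open>fcov\<close> are constant on the class, the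
  product of means can be written back as the mean of X times \<open>drift\<close>.\<close>

lemma mean_exchange:
  fixes m n k l :: nat and s t :: "nat \<Rightarrow> nat" and H :: "(nat \<times> nat) set"
    and X x0 :: "(nat \<times> nat) set \<Rightarrow> real" and u w :: "(nat \<times> nat) set \<Rightarrow> nat \<Rightarrow> real"
  assumes kl: "k \<noteq> l" "k < n" "l < n"
  defines "\<Omega> \<equiv> bip_graphs m n s t H"
  assumes w: "\<And>G S. G \<in> \<Omega> \<Longrightarrow> S \<subseteq> free H G k l \<Longrightarrow> w (put H G k l S) = w G"
    and u: "\<And>G S. G \<in> \<Omega> \<Longrightarrow> S \<subseteq> free H G k l \<Longrightarrow> u (put H G k l S) = u G"
    and x: "\<And>G S. G \<in> \<Omega> \<Longrightarrow> S \<subseteq> free H G k l \<Longrightarrow> X (put H G k l S) = x0 G + (\<Sum>j\<in>S. u G j)"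
  shows "mean \<Omega> (\<lambda>G. X G * (colsum G k (w G) - colsum G l (w G)))
    = mean \<Omega> (\<lambda>G. X G * drift H G k l (w G) + fcov H G k l (u G) (w G))"
proof -
  let ?N = "\<lambda>G. nsub (free H G k l) (card (free H G k l \<inter> col G k))"
  have "mean (?N G) (\<lambda>S. let G' = put H G k l S in X G' * (colsum G' k (w G') - colsum G' l (w G')))
      = mean (?N G) (\<lambda>S. let G' = put H G k l S in X G' * drift H G' k l (w G') + fcov H G' k l (u G') (w G'))"
    if G: "G \<in> \<Omega>" for G
  proof -
    define F where "F = free H G k l"
    define B where "B = card (F \<inter> col G k)"
    define D where "D = real (card F)"
    define U where "U = (\<Sum>j\<in>F. w G j)"
    define V where "V = (\<Sum>j\<in>F. u G j)"
    define UV where "UV = (\<Sum>j\<in>F. u G j * w G j)"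
    define b where "b = bnd H G k l (w G)"
    have finF: "finite F" using finite_free[OF bip_sub[of G m n s t H]] G by (simp add: \<Omega>_def F_def)
    have BD: "B \<le> card F" unfolding B_def by (simp add: card_mono finF)
    have fN: "finite (nsub F B)" "nsub F B \<noteq> {}"
      using finite_nsub[OF finF] nsub_nonempty[OF finF BD] by auto
    have bal: "bal H G k l = 2 * real B - D"
      using card_free_split[OF G[unfolded \<Omega>_def], of k l] unfolding bal_def B_def D_def F_def by linarith
    have S1: "bnd H (put H G k l S) k l v = bnd H G k l v" "free H (put H G k l S) k l = F"
         "F \<inter> col (put H G k l S) k = S" if S: "S \<in> nsub F B" for S v
    proof -
      have SF: "S \<subseteq> free H G k l" using S by (simp add: nsub_def F_def)
      show "free H (put H G k l S) k l = F" using free_put[OF SF kl(1)] by (simp add: F_def)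
      show "F \<inter> col (put H G k l S) k = S" using free_cap_put_fst[OF SF kl(1)] by (simp add: F_def)
      have FH: "free H G k l \<inter> col H l = {}" "free H G k l \<inter> col H k = {}"
        by (auto simp: free_def col_def)
      have "col (put H G k l S) k \<inter> col H l = col G k \<inter> col H l"
           "col (put H G k l S) l \<inter> col H k = col G l \<inter> col H k"
        unfolding col_put_fst[OF SF kl(1)] col_put_snd[OF SF kl(1)] using SF FH by blast+
      then show "bnd H (put H G k l S) k l v = bnd H G k l v" by (simp add: bnd_def)
    qed
    have S2: "put H G k l S \<in> \<Omega>" if S: "S \<in> nsub F B" for S
      unfolding \<Omega>_def by (rule put_in_bip[OF G[unfolded \<Omega>_def] kl S[unfolded B_def F_def]])
    have Sw: "w (put H G k l S) = w G" "u (put H G k l S) = u G"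
       "X (put H G k l S) = x0 G + (\<Sum>j\<in>S. u G j)" if S: "S \<in> nsub F B" for S
      using w[OF G] u[OF G] x[OF G] S by (auto simp: nsub_def F_def)
    have lhs: "mean (nsub F B) (\<lambda>S. let G' = put H G k l S in X G' * (colsum G' k (w G') - colsum G' l (w G')))
       = mean (nsub F B) (\<lambda>S. (x0 G + (\<Sum>j\<in>S. u G j)) * (b + 2 * (\<Sum>j\<in>S. w G j) - U))"
    proof (rule mean_cong)
      fix S assume S: "S \<in> nsub F B"
      show "(let G' = put H G k l S in X G' * (colsum G' k (w G') - colsum G' l (w G')))
        = (x0 G + (\<Sum>j\<in>S. u G j)) * (b + 2 * (\<Sum>j\<in>S. w G j) - U)"
        using colsum_diff[OF S2[OF S, unfolded \<Omega>_def] kl(1), of "w G"] S1[OF S] Sw[OF S]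
        by (simp add: Let_def b_def U_def)
    qed
    have e1: "mean (nsub F B) (\<lambda>S. (x0 G + (\<Sum>j\<in>S. u G j)) * (b + 2 * (\<Sum>j\<in>S. w G j) - U))
      = x0 G * (b - U) + 2 * x0 G * (real B / D * U) + (b - U) * (real B / D * V)
        + 2 * (real B / D * UV + real B * (real B - 1) / (D * (D - 1)) * (V * U - UV))"
    proof -
      have "(\<lambda>S. (x0 G + (\<Sum>j\<in>S. u G j)) * (b + 2 * (\<Sum>j\<in>S. w G j) - U))
        = (\<lambda>S. x0 G * (b - U) + 2 * x0 G * (\<Sum>j\<in>S. w G j) + (b - U) * (\<Sum>j\<in>S. u G j)
          + 2 * ((\<Sum>j\<in>S. u G j) * (\<Sum>j\<in>S. w G j)))"
        by (intro ext) (simp add: algebra_simps)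
      then show ?thesis
        by (simp only: mean_add mean_cmult mean_const[OF fN] mean_nsub_sum[OF finF BD]
            mean_nsub_sum_mult[OF finF BD] D_def U_def V_def UV_def)
    qed
    \<comment> \<open>The right side is averaged over the same class, where only X varies: boundary,
      free set and balance are unchanged by resampling.\<close>
    have rhs: "mean (nsub F B) (\<lambda>S. let G' = put H G k l S in X G' * drift H G' k l (w G') + fcov H G' k l (u G') (w G'))
       = mean (nsub F B) (\<lambda>S. (x0 G + (\<Sum>j\<in>S. u G j)) * (b + (2 * real B - D) / D * U)
          + 2 * (real B * (D - real B) / (D * (D - 1))) * (UV - V * U / D))"
    proof (rule mean_cong)
      fix S assume S: "S \<in> nsub F B"
      have cS: "card S = B" using S by (simp add: nsub_def)
      have "bal H (put H G k l S) k l = 2 * real B - D"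
        using card_free_split[OF S2[OF S, unfolded \<Omega>_def], of k l] unfolding bal_def D_def S1(2,3)[OF S] cS by linarith
      then show "(let G' = put H G k l S in X G' * drift H G' k l (w G') + fcov H G' k l (u G') (w G'))
         = (x0 G + (\<Sum>j\<in>S. u G j)) * (b + (2 * real B - D) / D * U)
          + 2 * (real B * (D - real B) / (D * (D - 1))) * (UV - V * U / D)"
        using S1[OF S] Sw[OF S] cS
        by (simp add: Let_def drift_def fcov_def b_def U_def V_def UV_def D_def)
    qed
    have e2: "mean (nsub F B) (\<lambda>S. (x0 G + (\<Sum>j\<in>S. u G j)) * (b + (2 * real B - D) / D * U)
          + 2 * (real B * (D - real B) / (D * (D - 1))) * (UV - V * U / D))
      = (x0 G + real B / D * V) * (b + (2 * real B - D) / D * U)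
          + 2 * (real B * (D - real B) / (D * (D - 1))) * (UV - V * U / D)"
      by (simp only: mean_add mean_multc mean_const[OF fN] mean_nsub_sum[OF finF BD] D_def V_def)
    have alg: "x0 G * (b - U) + 2 * x0 G * (real B / D * U) + (b - U) * (real B / D * V)
        + 2 * (real B / D * UV + real B * (real B - 1) / (D * (D - 1)) * (V * U - UV))
      = (x0 G + real B / D * V) * (b + (2 * real B - D) / D * U)
          + 2 * (real B * (D - real B) / (D * (D - 1))) * (UV - V * U / D)"
    proof -
      \<comment> \<open>With at most one free row D * (D - 1) is 0 and quotients by it are 0 by
        convention, so these cases are evaluated directly.\<close>
      consider "card F = 0" | "card F = 1" | "card F > 1" by linarith
      then show ?thesis
      proof cases
        case 1
        then have "F = {}" using finF by simp
        then show ?thesis using BD by (simp add: U_def V_def UV_def algebra_simps)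
      next
        case 2
        then obtain i where i: "F = {i}" by (rule card_1_singletonE)
        have "B = 0 \<or> B = 1" using BD 2 by auto
        moreover have "D = 1" using 2 by (simp add: D_def)
        ultimately show ?thesis by (auto simp: U_def V_def UV_def i algebra_simps)
      next
        case 3
        then have "D > 1" by (simp add: D_def)
        then have D0: "D \<noteq> 0" "D - 1 \<noteq> 0" by auto
        define q where "q = real B / D"
        define c where "c = real B * (D - real B) / (D * (D - 1))"
        have h1: "real B * (real B - 1) / (D * (D - 1)) = q - c"
          unfolding q_def c_def using D0 by (simp add: divide_simps) (simp add: algebra_simps)
        have h2: "c / D = c - q + q * q"
          unfolding q_def c_def using D0 by (simp add: divide_simps) (simp add: algebra_simps)
        have h3: "(2 * real B - D) / D = 2 * q - 1"
          unfolding q_def using D0 by (simp add: divide_simps)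
        have h4: "2 * c * (UV - V * U / D) = 2 * c * UV - 2 * (c / D) * (V * U)"
          by (simp add: algebra_simps)
        show ?thesis unfolding h1 h3 q_def[symmetric] c_def[symmetric] h4 unfolding h2
          by (simp add: algebra_simps)
      qed
    qed
    show ?thesis using lhs e1 rhs e2 alg unfolding F_def B_def by simp
  qed
  then show ?thesis
    unfolding \<Omega>_def
    by (subst class_average[OF kl], subst (2) class_average[OF kl])
      (rule mean_cong, simp add: Let_def)
qed

section \<open>Moving one entry between two columns\<close>

text \<open>Both sides count pairs of a graph and a free row whose entry is moved from column l to
  column k, each weighted by the reciprocal of the number of free entries of column k afterwards.\<close>

lemma switch_count:
  assumes kl: "k \<noteq> l" "k < n" "l < n" and tl: "0 < t l"
  shows "(\<Sum>G\<in>bip_graphs m n s t H.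
      real (card (free H G k l \<inter> col G l)) / (real (card (free H G k l \<inter> col G k)) + 1))
    = real (card {G \<in> bip_graphs m n s (t(k := t k + 1, l := t l - 1)) H. free H G k l \<inter> col G k \<noteq> {}})"
proof -
  define t' where "t' = t(k := t k + 1, l := t l - 1)"
  define \<Omega> where "\<Omega> = bip_graphs m n s t H"
  define \<Omega>' where "\<Omega>' = bip_graphs m n s t' H"
  define A where "A = Sigma \<Omega> (\<lambda>G. free H G k l \<inter> col G l)"
  define A' where "A' = Sigma \<Omega>' (\<lambda>G. free H G k l \<inter> col G k)"
  let ?\<phi> = "\<lambda>(G,j). (insert (j,k) (G - {(j,l)}), j)"
  let ?\<psi> = "\<lambda>(G,j). (insert (j,l) (G - {(j,k)}), j)"
  have fO: "finite \<Omega>" "finite \<Omega>'" unfolding \<Omega>_def \<Omega>'_def by (rule finite_bip_graphs)+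
  have ffr: "finite (free H G k l)" if "G \<in> \<Omega> \<or> G \<in> \<Omega>'" for G
    using finite_free[OF bip_sub[of G m n s t H]] finite_free[OF bip_sub[of G m n s t' H]] that by (auto simp: \<Omega>_def \<Omega>'_def)
  \<comment> \<open>One statement for both directions: an entry of a free row moves from column b to
    column a, where {a, b} = {k, l}. The free set is unaffected, so the two maps are inverse to each
    other.\<close>
  have gen: "insert (j,a) (G - {(j,b)}) \<in> bip_graphs m n s q' H \<and> free H (insert (j,a) (G - {(j,b)})) k l = free H G k l
      \<and> j \<in> col (insert (j,a) (G - {(j,b)})) a
      \<and> card (free H G k l \<inter> col (insert (j,a) (G - {(j,b)})) a) = card (free H G k l \<inter> col G a) + 1"
    if G: "G \<in> bip_graphs m n s q H" and j: "j \<in> free H G k l" "j \<in> col G b"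
      and ab: "(a = k \<and> b = l) \<or> (a = l \<and> b = k)" and q': "q' a = q a + 1" "q' b + 1 = q b" "\<And>i. i \<noteq> a \<Longrightarrow> i \<noteq> b \<Longrightarrow> q' i = q i"
    for G j a b q q'
  proof -
    let ?P = "insert (j,a) (G - {(j,b)})"
    have anb: "a \<noteq> b" "a < n" "b < n" using ab kl by auto
    note Gs = bip_sub[OF G]
    have ja: "(j,a) \<notin> G" "(j,b) \<in> G" "(j,a) \<notin> H" using j ab by (auto simp: free_def col_def)
    have jm: "j < m" using ja Gs by auto
    have sub: "?P \<subseteq> {..<m} \<times> {..<n}" using Gs jm anb by auto
    have disj: "?P \<inter> H = {}" using ja bip_disj[OF G] by auto
    have rows: "card {i. (j',i) \<in> ?P} = s j'" if "j' < m" for j'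
    proof (cases "j' = j")
      case False
      then show ?thesis using bip_row_card[OF G that] by simp
    next
      case True
      have f: "finite {i. (j,i) \<in> G}" using finite_row[OF Gs] .
      have "{i. (j,i) \<in> ?P} = insert a ({i. (j,i) \<in> G} - {b})" using anb by auto
      moreover have "card (insert a ({i. (j,i) \<in> G} - {b})) = card {i. (j,i) \<in> G}"
        using f ja card_Suc_Diff1[OF f, of b] by simp
      ultimately show ?thesis using True bip_row_card[OF G that] by simp
    qed
    have cola: "col ?P a = insert j (col G a)" and colb: "col ?P b = col G b - {j}"
      using anb by (auto simp: col_def)
    have fa: "finite (col G a)" "finite (col G b)" using finite_col[OF Gs] by auto
    have cols: "card (col ?P i) = q' i" if i: "i < n" for i
    proof -
      consider "i = a" | "i = b" | "i \<noteq> a" "i \<noteq> b" by blast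
      then show ?thesis
      proof cases
        case 1 then show ?thesis using cola fa ja q' bip_col_card[OF G i] by (simp add: col_def)
      next
        case 2
        have "card (col G b) = Suc (card (col G b - {j}))" using fa ja by (simp add: card_Suc_Diff1 col_def del: card_Diff_insert)
        then show ?thesis using 2 colb q' bip_col_card[OF G i] by simp
      next
        case 3
        then have "col ?P i = col G i" by (auto simp: col_def)
        then show ?thesis using 3 q' bip_col_card[OF G i] by simp
      qed
    qed
    have fr: "free H ?P k l = free H G k l"
      using ja ab anb j by (auto simp: free_def)
    have "free H G k l \<inter> col ?P a = insert j (free H G k l \<inter> col G a)" using cola j by auto
    then have "card (free H G k l \<inter> col ?P a) = card (free H G k l \<inter> col G a) + 1"
      using ja fa by (simp add: col_def)
    then show ?thesis using sub disj rows cols fr cola by (simp add: bip_graphs_def col_def)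
  qed
  have t'1: "t' k = t k + 1" "t' l + 1 = t l" "\<And>i. i \<noteq> k \<Longrightarrow> i \<noteq> l \<Longrightarrow> t' i = t i"
    using kl tl by (auto simp: t'_def)
  have t'2: "t l = t' l + 1" "t k + 1 = t' k" "\<And>i. i \<noteq> l \<Longrightarrow> i \<noteq> k \<Longrightarrow> t i = t' i"
    using kl tl by (auto simp: t'_def)
  have "(\<Sum>G\<in>\<Omega>. real (card (free H G k l \<inter> col G l)) / (real (card (free H G k l \<inter> col G k)) + 1))
     = (\<Sum>(G,j)\<in>A. 1 / (real (card (free H G k l \<inter> col G k)) + 1))"
    unfolding A_def using fO ffr by (subst sum.Sigma[symmetric]) auto
  also have "\<dots> = (\<Sum>(G,j)\<in>A'. 1 / real (card (free H G k l \<inter> col G k)))"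
  proof (rule sum.reindex_bij_witness[where i = ?\<psi> and j = ?\<phi>])
    fix x assume x: "x \<in> A"
    then obtain G j where GS: "x = (G,j)" "G \<in> \<Omega>" "j \<in> free H G k l" "j \<in> col G l" by (auto simp: A_def)
    note g = gen[OF GS(2)[unfolded \<Omega>_def] GS(3,4), of k t', OF _ t'1]
    have jk: "(j,k) \<notin> G" "(j,l) \<in> G" using GS by (auto simp: free_def col_def)
    show "?\<psi> (?\<phi> x) = x" using GS jk kl by auto
    show "?\<phi> x \<in> A'" using g GS by (auto simp: A'_def \<Omega>'_def)
    show "(case ?\<phi> x of (G, j) \<Rightarrow> 1 / real (card (free H G k l \<inter> col G k)))
      = (case x of (G, j) \<Rightarrow> 1 / (real (card (free H G k l \<inter> col G k)) + 1))"
      using g GS by (auto simp: add.commute)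
  next
    fix x assume x: "x \<in> A'"
    then obtain G j where GS: "x = (G,j)" "G \<in> \<Omega>'" "j \<in> free H G k l" "j \<in> col G k" by (auto simp: A'_def)
    note g = gen[OF GS(2)[unfolded \<Omega>'_def] GS(3,4), of l t, OF _ t'2]
    have jk: "(j,l) \<notin> G" "(j,k) \<in> G" using GS by (auto simp: free_def col_def)
    show "?\<phi> (?\<psi> x) = x" using GS jk kl by auto
    show "?\<psi> x \<in> A" using g GS by (auto simp: A_def \<Omega>_def)
  qed
  \<comment> \<open>The weights are reciprocal to the number of movable entries, so every graph
    counts once, except those with no free entry in column k, which are not reached.\<close>
  also have "\<dots> = (\<Sum>G\<in>\<Omega>'. of_bool (free H G k l \<inter> col G k \<noteq> {}))"
  proof -
    have "(\<Sum>(G,j)\<in>A'. 1 / real (card (free H G k l \<inter> col G k)))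
      = (\<Sum>G\<in>\<Omega>'. \<Sum>j\<in>free H G k l \<inter> col G k. 1 / real (card (free H G k l \<inter> col G k)))"
      unfolding A'_def using fO ffr by (subst sum.Sigma[symmetric]) auto
    also have "\<dots> = (\<Sum>G\<in>\<Omega>'. of_bool (free H G k l \<inter> col G k \<noteq> {}))"
    proof (rule sum.cong[OF refl])
      fix G assume "G \<in> \<Omega>'"
      then have "finite (free H G k l \<inter> col G k)" using ffr by simp
      then show "(\<Sum>j\<in>free H G k l \<inter> col G k. 1 / real (card (free H G k l \<inter> col G k)))
        = of_bool (free H G k l \<inter> col G k \<noteq> {})"
        by (cases "free H G k l \<inter> col G k = {}") simp_all
    qed
    finally show ?thesis .
  qed
  also have "\<dots> = real (card {G \<in> \<Omega>'. free H G k l \<inter> col G k \<noteq> {}})"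
    by (subst sum_of_bool_eq) (use fO in \<open>simp_all add: Int_def\<close>)
  finally show ?thesis unfolding \<Omega>_def \<Omega>'_def t'_def .
qed

section \<open>Dense parameters and a calculus of bounds\<close>

text \<open>All errors are measured in powers of \<open>r = sqrt n\<close>, up to powers of a slowly growing \<open>Q\<close>.\<close>

locale dense =
  fixes m n :: nat and s :: "nat \<Rightarrow> nat" and H :: "(nat \<times> nat) set" and Q :: real
  assumes Hsub: "H \<subseteq> {..<m} \<times> {..<n}"
    and Q16: "16 \<le> Q"
    and m_le: "real m \<le> Q * real n" and n_le: "real n \<le> Q * real m"
    and dens_lo: "1 / Q \<le> dens m n s" and dens_hi: "1 / Q \<le> 1 - dens m n s"
    and s_dev: "\<And>j. j < m \<Longrightarrow> \<bar>real (s j) - avg_s m s\<bar> \<le> Q * sqrt (real n)"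
    and x_le: "\<And>j. j < m \<Longrightarrow> real (degU H j) \<le> Q * sqrt (real n)"
    and y_le: "\<And>k. k < n \<Longrightarrow> real (degV H k) \<le> Q * sqrt (real n)"
    and H_le: "real (card H) \<le> Q * real n"
    and big: "Q ^ 100 \<le> sqrt (real n)"
    and tail: "exp (- Q) * sqrt (real n) ^ 60 \<le> 1"
begin

definition r :: real where "r = sqrt (real n)"
definition lam :: real where "lam = dens m n s"
definition y :: "nat \<Rightarrow> real" where "y k = real (degV H k)"

text \<open>The exponent i is the true order of magnitude, a counts slowly growing factors, and g is
  a weight such as 1 + y k that is kept symbolic until it is summed over columns.\<close>

definition bd :: "real \<Rightarrow> nat \<Rightarrow> int \<Rightarrow> real \<Rightarrow> bool"
  where "bd g a i x \<longleftrightarrow> \<bar>x\<bar> \<le> Q ^ a * r powi i * g"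

text \<open>The companion for denominators: x is at least r^i up to b factors Q, and in particular
  positive.\<close>

definition lo :: "nat \<Rightarrow> int \<Rightarrow> real \<Rightarrow> bool"
  where "lo b i x \<longleftrightarrow> r powi i \<le> Q ^ b * x"

lemma Qpos: "0 < Q" "1 \<le> Q" "2 \<le> Q" using Q16 by auto

lemma r_ge: "Q ^ 100 \<le> r" using big by (simp add: r_def)

lemma r_pos: "0 < r" "1 \<le> r"
  using r_ge one_le_power[OF Qpos(2), of 100] by linarith+

lemma r_sq: "r * r = real n" "r\<^sup>2 = real n" by (simp_all add: r_def)

lemma n_pos: "0 < n" using r_pos by (simp add: r_def)

lemma m_pos: "0 < m" using n_le n_pos by (cases m) auto

lemma bd_nonneg: "bd g a i x \<Longrightarrow> 0 \<le> g"
proof -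
  assume "bd g a i x"
  then have "0 \<le> (Q ^ a * r powi i) * g" unfolding bd_def using abs_ge_zero order_trans by blast
  moreover have "0 < Q ^ a * r powi i" using Qpos r_pos by simp
  ultimately show ?thesis by (simp only: zero_le_mult_iff) auto
qed

lemma bd_weak: "bd g a i x \<Longrightarrow> g \<le> h \<Longrightarrow> a \<le> b \<Longrightarrow> i \<le> j \<Longrightarrow> bd h b j x"
proof -
  assume a: "bd g a i x" "g \<le> h" "a \<le> b" "i \<le> j"
  have "Q ^ a * r powi i * g \<le> Q ^ b * r powi j * h"
    using a bd_nonneg[OF a(1)] Qpos r_pos
    by (intro mult_mono power_increasing power_int_increasing) auto
  then show ?thesis using a(1) by (simp add: bd_def)
qed

lemma bd_trade: "bd g a i x \<Longrightarrow> a \<le> b + 100 * k \<Longrightarrow> bd g b (i + int k) x"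
proof -
  assume a: "bd g a i x" "a \<le> b + 100 * k"
  have "Q ^ a \<le> Q ^ b * (Q ^ 100) ^ k"
    using power_increasing[OF a(2) Qpos(2)] by (simp add: power_add power_mult)
  also have "\<dots> \<le> Q ^ b * r ^ k"
    using Qpos r_ge by (intro mult_left_mono power_mono) auto
  finally have "Q ^ a * r powi i \<le> Q ^ b * r ^ k * r powi i"
    using r_pos by (intro mult_right_mono) auto
  also have "\<dots> = Q ^ b * r powi (i + int k)"
    using r_pos by (simp add: power_int_add)
  finally have "Q ^ a * r powi i * g \<le> Q ^ b * r powi (i + int k) * g"
    using bd_nonneg[OF a(1)] by (rule mult_right_mono)
  then show ?thesis using a(1) by (simp add: bd_def)
qed

lemma bd_mult: "bd g a i x \<Longrightarrow> bd h b j z \<Longrightarrow> bd (g * h) (a + b) (i + j) (x * z)"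
proof -
  assume a: "bd g a i x" "bd h b j z"
  have "\<bar>x * z\<bar> \<le> (Q ^ a * r powi i * g) * (Q ^ b * r powi j * h)"
    unfolding abs_mult using a bd_nonneg[OF a(1)] Qpos r_pos by (intro mult_mono) (auto simp: bd_def)
  then show ?thesis using r_pos by (simp add: bd_def power_add power_int_add mult_ac)
qed

text \<open>The factor 2 of the triangle inequality is absorbed into one more Q. This is why the
  exponents of Q in later lemmas grow with the number of summands.\<close>

lemma bd_add: "bd g a i x \<Longrightarrow> bd g b i z \<Longrightarrow> bd g (Suc (max a b)) i (x + z)"
proof -
  assume a: "bd g a i x" "bd g b i z"
  have 1: "bd g (max a b) i x" "bd g (max a b) i z"
    using bd_weak[OF a(1)] bd_weak[OF a(2)] by auto
  have "\<bar>x + z\<bar> \<le> 2 * (Q ^ (max a b) * r powi i * g)"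
    using 1 unfolding bd_def by linarith
  also have "\<dots> \<le> Q * (Q ^ (max a b) * r powi i * g)"
    using bd_nonneg[OF a(1)] Qpos r_pos by (intro mult_right_mono) auto
  finally show ?thesis by (simp add: bd_def mult_ac)
qed

lemma bd_minus: "bd g a i x \<Longrightarrow> bd g a i (- x)" by (simp add: bd_def)

lemma bd_swap: "bd g a i (x - z) \<Longrightarrow> bd g a i (z - x)" by (simp add: bd_def abs_minus_commute)

lemma bd_diff: "bd g a i x \<Longrightarrow> bd g b i z \<Longrightarrow> bd g (Suc (max a b)) i (x - z)"
  using bd_add[of g a i x b "- z"] bd_minus[of g b i z] by simp

lemma bd_abs: "bd g a i \<bar>x\<bar> \<longleftrightarrow> bd g a i x" by (simp add: bd_def)

lemma bd_le: "\<bar>x\<bar> \<le> \<bar>z\<bar> \<Longrightarrow> bd g a i z \<Longrightarrow> bd g a i x" by (simp add: bd_def)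

lemma bd_zero: "0 \<le> g \<Longrightarrow> bd g a i 0" using Qpos r_pos by (simp add: bd_def)

lemma bd_one: "\<bar>x\<bar> \<le> 1 \<Longrightarrow> bd 1 0 0 x" by (simp add: bd_def)

lemma bd_const: "\<bar>x\<bar> \<le> 16 \<Longrightarrow> bd 1 1 0 x" using Q16 by (simp add: bd_def)

lemma bd_self: "0 \<le> g \<Longrightarrow> \<bar>x\<bar> \<le> g \<Longrightarrow> bd g 0 0 x" by (simp add: bd_def)

lemma lo_pos: "lo b i x \<Longrightarrow> 0 < x"
proof -
  assume "lo b i x"
  then have "0 < Q ^ b * x" unfolding lo_def using r_pos zero_less_power_int[of r i] by linarith
  then show ?thesis using Qpos by (simp add: zero_less_mult_iff)
qed

lemma lo_weak: "lo b i x \<Longrightarrow> b \<le> c \<Longrightarrow> j \<le> i \<Longrightarrow> x \<le> z \<Longrightarrow> lo c j z"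
proof -
  assume a: "lo b i x" "b \<le> c" "j \<le> i" "x \<le> z"
  have "r powi j \<le> r powi i" using a r_pos by (intro power_int_increasing) auto
  also have "\<dots> \<le> Q ^ b * x" using a(1) by (simp add: lo_def)
  also have "\<dots> \<le> Q ^ c * z" using a lo_pos[OF a(1)] Qpos by (intro mult_mono power_increasing) auto
  finally show ?thesis by (simp add: lo_def)
qed

lemma lo_mult: "lo a i x \<Longrightarrow> lo b j z \<Longrightarrow> lo (a + b) (i + j) (x * z)"
proof -
  assume a: "lo a i x" "lo b j z"
  have "r powi i * r powi j \<le> (Q ^ a * x) * (Q ^ b * z)"
    using a lo_pos[OF a(1)] Qpos r_pos by (intro mult_mono) (auto simp: lo_def)
  then show ?thesis using r_pos by (simp add: lo_def power_add power_int_add mult_ac)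
qed

lemma bd_div: "bd g a i x \<Longrightarrow> lo b j z \<Longrightarrow> bd g (a + b) (i - j) (x / z)"
proof -
  assume a: "bd g a i x" "lo b j z"
  have z: "0 < z" by (rule lo_pos[OF a(2)])
  have "1 / z \<le> Q ^ b * r powi (- j)"
  proof -
    have "r powi (- j) * r powi j = 1" using r_pos by (simp add: power_int_minus)
    moreover have "r powi (- j) * r powi j \<le> r powi (- j) * (Q ^ b * z)"
      using a(2) r_pos by (intro mult_left_mono) (auto simp: lo_def)
    ultimately have "1 \<le> (Q ^ b * r powi (- j)) * z" by (simp add: mult_ac)
    then show ?thesis using z by (simp add: pos_divide_le_eq)
  qed
  then have "\<bar>x\<bar> * (1 / z) \<le> (Q ^ a * r powi i * g) * (Q ^ b * r powi (- j))"
    using a(1) z bd_nonneg[OF a(1)] Qpos r_pos by (intro mult_mono) (auto simp: bd_def)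
  moreover have "\<bar>x / z\<bar> = \<bar>x\<bar> * (1 / z)" using z by simp
  moreover have "r powi (i - j) = r powi i * r powi (- j)" using r_pos by (simp add: power_int_add[symmetric])
  ultimately show ?thesis by (simp only: bd_def power_add mult_ac)
qed

text \<open>The perturbation is smaller than the main term by a factor r, which outweighs the a + b
  + 1 <= 100 factors Q involved. At most half of the main term is lost, and that costs one
  Q.\<close>

lemma lo_approx: "lo b i x \<Longrightarrow> bd 1 a j (z - x) \<Longrightarrow> a + b + 1 \<le> 100 \<Longrightarrow> j < i \<Longrightarrow> lo (Suc b) i z"
proof -
  assume a: "lo b i x" "bd 1 a j (z - x)" "a + b + 1 \<le> 100" "j < i"
  have "bd 1 (a + b + 1) j (z - x)" using bd_weak[OF a(2)] by auto
  then have "Q ^ (a + b + 1) * 1 * r powi j \<ge> \<bar>z - x\<bar>" by (simp add: bd_def)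
  have p1: "\<bar>z - x\<bar> \<le> Q ^ a * r powi j" using a(2) by (simp add: bd_def)
  have "Q ^ (b + 1) * \<bar>z - x\<bar> \<le> Q ^ (b + 1) * (Q ^ a * r powi j)"
    using p1 Qpos by (intro mult_left_mono) auto
  also have "\<dots> = Q ^ (a + b + 1) * r powi j" by (simp add: power_add mult_ac)
  also have "\<dots> \<le> r * r powi j"
    using power_increasing[OF a(3) Qpos(2)] r_ge r_pos by (intro mult_right_mono) auto
  also have "\<dots> = r powi (j + 1)" using r_pos by (simp add: power_int_add)
  also have "\<dots> \<le> r powi i" using a(4) r_pos by (intro power_int_increasing) auto
  finally have p2: "Q ^ (b + 1) * \<bar>z - x\<bar> \<le> r powi i" .
  have "2 * r powi i \<le> Q * r powi i" using Qpos r_pos by (intro mult_right_mono) auto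
  also have "\<dots> \<le> Q * (Q ^ b * x)" using a(1) Qpos by (intro mult_left_mono) (auto simp: lo_def)
  finally have "2 * r powi i \<le> Q ^ (b + 1) * x" by (simp add: mult_ac)
  moreover have "Q ^ (b + 1) * x \<le> Q ^ (b + 1) * (z + \<bar>z - x\<bar>)"
    using Qpos by (intro mult_left_mono) auto
  ultimately have "2 * r powi i \<le> Q ^ (b + 1) * z + r powi i"
    using p2 by (simp add: distrib_left)
  then show ?thesis by (simp add: lo_def)
qed

lemma bd_sum:
  assumes "\<And>x. x \<in> A \<Longrightarrow> bd g a i (f x)" "bd 1 b j (real (card A))" "0 \<le> g"
  shows "bd g (a + b) (i + j) (\<Sum>x\<in>A. f x)"
proof -
  have "\<bar>\<Sum>x\<in>A. f x\<bar> \<le> (\<Sum>x\<in>A. Q ^ a * r powi i * g)"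
    using assms(1) by (intro order_trans[OF sum_abs] sum_mono) (auto simp: bd_def)
  also have "\<dots> = real (card A) * (Q ^ a * r powi i * g)" by simp
  also have "\<dots> \<le> (Q ^ b * r powi j) * (Q ^ a * r powi i * g)"
    using assms(2,3) Qpos r_pos by (intro mult_right_mono) (auto simp: bd_def)
  finally show ?thesis using r_pos by (simp add: bd_def power_add power_int_add mult_ac)
qed

text \<open>Individual weights may be as large as order r; only their total matters. With g = 1 + y
  or g = y the total is of order n, as if every weight were bounded.\<close>

lemma bd_sum_weighted:
  assumes "\<And>x. x \<in> A \<Longrightarrow> bd (g x) a i (f x)" "bd 1 b j (\<Sum>x\<in>A. g x)"
  shows "bd 1 (a + b) (i + j) (\<Sum>x\<in>A. f x)"
proof -
  have "\<bar>\<Sum>x\<in>A. f x\<bar> \<le> (\<Sum>x\<in>A. Q ^ a * r powi i * g x)"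
    using assms(1) by (intro order_trans[OF sum_abs] sum_mono) (auto simp: bd_def)
  also have "\<dots> = (Q ^ a * r powi i) * (\<Sum>x\<in>A. g x)" by (simp add: sum_distrib_left)
  also have "\<dots> \<le> (Q ^ a * r powi i) * (Q ^ b * r powi j)"
    using assms(2) Qpos r_pos by (intro mult_left_mono) (auto simp: bd_def)
  finally show ?thesis using r_pos by (simp add: bd_def power_add power_int_add mult_ac)
qed

lemma bd_n: "bd 1 0 2 (real n)" using r_sq by (simp add: bd_def)
lemma lo_n: "lo 0 2 (real n)" using r_sq by (simp add: lo_def)
lemma bd_m: "bd 1 1 2 (real m)" using r_sq m_le by (simp add: bd_def)
lemma lo_m: "lo 1 2 (real m)" using r_sq n_le by (simp add: lo_def)
lemma lo_lam: "lo 1 0 lam" using dens_lo Qpos by (simp add: lo_def lam_def pos_divide_le_eq mult.commute)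
lemma lo_lam1: "lo 1 0 (1 - lam)" using dens_hi Qpos by (simp add: lo_def lam_def pos_divide_le_eq mult.commute)
lemma lam01: "0 < lam" "lam < 1" using lo_pos[OF lo_lam] lo_pos[OF lo_lam1] by auto
lemma bd_lam: "bd 1 0 0 lam" using lam01 by (intro bd_one) auto

lemma avg_s_eq: "avg_s m s = lam * real n"
  using n_pos by (simp add: lam_def dens_def)

lemma sum_s: "(\<Sum>j<m. real (s j)) = lam * real m * real n"
  using avg_s_eq m_pos by (simp add: avg_s_def field_simps)

lemma bd_s: "j < m \<Longrightarrow> bd 1 1 1 (real (s j) - lam * real n)"
  using s_dev[of j] by (simp add: bd_def avg_s_eq r_def)

lemma bd_s_div: "j < m \<Longrightarrow> bd 1 1 (-1) (real (s j) / real n - lam)"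
  using bd_div[OF bd_s lo_n, of j] n_pos by (simp add: diff_divide_distrib)

lemma bd_y: "k < n \<Longrightarrow> bd 1 1 1 (y k)"
  using y_le[of k] by (simp add: bd_def y_def r_def)

lemma y_nonneg: "0 \<le> y k" by (simp add: y_def)

lemma finite_H: "finite H" using Hsub finite_subset by blast

lemma finite_colH: "finite (col H k)" using finite_col[OF Hsub] .

lemma card_colH: "real (card (col H k)) = y k" by (simp add: y_def degV_col)

lemma bd_x: "j < m \<Longrightarrow> bd 1 1 1 (real (degU H j))"
  using x_le[of j] by (simp add: bd_def r_def)

lemma sum_y: "(\<Sum>k<n. y k) = real (card H)"
proof -
  have "card H = card (SIGMA k:{..<n}. col H k)"
    by (rule bij_betw_same_card[of "\<lambda>(j,k). (k,j)"], rule bij_betw_byWitness[where f' = "\<lambda>(k,j). (j,k)"])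
      (use Hsub in \<open>auto simp: col_def\<close>)
  then show ?thesis using finite_colH by (simp add: y_def degV_col)
qed

lemma sum_x: "(\<Sum>j<m. real (degU H j)) = real (card H)"
proof -
  have f: "finite {k. (j,k) \<in> H}" for j by (rule finite_row[OF Hsub])
  have "card H = card (SIGMA j:{..<m}. {k. (j,k) \<in> H})"
    by (rule bij_betw_same_card[of "\<lambda>x. x"], rule bij_betw_byWitness[where f' = "\<lambda>x. x"])
      (use Hsub in auto)
  then show ?thesis using f by (simp add: degU_def)
qed

lemma bd_card_H: "bd 1 1 2 (real (card H))"
  using H_le r_sq by (simp add: bd_def)

lemma bd_sum_1y: "bd 1 2 2 (\<Sum>k<n. 1 + y k)"
proof -
  have "(\<Sum>k<n. 1 + y k) = real n + real (card H)" by (simp add: sum.distrib sum_y)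
  then show ?thesis using bd_weak[OF bd_add[OF bd_n bd_card_H]] by simp
qed

end

section \<open>Statistics that depend on few columns, and their concentration\<close>

definition dep :: "nat set \<Rightarrow> ((nat \<times> nat) set \<Rightarrow> 'a) \<Rightarrow> bool"
  where "dep K w \<longleftrightarrow> (\<forall>G G'. (\<forall>i\<in>K. col G i = col G' i) \<longrightarrow> w G = w G')"

text \<open>The reason for \<open>dep\<close>: a weight determined by columns other than k and l is
  constant on the class in which these two are resampled.\<close>

lemma dep_put: "dep K w \<Longrightarrow> k \<notin> K \<Longrightarrow> l \<notin> K \<Longrightarrow> w (put H G k l S) = w G"
  unfolding dep_def by (metis col_put_other)

lemma free_col_eq: "free H G k l = {j. j \<notin> col H k \<and> j \<notin> col H l \<and> (j \<in> col G k) \<noteq> (j \<in> col G l)}"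
  by (auto simp: free_def col_def)

text \<open>Nonemptiness is assumed so that \<open>EE\<close> is a genuine expectation; vectors
  without graphs are treated separately in \<open>Th_step\<close>.\<close>

locale colwin = dense +
  fixes t :: "nat \<Rightarrow> nat"
  assumes t_sum: "(\<Sum>k<n. t k) = (\<Sum>j<m. s j)"
    and t_dev: "\<And>k. k < n \<Longrightarrow> \<bar>real (t k) - avg_s n t\<bar> \<le> Q * sqrt (real n)"
    and nonempty: "bip_graphs m n s t H \<noteq> {}"
begin

definition \<Omega> :: "(nat \<times> nat) set set" where "\<Omega> = bip_graphs m n s t H"
definition EE :: "((nat \<times> nat) set \<Rightarrow> real) \<Rightarrow> real" where "EE f = mean \<Omega> f"

lemma finite_\<Omega>: "finite \<Omega>" by (simp add: \<Omega>_def finite_bip_graphs)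
lemma \<Omega>_ne: "\<Omega> \<noteq> {}" using nonempty by (simp add: \<Omega>_def)
lemma \<Omega>_sub: "G \<in> \<Omega> \<Longrightarrow> G \<subseteq> {..<m} \<times> {..<n}" by (simp add: \<Omega>_def bip_sub)
lemma \<Omega>_fin_col: "G \<in> \<Omega> \<Longrightarrow> finite (col G k)" using finite_col[OF \<Omega>_sub] .
lemma \<Omega>_fin_free: "G \<in> \<Omega> \<Longrightarrow> finite (free H G k l)" using finite_free[OF \<Omega>_sub] .
lemma \<Omega>_col: "G \<in> \<Omega> \<Longrightarrow> k < n \<Longrightarrow> card (col G k) = t k" by (simp add: \<Omega>_def bip_col_card)

lemma avg_t: "avg_s n t = lam * real m"
proof -
  have "(\<Sum>k<n. real (t k)) = (\<Sum>j<m. real (s j))" using t_sum by (metis of_nat_sum)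
  then show ?thesis using sum_s n_pos by (simp add: avg_s_def field_simps)
qed

lemma sum_t: "(\<Sum>k<n. real (t k)) = lam * real m * real n"
  using avg_t n_pos by (simp add: avg_s_def field_simps)

lemma bd_t: "k < n \<Longrightarrow> bd 1 1 1 (real (t k) - lam * real m)"
  using t_dev[of k] by (simp add: bd_def avg_t r_def)

lemma bd_t_div: "k < n \<Longrightarrow> bd 1 2 (-1) (real (t k) / real m - lam)"
  using bd_div[OF bd_t lo_m, of k] m_pos by (simp add: diff_divide_distrib numeral_2_eq_2)

lemma EE_add: "EE (\<lambda>G. f G + g G) = EE f + EE g" by (simp add: EE_def mean_add)
lemma EE_diff: "EE (\<lambda>G. f G - g G) = EE f - EE g" by (simp add: EE_def mean_diff)
lemma EE_cmult: "EE (\<lambda>G. c * f G) = c * EE f" by (simp add: EE_def mean_cmult)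
lemma EE_multc: "EE (\<lambda>G. f G * c) = EE f * c" by (simp add: EE_def mean_multc)
lemma EE_divc: "EE (\<lambda>G. f G / c) = EE f / c" by (simp add: EE_def mean_divc)
lemma EE_const: "EE (\<lambda>G. c) = c" by (simp add: EE_def mean_const finite_\<Omega> \<Omega>_ne)
lemma EE_sum: "EE (\<lambda>G. \<Sum>i\<in>I. f i G) = (\<Sum>i\<in>I. EE (f i))" by (simp add: EE_def mean_sum)
lemma EE_cong: "(\<And>G. G \<in> \<Omega> \<Longrightarrow> f G = g G) \<Longrightarrow> EE f = EE g" unfolding EE_def by (rule mean_cong)
lemma EE_mono: "(\<And>G. G \<in> \<Omega> \<Longrightarrow> f G \<le> g G) \<Longrightarrow> EE f \<le> EE g" unfolding EE_def by (rule mean_mono)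
lemma EE_abs: "\<bar>EE f\<bar> \<le> EE (\<lambda>G. \<bar>f G\<bar>)" unfolding EE_def by (rule mean_abs_le)

lemma bd_EE: "(\<And>G. G \<in> \<Omega> \<Longrightarrow> bd g a i (f G)) \<Longrightarrow> bd g a i (EE f)"
proof -
  assume a: "\<And>G. G \<in> \<Omega> \<Longrightarrow> bd g a i (f G)"
  obtain G where "G \<in> \<Omega>" using \<Omega>_ne by auto
  then have "0 \<le> Q ^ a * r powi i * g" using a abs_ge_zero order_trans unfolding bd_def by blast
  then show ?thesis using mean_abs_bound[of \<Omega> f "Q ^ a * r powi i * g"] a by (simp add: bd_def EE_def)
qed

text \<open>Double counting: row j contributes w j once for each of its entries. The right side
  involves G only through w, which is what turns differences between columns into absolute
  values.\<close>

lemma sum_colsum: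
  assumes G: "G \<in> \<Omega>"
  shows "(\<Sum>k<n. colsum G k w) = (\<Sum>j<m. w j * real (s j))"
proof -
  note Gs = \<Omega>_sub[OF G]
  have "(\<Sum>k<n. colsum G k w) = (\<Sum>k<n. \<Sum>j<m. of_bool ((j,k) \<in> G) * w j)"
    unfolding colsum_def using sum_subset_of_bool[OF finite_lessThan col_sub[OF Gs], where w=w]
    by (simp add: col_def)
  also have "\<dots> = (\<Sum>j<m. w j * (\<Sum>k<n. of_bool ((j,k) \<in> G)))"
    by (subst sum.swap) (simp add: sum_distrib_left mult.commute)
  also have "\<dots> = (\<Sum>j<m. w j * real (s j))"
  proof (intro sum.cong refl)
    fix j assume "j \<in> {..<m}"
    then have "card {k. (j,k) \<in> G} = s j" using G by (simp add: \<Omega>_def bip_row_card)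
    moreover have "{..<n} \<inter> {k. (j,k) \<in> G} = {k. (j,k) \<in> G}" using Gs by auto
    ultimately show "w j * (\<Sum>k<n. of_bool ((j,k) \<in> G)) = w j * real (s j)" by simp
  qed
  finally show ?thesis .
qed

lemma card_free_le: "G \<in> \<Omega> \<Longrightarrow> card (free H G k l) \<le> m"
  using card_mono[of "{..<m}" "free H G k l"] free_sub[OF \<Omega>_sub] by auto

lemma card_colG_le: "G \<in> \<Omega> \<Longrightarrow> card (col G k) \<le> m"
  using card_mono[of "{..<m}" "col G k"] col_sub[OF \<Omega>_sub] by auto

lemma gk_le: "real (card (col G k \<inter> col H l)) \<le> y l"
  using card_mono[of "col H l" "col G k \<inter> col H l"] finite_colH card_colH[of l] by (simp add: of_nat_mono)

lemma bal_bound: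
  assumes "G \<in> \<Omega>" "k \<noteq> l" "k < n" "l < n"
  shows "\<bar>bal H G k l\<bar> \<le> 4 * Q * r"
proof -
  have "bal H G k l = real (t k) - real (t l) - real (card (col G k \<inter> col H l)) + real (card (col G l \<inter> col H k))"
    using bal_eq[OF assms(1)[unfolded \<Omega>_def] assms(2-4)] .
  moreover have "\<bar>real (t k) - lam * real m\<bar> \<le> Q * r" "\<bar>real (t l) - lam * real m\<bar> \<le> Q * r"
    "y k \<le> Q * r" "y l \<le> Q * r"
    using bd_t[of k] bd_t[of l] bd_y[of k] bd_y[of l] assms y_nonneg by (auto simp: bd_def)
  ultimately show ?thesis using gk_le[of G k l] gk_le[of G l k] by linarith
qed

lemma abs_sum_le: "(\<And>j. j \<in> A \<Longrightarrow> \<bar>w j\<bar> \<le> \<omega>) \<Longrightarrow> \<bar>\<Sum>j\<in>A. w j\<bar> \<le> real (card A) * (\<omega>::real)"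
  by (rule order_trans[OF sum_abs], rule order_trans[OF sum_mono[where g = "\<lambda>_. \<omega>"]]) auto

lemma bnd_abs:
  assumes G: "G \<in> \<Omega>" and w: "\<And>j. j < m \<Longrightarrow> \<bar>w j\<bar> \<le> \<omega>" and "0 \<le> \<omega>"
  shows "\<bar>bnd H G k l w\<bar> \<le> \<omega> * (y k + y l)"
proof -
  have cs: "col G i \<subseteq> {..<m}" for i using col_sub[OF \<Omega>_sub[OF G]] .
  have "\<bar>\<Sum>j\<in>col G i \<inter> col H i'. w j\<bar> \<le> y i' * \<omega>" for i i'
  proof -
    have "\<bar>\<Sum>j\<in>col G i \<inter> col H i'. w j\<bar> \<le> real (card (col G i \<inter> col H i')) * \<omega>"
      by (rule abs_sum_le) (use w cs in auto)
    also have "\<dots> \<le> y i' * \<omega>" by (rule mult_right_mono[OF gk_le]) fact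
    finally show ?thesis .
  qed
  from this[of k l] this[of l k] show ?thesis unfolding bnd_def by (simp add: algebra_simps)
qed

lemma drift_ratio_abs:
  assumes G: "G \<in> \<Omega>" and w: "\<And>j. j < m \<Longrightarrow> \<bar>w j\<bar> \<le> \<omega>" and "0 \<le> \<omega>"
  shows "\<bar>bal H G k l / real (card (free H G k l)) * (\<Sum>j\<in>free H G k l. w j)\<bar> \<le> \<bar>bal H G k l\<bar> * \<omega>"
proof -
  have "\<bar>\<Sum>j\<in>free H G k l. w j\<bar> \<le> real (card (free H G k l)) * \<omega>"
    by (rule abs_sum_le) (use w free_sub[OF \<Omega>_sub[OF G], of H k l] in auto)
  then have "\<bar>bal H G k l\<bar> * \<bar>\<Sum>j\<in>free H G k l. w j\<bar> \<le> \<bar>bal H G k l\<bar> * (real (card (free H G k l)) * \<omega>)"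
    by (intro mult_left_mono) auto
  then show ?thesis
    by (cases "card (free H G k l) = 0") (auto simp: abs_mult divide_simps mult_ac assms)
qed

lemma class_tail:
  assumes kl: "k \<noteq> l" "k < n" "l < n" and dep: "dep K w" "k \<notin> K" "l \<notin> K"
    and w: "\<And>G j. G \<in> \<Omega> \<Longrightarrow> j < m \<Longrightarrow> \<bar>w G j\<bar> \<le> \<omega>" and om: "0 < \<omega>"
  shows "EE (\<lambda>G. of_bool (4 * Q * r * \<omega> < \<bar>(\<Sum>j\<in>free H G k l \<inter> col G k. w G j)
     - real (card (free H G k l \<inter> col G k)) / real (card (free H G k l)) * (\<Sum>j\<in>free H G k l. w G j)\<bar>))
     \<le> 2 * exp (- Q)" (is "EE ?f \<le> _")
proof -
  have "EE ?f = mean \<Omega> (\<lambda>G. mean (nsub (free H G k l) (card (free H G k l \<inter> col G k))) (\<lambda>S. ?f (put H G k l S)))"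
    unfolding EE_def \<Omega>_def by (rule class_average[OF kl])
  also have "\<dots> \<le> mean \<Omega> (\<lambda>G. 2 * exp (- Q))"
  proof (rule mean_mono)
    fix G assume G: "G \<in> \<Omega>"
    define F where "F = free H G k l"
    define B where "B = card (F \<inter> col G k)"
    \<comment> \<open>With this scale the weights are at most 1 / (2 * r), so that four times the
      sum of squares is at most card F / r^2 <= Q, while the deviation 4 * Q * r * \<omega> becomes
      2 * Q.\<close>
    define \<theta> where "\<theta> = 1 / (2 * r * \<omega>)"
    have th: "0 < \<theta>" using r_pos om by (simp add: \<theta>_def)
    have finF: "finite F" unfolding F_def by (rule \<Omega>_fin_free[OF G])
    have BF: "B \<le> card F" unfolding B_def using finF by (simp add: card_mono)
    have FM: "F \<subseteq> {..<m}" using free_sub[OF \<Omega>_sub[OF G]] by (simp add: F_def)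
    have "mean (nsub F B) (\<lambda>S. ?f (put H G k l S))
      = mean (nsub F B) (\<lambda>S. of_bool (2 * Q < \<bar>(\<Sum>j\<in>S. \<theta> * w G j) - real B / real (card F) * (\<Sum>j\<in>F. \<theta> * w G j)\<bar>))"
    proof (rule mean_cong)
      fix S assume S: "S \<in> nsub F B"
      have SF: "S \<subseteq> free H G k l" "card S = B" using S by (auto simp: nsub_def F_def)
      have 1: "free H (put H G k l S) k l = F" using free_put[OF SF(1) kl(1)] by (simp add: F_def)
      have 2: "F \<inter> col (put H G k l S) k = S" using free_cap_put_fst[OF SF(1) kl(1)] by (simp add: F_def)
      have 3: "w (put H G k l S) = w G" by (rule dep_put[OF dep])
      let ?d = "(\<Sum>j\<in>S. w G j) - real B / real (card F) * (\<Sum>j\<in>F. w G j)"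
      have "(\<Sum>j\<in>S. \<theta> * w G j) - real B / real (card F) * (\<Sum>j\<in>F. \<theta> * w G j) = \<theta> * ?d"
        by (simp add: sum_distrib_left[symmetric] algebra_simps)
      then have "\<bar>(\<Sum>j\<in>S. \<theta> * w G j) - real B / real (card F) * (\<Sum>j\<in>F. \<theta> * w G j)\<bar> = \<theta> * \<bar>?d\<bar>"
        using th by (simp add: abs_mult)
      moreover have "(2 * Q < \<theta> * \<bar>?d\<bar>) = (4 * Q * r * \<omega> < \<bar>?d\<bar>)"
        using r_pos om by (simp add: \<theta>_def field_simps)
      ultimately show "?f (put H G k l S) = of_bool (2 * Q < \<bar>(\<Sum>j\<in>S. \<theta> * w G j) - real B / real (card F) * (\<Sum>j\<in>F. \<theta> * w G j)\<bar>)"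
        unfolding 1 2 3 SF(2) by simp
    qed
    also have "\<dots> \<le> 2 * exp (4 * real (card F) * (1 / (2 * r))\<^sup>2 - 2 * Q)"
    proof (rule mean_nsub_two_tails[OF finF BF])
      fix i assume "i \<in> F"
      then have "\<bar>w G i\<bar> \<le> \<omega>" using w[OF G] FM by auto
      then show "\<bar>\<theta> * w G i\<bar> \<le> 1 / (2 * r)"
        using r_pos om by (simp add: \<theta>_def abs_mult divide_simps)
    qed (use r_pos in simp)
    also have "\<dots> \<le> 2 * exp (- Q)"
    proof -
      have "real (card F) \<le> Q * r\<^sup>2" using card_free_le[OF G, of k l] m_le r_sq by (simp add: F_def)
      then have "4 * real (card F) * (1 / (2 * r))\<^sup>2 \<le> Q"
        using r_pos by (simp add: power_divide power_mult_distrib divide_simps)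
      then show ?thesis by simp
    qed
    finally show "mean (nsub (free H G k l) (card (free H G k l \<inter> col G k))) (\<lambda>S. ?f (put H G k l S)) \<le> 2 * exp (- Q)"
      by (simp add: F_def B_def)
  qed
  also have "\<dots> = 2 * exp (- Q)" by (simp add: mean_const finite_\<Omega> \<Omega>_ne)
  finally show ?thesis .
qed

definition bad :: "((nat \<times> nat) set \<Rightarrow> bool) \<Rightarrow> real" where "bad P = EE (\<lambda>G. of_bool (P G))"

lemma bad_mono: "(\<And>G. G \<in> \<Omega> \<Longrightarrow> P G \<Longrightarrow> P' G) \<Longrightarrow> bad P \<le> bad P'"
  unfolding bad_def by (rule EE_mono) auto

lemma bad_disj: "bad (\<lambda>G. P G \<or> P' G) \<le> bad P + bad P'"
  unfolding bad_def EE_add[symmetric] by (rule EE_mono) auto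

lemma bad_Ex:
  assumes "finite A"
  shows "bad (\<lambda>G. \<exists>x\<in>A. P x G) \<le> (\<Sum>x\<in>A. bad (P x))"
proof -
  have "bad (\<lambda>G. \<exists>x\<in>A. P x G) \<le> EE (\<lambda>G. \<Sum>x\<in>A. of_bool (P x G))"
    unfolding bad_def
  proof (rule EE_mono)
    fix G
    show "of_bool (\<exists>x\<in>A. P x G) \<le> (\<Sum>x\<in>A. of_bool (P x G) :: real)"
    proof (cases "\<exists>x\<in>A. P x G")
      case True
      then obtain x where "x \<in> A" "P x G" by auto
      then show ?thesis using member_le_sum[of x A "\<lambda>x. of_bool (P x G) :: real"] assms by auto
    qed (simp add: sum_nonneg)
  qed
  then show ?thesis by (simp add: bad_def EE_sum)
qed

text \<open>Comparing column k with every other column and averaging, since all columns together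
  have a known weighted sum.\<close>

lemma concentration:
  assumes k: "k < n" "k \<notin> K" and dep: "dep K w" and K: "finite K" "card K \<le> 3"
    and w: "\<And>G j. G \<in> \<Omega> \<Longrightarrow> j < m \<Longrightarrow> \<bar>w G j\<bar> \<le> \<omega>" and om: "0 < \<omega>"
  shows "bad (\<lambda>G. Q ^ 3 * r * \<omega> < \<bar>colsum G k (w G) - lam * (\<Sum>j<m. w G j)\<bar>) \<le> 2 * r\<^sup>2 * exp (- Q)"
proof -
  let ?L = "{..<n} - K - {k}"
  let ?P = "\<lambda>l G. 4 * Q * r * \<omega> < \<bar>(\<Sum>j\<in>free H G k l \<inter> col G k. w G j)
     - real (card (free H G k l \<inter> col G k)) / real (card (free H G k l)) * (\<Sum>j\<in>free H G k l. w G j)\<bar>"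
  have "bad (\<lambda>G. Q ^ 3 * r * \<omega> < \<bar>colsum G k (w G) - lam * (\<Sum>j<m. w G j)\<bar>) \<le> bad (\<lambda>G. \<exists>l\<in>?L. ?P l G)"
  proof (rule bad_mono, rule ccontr)
    fix G assume G: "G \<in> \<Omega>" and gt: "Q ^ 3 * r * \<omega> < \<bar>colsum G k (w G) - lam * (\<Sum>j<m. w G j)\<bar>"
      and nb: "\<not> (\<exists>l\<in>?L. ?P l G)"
    let ?Z = "\<lambda>l. colsum G l (w G)"
    have near: "\<bar>?Z k - ?Z l\<bar> \<le> 14 * Q * r * \<omega>" if l: "l \<in> ?L" for l
    proof -
      have kl: "k \<noteq> l" "l < n" using l by auto
      let ?F = "free H G k l"
      let ?B = "real (card (?F \<inter> col G k))" and ?D = "real (card ?F)" and ?U = "(\<Sum>j\<in>?F. w G j)"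
      let ?S = "(\<Sum>j\<in>?F \<inter> col G k. w G j)"
      have 1: "\<bar>?S - ?B / ?D * ?U\<bar> \<le> 4 * Q * r * \<omega>" using nb l by force
      have bal: "bal H G k l = 2 * ?B - ?D"
        using card_free_split[OF G[unfolded \<Omega>_def], of k l] unfolding bal_def by linarith
      have e: "bal H G k l / ?D * ?U = 2 * (?B / ?D * ?U) - ?U"
      proof (cases "?D = 0")
        case True
        then have "?F = {}" using \<Omega>_fin_free[OF G] by simp
        then show ?thesis by simp
      next
        case False
        then show ?thesis unfolding bal by (simp add: field_simps)
      qed
      have 2: "\<bar>bal H G k l / ?D * ?U\<bar> \<le> \<bar>bal H G k l\<bar> * \<omega>"
        by (rule drift_ratio_abs[OF G]) (use w[OF G] om in auto)
      have 3: "\<bar>bal H G k l\<bar> * \<omega> \<le> 4 * Q * r * \<omega>"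
        using bal_bound[OF G kl(1) k(1) kl(2)] om by (intro mult_right_mono) auto
      have 4: "\<bar>bnd H G k l (w G)\<bar> \<le> \<omega> * (y k + y l)"
        by (rule bnd_abs[OF G]) (use w[OF G] om in auto)
      have "y k + y l \<le> 2 * Q * r" using bd_y[OF k(1)] bd_y[OF kl(2)] y_nonneg by (auto simp: bd_def)
      then have 5: "\<omega> * (y k + y l) \<le> 2 * Q * r * \<omega>" using om mult_left_mono[of "y k + y l" "2 * Q * r" \<omega>] by (simp add: mult_ac)
      have "?Z k - ?Z l = bnd H G k l (w G) + 2 * ?S - ?U" by (rule colsum_diff[OF G[unfolded \<Omega>_def] kl(1)])
      then show ?thesis using 1 2 3 4 5 e by linarith
    qed
    have Zb: "\<bar>?Z l\<bar> \<le> real m * \<omega>" for l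
    proof -
      have "\<bar>?Z l\<bar> \<le> real (card (col G l)) * \<omega>"
        unfolding colsum_def by (rule abs_sum_le) (use w[OF G] col_sub[OF \<Omega>_sub[OF G]] in auto)
      also have "\<dots> \<le> real m * \<omega>" using card_colG_le[OF G] om by (intro mult_right_mono) auto
      finally show ?thesis .
    qed
    \<comment> \<open>Columns in K determine the weight and cannot be exchanged. There are at most
      three of them, so the trivial bound is good enough.\<close>
    have all: "\<bar>?Z k - ?Z l\<bar> \<le> 14 * Q * r * \<omega> + (if l \<in> K then 2 * (real m * \<omega>) else 0)" if "l < n" for l
    proof -
      have p: "0 < 14 * Q * r * \<omega>" using Qpos r_pos om by simp
      consider "l = k" | "l \<in> K" | "l \<in> ?L" using \<open>l < n\<close> by auto
      then show ?thesis
      proof cases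
        case 2
        have "\<bar>?Z k - ?Z l\<bar> \<le> 14 * Q * r * \<omega> + 2 * (real m * \<omega>)" using Zb[of k] Zb[of l] p by linarith
        then show ?thesis using 2 by simp
      qed (use p near[of l] k in auto)
    qed
    have "\<bar>real n * ?Z k - (\<Sum>l<n. ?Z l)\<bar> = \<bar>\<Sum>l<n. ?Z k - ?Z l\<bar>" by (simp add: sum_subtractf)
    also have "\<dots> \<le> (\<Sum>l<n. 14 * Q * r * \<omega> + (if l \<in> K then 2 * (real m * \<omega>) else 0))"
      by (rule order_trans[OF sum_abs]) (rule sum_mono, use all in auto)
    also have "\<dots> = real n * (14 * Q * r * \<omega>) + real (card ({..<n} \<inter> K)) * (2 * (real m * \<omega>))"
      by (simp add: sum.distrib sum.If_cases)
    also have "real (card ({..<n} \<inter> K)) * (2 * (real m * \<omega>)) \<le> 3 * (2 * (real m * \<omega>))"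
      using K card_mono[of K "{..<n} \<inter> K"] om by (intro mult_right_mono) auto
    finally have A: "\<bar>real n * ?Z k - (\<Sum>l<n. ?Z l)\<bar> \<le> real n * (14 * Q * r * \<omega>) + 6 * (real m * \<omega>)" by simp
    \<comment> \<open>The exact total from \<open>sum_colsum\<close> is compared with what equal row
      sums would give; each row sum is off by at most Q * r.\<close>
    have "(\<Sum>l<n. ?Z l) - lam * real n * (\<Sum>j<m. w G j) = (\<Sum>j<m. w G j * (real (s j) - lam * real n))"
      unfolding sum_colsum[OF G] by (simp add: sum_distrib_left right_diff_distrib sum_subtractf mult_ac)
    also have "\<bar>\<dots>\<bar> \<le> (\<Sum>j<m. \<omega> * (Q * r))"
      using w[OF G] bd_s om unfolding bd_def
      by (intro order_trans[OF sum_abs] sum_mono) (auto simp: abs_mult intro!: mult_mono)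
    finally have B: "\<bar>(\<Sum>l<n. ?Z l) - lam * real n * (\<Sum>j<m. w G j)\<bar> \<le> real m * (\<omega> * (Q * r))" by simp
    have "real n * \<bar>?Z k - lam * (\<Sum>j<m. w G j)\<bar> = \<bar>real n * ?Z k - lam * real n * (\<Sum>j<m. w G j)\<bar>"
      by (subst abs_of_nonneg[of "real n", symmetric], simp, subst abs_mult[symmetric]) (simp add: algebra_simps)
    also have "\<dots> \<le> real n * (14 * Q * r * \<omega>) + 6 * (real m * \<omega>) + real m * (\<omega> * (Q * r))"
      using A B by linarith
    also have "\<dots> \<le> real n * (14 * Q * r * \<omega>) + 6 * (Q * real n * \<omega>) + Q * real n * (\<omega> * (Q * r))"
      using m_le om Qpos r_pos by (intro add_mono mult_right_mono mult_left_mono) auto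
    also have "\<dots> = real n * ((14 * Q * r + 6 * Q + Q * Q * r) * \<omega>)" by (simp add: algebra_simps)
    also have "\<dots> \<le> real n * ((Q ^ 3 * r) * \<omega>)"
    proof (intro mult_left_mono mult_right_mono)
      have "14 * Q * r + 6 * Q + Q * Q * r \<le> 14 * Q * r + 6 * Q * r + Q * Q * r" using r_pos Qpos by simp
      also have "\<dots> = (20 + Q) * (Q * r)" by (simp add: algebra_simps)
      also have "\<dots> \<le> (Q * Q) * (Q * r)"
      proof (rule mult_right_mono)
        have "16 * Q \<le> Q * Q" using Q16 by (intro mult_right_mono) auto
        then show "20 + Q \<le> Q * Q" using Q16 by linarith
      qed (use Qpos r_pos in simp)
      finally show "14 * Q * r + 6 * Q + Q * Q * r \<le> Q ^ 3 * r" by (simp add: power3_eq_cube mult_ac)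
    qed (use om in auto)
    finally show False using gt n_pos by (simp add: mult_ac)
  qed
  also have "\<dots> \<le> (\<Sum>l\<in>?L. bad (?P l))" by (rule bad_Ex) simp
  also have "\<dots> \<le> (\<Sum>l\<in>?L. 2 * exp (- Q))"
    unfolding bad_def by (intro sum_mono class_tail[OF _ _ _ dep]) (use k w om in auto)
  also have "\<dots> \<le> real n * (2 * exp (- Q))"
    by (rule order_trans[OF sum_mono2[of "{..<n}"]]) auto
  finally show ?thesis using r_sq by simp
qed

end

section \<open>Typical graphs\<close>

context colwin
begin

text \<open>\<open>concentration\<close> for the weight v restricted to a random set of rows. The
  set may depend on up to three other columns, which covers intersections of columns and free
  sets.\<close>

lemma concentration_inter:
  assumes k: "k < n" "k \<notin> K" and dep: "dep K A" and K: "finite K" "card K \<le> 3"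
    and A: "\<And>G. G \<in> \<Omega> \<Longrightarrow> A G \<subseteq> {..<m}"
    and v: "\<And>j. j < m \<Longrightarrow> \<bar>v j\<bar> \<le> Q ^ a * r powi i"
  shows "bad (\<lambda>G. \<not> bd 1 (3 + a) (1 + i) ((\<Sum>j\<in>A G \<inter> col G k. v j) - lam * (\<Sum>j\<in>A G. v j))) \<le> 2 * r\<^sup>2 * exp (- Q)"
proof -
  let ?w = "\<lambda>G j. of_bool (j \<in> A G) * v j"
  let ?om = "Q ^ a * r powi i"
  have om: "0 < ?om" using Qpos r_pos by simp
  have d: "dep K ?w" 
    unfolding dep_def
  proof (intro allI impI)
    fix G G' :: "(nat \<times> nat) set" assume "\<forall>i\<in>K. col G i = col G' i"
    then have "A G = A G'" using dep unfolding dep_def by blast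
    then show "?w G = ?w G'" by simp
  qed
  have "bad (\<lambda>G. \<not> bd 1 (3 + a) (1 + i) ((\<Sum>j\<in>A G \<inter> col G k. v j) - lam * (\<Sum>j\<in>A G. v j)))
    \<le> bad (\<lambda>G. Q ^ 3 * r * ?om < \<bar>colsum G k (?w G) - lam * (\<Sum>j<m. ?w G j)\<bar>)"
  proof (rule bad_mono)
    fix G assume G: "G \<in> \<Omega>" and b: "\<not> bd 1 (3 + a) (1 + i) ((\<Sum>j\<in>A G \<inter> col G k. v j) - lam * (\<Sum>j\<in>A G. v j))"
    have 1: "colsum G k (?w G) = (\<Sum>j\<in>A G \<inter> col G k. v j)"
      unfolding colsum_def
      using sum_subset_of_bool[OF \<Omega>_fin_col[OF G, of k], of "A G \<inter> col G k" v]
      by (auto intro!: sum.cong)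
    have 2: "(\<Sum>j<m. ?w G j) = (\<Sum>j\<in>A G. v j)"
      by (rule sum_subset_of_bool[OF finite_lessThan A[OF G], symmetric])
    have "Q ^ (3 + a) * r powi (1 + i) = Q ^ 3 * r * ?om" using r_pos by (simp add: power_add power_int_add)
    then show "Q ^ 3 * r * ?om < \<bar>colsum G k (?w G) - lam * (\<Sum>j<m. ?w G j)\<bar>"
      unfolding 1 2 using b by (simp add: bd_def not_le)
  qed
  also have "\<dots> \<le> 2 * r\<^sup>2 * exp (- Q)"
    by (rule concentration[OF k d K _ om]) (use v om in \<open>auto simp: abs_mult\<close>)
  finally show ?thesis .
qed

abbreviation sv :: "nat \<Rightarrow> real" where "sv j \<equiv> real (s j) - lam * real n"

text \<open>Pseudorandomness needed later: codegrees, the meeting of a free set with one or two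
  further columns, and the row deviations \<open>sv\<close> summed over a column or over the
  intersection of two. Each condition adds one new column k to a set of rows determined by other
  columns, so \<open>concentration_inter\<close> applies.\<close>

definition typical :: "(nat \<times> nat) set \<Rightarrow> bool" where
  "typical G \<longleftrightarrow> G \<in> \<Omega>
   \<and> (\<forall>k<n. \<forall>l<n. k \<noteq> l \<longrightarrow> bd 1 3 1 (real (card (col G l \<inter> col G k)) - lam * real (card (col G l))))
   \<and> (\<forall>k<n. \<forall>l<n. \<forall>l'<n. k \<notin> {l,l'} \<longrightarrow>
        bd 1 3 1 (real (card (free H G l l' \<inter> col G k)) - lam * real (card (free H G l l'))))
   \<and> (\<forall>k<n. \<forall>k'<n. \<forall>l<n. \<forall>l'<n. k \<notin> {k',l,l'} \<longrightarrow>
        bd 1 3 1 (real (card (free H G l l' \<inter> col G k' \<inter> col G k)) - lam * real (card (free H G l l' \<inter> col G k'))))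
   \<and> (\<forall>k<n. bd 1 4 2 (\<Sum>j\<in>col G k. sv j))
   \<and> (\<forall>k<n. \<forall>l<n. k \<noteq> l \<longrightarrow> bd 1 4 2 ((\<Sum>j\<in>col G l \<inter> col G k. sv j) - lam * (\<Sum>j\<in>col G l. sv j)))"

lemma typ_\<Omega>: "typical G \<Longrightarrow> G \<in> \<Omega>" by (simp add: typical_def)

lemmas typical_col = typical_def[THEN iffD1, THEN conjunct2, THEN conjunct1, rule_format]
lemmas typical_free = typical_def[THEN iffD1, THEN conjunct2, THEN conjunct2, THEN conjunct1, rule_format]
lemmas typical_free_col =
  typical_def[THEN iffD1, THEN conjunct2, THEN conjunct2, THEN conjunct2, THEN conjunct1, rule_format]
lemmas typical_sv =
  typical_def[THEN iffD1, THEN conjunct2, THEN conjunct2, THEN conjunct2, THEN conjunct2, THEN conjunct1, rule_format]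
lemmas typical_sv_inter =
  typical_def[THEN iffD1, THEN conjunct2, THEN conjunct2, THEN conjunct2, THEN conjunct2, THEN conjunct2, rule_format]

lemma bad_family:
  assumes "finite A" "real (card A) \<le> r ^ 8" "\<And>x. x \<in> A \<Longrightarrow> bad (P x) \<le> 2 * r\<^sup>2 * exp (- Q)"
  shows "bad (\<lambda>G. \<exists>x\<in>A. P x G) \<le> 2 * r ^ 10 * exp (- Q)"
proof -
  have "bad (\<lambda>G. \<exists>x\<in>A. P x G) \<le> (\<Sum>x\<in>A. bad (P x))" by (rule bad_Ex[OF assms(1)])
  also have "\<dots> \<le> (\<Sum>x\<in>A. 2 * r\<^sup>2 * exp (- Q))" using assms(3) by (rule sum_mono)
  also have "\<dots> = real (card A) * (2 * r\<^sup>2 * exp (- Q))" by simp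
  also have "\<dots> \<le> r ^ 8 * (2 * r\<^sup>2 * exp (- Q))" using assms(2) by (intro mult_right_mono) auto
  finally show ?thesis by (simp add: power_add[symmetric] mult_ac)
qed

text \<open>Five families of at most n^4 = r^8 events, each of probability at most 2 * r^2 * exp (-
  Q), have total probability at most r^11 * exp (- Q). The assumption \<open>tail\<close> allows 60
  powers of r, so 49 are left.\<close>

lemma bad_typ: "bad (\<lambda>G. \<not> typical G) \<le> r powi (- 49)"
proof -
  have rn: "real n ^ i = r ^ (2 * i)" for i by (simp add: r_sq(2)[symmetric] power_mult)
  have rp: "r ^ i \<le> r ^ 8" if "i \<le> 8" for i using that r_pos by (intro power_increasing) auto
  have sb: "\<bar>sv j\<bar> \<le> Q ^ 1 * r powi 1" if "j < m" for j using bd_s[OF that] by (simp add: bd_def)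
  define A1 where "A1 = {(k,l). k < n \<and> l < n \<and> k \<noteq> l}"
  define A2 where "A2 = {(k,l,l'). k < n \<and> l < n \<and> l' < n \<and> k \<notin> {l,l'}}"
  define A3 where "A3 = {(k,k',l,l'). k < n \<and> k' < n \<and> l < n \<and> l' < n \<and> k \<notin> {k',l,l'}}"
  have f1: "finite A1" "card A1 \<le> n ^ 2"
    using card_mono[of "{..<n} \<times> {..<n}" A1] finite_subset[of A1 "{..<n} \<times> {..<n}"]
    by (auto simp: A1_def card_cartesian_product power2_eq_square)
  have s2: "A2 \<subseteq> {..<n} \<times> {..<n} \<times> {..<n}" by (auto simp: A2_def)
  have f2: "finite A2" "card A2 \<le> n ^ 3"
    using card_mono[OF _ s2] finite_subset[OF s2]
    by (auto simp: card_cartesian_product power3_eq_cube)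
  have s3: "A3 \<subseteq> {..<n} \<times> {..<n} \<times> {..<n} \<times> {..<n}" by (auto simp: A3_def)
  have f3: "finite A3" "card A3 \<le> n ^ 4"
    using card_mono[OF _ s3] finite_subset[OF s3]
    by (auto simp: card_cartesian_product power4_eq_xxxx mult_ac)
  have c: "real c \<le> r ^ 8" if "c \<le> n ^ i" "i \<le> 4" for c i
  proof -
    have "real c \<le> real n ^ i" using that(1) by (metis of_nat_le_iff of_nat_power)
    then show ?thesis using rn[of i] rp[of "2 * i"] that(2) by simp
  qed
  let ?P1 = "\<lambda>(k,l) G. \<not> bd 1 3 1 (real (card (col G l \<inter> col G k)) - lam * real (card (col G l)))"
  let ?P2 = "\<lambda>(k,l,l') G. \<not> bd 1 3 1 (real (card (free H G l l' \<inter> col G k)) - lam * real (card (free H G l l')))"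
  let ?P3 = "\<lambda>(k,k',l,l') G. \<not> bd 1 3 1 (real (card (free H G l l' \<inter> col G k' \<inter> col G k)) - lam * real (card (free H G l l' \<inter> col G k')))"
  let ?P4 = "\<lambda>k G. \<not> bd 1 4 2 (\<Sum>j\<in>col G k. sv j)"
  let ?P5 = "\<lambda>(k,l) G. \<not> bd 1 4 2 ((\<Sum>j\<in>col G l \<inter> col G k. sv j) - lam * (\<Sum>j\<in>col G l. sv j))"
  have e1: "bad (\<lambda>G. \<exists>x\<in>A1. ?P1 x G) \<le> 2 * r ^ 10 * exp (- Q)"
  proof (rule bad_family[OF f1(1) c[OF f1(2)]])
    fix x assume x: "x \<in> A1"
    obtain k l where kl: "x = (k,l)" by (cases x)
    have "bad (\<lambda>G. \<not> bd 1 (3 + 0) (1 + 0) ((\<Sum>j\<in>col G l \<inter> col G k. 1) - lam * (\<Sum>j\<in>col G l. 1))) \<le> 2 * r\<^sup>2 * exp (- Q)"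
      by (rule concentration_inter[where K = "{l}"])
        (use x kl col_sub[OF \<Omega>_sub] in \<open>auto simp: A1_def dep_def\<close>)
    then show "bad (?P1 x) \<le> 2 * r\<^sup>2 * exp (- Q)" using kl by simp
  qed simp
  have e2: "bad (\<lambda>G. \<exists>x\<in>A2. ?P2 x G) \<le> 2 * r ^ 10 * exp (- Q)"
  proof (rule bad_family[OF f2(1) c[OF f2(2)]])
    fix x assume x: "x \<in> A2"
    obtain k l l' where kl: "x = (k,l,l')" by (cases x)
    have "bad (\<lambda>G. \<not> bd 1 (3 + 0) (1 + 0) ((\<Sum>j\<in>free H G l l' \<inter> col G k. 1) - lam * (\<Sum>j\<in>free H G l l'. 1))) \<le> 2 * r\<^sup>2 * exp (- Q)"
      by (rule concentration_inter[where K = "{l,l'}"])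
        (use x kl free_sub[OF \<Omega>_sub, of _ H l l'] card_insert_le_m1[of 2 "{l'}" l] in \<open>auto simp: A2_def dep_def free_col_eq\<close>)
    then show "bad (?P2 x) \<le> 2 * r\<^sup>2 * exp (- Q)" using kl by simp
  qed simp
  have e3: "bad (\<lambda>G. \<exists>x\<in>A3. ?P3 x G) \<le> 2 * r ^ 10 * exp (- Q)"
  proof (rule bad_family[OF f3(1) c[OF f3(2)]])
    fix x assume x: "x \<in> A3"
    obtain k k' l l' where kl: "x = (k,k',l,l')" by (cases x)
    have c3: "card {k',l,l'} \<le> 3"
      using card_insert_le_m1[of 3 "{l,l'}" k'] card_insert_le_m1[of 2 "{l'}" l] by simp
    have "bad (\<lambda>G. \<not> bd 1 (3 + 0) (1 + 0) ((\<Sum>j\<in>free H G l l' \<inter> col G k' \<inter> col G k. 1) - lam * (\<Sum>j\<in>free H G l l' \<inter> col G k'. 1))) \<le> 2 * r\<^sup>2 * exp (- Q)"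
      by (rule concentration_inter[where K = "{k',l,l'}"])
        (use x kl c3 free_sub[OF \<Omega>_sub, of _ H l l'] in \<open>auto simp: A3_def dep_def free_col_eq\<close>)
    then show "bad (?P3 x) \<le> 2 * r\<^sup>2 * exp (- Q)" using kl by simp
  qed simp
  have e4: "bad (\<lambda>G. \<exists>x\<in>{..<n}. ?P4 x G) \<le> 2 * r ^ 10 * exp (- Q)"
  proof (rule bad_family[OF _ c[of _ 1]])
    fix k assume k: "k \<in> {..<n}"
    have z: "(\<Sum>j<m. sv j) = 0" using sum_s by (simp add: sum_subtractf mult_ac)
    have "bad (\<lambda>G. \<not> bd 1 (3 + 1) (1 + 1) ((\<Sum>j\<in>{..<m} \<inter> col G k. sv j) - lam * (\<Sum>j\<in>{..<m}. sv j))) \<le> 2 * r\<^sup>2 * exp (- Q)"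
      by (rule concentration_inter[where K = "{}"]) (use k sb in \<open>auto simp: dep_def\<close>)
    moreover have "bad (?P4 k) \<le> bad (\<lambda>G. \<not> bd 1 (3 + 1) (1 + 1) ((\<Sum>j\<in>{..<m} \<inter> col G k. sv j) - lam * (\<Sum>j\<in>{..<m}. sv j)))"
    proof (rule bad_mono)
      fix G assume "G \<in> \<Omega>" "\<not> bd 1 4 2 (\<Sum>j\<in>col G k. sv j)"
      moreover have "{..<m} \<inter> col G k = col G k" using col_sub[OF \<Omega>_sub[OF \<open>G \<in> \<Omega>\<close>], of k] by auto
      ultimately show "\<not> bd 1 (3 + 1) (1 + 1) ((\<Sum>j\<in>{..<m} \<inter> col G k. sv j) - lam * (\<Sum>j\<in>{..<m}. sv j))"
        unfolding z by simp
    qed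
    ultimately show "bad (?P4 k) \<le> 2 * r\<^sup>2 * exp (- Q)" by linarith
  qed auto
  have e5: "bad (\<lambda>G. \<exists>x\<in>A1. ?P5 x G) \<le> 2 * r ^ 10 * exp (- Q)"
  proof (rule bad_family[OF f1(1) c[OF f1(2)]])
    fix x assume x: "x \<in> A1"
    obtain k l where kl: "x = (k,l)" by (cases x)
    have "bad (\<lambda>G. \<not> bd 1 (3 + 1) (1 + 1) ((\<Sum>j\<in>col G l \<inter> col G k. sv j) - lam * (\<Sum>j\<in>col G l. sv j))) \<le> 2 * r\<^sup>2 * exp (- Q)"
      by (rule concentration_inter[where K = "{l}"])
        (use x kl col_sub[OF \<Omega>_sub] sb in \<open>auto simp: A1_def dep_def\<close>)
    then show "bad (?P5 x) \<le> 2 * r\<^sup>2 * exp (- Q)" using kl by simp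
  qed simp
  have "bad (\<lambda>G. \<not> typical G) \<le> bad (\<lambda>G. (\<exists>x\<in>A1. ?P1 x G) \<or> (\<exists>x\<in>A2. ?P2 x G) \<or> (\<exists>x\<in>A3. ?P3 x G) \<or> (\<exists>x\<in>{..<n}. ?P4 x G) \<or> (\<exists>x\<in>A1. ?P5 x G))"
  proof (rule bad_mono, rule ccontr)
    fix G assume "G \<in> \<Omega>" "\<not> typical G"
      and *: "\<not> ((\<exists>x\<in>A1. ?P1 x G) \<or> (\<exists>x\<in>A2. ?P2 x G) \<or> (\<exists>x\<in>A3. ?P3 x G) \<or> (\<exists>x\<in>{..<n}. ?P4 x G) \<or> (\<exists>x\<in>A1. ?P5 x G))"
    have "typical G" unfolding typical_def
    proof (intro conjI allI impI)
      show "G \<in> \<Omega>" by fact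
      fix k assume k: "k < n"
      show "bd 1 4 2 (\<Sum>j\<in>col G k. sv j)" using * k by blast
      fix l assume l: "l < n"
      {
        assume "k \<noteq> l"
        then have x: "(k,l) \<in> A1" using k l by (simp add: A1_def)
        show "bd 1 3 1 (real (card (col G l \<inter> col G k)) - lam * real (card (col G l)))" using * x by blast
        show "bd 1 4 2 ((\<Sum>j\<in>col G l \<inter> col G k. sv j) - lam * (\<Sum>j\<in>col G l. sv j))" using * x by blast
      next
        fix l' assume "l' < n" "k \<notin> {l,l'}"
        then have x: "(k,l,l') \<in> A2" using k l by (simp add: A2_def)
        show "bd 1 3 1 (real (card (free H G l l' \<inter> col G k)) - lam * real (card (free H G l l')))" using * x by blast
      next
        fix p q assume "p < n" "q < n" "k \<notin> {l,p,q}"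
        then have x: "(k,l,p,q) \<in> A3" using k l by (simp add: A3_def)
        show "bd 1 3 1 (real (card (free H G p q \<inter> col G l \<inter> col G k)) - lam * real (card (free H G p q \<inter> col G l)))" using * x by blast
      }
    qed
    then show False using \<open>\<not> typical G\<close> by simp
  qed
  also have "\<dots> \<le> 5 * (2 * r ^ 10 * exp (- Q))"
    by (rule order_trans[OF bad_disj], rule order_trans[OF add_mono[OF e1 order_trans[OF bad_disj
        add_mono[OF e2 order_trans[OF bad_disj add_mono[OF e3 order_trans[OF bad_disj add_mono[OF e4 e5]]]]]]]]) simp
  also have "\<dots> \<le> r ^ 11 * exp (- Q)"
  proof -
    have "10 \<le> r" using r_ge power_increasing[of 1 100 Q] Q16 by simp
    then have "10 * (r ^ 10 * exp (- Q)) \<le> r * (r ^ 10 * exp (- Q))" using r_pos by (intro mult_right_mono) auto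
    then show ?thesis by (simp add: mult_ac power_Suc[symmetric] del: power_Suc)
  qed
  also have "\<dots> = (exp (- Q) * r ^ 60) * r powi (- 49)"
  proof -
    have "r ^ 11 = r ^ 60 * r powi (- 49)"
      using r_pos power_int_add[of r 60 "- 49"] by (simp add: power_int_numeral[symmetric] del: power_int_numeral)
    then show ?thesis by simp
  qed
  also have "\<dots> \<le> 1 * r powi (- 49)"
    using tail r_pos by (intro mult_right_mono) (auto simp: r_def)
  finally show ?thesis by simp
qed

text \<open>Atypical graphs contribute at most Q^100 * r^25 * r^-49 <= r^-23, below every precision
  r^i with i >= -20. A crude bound on all of \<Omega> therefore suffices next to a sharp one on
  typical graphs.\<close>

lemma bd_EE_typ:
  assumes "\<And>G. typical G \<Longrightarrow> bd g a i (f G)" and "\<And>G. G \<in> \<Omega> \<Longrightarrow> bd 1 b j (f G)"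
    and "1 \<le> g" "b \<le> 100" "j \<le> 25" "-20 \<le> i"
  shows "bd g (Suc a) i (EE f)"
proof -
  let ?B = "Q ^ a * r powi i * g" and ?C = "Q ^ b * r powi j"
  have "\<bar>EE f\<bar> \<le> EE (\<lambda>G. \<bar>f G\<bar>)" by (rule EE_abs)
  also have "\<dots> \<le> EE (\<lambda>G. ?B + ?C * of_bool (\<not> typical G))"
  proof (rule EE_mono)
    fix G assume G: "G \<in> \<Omega>"
    have "0 \<le> ?B" "0 \<le> ?C" using Qpos r_pos assms(3) by auto
    then show "\<bar>f G\<bar> \<le> ?B + ?C * of_bool (\<not> typical G)"
      using assms(1)[of G] assms(2)[OF G] by (cases "typical G") (auto simp: bd_def)
  qed
  also have "\<dots> = ?B + ?C * bad (\<lambda>G. \<not> typical G)" by (simp add: EE_add EE_cmult EE_const bad_def)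
  also have "?C * bad (\<lambda>G. \<not> typical G) \<le> ?C * r powi (- 49)"
    using bad_typ Qpos r_pos by (intro mult_left_mono) auto
  also have "?C * r powi (- 49) \<le> (r * r powi 25) * r powi (- 49)"
  proof (intro mult_right_mono mult_mono)
    show "Q ^ b \<le> r" using power_increasing[OF assms(4) Qpos(2)] r_ge by linarith
    show "r powi j \<le> r powi 25" using assms(5) r_pos by (intro power_int_increasing) auto
  qed (use r_pos in auto)
  also have "(r * r powi 25) * r powi (- 49) = r powi (- 23)"
    using r_pos power_int_add[of r 1 25] power_int_add[of r 26 "- 49"] by simp
  also have "\<dots> \<le> 1 * r powi i * 1" using assms(6) r_pos by (auto intro!: power_int_increasing)
  also have "\<dots> \<le> ?B" using assms(3) Qpos r_pos one_le_power[OF Qpos(2)] by (intro mult_mono) auto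
  finally have "\<bar>EE f\<bar> \<le> 2 * ?B" by (simp only: mult_2)
  also have "\<dots> \<le> Q * ?B" using Qpos r_pos assms(3) by (intro mult_right_mono) auto
  finally show ?thesis by (simp add: bd_def mult_ac)
qed

lemma bad_typ_half: "\<exists>G\<in>\<Omega>. typical G"
proof (rule ccontr)
  assume "\<not> ?thesis"
  then have "bad (\<lambda>G. \<not> typical G) = EE (\<lambda>G. 1)" unfolding bad_def by (intro EE_cong) auto
  then have "bad (\<lambda>G. \<not> typical G) = 1" by (simp add: EE_const)
  moreover have "r powi (- 49) < 1"
  proof -
    have "1 < r" using r_ge power_increasing[of 1 100 Q] Q16 by simp
    then show ?thesis using power_int_strict_increasing[of "- 49" 0 r] by simp
  qed
  ultimately show False using bad_typ by simp
qed

section \<open>Sizes of free sets and centred codegrees in typical graphs\<close>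

lemma sum_free:
  assumes G: "G \<in> \<Omega>" and kl: "k \<noteq> l"
  shows "(\<Sum>j\<in>free H G k l. w j) = (\<Sum>j\<in>col G k. w j) + (\<Sum>j\<in>col G l. w j) - 2 * (\<Sum>j\<in>col G l \<inter> col G k. w j)
    - (\<Sum>j\<in>col G k \<inter> col H l. w j) - (\<Sum>j\<in>col G l \<inter> col H k. (w j :: real))"
  using sum_free_split[OF G[unfolded \<Omega>_def], where k=k and l=l and w=w]
    sum_col_split[OF G[unfolded \<Omega>_def] kl, where w=w]
    sum_col_split[OF G[unfolded \<Omega>_def] kl[symmetric], where w=w]
  unfolding free_commute[of H G l k] Int_commute[of "col G k" "col G l"] by linarith

text \<open>The approximate size of a free set: independent entries of density \<open>lam\<close>
  differ with probability 2 * lam * (1 - lam), and the few rows blocked by H are of lower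
  order.\<close>

definition dd :: real where "dd = 2 * lam * (1 - lam) * real m"

lemma lo_dd: "lo 3 2 dd"
proof -
  have "lo (1 + 1 + 1) (0 + 0 + 2) (lam * (1 - lam) * real m)"
    by (intro lo_mult lo_lam lo_lam1 lo_m)
  then show ?thesis by (rule lo_weak) (use lam01 in \<open>auto simp: dd_def\<close>)
qed

lemma bd_card: "A \<subseteq> {..<m} \<Longrightarrow> bd 1 1 2 (real (card A))"
  by (rule bd_le[OF _ bd_m]) (use card_mono[of "{..<m}" A] in auto)

lemma bd_free: "G \<in> \<Omega> \<Longrightarrow> bd 1 1 2 (real (card (free H G k l)))"
  by (rule bd_card[OF free_sub[OF \<Omega>_sub]])

lemma bd_tk: "k < n \<Longrightarrow> bd 1 1 2 (real (t k))"
proof -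
  assume k: "k < n"
  obtain G where G: "G \<in> \<Omega>" using \<Omega>_ne by auto
  show ?thesis using bd_card[OF col_sub[OF \<Omega>_sub[OF G]], of k] \<Omega>_col[OF G k] by simp
qed

lemma tk_le: "k < n \<Longrightarrow> real (t k) \<le> real m"
proof -
  assume k: "k < n"
  obtain G where G: "G \<in> \<Omega>" using \<Omega>_ne by auto
  show ?thesis using card_colG_le[OF G, of k] \<Omega>_col[OF G k] by simp
qed

lemma bd_gk: "l < n \<Longrightarrow> bd 1 1 1 (real (card (col G k \<inter> col H l)))"
  by (rule bd_le[OF _ bd_y]) (use gk_le[of G k l] y_nonneg[of l] in auto)

lemma typ_codeg:
  assumes G: "typical G" and kl: "k \<noteq> l" "k < n" "l < n"
  shows "bd 1 4 1 (real (card (col G l \<inter> col G k)) - lam * lam * real m)"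
    and "bd 1 4 1 (real (card (col G l \<inter> col G k)) - real (t k) * real (t l) / real m)"
proof -
  have c: "card (col G l) = t l" using \<Omega>_col[OF typ_\<Omega>[OF G] kl(3)] .
  have 1: "bd 1 3 1 (real (card (col G l \<inter> col G k)) - lam * real (t l))"
    using typical_col[OF G kl(2,3,1)] c by simp
  have 2: "bd 1 1 1 (lam * (real (t l) - lam * real m))" using bd_mult[OF bd_lam bd_t[OF kl(3)]] by simp
  show "bd 1 4 1 (real (card (col G l \<inter> col G k)) - lam * lam * real m)"
    using bd_add[OF 1 2] by (simp add: algebra_simps numeral_eq_Suc)
  have 3: "bd 1 3 1 ((real (t k) / real m - lam) * real (t l))"
    using bd_mult[OF bd_t_div[OF kl(2)] bd_tk[OF kl(3)]] by simp
  show "bd 1 4 1 (real (card (col G l \<inter> col G k)) - real (t k) * real (t l) / real m)"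
    using bd_diff[OF 1 3] by (simp add: algebra_simps numeral_eq_Suc)
qed

text \<open>Inclusion and exclusion: two columns of size about lam * m with codegree about lam^2 * m
  differ in about 2 * lam * m - 2 * lam^2 * m rows.\<close>

lemma typ_D:
  assumes G: "typical G" and kl: "k \<noteq> l" "k < n" "l < n"
  shows "bd 1 8 1 (real (card (free H G k l)) - dd)" and "lo 4 2 (real (card (free H G k l)))"
proof -
  note G' = typ_\<Omega>[OF G]
  have D: "real (card (free H G k l)) - dd = (real (t k) - lam * real m) + (real (t l) - lam * real m)
    - 2 * (real (card (col G l \<inter> col G k)) - lam * lam * real m)
    - real (card (col G k \<inter> col H l)) - real (card (col G l \<inter> col H k))"
    using sum_free[OF G' kl(1), where w = "\<lambda>_. 1"] \<Omega>_col[OF G' kl(2)] \<Omega>_col[OF G' kl(3)]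
    by (simp add: dd_def algebra_simps)
  show *: "bd 1 8 1 (real (card (free H G k l)) - dd)"
    unfolding D
    by (rule bd_weak[OF bd_diff[OF bd_diff[OF bd_diff[OF bd_add[OF bd_t[OF kl(2)] bd_t[OF kl(3)]]
        bd_mult[OF bd_const typ_codeg(1)[OF G kl], simplified]] bd_gk[OF kl(3)]] bd_gk[OF kl(2)]]]) auto
  show "lo 4 2 (real (card (free H G k l)))"
    using lo_approx[OF lo_dd *] by (simp add: numeral_eq_Suc)
qed

lemma bd_bal: "G \<in> \<Omega> \<Longrightarrow> k \<noteq> l \<Longrightarrow> k < n \<Longrightarrow> l < n \<Longrightarrow> bd 1 2 1 (bal H G k l)"
proof -
  assume a: "G \<in> \<Omega>" "k \<noteq> l" "k < n" "l < n"
  have "4 * Q * r \<le> Q * Q * r" using Q16 r_pos by (intro mult_right_mono) auto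
  then show ?thesis using bal_bound[OF a] by (simp add: bd_def power2_eq_square)
qed

lemma typ_bal:
  assumes "typical G" "k \<noteq> l" "k < n" "l < n"
  shows "bd 1 6 (-1) (bal H G k l / real (card (free H G k l)))"
  using bd_div[OF bd_bal[OF typ_\<Omega>[OF assms(1)] assms(2-4)] typ_D(2)[OF assms]] by simp

lemma bal_ratio_le: "G \<in> \<Omega> \<Longrightarrow> \<bar>bal H G k l / real (card (free H G k l))\<bar> \<le> 1"
  using card_free_split[of G m n s t H k l] unfolding \<Omega>_def bal_def
  by (cases "card (free H G k l) = 0") (auto simp: divide_simps)

text \<open>Column sums of this weight are centred codegrees.\<close>

definition cw :: "nat \<Rightarrow> (nat \<times> nat) set \<Rightarrow> nat \<Rightarrow> real"
  where "cw l G j = of_bool (j \<in> col G l) - real (t l) / real m"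

lemma dep_cw: "dep {l} (cw l)" by (simp add: dep_def cw_def fun_eq_iff)

lemma cw_le: "l < n \<Longrightarrow> \<bar>cw l G j\<bar> \<le> 1"
  using tk_le[of l] m_pos by (auto simp: cw_def divide_simps)

lemma sum_cw: "finite A \<Longrightarrow> (\<Sum>j\<in>A. cw l G j) = real (card (A \<inter> col G l)) - real (card A) * (real (t l) / real m)"
  by (simp add: cw_def sum_subtractf)

lemma colsum_cw: "G \<in> \<Omega> \<Longrightarrow> k < n \<Longrightarrow> colsum G k (cw l G) = real (card (col G l \<inter> col G k)) - real (t k) * real (t l) / real m"
  unfolding colsum_def by (subst sum_cw) (auto simp: \<Omega>_fin_col \<Omega>_col Int_commute)

lemma typ_Z: "typical G \<Longrightarrow> k \<noteq> l \<Longrightarrow> k < n \<Longrightarrow> l < n \<Longrightarrow> bd 1 4 1 (colsum G k (cw l G))"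
  using typ_codeg(2)[of G k l] by (simp add: colsum_cw typ_\<Omega>)

lemma bd_Z: "G \<in> \<Omega> \<Longrightarrow> l < n \<Longrightarrow> bd 1 1 2 (colsum G k (cw l G))"
  unfolding colsum_def
  using bd_sum[of "col G k" 1 0 0 "cw l G" 1 2] bd_card[OF col_sub[OF \<Omega>_sub]] bd_one[OF cw_le] by simp

lemma typ_U:
  assumes G: "typical G" and kl: "k < n" "l < n" "l' < n" "k \<notin> {l,l'}"
  shows "bd 1 4 1 (\<Sum>j\<in>free H G l l'. cw k G j)"
proof -
  note G' = typ_\<Omega>[OF G]
  have 1: "bd 1 3 1 (real (card (free H G l l' \<inter> col G k)) - lam * real (card (free H G l l')))"
    by (rule typical_free[OF G kl])
  have 2: "bd 1 3 1 (real (card (free H G l l')) * (real (t k) / real m - lam))"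
    using bd_mult[OF bd_free[OF G'] bd_t_div[OF kl(1)]] by (simp add: numeral_eq_Suc)
  show ?thesis unfolding sum_cw[OF \<Omega>_fin_free[OF G']]
    using bd_diff[OF 1 2] by (simp add: algebra_simps numeral_eq_Suc)
qed

lemma typ_FS:
  assumes G: "typical G" and kl: "k \<noteq> l" "k < n" "l < n"
  shows "bd 1 9 2 (\<Sum>j\<in>free H G k l. sv j)"
proof -
  note G' = typ_\<Omega>[OF G]
  have a: "bd 1 4 2 (\<Sum>j\<in>col G k. sv j)" "bd 1 4 2 (\<Sum>j\<in>col G l. sv j)" using typical_sv[OF G] kl by auto
  have "bd 1 4 2 ((\<Sum>j\<in>col G l \<inter> col G k. sv j) - lam * (\<Sum>j\<in>col G l. sv j))" by (rule typical_sv_inter[OF G kl(2,3,1)])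
  from bd_add[OF this bd_mult[OF bd_lam a(2), simplified]]
  have b: "bd 1 5 2 (\<Sum>j\<in>col G l \<inter> col G k. sv j)" by (simp add: numeral_eq_Suc)
  have c: "bd 1 2 2 (\<Sum>j\<in>col G i \<inter> col H i'. sv j)" if "i' < n" for i i'
    using bd_sum[OF _ bd_gk[OF that, of G i], of 1 1 1 sv] bd_s col_sub[OF \<Omega>_sub[OF G'], of i]
    by (auto simp: numeral_2_eq_2)
  show ?thesis unfolding sum_free[OF G' kl(1)]
    by (rule bd_weak[OF bd_diff[OF bd_diff[OF bd_diff[OF bd_add[OF a]
        bd_mult[OF bd_const b, simplified]] c[OF kl(3)]] c[OF kl(2)]]]) auto
qed

text \<open>Free sets of disjoint pairs of columns are nearly independent. Splitting F' into its two
  columns and intersecting with F gives card (F \<inter> F') close to 2 * lam * (1 - lam) * card F,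
  and card F' is close to 2 * lam * (1 - lam) * m, so the quotient is 1 / m up to a relative error
  of order r^-1.\<close>

lemma typ_FF:
  assumes G: "typical G" and kl: "k < n" "k' < n" "l < n" "l' < n" "k \<noteq> k'" "l \<noteq> l'" "{k,k'} \<inter> {l,l'} = {}"
  defines "F \<equiv> free H G l l'" and "F' \<equiv> free H G k k'"
  shows "bd 1 17 (-3) (real (card (F \<inter> F')) / (real (card F) * real (card F')) - 1 / real m)"
proof -
  note G' = typ_\<Omega>[OF G]
  let ?w = "\<lambda>j. of_bool (j \<in> F) :: real"
  have fin: "finite F" "finite F'" unfolding F_def F'_def by (simp_all add: \<Omega>_fin_free G')
  have cs: "(\<Sum>j\<in>A. ?w j) = real (card (F \<inter> A))" if "finite A" for A using that by (simp add: Int_commute)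
  have fc: "finite (col G i)" for i by (rule \<Omega>_fin_col[OF G'])
  have e: "real (card (F \<inter> F')) = real (card (F \<inter> col G k)) + real (card (F \<inter> col G k'))
     - 2 * real (card (F \<inter> col G k' \<inter> col G k)) - real (card (F \<inter> (col G k \<inter> col H k'))) - real (card (F \<inter> (col G k' \<inter> col H k)))"
    using sum_free[OF G' kl(5), where w = ?w] fc fin unfolding F'_def[symmetric]
    by (simp add: cs Int_assoc del: sum_of_bool_eq)
  have 1: "bd 1 3 1 (real (card (F \<inter> col G i)) - lam * real (card F))" if "i \<in> {k,k'}" for i
  proof -
    have "i < n" "i \<notin> {l,l'}" using kl that by auto
    then show ?thesis using typical_free[OF G _ kl(3,4)] unfolding F_def by simp
  qed
  have "k \<notin> {k',l,l'}" using kl by auto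
  then have 2: "bd 1 3 1 (real (card (F \<inter> col G k' \<inter> col G k)) - lam * real (card (F \<inter> col G k')))"
    unfolding F_def by (rule typical_free_col[OF G kl(1-4)])
  have 3: "bd 1 1 1 (real (card (F \<inter> (col G i \<inter> col H i'))))" if "i' < n" for i i'
  proof (rule bd_le[OF _ bd_gk[OF that]])
    show "\<bar>real (card (F \<inter> (col G i \<inter> col H i')))\<bar> \<le> \<bar>real (card (col G i \<inter> col H i'))\<bar>"
      using card_mono[OF finite_Int[OF disjI1[OF fc]] Int_lower2] by simp
  qed
  have 4: "bd 1 4 1 (2 * lam * (real (card (F \<inter> col G k')) - lam * real (card F)))"
    using bd_mult[OF bd_mult[OF bd_const[of 2] bd_lam] 1[of k']] by simp
  have 5: "bd 1 8 1 (real (card (F \<inter> F')) - 2 * lam * (1 - lam) * real (card F))"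
  proof -
    have "real (card (F \<inter> F')) - 2 * lam * (1 - lam) * real (card F)
      = (real (card (F \<inter> col G k)) - lam * real (card F)) + (real (card (F \<inter> col G k')) - lam * real (card F))
        - 2 * (real (card (F \<inter> col G k' \<inter> col G k)) - lam * real (card (F \<inter> col G k')))
        - 2 * lam * (real (card (F \<inter> col G k')) - lam * real (card F))
        - real (card (F \<inter> (col G k \<inter> col H k'))) - real (card (F \<inter> (col G k' \<inter> col H k)))"
      unfolding e by (simp add: algebra_simps)
    also have "bd 1 8 1 \<dots>"
      by (rule bd_weak[OF bd_diff[OF bd_diff[OF bd_diff[OF bd_diff[OF bd_add[OF 1 1]
         bd_mult[OF bd_const 2, simplified]] 4] 3[OF kl(2)]] 3[OF kl(1)]]]) auto
    finally show ?thesis .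
  qed
  have D: "lo 4 2 (real (card F))" "lo 4 2 (real (card F'))" "bd 1 8 1 (real (card F') - dd)"
    unfolding F_def F'_def using typ_D[OF G] kl by auto
  have D0: "real (card F) \<noteq> 0" "real (card F') \<noteq> 0" "real m \<noteq> 0" using lo_pos[OF D(1)] lo_pos[OF D(2)] m_pos by auto
  have "real (card (F \<inter> F')) / (real (card F) * real (card F')) - 1 / real m
     = (real (card (F \<inter> F')) - 2 * lam * (1 - lam) * real (card F)) / (real (card F) * real (card F'))
       + (dd - real (card F')) / (real (card F') * real m)"
  proof -
    have h1: "(a - c * D) / (D * D') = a / (D * D') - c / D'" if "D \<noteq> 0" for a c D D' :: real
      using that by (simp add: diff_divide_distrib)
    have h2: "(c * M - D') / (D' * M) = c / D' - 1 / M" if "D' \<noteq> 0" "M \<noteq> 0" for c M D' :: real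
      using that by (simp add: diff_divide_distrib)
    show ?thesis unfolding dd_def h1[OF D0(1)] h2[OF D0(2,3)] by simp
  qed
  also have "bd 1 17 (-3) \<dots>"
    by (rule bd_weak[OF bd_add[OF bd_div[OF 5 lo_mult[OF D(1,2)], simplified]
       bd_div[OF bd_swap[OF D(3)] lo_mult[OF D(2) lo_m], simplified]]]) auto
  finally show ?thesis .
qed

end

section \<open>Edge probabilities\<close>

context dense
begin

lemma bd_sum_weighted2:
  assumes "\<And>x. x \<in> A \<Longrightarrow> bd (h * g x) a i (f x)" "bd 1 b j (\<Sum>x\<in>A. g x)" "0 \<le> h"
  shows "bd h (a + b) (i + j) (\<Sum>x\<in>A. f x)"
proof -
  have "\<bar>\<Sum>x\<in>A. f x\<bar> \<le> (\<Sum>x\<in>A. Q ^ a * r powi i * (h * g x))"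
    using assms(1) by (intro order_trans[OF sum_abs] sum_mono) (auto simp: bd_def)
  also have "\<dots> = (Q ^ a * r powi i * h) * (\<Sum>x\<in>A. g x)" by (simp only: sum_distrib_left mult.assoc)
  also have "\<dots> \<le> (Q ^ a * r powi i * h) * (Q ^ b * r powi j)"
    using assms(2,3) Qpos r_pos by (intro mult_left_mono) (auto simp: bd_def)
  finally show ?thesis using r_pos by (simp add: bd_def power_add power_int_add mult_ac)
qed

lemma bd_divn: "bd g a i (real n * x) \<Longrightarrow> bd g a (i - 2) x"
  using bd_div[OF _ lo_n, of g a i "real n * x"] n_pos by simp

lemma card_colH_row: "j < m \<Longrightarrow> real (card {l \<in> {..<n}. j \<in> col H l}) = real (degU H j)"
proof -
  have "{l \<in> {..<n}. j \<in> col H l} = {l. (j,l) \<in> H}" using Hsub by (auto simp: col_def)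
  then show ?thesis by (simp add: degU_def)
qed

lemma one_le_1y: "1 \<le> 1 + y k" using y_nonneg[of k] by simp

lemma y_prod_le: "1 + y k + y l \<le> (1 + y k) * (1 + y l)"
  using y_nonneg[of k] y_nonneg[of l] by (simp add: algebra_simps)

end

context colwin
begin

text \<open>\<open>mean_exchange\<close> with X constantly 1, for which the covariance
  vanishes.\<close>

lemma EE_exchange:
  assumes kl: "k \<noteq> l" "k < n" "l < n" and dep: "dep K w" "k \<notin> K" "l \<notin> K"
  shows "EE (\<lambda>G. colsum G k (w G)) - EE (\<lambda>G. colsum G l (w G)) = EE (\<lambda>G. drift H G k l (w G))"
proof -
  have "EE (\<lambda>G. 1 * (colsum G k (w G) - colsum G l (w G)))
      = EE (\<lambda>G. 1 * drift H G k l (w G) + fcov H G k l ((\<lambda>_ _. 0) G) (w G))"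
    unfolding EE_def \<Omega>_def
    by (rule mean_exchange[OF kl, where ?x0.0 = "\<lambda>_. 1"]) (auto simp: dep_put[OF dep])
  then show ?thesis by (simp add: EE_diff fcov_def)
qed

lemma sum_single: "j < m \<Longrightarrow> (\<Sum>i<m. c * of_bool (i = j) * f i) = c * (f j :: real)"
  by (subst sum.remove[of _ j]) (auto intro!: sum.neutral)

lemma colsum_single: "G \<in> \<Omega> \<Longrightarrow> colsum G k (\<lambda>i. c * of_bool (i = j)) = c * of_bool (j \<in> col G k)"
  unfolding colsum_def using \<Omega>_fin_col[of G k] by (simp add: sum_distrib_left[symmetric] of_bool_def)

lemma drift_single:
  assumes "G \<in> \<Omega>" "j \<notin> col H k" "j \<notin> col H l"
  shows "drift H G k l (\<lambda>i. c * of_bool (i = j)) = bal H G k l / real (card (free H G k l)) * (c * of_bool (j \<in> free H G k l))"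
proof -
  have z: "(\<Sum>i\<in>col G a \<inter> col H b. c * of_bool (i = j)) = 0" if "j \<notin> col H b" for a b
    by (rule sum.neutral) (use that in auto)
  show ?thesis using \<Omega>_fin_free[OF assms(1), of k l]
    unfolding drift_def bnd_def z[OF assms(3)] z[OF assms(2)]
    by (simp add: sum_distrib_left[symmetric] of_bool_def)
qed

lemmas colsum_single1 = colsum_single[where c = 1, unfolded mult_1]
lemmas drift_single1 = drift_single[where c = 1, unfolded mult_1]

lemma dep_single: "dep K X \<Longrightarrow> dep K (\<lambda>G i. X G * of_bool (i = (j::nat)))"
  unfolding dep_def by metis

text \<open>The indicator of row j, multiplied by X, is a weight on which exchanges act by the
  balance ratio, typically of order r^-1. Comparing column k with the other columns and using that
  row j has exactly \<open>s j\<close> entries gives the value. A general X yields joint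
  probabilities from single ones.\<close>

lemma corr_one:
  assumes X: "dep K X" "\<And>G. G \<in> \<Omega> \<Longrightarrow> \<bar>X G\<bar> \<le> 1" and K: "finite K" "card K \<le> 2" "k \<notin> K"
    and k: "k < n" and j: "j < m" "j \<notin> col H k"
  shows "bd 1 9 (-1) (EE (\<lambda>G. X G * of_bool (j \<in> col G k)) - lam * EE X)"
proof -
  define f where "f l = EE (\<lambda>G. X G * of_bool (j \<in> col G l))" for l
  let ?w = "\<lambda>G i. X G * of_bool (i = j)"
  \<comment> \<open>The columns to which the exchange estimate does not apply. There are at most 3 +
    \<open>degU H j\<close> of them, hence order r, and after division by n they cost only
    r^-1.\<close>
  define L where "L = {l \<in> {..<n}. l \<in> K \<or> l = k \<or> j \<in> col H l}"
  have f1: "bd 1 0 0 (f l)" for l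
    unfolding f_def by (rule bd_EE, rule bd_one) (use X in auto)
  have good: "bd 1 7 (-1) (f k - f l)" if l: "l \<in> {..<n} - L" for l
  proof -
    have kl: "k \<noteq> l" "l < n" "l \<notin> K" "j \<notin> col H l" using l by (auto simp: L_def)
    have "f k - f l = EE (\<lambda>G. colsum G k (?w G)) - EE (\<lambda>G. colsum G l (?w G))"
      unfolding f_def by (intro arg_cong2[where f = "(-)"] EE_cong) (simp_all add: colsum_single)
    also have "\<dots> = EE (\<lambda>G. drift H G k l (?w G))"
      by (rule EE_exchange[OF kl(1) k kl(2) dep_single[OF X(1)] K(3) kl(3)])
    also have "\<dots> = EE (\<lambda>G. bal H G k l / real (card (free H G k l)) * (X G * of_bool (j \<in> free H G k l)))"
      by (rule EE_cong) (simp add: drift_single j kl)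
    also have "bd 1 (Suc 6) (-1) \<dots>"
    proof (rule bd_EE_typ[where b = 0 and j = 0])
      fix G
      {
        assume G: "typical G"
        have "bd 1 0 0 (X G * of_bool (j \<in> free H G k l))" using X(2)[OF typ_\<Omega>[OF G]] by (intro bd_one) auto
        from bd_mult[OF typ_bal[OF G kl(1) k kl(2)] this]
        show "bd 1 6 (-1) (bal H G k l / real (card (free H G k l)) * (X G * of_bool (j \<in> free H G k l)))" by simp
      next
        assume G: "G \<in> \<Omega>"
        have "bd 1 0 0 (X G * of_bool (j \<in> free H G k l))" using X(2)[OF G] by (intro bd_one) auto
        from bd_mult[OF bd_one[OF bal_ratio_le[OF G]] this]
        show "bd 1 0 0 (bal H G k l / real (card (free H G k l)) * (X G * of_bool (j \<in> free H G k l)))" by simp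
      }
    qed auto
    finally show ?thesis by (simp add: numeral_eq_Suc)
  qed
  have cL: "bd 1 2 1 (real (card L))"
  proof -
    have "L \<subseteq> insert k K \<union> {l \<in> {..<n}. j \<in> col H l}" by (auto simp: L_def)
    then have "card L \<le> card (insert k K) + card {l \<in> {..<n}. j \<in> col H l}"
      using K(1) by (intro order_trans[OF card_mono card_Un_le]) auto
    moreover have "card (insert k K) \<le> 3" using K by simp
    ultimately have "real (card L) \<le> 3 + real (degU H j)" using card_colH_row[OF j(1)] by linarith
    then show ?thesis
      using bd_add[OF bd_weak[OF bd_const[of 3], of 1 1 1] bd_x[OF j(1)]] by (intro bd_le[of "real (card L)"]) (auto simp: numeral_2_eq_2)
  qed
  have "bd 1 4 1 (\<Sum>l\<in>L. f k - f l)"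
    using bd_sum[OF bd_weak[OF bd_diff[OF f1 f1], of 1 2 0] cL] by simp
  moreover have "bd 1 7 1 (\<Sum>l\<in>{..<n} - L. f k - f l)"
    using bd_sum[of "{..<n} - L" 1 7 "-1" "\<lambda>l. f k - f l" 0 2] good bd_le[OF _ bd_n, of "real (card ({..<n} - L))"]
      card_mono[of "{..<n}" "{..<n} - L"] by (auto simp del: card_Diff_insert)
  ultimately have "bd 1 8 1 ((\<Sum>l\<in>{..<n} - L. f k - f l) + (\<Sum>l\<in>L. f k - f l))"
    using bd_add[of 1 7 1 _ 4] by (simp add: numeral_eq_Suc)
  moreover have "(\<Sum>l<n. f k - f l) = (\<Sum>l\<in>{..<n} - L. f k - f l) + (\<Sum>l\<in>L. f k - f l)"
    by (rule sum.subset_diff) (auto simp: L_def)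
  moreover have "(\<Sum>l<n. f k - f l) = real n * f k - real (s j) * EE X"
  proof -
    have "(\<Sum>l<n. f l) = EE (\<lambda>G. \<Sum>l<n. colsum G l (?w G))"
      unfolding f_def EE_sum[symmetric] by (rule EE_cong) (simp add: colsum_single)
    also have "\<dots> = EE (\<lambda>G. real (s j) * X G)"
    proof (rule EE_cong)
      fix G assume "G \<in> \<Omega>"
      then show "(\<Sum>l<n. colsum G l (?w G)) = real (s j) * X G"
        using sum_single[OF j(1), of "X G" "\<lambda>i. real (s i)"] by (simp add: sum_colsum mult.commute)
    qed
    finally show ?thesis by (simp add: sum_subtractf EE_cmult)
  qed
  ultimately have "bd 1 8 1 (real n * (f k - real (s j) / real n * EE X))"
    using n_pos by (simp add: right_diff_distrib)
  then have 1: "bd 1 8 (-1) (f k - real (s j) / real n * EE X)" using bd_divn by fastforce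
  have "bd 1 0 0 (EE X)" by (rule bd_EE, rule bd_one) (use X in auto)
  from bd_mult[OF bd_s_div[OF j(1)] this]
  have "bd 1 1 (-1) ((real (s j) / real n - lam) * EE X)" by simp
  from bd_add[OF 1 this] show ?thesis
    unfolding f_def by (simp add: algebra_simps numeral_eq_Suc)
qed

definition pr :: "nat \<Rightarrow> nat \<Rightarrow> real" where "pr j k = EE (\<lambda>G. of_bool (j \<in> col G k))"

lemma pr_zero: "j \<in> col H k \<Longrightarrow> pr j k = 0"
proof -
  assume "j \<in> col H k"
  then have "pr j k = EE (\<lambda>G. 0)" unfolding pr_def
    by (intro EE_cong) (use bip_disj in \<open>force simp: \<Omega>_def col_def\<close>)
  then show ?thesis by (simp add: EE_const)
qed

lemma bd_pr: "bd 1 0 0 (pr j k)"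
  unfolding pr_def by (rule bd_EE) (auto intro: bd_one)

lemma prob_one:
  assumes "k < n" "j < m" "j \<notin> col H k"
  shows "bd 1 9 (-1) (pr j k - lam)"
  using corr_one[where K = "{}" and X = "\<lambda>_. 1" and k = k and j = j] assms by (simp add: dep_def EE_const pr_def)

lemma prob_two:
  assumes "k < n" "l < n" "k \<noteq> l" "j < m" "j \<notin> col H k" "j \<notin> col H l"
  shows "bd 1 10 (-1) (EE (\<lambda>G. of_bool (j \<in> col G l) * of_bool (j \<in> col G k)) - lam * lam)"
proof -
  have "bd 1 9 (-1) (EE (\<lambda>G. of_bool (j \<in> col G l) * of_bool (j \<in> col G k)) - lam * pr j l)"
    unfolding pr_def by (rule corr_one[where K = "{l}"]) (use assms in \<open>auto simp: dep_def\<close>)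
  from bd_add[OF this bd_mult[OF bd_lam prob_one[OF assms(2,4,6)], simplified]]
  show ?thesis by (simp add: algebra_simps numeral_eq_Suc)
qed

lemma prob_free:
  assumes "k < n" "l < n" "k \<noteq> l" "j < m" "j \<notin> col H k" "j \<notin> col H l"
  shows "bd 1 12 (-1) (EE (\<lambda>G. of_bool (j \<in> free H G k l)) - 2 * lam * (1 - lam))"
proof -
  let ?p2 = "EE (\<lambda>G. of_bool (j \<in> col G l) * of_bool (j \<in> col G k))"
  have "EE (\<lambda>G. of_bool (j \<in> free H G k l))
     = EE (\<lambda>G. of_bool (j \<in> col G k) + of_bool (j \<in> col G l) - 2 * (of_bool (j \<in> col G l) * of_bool (j \<in> col G k)))"
    by (rule EE_cong) (use assms in \<open>auto simp: free_col_eq\<close>)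
  also have "\<dots> = pr j k + pr j l - 2 * ?p2" by (simp only: EE_add EE_diff EE_cmult pr_def)
  finally have "EE (\<lambda>G. of_bool (j \<in> free H G k l)) - 2 * lam * (1 - lam) = (pr j k - lam) + (pr j l - lam) - 2 * (?p2 - lam * lam)"
    by (simp add: algebra_simps)
  also have "bd 1 12 (-1) \<dots>"
  proof -
    have 2: "bd 1 11 (-1) (2 * (?p2 - lam * lam))"
      using bd_mult[OF bd_const[of 2] prob_two[OF assms]] by simp
    show ?thesis
      by (rule bd_weak[OF bd_diff[OF bd_add[OF prob_one[OF assms(1,4,5)] prob_one[OF assms(2,4,6)]] 2]]) auto
  qed
  finally show ?thesis .
qed

lemma inv_card_le: "\<bar>of_bool P / real (card A)\<bar> \<le> 1"
  by (cases "card A = 0") auto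

text \<open>The random denominator may be replaced by \<open>dd\<close>, because a typical size
  deviates from it by a relative error of order r^-1. The numerator has mean 2 * lam * (1 - lam),
  and dividing this by \<open>dd\<close> leaves 1 / m.\<close>

lemma prob_free_ratio:
  assumes "k < n" "l < n" "k \<noteq> l" "j < m" "j \<notin> col H k" "j \<notin> col H l"
  shows "bd 1 17 (-3) (EE (\<lambda>G. of_bool (j \<in> free H G k l) / real (card (free H G k l))) - 1 / real m)"
proof -
  let ?D = "\<lambda>G. real (card (free H G k l))" and ?b = "\<lambda>G. of_bool (j \<in> free H G k l) :: real"
  have b1: "bd 1 0 0 (?b G)" for G by (rule bd_one) auto
  have 1: "bd 1 (Suc 15) (-3) (EE (\<lambda>G. ?b G / ?D G - ?b G / dd))"
  proof (rule bd_EE_typ[where b = 4 and j = 0])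
    fix G
    {
      assume G: "typical G"
      have D: "lo 4 2 (?D G)" "bd 1 8 1 (?D G - dd)" using typ_D[OF G] assms by auto
      have "?b G / ?D G - ?b G / dd = ?b G * (dd - ?D G) / (?D G * dd)"
        using lo_pos[OF D(1)] lo_pos[OF lo_dd] by (simp add: field_simps)
      then show "bd 1 15 (-3) (?b G / ?D G - ?b G / dd)"
        using bd_div[OF bd_mult[OF b1 bd_swap[OF D(2)]] lo_mult[OF D(1) lo_dd]] by simp
    next
      assume G: "G \<in> \<Omega>"
      show "bd 1 4 0 (?b G / ?D G - ?b G / dd)"
        by (rule bd_weak[OF bd_diff[OF bd_one[OF inv_card_le] bd_weak[OF bd_div[OF b1 lo_dd], of 1 3 0]]]) auto
    }
  qed auto
  have dm: "2 * lam * (1 - lam) / dd = 1 / real m" using lam01 m_pos by (simp add: dd_def)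
  have "EE (\<lambda>G. ?b G / ?D G) - 1 / real m = EE (\<lambda>G. ?b G / ?D G - ?b G / dd) + (EE ?b - 2 * lam * (1 - lam)) / dd"
    by (simp only: EE_diff EE_divc diff_divide_distrib dm)
  also have "bd 1 17 (-3) \<dots>"
    by (rule bd_weak[OF bd_add[OF 1 bd_div[OF prob_free[OF assms] lo_dd, simplified]]]) auto
  finally show ?thesis .
qed

lemma gdiff_bd:
  assumes "k < n" "l < n"
  shows "bd (1 + y k + y l) 0 0 (real (card (col G l \<inter> col H k)) - real (card (col G k \<inter> col H l)))"
    and "bd 1 2 1 (real (card (col G l \<inter> col H k)) - real (card (col G k \<inter> col H l)))"
  using gk_le[of G k l] gk_le[of G l k] y_nonneg[of k] y_nonneg[of l]
    bd_diff[OF bd_gk[OF assms(1), of G l] bd_gk[OF assms(2), of G k]]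
  by (auto simp: numeral_2_eq_2 intro!: bd_self)

lemma bd_tdiff: "k < n \<Longrightarrow> l < n \<Longrightarrow> bd 1 2 1 (real (t k) - real (t l))"
  using bd_diff[OF bd_t bd_t, of k l] by (simp add: numeral_2_eq_2)

text \<open>The balance is t k - t l plus a difference of boundary counts. The first part meets a
  ratio known up to r^-3; the second is at most 1 + y k + y l and is divided by order r^2. The
  weight is enlarged to a product so that it can be summed over l alone.\<close>

lemma prob_diff:
  assumes kl: "k < n" "l < n" "k \<noteq> l" and j: "j < m" "j \<notin> col H k" "j \<notin> col H l"
  shows "bd ((1 + y k) * (1 + y l)) 20 (-2) (pr j k - pr j l - (real (t k) - real (t l)) / real m)"
proof -
  let ?D = "\<lambda>G. real (card (free H G k l))" and ?b = "\<lambda>G. of_bool (j \<in> free H G k l) :: real"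
  let ?g = "\<lambda>G. real (card (col G l \<inter> col H k)) - real (card (col G k \<inter> col H l))"
  let ?w = "\<lambda>(G::(nat\<times>nat) set) i. of_bool (i = j) :: real"
  have "pr j k - pr j l = EE (\<lambda>G. colsum G k (?w G)) - EE (\<lambda>G. colsum G l (?w G))"
    unfolding pr_def by (intro arg_cong2[where f = "(-)"] EE_cong) (simp_all add: colsum_single1)
  also have "\<dots> = EE (\<lambda>G. drift H G k l (?w G))"
    by (rule EE_exchange[OF kl(3,1,2), of "{}"]) (auto simp: dep_def)
  also have "\<dots> = EE (\<lambda>G. (real (t k) - real (t l)) * (?b G / ?D G) + ?g G * (?b G / ?D G))"
  proof (rule EE_cong)
    fix G assume G: "G \<in> \<Omega>"
    have "bal H G k l = (real (t k) - real (t l)) + ?g G"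
      using bal_eq[OF G[unfolded \<Omega>_def] kl(3,1,2)] by simp
    then show "drift H G k l (?w G) = (real (t k) - real (t l)) * (?b G / ?D G) + ?g G * (?b G / ?D G)"
      unfolding drift_single1[OF G j(2,3)] by (simp only: distrib_right times_divide_eq_right times_divide_eq_left add_divide_distrib)
  qed
  also have "\<dots> = (real (t k) - real (t l)) * EE (\<lambda>G. ?b G / ?D G) + EE (\<lambda>G. ?g G * (?b G / ?D G))"
    by (simp only: EE_add EE_cmult)
  finally have e0: "pr j k - pr j l = (real (t k) - real (t l)) * EE (\<lambda>G. ?b G / ?D G) + EE (\<lambda>G. ?g G * (?b G / ?D G))" .
  have e: "pr j k - pr j l - (real (t k) - real (t l)) / real m
     = (real (t k) - real (t l)) * (EE (\<lambda>G. ?b G / ?D G) - 1 / real m) + EE (\<lambda>G. ?g G * (?b G / ?D G))"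
    unfolding e0 right_diff_distrib[of "real (t k) - real (t l)" "EE (\<lambda>G. ?b G / ?D G)"] by simp
  have 1: "bd 1 19 (-2) ((real (t k) - real (t l)) * (EE (\<lambda>G. ?b G / ?D G) - 1 / real m))"
    using bd_mult[OF bd_tdiff[OF kl(1,2)] prob_free_ratio[OF kl j]] by simp
  have 2: "bd (1 + y k + y l) (Suc 4) (-2) (EE (\<lambda>G. ?g G * (?b G / ?D G)))"
  proof (rule bd_EE_typ[where b = 2 and j = 1])
    fix G
    {
      assume G: "typical G"
      have "bd 1 4 (-2) (?b G / ?D G)"
        using bd_div[OF bd_one[of "?b G"] typ_D(2)[OF G kl(3,1,2)]] by simp
      from bd_mult[OF gdiff_bd(1)[OF kl(1,2)] this] show "bd (1 + y k + y l) 4 (-2) (?g G * (?b G / ?D G))" by simp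
    next
      assume G: "G \<in> \<Omega>"
      show "bd 1 2 1 (?g G * (?b G / ?D G))"
        by (rule bd_weak[OF bd_mult[OF gdiff_bd(2)[OF kl(1,2)] bd_one[OF inv_card_le]]]) auto
    }
  qed (use y_nonneg[of k] y_nonneg[of l] in auto)
  have "1 \<le> 1 + y k + y l" using y_nonneg[of k] y_nonneg[of l] by simp
  from bd_add[OF bd_weak[OF 1 this order_refl order_refl] 2]
  show ?thesis unfolding e by (rule bd_weak) (use y_prod_le in auto)
qed

text \<open>Averaging \<open>prob_diff\<close> over all columns l gains a factor r over
  \<open>prob_one\<close>. The three terms reflect the row sum, the forbidden entries of the row,
  and the deviation of the column sum.\<close>

lemma prob_refined:
  assumes k: "k < n" and j: "j < m" "j \<notin> col H k"
  shows "bd (1 + y k) 25 (-2)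
    (pr j k - (real (s j) + lam * real (degU H j)) / real n - (real (t k) - lam * real m) / real m)"
proof -
  define L where "L = {l \<in> {..<n}. j \<in> col H l}"
  define e where "e l = pr j k - pr j l - (real (t k) - real (t l)) / real m" for l
  have LF: "L \<subseteq> {..<n}" "finite L" by (auto simp: L_def)
  have cL: "real (card L) = real (degU H j)" unfolding L_def by (rule card_colH_row[OF j(1)])
  have g1: "1 \<le> 1 + y k" by (rule one_le_1y)
  have good: "bd ((1 + y k) * (1 + y l)) 20 (-2) (e l)" if "l \<in> {..<n} - L" for l
  proof (cases "l = k")
    case True
    then show ?thesis using y_nonneg[of k] by (auto simp: e_def intro!: bd_zero)
  next
    case False
    then show ?thesis unfolding e_def using that by (intro prob_diff k j) (auto simp: L_def)
  qed
  have S1: "bd (1 + y k) 22 0 (\<Sum>l\<in>{..<n} - L. e l)"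
  proof -
    have "bd 1 2 2 (\<Sum>l\<in>{..<n} - L. 1 + y l)"
      by (rule bd_le[OF _ bd_sum_1y]) (use y_nonneg in \<open>auto simp: abs_of_nonneg sum_nonneg intro!: sum_mono2 add_nonneg_nonneg\<close>)
    from bd_sum_weighted2[OF good this] show ?thesis using g1 by simp
  qed
  \<comment> \<open>In a column where row j is forbidden the probability is 0, so the difference is
    about \<open>lam\<close> instead of being small. These columns produce the term lam * degU H
    j.\<close>
  have bad': "bd 1 10 (-1) (e l - lam)" if "l \<in> L" for l
  proof -
    have "e l - lam = (pr j k - lam) - (real (t k) - real (t l)) / real m"
      using that pr_zero[of j l] by (simp add: e_def L_def)
    also have "bd 1 10 (-1) \<dots>"
      by (rule bd_weak[OF bd_diff[OF prob_one[OF k j] bd_div[OF bd_tdiff lo_m, simplified]]])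
        (use that k in \<open>auto simp: L_def\<close>)
    finally show ?thesis .
  qed
  have S2: "bd 1 11 0 (\<Sum>l\<in>L. e l - lam)"
    using bd_sum[where A = L and f = "\<lambda>l. e l - lam", OF bad', where b = 1 and j = 1] bd_x[OF j(1)] cL by simp
  have "(\<Sum>l<n. pr j k - pr j l) = (\<Sum>l<n. e l) + (\<Sum>l<n. (real (t k) - real (t l)) / real m)"
    by (simp add: e_def sum.distrib[symmetric])
  also have "(\<Sum>l<n. (real (t k) - real (t l)) / real m) = real n * ((real (t k) - lam * real m) / real m)"
    using sum_t m_pos by (simp add: sum_divide_distrib[symmetric] sum_subtractf diff_divide_distrib right_diff_distrib mult_ac)
  also have "(\<Sum>l<n. e l) = (\<Sum>l\<in>{..<n} - L. e l) + (\<Sum>l\<in>L. e l)"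
    by (rule sum.subset_diff[OF LF(1)]) simp
  also have "(\<Sum>l\<in>L. e l) = (\<Sum>l\<in>L. e l - lam) + lam * real (degU H j)"
    using cL by (simp add: sum_subtractf)
  also have "(\<Sum>l<n. pr j k - pr j l) = real n * pr j k - real (s j)"
  proof -
    have "(\<Sum>l<n. pr j l) = EE (\<lambda>G. \<Sum>l<n. colsum G l (\<lambda>i. of_bool (i = j)))"
      unfolding pr_def EE_sum[symmetric] by (rule EE_cong) (simp add: colsum_single1)
    also have "\<dots> = EE (\<lambda>G. real (s j))"
      using sum_single[OF j(1), of 1 "\<lambda>i. real (s i)"] by (intro EE_cong) (simp add: sum_colsum)
    finally show ?thesis by (simp add: sum_subtractf EE_const)
  qed
  finally have "real n * (pr j k - (real (s j) + lam * real (degU H j)) / real n - (real (t k) - lam * real m) / real m)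
     = (\<Sum>l\<in>{..<n} - L. e l) + (\<Sum>l\<in>L. e l - lam)"
    using n_pos by (simp add: right_diff_distrib)
  moreover have "bd (1 + y k) 25 0 ((\<Sum>l\<in>{..<n} - L. e l) + (\<Sum>l\<in>L. e l - lam))"
    by (rule bd_weak[OF bd_add[OF S1 bd_weak[OF S2 g1 order_refl order_refl]]]) auto
  ultimately have "bd (1 + y k) 25 (0 - 2)
     (pr j k - (real (s j) + lam * real (degU H j)) / real n - (real (t k) - lam * real m) / real m)"
    by (intro bd_divn) simp
  then show ?thesis by simp
qed

end

section \<open>Mean codegrees\<close>

context colwin
begin

lemma bd_sum_card:
  assumes "\<And>x. x \<in> A \<Longrightarrow> bd 1 a i (f x)"
  shows "bd (real (card A)) a i (\<Sum>x\<in>A. f x)"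
proof -
  have "\<bar>\<Sum>x\<in>A. f x\<bar> \<le> (\<Sum>x\<in>A. Q ^ a * r powi i)"
    using assms by (intro order_trans[OF sum_abs] sum_mono) (auto simp: bd_def)
  then show ?thesis by (simp add: bd_def mult_ac)
qed

lemma ratio_inter_le:
  assumes "finite F" "finite F'"
  shows "\<bar>real (card (F \<inter> F')) / (real (card F) * real (card F'))\<bar> \<le> 1"
proof (cases "card F' = 0")
  case False
  then have F': "1 \<le> real (card F')" by linarith
  have "real (card (F \<inter> F')) * 1 \<le> real (card F) * real (card F')"
    using F' card_mono[OF assms(1) Int_lower1, of F'] by (intro mult_mono) auto
  then show ?thesis by (cases "real (card F) * real (card F') = 0") (auto simp: divide_le_eq_1)
qed simp

text \<open>For typical graphs this quotient is only of order r^-1; its mean is smaller by another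
  factor r, apart from the weight 1 + y k. The weight 1 / card F on the free set F of l and l'
  depends on those two columns only, so column k can be compared with every other k', each
  comparison giving (t k - t k') / m up to order r^-2 by \<open>typ_FF\<close>. The total over all
  columns is again known.\<close>

lemma mean_free_ratio:
  assumes kl: "k < n" "l < n" "l' < n" "l \<noteq> l'" "k \<notin> {l,l'}"
  shows "bd (1 + y k) 28 (-2) (EE (\<lambda>G. (\<Sum>j\<in>free H G l l'. cw k G j) / real (card (free H G l l'))))"
proof -
  let ?F = "\<lambda>G. free H G l l'"
  let ?D = "\<lambda>G. real (card (?F G))"
  let ?w = "\<lambda>G j. of_bool (j \<in> ?F G) / ?D G"
  define V where "V i = EE (\<lambda>G. colsum G i (?w G))" for i
  have dw: "dep {l,l'} ?w" by (simp add: dep_def free_col_eq)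
  have w1: "\<bar>?w G j\<bar> \<le> 1" for G j by (rule inv_card_le)
  have sw: "(\<Sum>j\<in>A. ?w G j) = real (card (?F G \<inter> A)) / ?D G" if "finite A" for A G
    using that by (simp add: sum_divide_distrib[symmetric] Int_commute)
  have V1: "bd 1 0 0 (V i)" for i unfolding V_def
  proof (rule bd_EE, rule bd_one)
    fix G assume G: "G \<in> \<Omega>"
    have "card (?F G \<inter> col G i) \<le> card (?F G)" using \<Omega>_fin_free[OF G] by (intro card_mono) auto
    then show "\<bar>colsum G i (?w G)\<bar> \<le> 1"
      unfolding colsum_def sw[OF \<Omega>_fin_col[OF G]] by (cases "card (?F G) = 0") (auto simp: divide_le_eq_1)
  qed
  define e where "e k' = V k - V k' - (real (t k) - real (t k')) / real m" for k'
  have good: "bd ((1 + y k) * (1 + y k')) 23 (-2) (e k')" if k': "k' \<in> {..<n} - {l,l'}" for k'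
  proof (cases "k' = k")
    case True
    then show ?thesis using y_nonneg[of k] by (auto simp: e_def intro!: bd_zero)
  next
    case False
    have kk': "k \<noteq> k'" "k' < n" "k' \<notin> {l,l'}" using k' False by auto
    let ?F' = "\<lambda>G. free H G k k'"
    let ?D' = "\<lambda>G. real (card (?F' G))"
    let ?q = "\<lambda>G. real (card (?F G \<inter> ?F' G)) / (?D G * ?D' G)"
    let ?g = "\<lambda>G. real (card (col G k' \<inter> col H k)) - real (card (col G k \<inter> col H k'))"
    let ?dt = "real (t k) - real (t k')"
    let ?h = "1 + y k + y k'"
    have h1: "1 \<le> ?h" using y_nonneg[of k] y_nonneg[of k'] by simp
    have "V k - V k' = EE (\<lambda>G. drift H G k k' (?w G))"
      unfolding V_def by (rule EE_exchange[OF kk'(1) kl(1) kk'(2) dw kl(5) kk'(3)])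
    also have "\<dots> = EE (\<lambda>G. bnd H G k k' (?w G) + ?dt * (?q G - 1 / real m) + ?g G * ?q G + ?dt / real m)"
    proof (rule EE_cong)
      fix G assume G: "G \<in> \<Omega>"
      have b: "bal H G k k' = ?dt + ?g G"
        using bal_eq[OF G[unfolded \<Omega>_def] kk'(1) kl(1) kk'(2)] by simp
      show "drift H G k k' (?w G) = bnd H G k k' (?w G) + ?dt * (?q G - 1 / real m) + ?g G * ?q G + ?dt / real m"
        unfolding drift_def sw[OF \<Omega>_fin_free[OF G]] b
        by (simp only: times_divide_times_eq mult.commute[of "?D' G" "?D G"] distrib_right right_diff_distrib
            times_divide_eq_left times_divide_eq_right add_divide_distrib mult_1_right) (simp add: mult.commute)
    qed
    also have "\<dots> = EE (\<lambda>G. bnd H G k k' (?w G) + ?dt * (?q G - 1 / real m) + ?g G * ?q G) + ?dt / real m"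
      by (simp only: EE_add EE_const)
    finally have "e k' = EE (\<lambda>G. bnd H G k k' (?w G) + ?dt * (?q G - 1 / real m) + ?g G * ?q G)" by (simp add: e_def)
    also have "bd ?h (Suc 22) (-2) \<dots>"
    proof (rule bd_EE_typ[where b = 6 and j = 1])
      fix G
      have m1: "bd 1 1 (-2) (1 / real m)" using bd_div[OF bd_one[of 1] lo_m] by simp
      {
        assume G: "typical G"
        note G' = typ_\<Omega>[OF G]
        have D: "lo 4 2 (?D G)" using typ_D(2)[OF G kl(4,2,3)] .
        have F: "bd 1 17 (-3) (?q G - 1 / real m)"
          by (rule typ_FF[OF G kl(1) kk'(2) kl(2,3) kk'(1) kl(4)]) (use kl kk' in auto)
        have q: "bd 1 18 (-2) (?q G)"
          using bd_add[OF bd_weak[OF F order_refl order_refl, of "-2"] m1] by simp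
        have "\<bar>bnd H G k k' (?w G)\<bar> \<le> 1 / ?D G * (y k + y k')"
          by (rule bnd_abs[OF G']) (auto simp: divide_simps)
        moreover have "0 \<le> y k" "0 \<le> y k'" by (rule y_nonneg)+
        ultimately have "\<bar>bnd H G k k' (?w G)\<bar> \<le> \<bar>?h / ?D G\<bar>"
          using lo_pos[OF D] by (simp add: divide_simps)
        then have b: "bd ?h 4 (-2) (bnd H G k k' (?w G))"
          by (rule bd_le[OF _ bd_weak[OF bd_div[OF bd_self[of ?h ?h] D]]]) (use h1 in auto)
        have d: "bd ?h 19 (-2) (?dt * (?q G - 1 / real m))"
          by (rule bd_weak[OF bd_mult[OF bd_tdiff[OF kl(1) kk'(2)] F]]) (use h1 in auto)
        have g: "bd ?h 18 (-2) (?g G * ?q G)"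
          using bd_mult[OF gdiff_bd(1)[OF kl(1) kk'(2)] q] by simp
        show "bd ?h 22 (-2) (bnd H G k k' (?w G) + ?dt * (?q G - 1 / real m) + ?g G * ?q G)"
          by (rule bd_weak[OF bd_add[OF bd_add[OF b d] g]]) auto
      next
        assume G: "G \<in> \<Omega>"
        have q: "bd 1 0 0 (?q G)" by (rule bd_one, rule ratio_inter_le[OF \<Omega>_fin_free[OF G] \<Omega>_fin_free[OF G]])
        have "\<bar>bnd H G k k' (?w G)\<bar> \<le> 1 * (y k + y k')"
          by (rule bnd_abs[OF G w1]) simp
        moreover have "0 \<le> y k" "0 \<le> y k'" by (rule y_nonneg)+
        ultimately have "\<bar>bnd H G k k' (?w G)\<bar> \<le> \<bar>y k + y k'\<bar>" by simp
        then have b: "bd 1 2 1 (bnd H G k k' (?w G))"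
          by (rule bd_le[OF _ bd_weak[OF bd_add[OF bd_y[OF kl(1)] bd_y[OF kk'(2)]]]]) auto
        have d: "bd 1 4 1 (?dt * (?q G - 1 / real m))"
          by (rule bd_weak[OF bd_mult[OF bd_tdiff[OF kl(1) kk'(2)] bd_diff[OF q bd_weak[OF m1, of 1 1 0]]]]) auto
        have g: "bd 1 2 1 (?g G * ?q G)"
          using bd_mult[OF gdiff_bd(2)[OF kl(1) kk'(2)] q] by simp
        show "bd 1 6 1 (bnd H G k k' (?w G) + ?dt * (?q G - 1 / real m) + ?g G * ?q G)"
          by (rule bd_weak[OF bd_add[OF bd_add[OF b d] g]]) auto
      }
    qed (use h1 in auto)
    finally show ?thesis by (rule bd_weak) (use y_prod_le in auto)
  qed
  have g1: "1 \<le> 1 + y k" by (rule one_le_1y)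
  have S1: "bd (1 + y k) 25 0 (\<Sum>k'\<in>{..<n} - {l,l'}. e k')"
  proof -
    have "bd 1 2 2 (\<Sum>l\<in>{..<n} - {l,l'}. 1 + y l)"
      by (rule bd_le[OF _ bd_sum_1y]) (use y_nonneg in \<open>auto simp: abs_of_nonneg sum_nonneg intro!: sum_mono2 add_nonneg_nonneg\<close>)
    from bd_sum_weighted2[OF good this] show ?thesis using g1 by simp
  qed
  have el: "bd 1 4 0 (e i)" if "i < n" for i
    unfolding e_def
    by (rule bd_weak[OF bd_diff[OF bd_diff[OF V1 V1] bd_weak[OF bd_div[OF bd_tdiff[OF kl(1) that] lo_m], of 1 3 0]]]) auto
  have S2: "bd (1 + y k) 5 0 (\<Sum>k'\<in>{l,l'}. e k')"
    using bd_weak[OF bd_add[OF el[OF kl(2)] el[OF kl(3)]], of "1 + y k" 5 0] kl(4) g1 by simp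
  have sub: "{l,l'} \<subseteq> {..<n}" using kl by auto
  have S: "bd (1 + y k) 26 0 (\<Sum>k'<n. e k')"
    unfolding sum.subset_diff[OF sub finite_lessThan]
    by (rule bd_weak[OF bd_add[OF S1 S2]]) auto
  \<comment> \<open>By \<open>sum_colsum\<close> the total over all columns is the mean of the
    average row sum within the free set, which is lam * n up to bounded order by
    \<open>typ_FS\<close>.\<close>
  define W where "W = EE (\<lambda>G. (\<Sum>j\<in>?F G. real (s j)) / ?D G)"
  have sV: "(\<Sum>k'<n. V k') = W"
    unfolding V_def W_def EE_sum[symmetric]
  proof (rule EE_cong)
    fix G assume G: "G \<in> \<Omega>"
    have "(\<Sum>i<n. colsum G i (?w G)) = (\<Sum>j<m. of_bool (j \<in> ?F G) * (real (s j) / ?D G))"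
      unfolding sum_colsum[OF G] by simp
    also have "\<dots> = (\<Sum>j\<in>?F G. real (s j) / ?D G)"
      by (rule sum_subset_of_bool[symmetric]) (use free_sub[OF \<Omega>_sub[OF G]] in auto)
    finally show "(\<Sum>i<n. colsum G i (?w G)) = (\<Sum>j\<in>?F G. real (s j)) / ?D G" by (simp add: sum_divide_distrib)
  qed
  have Wb: "bd 1 15 0 (W - lam * real n)"
  proof -
    have "W - lam * real n = EE (\<lambda>G. (\<Sum>j\<in>?F G. real (s j)) / ?D G - lam * real n)"
      by (simp add: W_def EE_diff EE_const)
    also have "bd 1 (Suc 13) 0 \<dots>"
    proof (rule bd_EE_typ[where b = 2 and j = 2])
      fix G
      {
        assume G: "typical G"
        have D: "lo 4 2 (?D G)" using typ_D(2)[OF G kl(4,2,3)] .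
        have "(\<Sum>j\<in>?F G. real (s j)) / ?D G - lam * real n = (\<Sum>j\<in>?F G. sv j) / ?D G"
          using lo_pos[OF D] by (simp add: sum_subtractf diff_divide_distrib)
        then show "bd 1 13 0 ((\<Sum>j\<in>?F G. real (s j)) / ?D G - lam * real n)"
          using bd_div[OF typ_FS[OF G kl(4,2,3)] D] by simp
      next
        assume G: "G \<in> \<Omega>"
        have s1: "\<bar>real (s j)\<bar> \<le> real n" if "j < m" for j
        proof -
          have "s j = card {k. (j,k) \<in> G}" using bip_row_card[OF G[unfolded \<Omega>_def] that] by simp
          also have "\<dots> \<le> card {..<n}" by (rule card_mono) (use \<Omega>_sub[OF G] in auto)
          finally show ?thesis by simp
        qed
        have "\<bar>\<Sum>j\<in>?F G. real (s j)\<bar> \<le> ?D G * real n"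
          by (rule abs_sum_le) (use s1 free_sub[OF \<Omega>_sub[OF G], of H l l'] in auto)
        then have "\<bar>(\<Sum>j\<in>?F G. real (s j)) / ?D G\<bar> \<le> \<bar>real n\<bar>"
          by (cases "?D G = 0") (auto simp: divide_simps mult_ac)
        from bd_diff[OF bd_le[OF this bd_n] bd_mult[OF bd_lam bd_n, simplified]]
        show "bd 1 2 2 ((\<Sum>j\<in>?F G. real (s j)) / ?D G - lam * real n)" by (rule bd_weak) auto
      }
    qed auto
    finally show ?thesis by (rule bd_weak) auto
  qed
  have "(\<Sum>k'<n. e k') = real n * V k - W - real n * ((real (t k) - lam * real m) / real m)"
    using sV sum_t m_pos
    by (simp add: e_def sum_subtractf sum_divide_distrib[symmetric] diff_divide_distrib right_diff_distrib mult_ac)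
  then have "real n * (V k - real (t k) / real m) = (\<Sum>k'<n. e k') + (W - lam * real n)"
    using m_pos by (simp add: right_diff_distrib diff_divide_distrib)
  moreover have "bd (1 + y k) 27 0 ((\<Sum>k'<n. e k') + (W - lam * real n))"
    by (rule bd_weak[OF bd_add[OF S bd_weak[OF Wb g1 order_refl order_refl]]]) auto
  ultimately have Vb: "bd (1 + y k) 27 (0 - 2) (V k - real (t k) / real m)" by (intro bd_divn) simp
  \<comment> \<open>If the free set is empty the left quotient is 0, while the right side still
    subtracts t k / m. The indicator restores this; it vanishes on typical graphs.\<close>
  have "EE (\<lambda>G. (\<Sum>j\<in>?F G. cw k G j) / ?D G) = EE (\<lambda>G. colsum G k (?w G) - real (t k) / real m + (real (t k) / real m) * of_bool (?D G = 0))"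
  proof (rule EE_cong)
    fix G assume G: "G \<in> \<Omega>"
    have "colsum G k (?w G) = real (card (?F G \<inter> col G k)) / ?D G"
      unfolding colsum_def by (rule sw[OF \<Omega>_fin_col[OF G]])
    then show "(\<Sum>j\<in>?F G. cw k G j) / ?D G = colsum G k (?w G) - real (t k) / real m + (real (t k) / real m) * of_bool (?D G = 0)"
      unfolding sum_cw[OF \<Omega>_fin_free[OF G]] by (auto simp: diff_divide_distrib)
  qed
  also have "\<dots> = V k - real (t k) / real m + EE (\<lambda>G. (real (t k) / real m) * of_bool (?D G = 0))"
    by (simp only: EE_add EE_diff EE_const V_def)
  also have "bd (1 + y k) 28 (-2) \<dots>"
  proof -
    have "bd 1 (Suc 0) (-2) (EE (\<lambda>G. (real (t k) / real m) * of_bool (?D G = 0)))"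
    proof (rule bd_EE_typ[where b = 0 and j = 0])
      fix G assume G: "typical G"
      show "bd 1 0 (-2) (real (t k) / real m * of_bool (?D G = 0))"
        using lo_pos[OF typ_D(2)[OF G kl(4,2,3)]] by (simp add: bd_zero)
    next
      fix G
      show "bd 1 0 0 (real (t k) / real m * of_bool (?D G = 0))"
        by (rule bd_one) (use tk_le[OF kl(1)] m_pos in \<open>auto simp: divide_simps\<close>)
    qed auto
    then have "bd (1 + y k) 27 (-2) (EE (\<lambda>G. (real (t k) / real m) * of_bool (?D G = 0)))"
      by (rule bd_weak) (use g1 in auto)
    from bd_add[OF _ this, of 27] Vb show ?thesis by simp
  qed
  finally show ?thesis .
qed

end

section \<open>Totals of centred codegrees and the mean codegree\<close>

context colwin
begin

abbreviation zz :: "nat \<Rightarrow> nat \<Rightarrow> (nat \<times> nat) set \<Rightarrow> real"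
  where "zz k l G \<equiv> colsum G k (cw l G)"

text \<open>The total of the centred codegrees of column l with all other columns; by the fixed row
  sums it depends on column l alone. The subtracted part is the centred codegree of l with
  itself.\<close>

definition TT :: "nat \<Rightarrow> (nat \<times> nat) set \<Rightarrow> real"
  where "TT l G = (\<Sum>j\<in>col G l. sv j) - (real (t l) - real (t l) * real (t l) / real m)"

lemma sum_zz:
  assumes G: "G \<in> \<Omega>" and l: "l < n"
  shows "(\<Sum>k\<in>{..<n} - {l}. zz k l G) = TT l G"
proof -
  have "(\<Sum>k<n. zz k l G) = (\<Sum>j<m. cw l G j * real (s j))" by (rule sum_colsum[OF G])
  also have "\<dots> = (\<Sum>j<m. of_bool (j \<in> col G l) * real (s j)) - real (t l) / real m * (\<Sum>j<m. real (s j))"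
    by (simp add: cw_def left_diff_distrib sum_subtractf sum_distrib_left)
  also have "(\<Sum>j<m. of_bool (j \<in> col G l) * real (s j)) = (\<Sum>j\<in>col G l. real (s j))"
    by (rule sum_subset_of_bool[symmetric]) (use col_sub[OF \<Omega>_sub[OF G]] in auto)
  also have "real (t l) / real m * (\<Sum>j<m. real (s j)) = real (t l) * (lam * real n)"
    unfolding sum_s using m_pos by simp
  also have "(\<Sum>j\<in>col G l. real (s j)) - real (t l) * (lam * real n) = (\<Sum>j\<in>col G l. sv j)"
    using \<Omega>_col[OF G l] by (simp add: sum_subtractf)
  finally have "(\<Sum>k<n. zz k l G) = (\<Sum>j\<in>col G l. sv j)" .
  moreover have "zz l l G = real (t l) - real (t l) * real (t l) / real m"
    using colsum_cw[OF G l, of l] \<Omega>_col[OF G l] by simp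
  moreover have "(\<Sum>k<n. zz k l G) = zz l l G + (\<Sum>k\<in>{..<n} - {l}. zz k l G)"
    using l by (intro sum.remove) auto
  ultimately show ?thesis by (simp add: TT_def)
qed

lemma tl_var_bd: "l < n \<Longrightarrow> bd 1 1 2 (real (t l) - real (t l) * real (t l) / real m)"
proof -
  assume l: "l < n"
  have "\<bar>real (t l) - real (t l) * real (t l) / real m\<bar> \<le> \<bar>real (t l)\<bar>"
    using tk_le[OF l] m_pos by (simp add: divide_simps) (simp add: mult_left_mono)
  then show ?thesis using bd_tk[OF l] by (rule bd_le)
qed

lemma typ_TT: "typical G \<Longrightarrow> l < n \<Longrightarrow> bd 1 5 2 (TT l G)"
  unfolding TT_def using bd_diff[OF typical_sv tl_var_bd] by (simp add: numeral_eq_Suc)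

lemma bd_TT: "G \<in> \<Omega> \<Longrightarrow> l < n \<Longrightarrow> bd 1 3 3 (TT l G)"
proof -
  assume G: "G \<in> \<Omega>" and l: "l < n"
  note cs = col_sub[OF \<Omega>_sub[OF G], of l]
  have "bd 1 (1 + 1) (1 + 2) (\<Sum>j\<in>col G l. sv j)"
    by (rule bd_sum[OF _ bd_card[OF cs]]) (use bd_s cs in auto)
  from bd_diff[OF this bd_weak[OF tl_var_bd[OF l], of 1 1 "1 + 2"]]
  show ?thesis unfolding TT_def by (simp add: numeral_eq_Suc)
qed

text \<open>Averaging over the second column turns exchange estimates into estimates for one column.\<close>

lemma average_exchange:
  assumes kl: "k < n" "l < n" "k \<noteq> l" and h: "0 \<le> h"
    and ex: "\<And>k'. k' \<in> {..<n} - {k,l} \<Longrightarrow>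
        bd (h * (1 + y k')) a i (EE (\<lambda>G. X G * zz k l G) - EE (\<lambda>G. X G * zz k' l G) - c k')"
    and X: "bd h b (i + 2) (EE (\<lambda>G. X G * zz k l G))"
  shows "bd h (Suc (max (a + 2) b)) (i + 2)
    (real n * EE (\<lambda>G. X G * zz k l G) - EE (\<lambda>G. X G * TT l G) - (\<Sum>k'\<in>{..<n} - {k,l}. c k'))"
proof -
  let ?E = "\<lambda>k'. EE (\<lambda>G. X G * zz k' l G)"
  let ?S = "{..<n} - {k,l}"
  have "bd 1 2 2 (\<Sum>k'\<in>?S. 1 + y k')"
    by (rule bd_le[OF _ bd_sum_1y]) (use y_nonneg in \<open>auto simp: abs_of_nonneg sum_nonneg intro!: sum_mono2 add_nonneg_nonneg\<close>)
  from bd_sum_weighted2[OF ex this h]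
  have 1: "bd h (a + 2) (i + 2) (\<Sum>k'\<in>?S. ?E k - ?E k' - c k')" by simp
  have "EE (\<lambda>G. X G * TT l G) = EE (\<lambda>G. \<Sum>k'\<in>{..<n} - {l}. X G * zz k' l G)"
    by (rule EE_cong) (simp add: sum_zz[OF _ kl(2), symmetric] sum_distrib_left)
  also have "\<dots> = (\<Sum>k'\<in>{..<n} - {l}. ?E k')" by (rule EE_sum)
  also have "\<dots> = ?E k + (\<Sum>k'\<in>{..<n} - {l} - {k}. ?E k')"
    using kl by (intro sum.remove) auto
  also have "{..<n} - {l} - {k} = ?S" by auto
  finally have T: "EE (\<lambda>G. X G * TT l G) = ?E k + (\<Sum>k'\<in>?S. ?E k')" .
  have "card ?S = n - 2" using kl by (simp add: card_Diff_subset)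
  moreover have "2 \<le> n" using kl by linarith
  ultimately have cS: "real (card ?S) = real n - 2" by simp
  have "(\<Sum>k'\<in>?S. ?E k - ?E k' - c k') + ?E k = real n * ?E k - EE (\<lambda>G. X G * TT l G) - (\<Sum>k'\<in>?S. c k')"
    unfolding T sum_subtractf sum_constant cS by (simp add: algebra_simps)
  then show ?thesis using bd_add[OF 1 X] by simp
qed

text \<open>For a row forbidden in k' the joint probability of entries in k and l nearly cancels
  against the centring. A row that is also forbidden in l has joint probability 0 and leaves -lam^2,
  unless it is forbidden in k too, where everything vanishes.\<close>

lemma bnd_part:
  assumes kl: "k < n" "k' < n" "l < n" "k \<noteq> l"
  shows "bd (y k') 13 (-1) (EE (\<lambda>G. \<Sum>j\<in>col G k \<inter> col H k'. cw l G j)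
     + lam * lam * real (card (col H k' \<inter> col H l - col H k)))"
proof -
  let ?\<tau> = "\<lambda>j. lam * lam * of_bool (j \<in> col H l \<and> j \<notin> col H k)"
  have "EE (\<lambda>G. \<Sum>j\<in>col G k \<inter> col H k'. cw l G j) = EE (\<lambda>G. \<Sum>j\<in>col H k'. of_bool (j \<in> col G k) * cw l G j)"
  proof (rule EE_cong)
    fix G assume "G \<in> \<Omega>"
    have "(\<Sum>j\<in>col G k \<inter> col H k'. cw l G j) = (\<Sum>j\<in>col H k'. of_bool (j \<in> col G k \<inter> col H k') * cw l G j)"
      by (rule sum_subset_of_bool) (use finite_colH in auto)
    then show "(\<Sum>j\<in>col G k \<inter> col H k'. cw l G j) = (\<Sum>j\<in>col H k'. of_bool (j \<in> col G k) * cw l G j)" by simp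
  qed
  also have "\<dots> = (\<Sum>j\<in>col H k'. EE (\<lambda>G. of_bool (j \<in> col G k) * cw l G j))" by (rule EE_sum)
  finally have "EE (\<lambda>G. \<Sum>j\<in>col G k \<inter> col H k'. cw l G j) + lam * lam * real (card (col H k' \<inter> col H l - col H k))
     = (\<Sum>j\<in>col H k'. EE (\<lambda>G. of_bool (j \<in> col G k) * cw l G j) + ?\<tau> j)"
    using finite_colH[of k'] by (simp add: sum.distrib sum_distrib_left[symmetric] Int_def set_diff_eq conj_ac del: of_bool_conj)
  also have "bd (real (card (col H k'))) 13 (-1) \<dots>"
  proof (rule bd_sum_card)
    fix j assume "j \<in> col H k'"
    then have jm: "j < m" using Hsub by (auto simp: col_def)
    let ?p2 = "EE (\<lambda>G. of_bool (j \<in> col G l) * of_bool (j \<in> col G k))"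
    have e: "EE (\<lambda>G. of_bool (j \<in> col G k) * cw l G j) = ?p2 - pr j k * (real (t l) / real m)"
    proof -
      have "(\<lambda>G. of_bool (j \<in> col G k) * cw l G j) = (\<lambda>G. of_bool (j \<in> col G l) * of_bool (j \<in> col G k) - of_bool (j \<in> col G k) * (real (t l) / real m))"
        by (intro ext) (simp add: cw_def algebra_simps)
      then show ?thesis by (simp only: EE_diff EE_multc pr_def)
    qed
    show "bd 1 13 (-1) (EE (\<lambda>G. of_bool (j \<in> col G k) * cw l G j) + ?\<tau> j)"
    proof (cases "j \<in> col H k")
      case True
      have "EE (\<lambda>G. of_bool (j \<in> col G k) * cw l G j) = EE (\<lambda>G. 0)"
      proof (rule EE_cong)
        fix G assume "G \<in> \<Omega>"
        then have "j \<notin> col G k" using True bip_disj[of G m n s t H j k] by (auto simp: \<Omega>_def col_def)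
        then show "of_bool (j \<in> col G k) * cw l G j = 0" by simp
      qed
      then show ?thesis using True by (simp add: EE_const bd_zero)
    next
      case False
      have d: "bd 1 10 (-1) (pr j k * (real (t l) / real m) - lam * lam)"
      proof -
        have "pr j k * (real (t l) / real m) - lam * lam = pr j k * (real (t l) / real m - lam) + lam * (pr j k - lam)"
          by (simp add: algebra_simps)
        also have "bd 1 10 (-1) \<dots>"
          by (rule bd_weak[OF bd_add[OF bd_mult[OF bd_pr bd_t_div[OF kl(3)], simplified]
            bd_mult[OF bd_lam prob_one[OF kl(1) jm False], simplified]]]) auto
        finally show ?thesis .
      qed
      show ?thesis
      proof (cases "j \<in> col H l")
        case True
        have "?p2 = EE (\<lambda>G. 0)"
        proof (rule EE_cong)
          fix G assume "G \<in> \<Omega>"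
          then have "j \<notin> col G l" using True bip_disj[of G m n s t H j l] by (auto simp: \<Omega>_def col_def)
          then show "of_bool (j \<in> col G l) * of_bool (j \<in> col G k) = (0::real)" by simp
        qed
        then have "EE (\<lambda>G. of_bool (j \<in> col G k) * cw l G j) + ?\<tau> j = - (pr j k * (real (t l) / real m) - lam * lam)"
          unfolding e using True False by (simp add: EE_const)
        then show ?thesis using bd_weak[OF bd_minus[OF d], of 1 13 "-1"] by simp
      next
        case jl: False
        have "EE (\<lambda>G. of_bool (j \<in> col G k) * cw l G j) + ?\<tau> j = (?p2 - lam * lam) - (pr j k * (real (t l) / real m) - lam * lam)"
          unfolding e using jl by simp
        also have "bd 1 13 (-1) \<dots>"
          by (rule bd_weak[OF bd_diff[OF prob_two[OF kl(1,3,4) jm False jl] d]]) auto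
        finally show ?thesis .
      qed
    qed
  qed
  finally show ?thesis by (simp add: card_colH)
qed

lemma EE_bnd:
  assumes kl: "k < n" "k' < n" "l < n" "k \<noteq> l" "k' \<noteq> l"
  shows "bd (1 + y k + y k') 14 (-1) (EE (\<lambda>G. bnd H G k k' (cw l G))
     - lam * lam * (real (card (col H k \<inter> col H l)) - real (card (col H k' \<inter> col H l))))"
proof -
  let ?h = "1 + y k + y k'"
  \<comment> \<open>Rows forbidden in all three columns contribute equally to both terms and
    cancel.\<close>
  have c: "real (card (col H k \<inter> col H l)) - real (card (col H k' \<inter> col H l))
      = real (card (col H k \<inter> col H l - col H k')) - real (card (col H k' \<inter> col H l - col H k))"
  proof -
    have s: "real (card A) = real (card (A \<inter> B)) + real (card (A - B))" if "finite A" for A B :: "nat set"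
      using card_Int_Diff[OF that, of B] by simp
    have "col H k \<inter> col H l \<inter> col H k' = col H k' \<inter> col H l \<inter> col H k" by auto
    then show ?thesis
      using s[of "col H k \<inter> col H l" "col H k'"] s[of "col H k' \<inter> col H l" "col H k"] finite_colH by simp
  qed
  have "EE (\<lambda>G. bnd H G k k' (cw l G)) - lam * lam * (real (card (col H k \<inter> col H l)) - real (card (col H k' \<inter> col H l)))
     = (EE (\<lambda>G. \<Sum>j\<in>col G k \<inter> col H k'. cw l G j) + lam * lam * real (card (col H k' \<inter> col H l - col H k)))
     - (EE (\<lambda>G. \<Sum>j\<in>col G k' \<inter> col H k. cw l G j) + lam * lam * real (card (col H k \<inter> col H l - col H k')))"
    unfolding c bnd_def EE_diff by (simp add: algebra_simps)
  also have "bd ?h 14 (-1) \<dots>"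
    by (rule bd_weak[OF bd_diff[OF bd_weak[OF bnd_part[OF kl(1-4)], of ?h 13 "-1"] bd_weak[OF bnd_part[OF kl(2,1,3,5)], of ?h 13 "-1"]]])
      (use y_nonneg[of k] y_nonneg[of k'] in auto)
  finally show ?thesis .
qed

lemma ratio_U_le: "G \<in> \<Omega> \<Longrightarrow> l < n \<Longrightarrow> \<bar>(\<Sum>j\<in>free H G k k'. cw l G j) / real (card (free H G k k'))\<bar> \<le> 1"
proof -
  assume a: "G \<in> \<Omega>" "l < n"
  have "\<bar>\<Sum>j\<in>free H G k k'. cw l G j\<bar> \<le> real (card (free H G k k')) * 1"
    by (rule abs_sum_le) (rule cw_le[OF a(2)])
  then show ?thesis by (cases "card (free H G k k') = 0") (auto simp: divide_simps)
qed

text \<open>The drift has a boundary part, evaluated by \<open>EE_bnd\<close>, and a part (t k - t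
  k') times the average of \<open>cw l\<close> over the free set. The latter is of order 1 for a
  single typical graph; only \<open>mean_free_ratio\<close> brings its mean down to r^-1.\<close>

lemma mean_zz_diff:
  assumes kl: "k < n" "k' < n" "l < n" "k \<noteq> k'" "k \<noteq> l" "k' \<noteq> l"
  shows "bd ((1 + y k + y l) * (1 + y k')) 32 (-1) (EE (zz k l) - EE (zz k' l)
     - lam * lam * (real (card (col H k \<inter> col H l)) - real (card (col H k' \<inter> col H l))))"
proof -
  let ?h = "1 + y k + y k'" and ?h' = "(1 + y k + y l) * (1 + y k')"
  let ?UD = "\<lambda>G. (\<Sum>j\<in>free H G k k'. cw l G j) / real (card (free H G k k'))"
  let ?g = "\<lambda>G. real (card (col G k' \<inter> col H k)) - real (card (col G k \<inter> col H k'))"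
  let ?dt = "real (t k) - real (t k')"
  let ?c = "lam * lam * (real (card (col H k \<inter> col H l)) - real (card (col H k' \<inter> col H l)))"
  have y0: "0 \<le> y k" "0 \<le> y k'" "0 \<le> y l" by (rule y_nonneg)+
  have h1: "1 \<le> ?h" "?h \<le> ?h'" "1 + y l \<le> ?h'"
    using y0 by (auto simp: algebra_simps)
  have "EE (zz k l) - EE (zz k' l) = EE (\<lambda>G. drift H G k k' (cw l G))"
    by (rule EE_exchange[OF kl(4,1,2) dep_cw]) (use kl in auto)
  also have "\<dots> = EE (\<lambda>G. bnd H G k k' (cw l G) + ?dt * ?UD G + ?g G * ?UD G)"
  proof (rule EE_cong)
    fix G assume G: "G \<in> \<Omega>"
    have b: "bal H G k k' = ?dt + ?g G"
      using bal_eq[OF G[unfolded \<Omega>_def] kl(4,1,2)] by simp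
    show "drift H G k k' (cw l G) = bnd H G k k' (cw l G) + ?dt * ?UD G + ?g G * ?UD G"
      unfolding drift_def b by (simp only: distrib_right times_divide_eq_left times_divide_eq_right add_divide_distrib add.assoc)
  qed
  also have "\<dots> = EE (\<lambda>G. bnd H G k k' (cw l G)) + ?dt * EE ?UD + EE (\<lambda>G. ?g G * ?UD G)"
    by (simp only: EE_add EE_cmult)
  finally have e: "EE (zz k l) - EE (zz k' l) - ?c
    = (EE (\<lambda>G. bnd H G k k' (cw l G)) - ?c) + ?dt * EE ?UD + EE (\<lambda>G. ?g G * ?UD G)" by simp
  have 1: "bd ?h' 14 (-1) (EE (\<lambda>G. bnd H G k k' (cw l G)) - ?c)"
    by (rule bd_weak[OF EE_bnd[OF kl(1-3,5,6)] h1(2)]) auto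
  have 2: "bd ?h' 30 (-1) (?dt * EE ?UD)"
    by (rule bd_weak[OF bd_mult[OF bd_tdiff[OF kl(1,2)] mean_free_ratio[OF kl(3,1,2,4)]]]) (use kl h1 in auto)
  have "bd ?h (Suc 8) (-1) (EE (\<lambda>G. ?g G * ?UD G))"
  proof (rule bd_EE_typ[where b = 2 and j = 1])
    fix G
    {
      assume G: "typical G"
      have "bd 1 8 (-1) (?UD G)"
        using bd_div[OF typ_U[OF G kl(3,1,2)] typ_D(2)[OF G kl(4,1,2)]] kl by simp
      from bd_mult[OF gdiff_bd(1)[OF kl(1,2)] this] show "bd ?h 8 (-1) (?g G * ?UD G)" by simp
    next
      assume G: "G \<in> \<Omega>"
      show "bd 1 2 1 (?g G * ?UD G)"
        by (rule bd_weak[OF bd_mult[OF gdiff_bd(2)[OF kl(1,2)] bd_one[OF ratio_U_le[OF G kl(3)]]]]) auto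
    }
  qed (use h1 in auto)
  then have 3: "bd ?h' 9 (-1) (EE (\<lambda>G. ?g G * ?UD G))" by (rule bd_weak) (use h1 in auto)
  show ?thesis unfolding e by (rule bd_weak[OF bd_add[OF bd_add[OF 1 2] 3]]) auto
qed

lemma Rsum_sv: "Rsum m s = (\<Sum>j<m. sv j * sv j)"
  by (simp add: Rsum_def avg_s_eq power2_eq_square)

text \<open>Insert the refined edge probabilities. The constant part disappears because the
  \<open>sv j\<close> sum to 0, the part sv j / n gives the variance of the row sums, and the part
  from H is of lower order. Rows forbidden in column l do not follow the refined formula, but there
  are only y l of them.\<close>

lemma EE_sv:
  assumes l: "l < n"
  shows "bd (1 + y l) 30 1 (EE (\<lambda>G. \<Sum>j\<in>col G l. sv j) - Rsum m s / real n)"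
proof -
  have g1: "1 \<le> 1 + y l" by (rule one_le_1y)
  define e where "e j = pr j l - real (t l) / real m - sv j / real n - lam * real (degU H j) / real n" for j
  have "EE (\<lambda>G. \<Sum>j\<in>col G l. sv j) = EE (\<lambda>G. \<Sum>j<m. of_bool (j \<in> col G l) * sv j)"
    by (intro EE_cong sum_subset_of_bool) (use col_sub[OF \<Omega>_sub] in auto)
  also have "\<dots> = (\<Sum>j<m. pr j l * sv j)" by (simp only: EE_sum EE_multc pr_def)
  also have "\<dots> = (\<Sum>j<m. real (t l) / real m * sv j + sv j * sv j / real n + lam * real (degU H j) / real n * sv j + e j * sv j)"
    by (intro sum.cong refl) (simp add: e_def algebra_simps)
  also have "\<dots> = real (t l) / real m * (\<Sum>j<m. sv j) + Rsum m s / real n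
      + (\<Sum>j<m. lam * real (degU H j) / real n * sv j) + (\<Sum>j<m. e j * sv j)"
    by (simp only: sum.distrib sum_distrib_left sum_divide_distrib Rsum_sv)
  also have "(\<Sum>j<m. sv j) = 0" using sum_s by (simp add: sum_subtractf mult_ac)
  finally have 0: "EE (\<lambda>G. \<Sum>j\<in>col G l. sv j) - Rsum m s / real n
     = (\<Sum>j<m. lam * real (degU H j) / real n * sv j) + (\<Sum>j<m. e j * sv j)" by simp
  have 1: "bd 1 2 1 (\<Sum>j<m. lam * real (degU H j) / real n * sv j)"
  proof -
    have "bd 1 (1 + 1) (-1 + 2) (\<Sum>j<m. lam * real (degU H j) / real n * sv j)"
    proof (rule bd_sum_weighted[where g = "\<lambda>j. real (degU H j)"])
      fix j assume "j \<in> {..<m}"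
      then have j: "j < m" by simp
      show "bd (real (degU H j)) 1 (-1) (lam * real (degU H j) / real n * sv j)"
        by (rule bd_weak[OF bd_mult[OF bd_div[OF bd_mult[OF bd_lam bd_self[of "real (degU H j)"]] lo_n] bd_s[OF j]]]) auto
    qed (use bd_card_H in \<open>simp add: sum_x\<close>)
    then show ?thesis by (simp add: numeral_2_eq_2)
  qed
  let ?A = "col H l"
  have Am: "?A \<subseteq> {..<m}" using col_sub[OF Hsub] .
  have 2: "bd (1 + y l) 27 1 (\<Sum>j\<in>{..<m} - ?A. e j * sv j)"
  proof -
    have "bd (1 + y l) (26 + 1) (-1 + 2) (\<Sum>j\<in>{..<m} - ?A. e j * sv j)"
    proof (rule bd_sum)
      fix j assume "j \<in> {..<m} - ?A"
      then have j: "j < m" "j \<notin> col H l" by auto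
      have "e j = pr j l - (real (s j) + lam * real (degU H j)) / real n - (real (t l) - lam * real m) / real m"
        using n_pos m_pos by (simp add: e_def field_simps)
      then have "bd (1 + y l) 25 (-2) (e j)" using prob_refined[OF l j] by simp
      from bd_mult[OF this bd_s[OF j(1)]] show "bd (1 + y l) 26 (-1) (e j * sv j)" by simp
    qed (use bd_card[of "{..<m} - ?A"] g1 in auto)
    then show ?thesis by simp
  qed
  have 3: "bd (y l) 5 1 (\<Sum>j\<in>?A. e j * sv j)"
  proof -
    have "bd (real (card ?A)) 5 1 (\<Sum>j\<in>?A. e j * sv j)"
    proof (rule bd_sum_card)
      fix j assume "j \<in> ?A"
      then have j: "j < m" using Am by auto
      have t1: "bd 1 0 0 (real (t l) / real m)" by (rule bd_one) (use tk_le[OF l] m_pos in \<open>auto simp: divide_simps\<close>)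
      have "bd 1 4 0 (e j)" unfolding e_def
        by (rule bd_weak[OF bd_diff[OF bd_diff[OF bd_diff[OF bd_pr t1]
          bd_weak[OF bd_div[OF bd_s[OF j] lo_n], of 1 1 0]] bd_weak[OF bd_div[OF bd_mult[OF bd_lam bd_x[OF j]] lo_n], of 1 1 0]]]) auto
      from bd_mult[OF this bd_s[OF j]] show "bd 1 5 1 (e j * sv j)" by simp
    qed
    then show ?thesis by (simp add: card_colH)
  qed
  have "(\<Sum>j<m. e j * sv j) = (\<Sum>j\<in>{..<m} - ?A. e j * sv j) + (\<Sum>j\<in>?A. e j * sv j)"
    by (rule sum.subset_diff[OF Am]) simp
  then show ?thesis unfolding 0
    by (simp only:, intro bd_weak[OF bd_add[OF bd_weak[OF 1, of "1 + y l" 2 1] bd_add[OF 2 bd_weak[OF 3, of "1 + y l" 5 1]]]])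
      (use g1 y_nonneg[of l] in auto)
qed

text \<open>What remains after \<open>EE_sv\<close> is replacing t l - (t l)^2 / m by its value at t
  l = lam * m; the difference has the factor t l - lam * m of order r.\<close>

lemma EE_TT:
  assumes l: "l < n"
  shows "bd (1 + y l) 31 1 (EE (TT l) - Rsum m s / real n + lam * (1 - lam) * real m)"
proof -
  have "EE (TT l) = EE (\<lambda>G. \<Sum>j\<in>col G l. sv j) - (real (t l) - real (t l) * real (t l) / real m)"
    by (simp add: TT_def[abs_def] EE_diff EE_const)
  then have "EE (TT l) - Rsum m s / real n + lam * (1 - lam) * real m
     = (EE (\<lambda>G. \<Sum>j\<in>col G l. sv j) - Rsum m s / real n) - (real (t l) - lam * real m) * (1 - real (t l) / real m - lam)"
    using m_pos by (simp add: field_simps)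
  also have "bd (1 + y l) 31 1 \<dots>"
  proof -
    have "bd 1 1 0 (1 - real (t l) / real m - lam)"
    proof (rule bd_const)
      have "0 \<le> real (t l) / real m" "real (t l) / real m \<le> 1" using tk_le[OF l] m_pos by auto
      then show "\<bar>1 - real (t l) / real m - lam\<bar> \<le> 16" using lam01 by linarith
    qed
    from bd_weak[OF bd_mult[OF bd_t[OF l] this], of "1 + y l" 2 1]
    have "bd (1 + y l) 2 1 ((real (t l) - lam * real m) * (1 - real (t l) / real m - lam))" using y_nonneg[of l] by simp
    from bd_diff[OF EE_sv[OF l] this] show ?thesis by (rule bd_weak) auto
  qed
  finally show ?thesis .
qed

text \<open>\<open>average_exchange\<close> with X = 1. Unequal row sums raise codegrees by R / n^2.
  Removing the codegree of a column with itself from a fixed total lowers the others by lam * (1 -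
  lam) * m / n. Rows forbidden in both columns add lam^2 each, because the remaining entries have to
  fit in fewer rows.\<close>

lemma mean_codegree:
  assumes kl: "k < n" "l < n" "k \<noteq> l"
  shows "bd (1 + y k + y l) 40 (-1) (EE (zz k l)
    - (Rsum m s / (real n * real n) - lam * (1 - lam) * real m / real n + lam * lam * real (card (col H k \<inter> col H l))))"
proof -
  let ?h = "1 + y k + y l"
  let ?c = "\<lambda>k'. lam * lam * (real (card (col H k \<inter> col H l)) - real (card (col H k' \<inter> col H l)))"
  let ?S = "{..<n} - {k,l}"
  have y0: "0 \<le> y k" "0 \<le> y l" by (rule y_nonneg)+
  have hk: "real (card (col H i \<inter> col H l)) \<le> y l" for i
    using card_mono[of "col H l" "col H i \<inter> col H l"] finite_colH card_colH[of l] by simp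
  have Zb: "bd ?h 5 1 (EE (\<lambda>G. 1 * zz k l G))"
  proof -
    have "bd 1 (Suc 4) 1 (EE (\<lambda>G. 1 * zz k l G))"
      by (rule bd_EE_typ[where b = 1 and j = 2]) (use typ_Z[OF _ kl(3,1,2)] bd_Z[OF _ kl(2)] in auto)
    then show ?thesis by (rule bd_weak) (use y0 in auto)
  qed
  have "bd ?h (Suc (max (32 + 2) 5)) (-1 + 2)
    (real n * EE (\<lambda>G. 1 * zz k l G) - EE (\<lambda>G. 1 * TT l G) - (\<Sum>k'\<in>?S. ?c k'))"
    by (rule average_exchange[OF kl]) (use y0 mean_zz_diff[OF kl(1) _ kl(2)] kl(3) Zb in auto)
  then have A: "bd ?h 35 1 (real n * EE (zz k l) - EE (TT l) - (\<Sum>k'\<in>?S. ?c k'))" by simp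
  have S: "(\<Sum>k'\<in>?S. ?c k') - real n * (lam * lam * real (card (col H k \<inter> col H l)))
      = - (2 * lam * lam * real (card (col H k \<inter> col H l)) + lam * lam * (\<Sum>k'\<in>?S. real (card (col H k' \<inter> col H l))))"
  proof -
    have "card ?S = n - 2" using kl by (simp add: card_Diff_subset)
    moreover have "2 \<le> n" using kl by linarith
    ultimately have cS: "real (card ?S) = real n - 2" by simp
    show ?thesis
      by (simp only: sum_distrib_left[symmetric] sum_subtractf sum_constant cS) (simp add: algebra_simps)
  qed
  have "bd ?h 5 1 (2 * lam * lam * real (card (col H k \<inter> col H l)) + lam * lam * (\<Sum>k'\<in>?S. real (card (col H k' \<inter> col H l))))"
  proof -
    have 1: "bd ?h 1 1 (2 * lam * lam * real (card (col H k \<inter> col H l)))"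
      by (rule bd_weak[OF bd_mult[OF bd_mult[OF bd_mult[OF bd_const[of 2] bd_lam] bd_lam] bd_self[OF y0(2)]]])
        (use hk[of k] y0 in auto)
    \<comment> \<open>Pairs of forbidden entries in a common row are counted from column l: each of
      its y l forbidden rows meets H at most Q * r times.\<close>
    have "(\<Sum>k'\<in>?S. real (card (col H k' \<inter> col H l))) \<le> (\<Sum>k'<n. real (card (col H k' \<inter> col H l)))"
      by (rule sum_mono2) auto
    also have "\<dots> = (\<Sum>k'<n. \<Sum>j\<in>col H l. of_bool (j \<in> col H k'))"
      using finite_colH by (simp add: Int_commute)
    also have "\<dots> = (\<Sum>j\<in>col H l. real (card {k' \<in> {..<n}. j \<in> col H k'}))"
      by (subst sum.swap) (simp add: Int_def)
    also have "\<dots> = (\<Sum>j\<in>col H l. real (degU H j))"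
      by (intro sum.cong refl card_colH_row) (use col_sub[OF Hsub, of l] in auto)
    finally have le: "(\<Sum>k'\<in>?S. real (card (col H k' \<inter> col H l))) \<le> (\<Sum>j\<in>col H l. real (degU H j))" .
    have "bd (real (card (col H l))) 1 1 (\<Sum>j\<in>col H l. real (degU H j))"
      by (rule bd_sum_card) (use bd_x col_sub[OF Hsub, of l] in auto)
    then have "bd (y l) 1 1 (\<Sum>k'\<in>?S. real (card (col H k' \<inter> col H l)))"
      unfolding card_colH by (rule bd_le[rotated]) (use le in \<open>simp add: abs_of_nonneg sum_nonneg\<close>)
    from bd_weak[OF bd_mult[OF bd_mult[OF bd_lam bd_lam] this], of ?h 1 1]
    have 2: "bd ?h 1 1 (lam * lam * (\<Sum>k'\<in>?S. real (card (col H k' \<inter> col H l))))" using y0 by simp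
    show ?thesis by (rule bd_weak[OF bd_add[OF 1 2]]) auto
  qed
  from bd_minus[OF this] have B: "bd ?h 5 1 ((\<Sum>k'\<in>?S. ?c k') - real n * (lam * lam * real (card (col H k \<inter> col H l))))"
    unfolding S .
  have C: "bd ?h 31 1 (EE (TT l) - Rsum m s / real n + lam * (1 - lam) * real m)"
    by (rule bd_weak[OF EE_TT[OF kl(2)]]) (use y0 in auto)
  have "real n * (EE (zz k l) - (Rsum m s / (real n * real n) - lam * (1 - lam) * real m / real n + lam * lam * real (card (col H k \<inter> col H l))))
     = (real n * EE (zz k l) - EE (TT l) - (\<Sum>k'\<in>?S. ?c k'))
       + ((\<Sum>k'\<in>?S. ?c k') - real n * (lam * lam * real (card (col H k \<inter> col H l))))
       + (EE (TT l) - Rsum m s / real n + lam * (1 - lam) * real m)"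
  proof -
    have "real n * (Rsum m s / (real n * real n)) = Rsum m s / real n"
      "real n * (lam * (1 - lam) * real m / real n) = lam * (1 - lam) * real m" using n_pos by simp_all
    then show ?thesis by (simp only: distrib_left right_diff_distrib)
  qed
  also have "bd ?h 40 1 \<dots>"
    by (rule bd_weak[OF bd_add[OF bd_add[OF A B] C]]) auto
  finally show ?thesis using bd_divn by fastforce
qed

end

section \<open>Second moments of codegrees\<close>

context colwin
begin

text \<open>Here X is itself a column sum. Its rows outside the free set are not touched by
  resampling and form the constant part \<open>x0\<close>.\<close>

lemma EE_exchange2:
  assumes kl: "k \<noteq> l" "k < n" "l < n" and K: "k \<notin> K" "l \<notin> K" and dep: "dep K u" "dep K w"
  shows "EE (\<lambda>G. colsum G k (u G) * colsum G k (w G)) - EE (\<lambda>G. colsum G k (u G) * colsum G l (w G))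
    = EE (\<lambda>G. colsum G k (u G) * drift H G k l (w G) + fcov H G k l (u G) (w G))"
proof -
  have "EE (\<lambda>G. colsum G k (u G) * (colsum G k (w G) - colsum G l (w G)))
      = EE (\<lambda>G. colsum G k (u G) * drift H G k l (w G) + fcov H G k l (u G) (w G))"
    unfolding EE_def \<Omega>_def
  proof (rule mean_exchange[OF kl, where ?x0.0 = "\<lambda>G. \<Sum>j\<in>col G k - free H G k l. u G j"])
    fix G S assume G: "G \<in> bip_graphs m n s t H" and S: "S \<subseteq> free H G k l"
    show "w (put H G k l S) = w G" by (rule dep_put[OF dep(2) K])
    show u: "u (put H G k l S) = u G" by (rule dep_put[OF dep(1) K])
    have "finite (col G k)" "finite S"
      using finite_col[OF bip_sub[OF G]] finite_subset[OF S finite_free[OF bip_sub[OF G]]] by auto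
    then show "colsum (put H G k l S) k (u (put H G k l S)) = (\<Sum>j\<in>col G k - free H G k l. u G j) + (\<Sum>j\<in>S. u G j)"
      unfolding colsum_def u col_put_fst[OF S kl(1)] using S by (intro sum.union_disjoint) auto
  qed
  then show ?thesis by (simp only: right_diff_distrib EE_diff)
qed

text \<open>The factor of the sums in \<open>fcov\<close>: twice the covariance factor for sampling
  B out of D rows without replacement.\<close>

definition kap :: "(nat \<times> nat) set \<Rightarrow> nat \<Rightarrow> nat \<Rightarrow> real"
  where "kap G k l = 2 * (real (card (free H G k l \<inter> col G k)) * (real (card (free H G k l)) - real (card (free H G k l \<inter> col G k)))
     / (real (card (free H G k l)) * (real (card (free H G k l)) - 1)))"

lemma fcov_kap: "fcov H G k l u w = kap G k l * ((\<Sum>j\<in>free H G k l. u j * w j)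
    - (\<Sum>j\<in>free H G k l. u j) * ((\<Sum>j\<in>free H G k l. w j) / real (card (free H G k l))))"
  by (simp add: fcov_def kap_def Let_def)

lemma kap_bal:
  fixes k l :: nat
  assumes G: "G \<in> \<Omega>"
  defines "D \<equiv> real (card (free H G k l))"
  shows "kap G k l = (D * D - bal H G k l * bal H G k l) / (2 * (D * (D - 1)))"
proof -
  define B where "B = real (card (free H G k l \<inter> col G k))"
  have b: "bal H G k l = 2 * B - D"
    using card_free_split[OF G[unfolded \<Omega>_def], of k l] unfolding bal_def D_def B_def by linarith
  have "D * D - bal H G k l * bal H G k l = 4 * (B * (D - B))" unfolding b by (simp add: algebra_simps)
  then show ?thesis unfolding kap_def D_def[symmetric] B_def[symmetric] by simp
qed

lemma kap_le: "G \<in> \<Omega> \<Longrightarrow> \<bar>kap G k l\<bar> \<le> 1"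
proof -
  assume G: "G \<in> \<Omega>"
  define D where "D = real (card (free H G k l))"
  define b where "b = bal H G k l"
  have k: "kap G k l = (D * D - b * b) / (2 * (D * (D - 1)))" unfolding D_def b_def by (rule kap_bal[OF G])
  consider "card (free H G k l) = 0" | "card (free H G k l) = 1" | "card (free H G k l) \<ge> 2" by linarith
  then show ?thesis
  proof cases
    case 3
    then have D2: "2 \<le> D" by (simp add: D_def)
    have "\<bar>b\<bar> \<le> D" using bal_ratio_le[OF G, of k l] D2 unfolding D_def[symmetric] b_def[symmetric] by (simp add: divide_simps)
    then have bb: "0 \<le> b * b" "b * b \<le> D * D" using abs_le_square_iff[of b D] D2 by (auto simp: power2_eq_square)
    have "2 * D \<le> D * D" using D2 by (intro mult_right_mono) auto
    then have "D * D - b * b \<le> 2 * (D * (D - 1))" using bb unfolding right_diff_distrib mult_1_right by linarith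
    then show ?thesis unfolding k using bb D2 by (simp add: abs_of_nonneg divide_le_eq_1)
  qed (simp_all add: k D_def)
qed

text \<open>With B = (D + bal) / 2 the factor is (D^2 - bal^2) / (2 * D * (D - 1)). Since
  \<open>bal\<close> has order r and D order r^2, it deviates from 1 / 2 by D - bal^2 of order r^2
  over order r^4.\<close>

lemma typ_kap:
  assumes G: "typical G" and kl: "k \<noteq> l" "k < n" "l < n"
  shows "bd 1 14 (-2) (kap G k l - 1 / 2)"
proof -
  define D where "D = real (card (free H G k l))"
  define b where "b = bal H G k l"
  have D: "lo 4 2 D" unfolding D_def by (rule typ_D(2)[OF G kl])
  have D1: "lo 5 2 (D - 1)"
    using lo_approx[OF D, of 0 0 "D - 1"] bd_one[of "- 1"] by (simp add: numeral_eq_Suc)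
  have "kap G k l - 1 / 2 = (D - b * b) / (2 * (D * (D - 1)))"
    unfolding kap_bal[OF typ_\<Omega>[OF G]] D_def[symmetric] b_def[symmetric]
    using lo_pos[OF D] lo_pos[OF D1] by (simp add: divide_simps) (simp add: algebra_simps)
  also have "bd 1 14 (-2) \<dots>"
  proof -
    have "lo 9 4 (2 * (D * (D - 1)))"
      by (rule lo_weak[OF lo_mult[OF D D1]]) (use lo_pos[OF D] lo_pos[OF D1] in auto)
    moreover have "bd 1 5 2 (D - b * b)"
      unfolding D_def b_def
      by (rule bd_weak[OF bd_diff[OF bd_free[OF typ_\<Omega>[OF G]] bd_mult[OF bd_bal[OF typ_\<Omega>[OF G] kl] bd_bal[OF typ_\<Omega>[OF G] kl], simplified]]]) auto
    ultimately show ?thesis using bd_div[of 1 5 2 _ 9 4] by simp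
  qed
  finally show ?thesis .
qed

lemma bnd_bd:
  assumes G: "G \<in> \<Omega>" and kl: "k < n" "k' < n" "l < n"
  shows "bd (1 + y k + y k') 0 0 (bnd H G k k' (cw l G))" and "bd 1 2 1 (bnd H G k k' (cw l G))"
proof -
  have b: "\<bar>bnd H G k k' (cw l G)\<bar> \<le> 1 * (y k + y k')"
    by (rule bnd_abs[OF G cw_le[OF kl(3)]]) simp
  have y0: "0 \<le> y k" "0 \<le> y k'" by (rule y_nonneg)+
  show "bd (1 + y k + y k') 0 0 (bnd H G k k' (cw l G))" by (rule bd_self) (use b y0 in auto)
  have "\<bar>bnd H G k k' (cw l G)\<bar> \<le> \<bar>y k + y k'\<bar>" using b y0 by simp
  then show "bd 1 2 1 (bnd H G k k' (cw l G))"
    by (rule bd_le[OF _ bd_weak[OF bd_add[OF bd_y[OF kl(1)] bd_y[OF kl(2)]]]]) auto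
qed

lemma typ_drift:
  assumes G: "typical G" and kl: "k < n" "k' < n" "l < n" "k \<noteq> k'" "k \<noteq> l" "k' \<noteq> l"
  shows "bd (1 + y k + y k') 11 0 (drift H G k k' (cw l G))"
proof -
  have y0: "0 \<le> y k" "0 \<le> y k'" by (rule y_nonneg)+
  have "bd (1 + y k + y k') 10 0 (bal H G k k' / real (card (free H G k k')) * (\<Sum>j\<in>free H G k k'. cw l G j))"
    by (rule bd_weak[OF bd_mult[OF typ_bal[OF G kl(4,1,2)] typ_U[OF G kl(3,1,2)]]]) (use kl y0 in auto)
  from bd_add[OF bnd_bd(1)[OF typ_\<Omega>[OF G] kl(1-3)] this] show ?thesis unfolding drift_def by (rule bd_weak) auto
qed

lemma bd_drift:
  assumes G: "G \<in> \<Omega>" and kl: "k < n" "k' < n" "l < n" "k \<noteq> k'"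
  shows "bd 1 3 1 (drift H G k k' (cw l G))"
proof -
  have "\<bar>bal H G k k' / real (card (free H G k k')) * (\<Sum>j\<in>free H G k k'. cw l G j)\<bar> \<le> \<bar>bal H G k k'\<bar> * 1"
    by (rule drift_ratio_abs[OF G cw_le[OF kl(3)]]) simp
  then have "bd 1 2 1 (bal H G k k' / real (card (free H G k k')) * (\<Sum>j\<in>free H G k k'. cw l G j))"
    by (intro bd_le[OF _ bd_bal[OF G kl(4,1,2)]]) simp
  from bd_add[OF bnd_bd(2)[OF G kl(1-3)] this] show ?thesis unfolding drift_def by (rule bd_weak) auto
qed

lemma bd_fcov:
  assumes G: "G \<in> \<Omega>" and l: "l < n" and u: "\<And>j. \<bar>u j\<bar> \<le> 1" and h: "\<bar>\<Sum>j\<in>free H G k k'. \<bar>u j\<bar>\<bar> \<le> h"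
  shows "\<bar>fcov H G k k' u (cw l G)\<bar> \<le> 2 * h"
proof -
  let ?F = "free H G k k'"
  have "\<bar>\<Sum>j\<in>?F. u j * cw l G j\<bar> \<le> (\<Sum>j\<in>?F. \<bar>u j\<bar> * 1)"
    using cw_le[OF l] by (intro order_trans[OF sum_abs] sum_mono) (auto simp: abs_mult intro!: mult_left_le)
  then have 1: "\<bar>\<Sum>j\<in>?F. u j * cw l G j\<bar> \<le> h" using h by simp
  have "\<bar>(\<Sum>j\<in>?F. u j) * ((\<Sum>j\<in>?F. cw l G j) / real (card ?F))\<bar> \<le> \<bar>\<Sum>j\<in>?F. u j\<bar> * 1"
    unfolding abs_mult by (rule mult_left_mono[OF ratio_U_le[OF G l]]) simp
  also have "\<bar>\<Sum>j\<in>?F. u j\<bar> \<le> h" using sum_abs[of u ?F] h by linarith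
  finally have 2: "\<bar>(\<Sum>j\<in>?F. u j) * ((\<Sum>j\<in>?F. cw l G j) / real (card ?F))\<bar> \<le> h" by simp
  have "\<bar>fcov H G k k' u (cw l G)\<bar> \<le> 1 * (2 * h)"
    unfolding fcov_kap abs_mult
  proof (rule mult_mono[OF kap_le[OF G]])
    show "\<bar>(\<Sum>j\<in>?F. u j * cw l G j) - (\<Sum>j\<in>?F. u j) * ((\<Sum>j\<in>?F. cw l G j) / real (card ?F))\<bar> \<le> 2 * h"
      using 1 2 by linarith
  qed auto
  then show ?thesis by simp
qed

text \<open>On the free set the squares of \<open>cw l\<close> average to lam * (1 - lam), the
  variance of one entry, and the set has size about 2 * lam * (1 - lam) * m. The factor
  \<open>kap\<close>, near 1 / 2, removes the 2. The square of the total U is divided by D and is of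
  bounded order.\<close>

lemma typ_fcov_cw:
  assumes G: "typical G" and kl: "k < n" "k' < n" "l < n" "k \<noteq> k'" "k \<noteq> l" "k' \<noteq> l"
  defines "c \<equiv> (lam * (1 - lam))\<^sup>2 * real m"
  shows "bd 1 29 1 (fcov H G k k' (cw l G) (cw l G) - c)"
proof -
  note G' = typ_\<Omega>[OF G]
  define F where "F = free H G k k'"
  define D where "D = real (card F)"
  define U where "U = (\<Sum>j\<in>F. cw l G j)"
  define \<tau> where "\<tau> = real (t l) / real m"
  define q where "q = real (card (F \<inter> col G l))"
  define S where "S = (\<Sum>j\<in>F. cw l G j * cw l G j) - U * (U / D)"
  have fF: "finite F" unfolding F_def by (rule \<Omega>_fin_free[OF G'])
  have lD: "lo 4 2 D" and dD: "bd 1 8 1 (D - dd)" and D1: "bd 1 1 2 D"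
    unfolding D_def F_def using typ_D[OF G kl(4,1,2)] bd_free[OF G'] by auto
  have U: "bd 1 4 1 U" unfolding U_def F_def by (rule typ_U[OF G kl(3,1,2)]) (use kl in auto)
  have q: "bd 1 3 1 (q - lam * D)"
    unfolding q_def D_def F_def by (rule typical_free[OF G kl(3,1,2)]) (use kl in auto)
  have tau: "bd 1 2 (-1) (\<tau> - lam)" unfolding \<tau>_def by (rule bd_t_div[OF kl(3)])
  have tau01: "0 \<le> \<tau>" "\<tau> \<le> 1" using tk_le[OF kl(3)] m_pos by (auto simp: \<tau>_def)
  have ss: "(\<Sum>j\<in>F. cw l G j * cw l G j) = q * (1 - 2 * \<tau>) + D * (\<tau> * \<tau>)"
  proof -
    have "(\<Sum>j\<in>F. cw l G j * cw l G j) = (\<Sum>j\<in>F. of_bool (j \<in> col G l) * (1 - 2 * \<tau>) + \<tau> * \<tau>)"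
      by (intro sum.cong refl) (simp add: cw_def \<tau>_def of_bool_def algebra_simps)
    then show ?thesis using fF by (simp add: sum.distrib sum_distrib_right[symmetric] q_def D_def)
  qed
  have "S - 2 * c = (q - lam * D) * (1 - 2 * \<tau>) + D * ((\<tau> - lam) * (\<tau> - lam)) + lam * (1 - lam) * (D - dd) - U * (U / D)"
    unfolding S_def ss c_def dd_def by (simp add: algebra_simps power2_eq_square)
  also have "bd 1 13 1 \<dots>"
  proof -
    have 1: "bd 1 3 1 ((q - lam * D) * (1 - 2 * \<tau>))"
      using bd_mult[OF q bd_one[of "1 - 2 * \<tau>"]] tau01 by (simp add: abs_le_iff)
    have 2: "bd 1 5 1 (D * ((\<tau> - lam) * (\<tau> - lam)))"
      by (rule bd_weak[OF bd_mult[OF D1 bd_mult[OF tau tau]]]) auto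
    have "\<bar>lam * (1 - lam)\<bar> \<le> 1" using lam01 by (simp add: abs_mult mult_le_one)
    from bd_mult[OF bd_one[OF this] dD] have 3: "bd 1 8 1 (lam * (1 - lam) * (D - dd))" by simp
    have 4: "bd 1 12 1 (U * (U / D))"
      by (rule bd_weak[OF bd_mult[OF U bd_div[OF U lD]]]) auto
    show ?thesis by (rule bd_weak[OF bd_diff[OF bd_add[OF bd_add[OF 1 2] 3] 4]]) auto
  qed
  finally have S1: "bd 1 13 1 (S - 2 * c)" .
  have c1: "bd 1 1 2 c"
  proof (rule bd_le[OF _ bd_m])
    have "\<bar>lam * (1 - lam)\<bar> \<le> 1" using lam01 by (simp add: abs_mult mult_le_one)
    then have "(lam * (1 - lam))\<^sup>2 \<le> 1" by (simp add: abs_square_le_1)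
    then show "\<bar>c\<bar> \<le> \<bar>real m\<bar>" unfolding c_def by (simp add: abs_mult mult_left_le_one_le)
  qed
  have c2: "bd 1 2 2 (2 * c)" using bd_mult[OF bd_const[of 2] c1] by (simp add: numeral_2_eq_2)
  have S2: "bd 1 14 2 S"
    using bd_weak[OF bd_add[OF bd_weak[OF S1, of 1 13 2] c2], of 1 14 2] by simp
  have "fcov H G k k' (cw l G) (cw l G) = kap G k k' * S"
    unfolding fcov_kap S_def U_def D_def F_def ..
  then have "fcov H G k k' (cw l G) (cw l G) - c = (kap G k k' - 1 / 2) * S + 1 / 2 * (S - 2 * c)"
    by (simp add: algebra_simps)
  also have "bd 1 29 1 \<dots>"
  proof -
    have 1: "bd 1 28 1 ((kap G k k' - 1 / 2) * S)"
      by (rule bd_weak[OF bd_mult[OF typ_kap[OF G kl(4,1,2)] S2]]) auto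
    have 2: "bd 1 13 1 (1 / 2 * (S - 2 * c))"
      by (rule bd_weak[OF bd_mult[OF bd_one S1]]) auto
    show ?thesis by (rule bd_weak[OF bd_add[OF 1 2]]) auto
  qed
  finally show ?thesis .
qed

lemma EE_zz_sq_exchange:
  assumes kl: "k < n" "k' < n" "l < n" "k \<noteq> k'" "k \<noteq> l" "k' \<noteq> l"
  shows "bd ((1 + y k) * (1 + y k')) 31 1 (EE (\<lambda>G. zz k l G * zz k l G) - EE (\<lambda>G. zz k l G * zz k' l G) - (lam * (1 - lam))\<^sup>2 * real m)"
proof -
  let ?c = "(lam * (1 - lam))\<^sup>2 * real m" and ?h = "1 + y k + y k'"
  have y0: "0 \<le> y k" "0 \<le> y k'" by (rule y_nonneg)+
  have "EE (\<lambda>G. zz k l G * zz k l G) - EE (\<lambda>G. zz k l G * zz k' l G)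
     = EE (\<lambda>G. zz k l G * drift H G k k' (cw l G) + fcov H G k k' (cw l G) (cw l G))"
    by (rule EE_exchange2[OF kl(4,1,2) _ _ dep_cw dep_cw]) (use kl in auto)
  then have "EE (\<lambda>G. zz k l G * zz k l G) - EE (\<lambda>G. zz k l G * zz k' l G) - ?c
     = EE (\<lambda>G. zz k l G * drift H G k k' (cw l G) + (fcov H G k k' (cw l G) (cw l G) - ?c))"
    by (simp add: EE_add EE_diff EE_const)
  also have "bd ?h (Suc 30) 1 \<dots>"
  proof (rule bd_EE_typ[where b = 6 and j = 3])
    fix G
    {
      assume G: "typical G"
      have 1: "bd ?h 15 1 (zz k l G * drift H G k k' (cw l G))"
        using bd_mult[OF typ_Z[OF G kl(5,1,3)] typ_drift[OF G kl]] by simp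
      have 2: "bd ?h 29 1 (fcov H G k k' (cw l G) (cw l G) - ?c)"
        by (rule bd_weak[OF typ_fcov_cw[OF G kl]]) (use y0 in auto)
      show "bd ?h 30 1 (zz k l G * drift H G k k' (cw l G) + (fcov H G k k' (cw l G) (cw l G) - ?c))"
        by (rule bd_weak[OF bd_add[OF 1 2]]) auto
    next
      assume G: "G \<in> \<Omega>"
      have 1: "bd 1 4 3 (zz k l G * drift H G k k' (cw l G))"
        using bd_mult[OF bd_Z[OF G kl(3)] bd_drift[OF G kl(1-4)]] by simp
      have "\<bar>\<Sum>j\<in>free H G k k'. \<bar>cw l G j\<bar>\<bar> \<le> real (card (free H G k k')) * 1"
        by (rule abs_sum_le) (use cw_le[OF kl(3)] in auto)
      also have "\<dots> \<le> real m" using card_free_le[OF G, of k k'] by simp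
      finally have "\<bar>fcov H G k k' (cw l G) (cw l G)\<bar> \<le> 2 * real m"
        by (rule bd_fcov[OF G kl(3) cw_le[OF kl(3)]])
      then have f: "\<bar>fcov H G k k' (cw l G) (cw l G)\<bar> \<le> \<bar>2 * real m\<bar>" by simp
      have 2: "bd 1 2 3 (fcov H G k k' (cw l G) (cw l G))"
        by (rule bd_weak[OF bd_le[OF f bd_mult[OF bd_const[of 2] bd_m]]]) auto
      have "\<bar>lam * (1 - lam)\<bar> \<le> 1" using lam01 by (simp add: abs_mult mult_le_one)
      then have "(lam * (1 - lam))\<^sup>2 \<le> 1" by (simp add: abs_square_le_1)
      then have "\<bar>?c\<bar> \<le> \<bar>real m\<bar>" by (simp add: abs_mult mult_left_le_one_le)
      from bd_weak[OF bd_le[OF this bd_m], of 1 1 3] have 3: "bd 1 1 3 ?c" by simp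
      show "bd 1 6 3 (zz k l G * drift H G k k' (cw l G) + (fcov H G k k' (cw l G) (cw l G) - ?c))"
        by (rule bd_weak[OF bd_add[OF 1 bd_diff[OF 2 3]]]) auto
    }
  qed (use y0 in auto)
  finally show ?thesis by (rule bd_weak) (use y_prod_le in auto)
qed

text \<open>Each of the n - 2 exchanges changes the second moment by the same main term. The mean of
  \<open>zz k l G * TT l G\<close> is only of order r^3, so after division by n it is within the
  error r.\<close>

lemma var_codegree:
  assumes kl: "k < n" "l < n" "k \<noteq> l"
  shows "bd (1 + y k) 37 1 (EE (\<lambda>G. zz k l G * zz k l G) - (lam * (1 - lam))\<^sup>2 * real m)"
proof -
  let ?c = "(lam * (1 - lam))\<^sup>2 * real m" and ?h = "1 + y k"
  let ?S = "{..<n} - {k,l}"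
  have h1: "1 \<le> ?h" by (rule one_le_1y)
  have "bd ?h (Suc 8) 3 (EE (\<lambda>G. zz k l G * zz k l G))"
  proof (rule bd_EE_typ[where b = 2 and j = 4])
    show "bd ?h 8 3 (zz k l G * zz k l G)" if "typical G" for G
      by (rule bd_weak[OF bd_mult[OF typ_Z[OF that kl(3,1,2)] typ_Z[OF that kl(3,1,2)]]]) (use h1 in auto)
    show "bd 1 2 4 (zz k l G * zz k l G)" if "G \<in> \<Omega>" for G
      using bd_mult[OF bd_Z[OF that kl(2)] bd_Z[OF that kl(2)]] by (simp add: numeral_2_eq_2)
  qed (use h1 in auto)
  then have X: "bd ?h 9 (1 + 2) (EE (\<lambda>G. zz k l G * zz k l G))" by simp
  have A: "bd ?h (Suc (max (31 + 2) 9)) (1 + 2)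
    (real n * EE (\<lambda>G. zz k l G * zz k l G) - EE (\<lambda>G. zz k l G * TT l G) - (\<Sum>k'\<in>?S. ?c))"
    by (rule average_exchange[OF kl _ _ X]) (use h1 EE_zz_sq_exchange[OF kl(1) _ kl(2)] kl(3) in auto)
  have "bd 1 (Suc 9) 3 (EE (\<lambda>G. zz k l G * TT l G))"
  proof (rule bd_EE_typ[where b = 4 and j = 5])
    show "bd 1 9 3 (zz k l G * TT l G)" if "typical G" for G
      using bd_mult[OF typ_Z[OF that kl(3,1,2)] typ_TT[OF that kl(2)]] by simp
    show "bd 1 4 5 (zz k l G * TT l G)" if "G \<in> \<Omega>" for G
      using bd_mult[OF bd_Z[OF that kl(2)] bd_TT[OF that kl(2)]] by simp
  qed auto
  then have B: "bd ?h 10 (1 + 2) (EE (\<lambda>G. zz k l G * TT l G))" by (rule bd_weak) (use h1 in auto)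
  have C: "bd ?h 2 (1 + 2) (2 * ?c)"
  proof -
    have "\<bar>lam * (1 - lam)\<bar> \<le> 1" using lam01 by (simp add: abs_mult mult_le_one)
    then have "(lam * (1 - lam))\<^sup>2 \<le> 1" by (simp add: abs_square_le_1)
    then have "\<bar>?c\<bar> \<le> \<bar>real m\<bar>" by (simp add: abs_mult mult_left_le_one_le)
    from bd_weak[OF bd_mult[OF bd_const[of 2] bd_le[OF this bd_m]], of ?h 2 3] show ?thesis using h1 by simp
  qed
  have "card ?S = n - 2" using kl by (simp add: card_Diff_subset)
  moreover have "2 \<le> n" using kl by linarith
  ultimately have cS: "real (card ?S) = real n - 2" by simp
  have "real n * (EE (\<lambda>G. zz k l G * zz k l G) - ?c)
    = (real n * EE (\<lambda>G. zz k l G * zz k l G) - EE (\<lambda>G. zz k l G * TT l G) - (\<Sum>k'\<in>?S. ?c)) + EE (\<lambda>G. zz k l G * TT l G) - 2 * ?c"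
    unfolding sum_constant cS by (simp add: algebra_simps)
  also have "bd ?h 37 (1 + 2) \<dots>"
    by (rule bd_weak[OF bd_diff[OF bd_add[OF A B] C]]) auto
  finally show ?thesis using bd_divn[of ?h 37 "1 + 2"] by simp
qed

text \<open>Multiplying typical sizes gives only y l times r. The exchange argument with the
  boundary count as X removes the factor r, because the covariance comes from the y l rows that are
  forbidden in column l.\<close>

lemma cov_boundary:
  assumes kl: "k < n" "l < n" "k \<noteq> l"
  shows "bd ((1 + y l) * (1 + y k)) 19 0 (EE (\<lambda>G. real (card (col G k \<inter> col H l)) * zz k l G))"
proof -
  let ?u = "\<lambda>(G::(nat\<times>nat) set) j. of_bool (j \<in> col H l) :: real"
  let ?X = "\<lambda>G. colsum G k (?u G)"
  have y0: "0 \<le> y k" "0 \<le> y l" by (rule y_nonneg)+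
  have Xe: "?X G = real (card (col G k \<inter> col H l))" if "G \<in> \<Omega>" for G
    unfolding colsum_def using \<Omega>_fin_col[OF that] by simp
  have X1: "bd (1 + y l) 0 0 (?X G)" "bd 1 1 1 (?X G)" if "G \<in> \<Omega>" for G
    unfolding Xe[OF that] using gk_le[of G k l] y0 bd_gk[OF kl(2)] by (auto intro!: bd_self)
  have du: "dep {l} ?u" by (simp add: dep_def)
  have ex: "bd ((1 + y l) * (1 + y k) * (1 + y k')) 14 0 (EE (\<lambda>G. ?X G * zz k l G) - EE (\<lambda>G. ?X G * zz k' l G) - 0)"
    if "k' \<in> {..<n} - {k,l}" for k'
  proof -
    have k': "k' < n" "k \<noteq> k'" "k' \<noteq> l" using that by auto
    let ?h = "1 + y k + y k'"
    have y1: "0 \<le> y k'" by (rule y_nonneg)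
    have h1: "1 \<le> (1 + y l) * ?h" "1 + y l \<le> (1 + y l) * ?h"
      using y0 y1 mult_mono[of 1 "1 + y l" 1 ?h] mult_left_mono[of 1 ?h "1 + y l"] by auto
    have "EE (\<lambda>G. ?X G * zz k l G) - EE (\<lambda>G. ?X G * zz k' l G)
       = EE (\<lambda>G. ?X G * drift H G k k' (cw l G) + fcov H G k k' (?u G) (cw l G))"
      by (rule EE_exchange2[OF k'(2) kl(1) k'(1) _ _ du dep_cw]) (use kl k' in auto)
    also have "bd ((1 + y l) * ?h) (Suc 12) 0 \<dots>"
    proof (rule bd_EE_typ[where b = 6 and j = 2])
      fix G
      have f: "bd (1 + y l) 1 0 (fcov H G k k' (?u G) (cw l G))" "bd 1 2 2 (fcov H G k k' (?u G) (cw l G))" if G: "G \<in> \<Omega>"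
      proof -
        have "\<bar>\<Sum>j\<in>free H G k k'. \<bar>?u G j\<bar>\<bar> \<le> y l"
          using card_mono[of "col H l" "free H G k k' \<inter> col H l"] finite_colH \<Omega>_fin_free[OF G] card_colH[of l] by simp
        then have a: "\<bar>fcov H G k k' (?u G) (cw l G)\<bar> \<le> 2 * y l"
          by (intro bd_fcov[OF G kl(2)]) auto
        then have "\<bar>fcov H G k k' (?u G) (cw l G)\<bar> \<le> \<bar>2 * (1 + y l)\<bar>" using y0 by simp
        from bd_le[OF this bd_mult[OF bd_const[of 2] bd_self[of "1 + y l" "1 + y l"]]]
        show "bd (1 + y l) 1 0 (fcov H G k k' (?u G) (cw l G))" using y0 by simp
        have "\<bar>fcov H G k k' (?u G) (cw l G)\<bar> \<le> \<bar>2 * y l\<bar>" using y0 a by simp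
        from bd_le[OF this bd_mult[OF bd_const[of 2] bd_y[OF kl(2)]]]
        show "bd 1 2 2 (fcov H G k k' (?u G) (cw l G))" by (rule bd_weak) auto
      qed
      {
        assume G: "typical G"
        have 1: "bd ((1 + y l) * ?h) 11 0 (?X G * drift H G k k' (cw l G))"
          using bd_mult[OF X1(1)[OF typ_\<Omega>[OF G]] typ_drift[OF G kl(1) k'(1) kl(2) k'(2) kl(3) k'(3)]] by simp
        show "bd ((1 + y l) * ?h) 12 0 (?X G * drift H G k k' (cw l G) + fcov H G k k' (?u G) (cw l G))"
          by (rule bd_weak[OF bd_add[OF 1 bd_weak[OF f(1)[OF typ_\<Omega>[OF G]] h1(2), of 11 0]]]) auto
      next
        assume G: "G \<in> \<Omega>"
        have 1: "bd 1 4 2 (?X G * drift H G k k' (cw l G))"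
          using bd_mult[OF X1(2)[OF G] bd_drift[OF G kl(1) k'(1) kl(2) k'(2)]] by simp
        show "bd 1 6 2 (?X G * drift H G k k' (cw l G) + fcov H G k k' (?u G) (cw l G))"
          by (rule bd_weak[OF bd_add[OF 1 f(2)[OF G]]]) auto
      }
    qed (use h1 in auto)
    finally have "bd ((1 + y l) * ?h) (Suc 12) 0 (EE (\<lambda>G. ?X G * zz k l G) - EE (\<lambda>G. ?X G * zz k' l G))" .
    then have "bd ((1 + y l) * ((1 + y k) * (1 + y k'))) 14 0 (EE (\<lambda>G. ?X G * zz k l G) - EE (\<lambda>G. ?X G * zz k' l G))"
      by (rule bd_weak) (use y0 y_prod_le[of k k'] in \<open>auto intro!: mult_left_mono\<close>)
    then show ?thesis by (simp add: mult.assoc)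
  qed
  let ?h = "(1 + y l) * (1 + y k)"
  have h1: "1 + y l \<le> ?h" "0 \<le> ?h" using y0 mult_left_mono[of 1 "1 + y k" "1 + y l"] by auto
  have "bd (1 + y l) (Suc 4) 1 (EE (\<lambda>G. ?X G * zz k l G))"
  proof (rule bd_EE_typ[where b = 2 and j = 3])
    show "bd (1 + y l) 4 1 (?X G * zz k l G)" if "typical G" for G
      using bd_mult[OF X1(1)[OF typ_\<Omega>[OF that]] typ_Z[OF that kl(3,1,2)]] by simp
    show "bd 1 2 3 (?X G * zz k l G)" if "G \<in> \<Omega>" for G
      using bd_mult[OF X1(2)[OF that] bd_Z[OF that kl(2)]] by (simp add: numeral_2_eq_2)
  qed (use y0 in auto)
  then have X: "bd ?h 5 (0 + 2) (EE (\<lambda>G. ?X G * zz k l G))" by (rule bd_weak) (use h1 in auto)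
  have A: "bd ?h (Suc (max (14 + 2) 5)) (0 + 2)
    (real n * EE (\<lambda>G. ?X G * zz k l G) - EE (\<lambda>G. ?X G * TT l G) - (\<Sum>k'\<in>{..<n} - {k,l}. 0))"
    by (rule average_exchange[OF kl h1(2) ex X])
  have "bd (1 + y l) (Suc 5) 2 (EE (\<lambda>G. ?X G * TT l G))"
  proof (rule bd_EE_typ[where b = 4 and j = 4])
    show "bd (1 + y l) 5 2 (?X G * TT l G)" if "typical G" for G
      using bd_mult[OF X1(1)[OF typ_\<Omega>[OF that]] typ_TT[OF that kl(2)]] by simp
    show "bd 1 4 4 (?X G * TT l G)" if "G \<in> \<Omega>" for G
      using bd_mult[OF X1(2)[OF that] bd_TT[OF that kl(2)]] by simp
  qed (use y0 in auto)
  then have B: "bd ?h 6 (0 + 2) (EE (\<lambda>G. ?X G * TT l G))" by (rule bd_weak) (use h1 in auto)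
  have "real n * EE (\<lambda>G. ?X G * zz k l G)
     = (real n * EE (\<lambda>G. ?X G * zz k l G) - EE (\<lambda>G. ?X G * TT l G) - (\<Sum>k'\<in>{..<n} - {k,l}. 0)) + EE (\<lambda>G. ?X G * TT l G)"
    by simp
  also have "bd ?h 19 (0 + 2) \<dots>" by (rule bd_weak[OF bd_add[OF A B]]) auto
  finally have "bd ?h 19 0 (EE (\<lambda>G. ?X G * zz k l G))" using bd_divn[of ?h 19 "0 + 2"] by simp
  moreover have "EE (\<lambda>G. ?X G * zz k l G) = EE (\<lambda>G. real (card (col G k \<inter> col H l)) * zz k l G)"
    by (rule EE_cong) (simp add: Xe)
  ultimately show ?thesis by simp
qed

end

section \<open>The effect of moving one unit between two column sums\<close>

text \<open>Column l gives an entry to column k. The giving column is assumed to have few forbidden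
  entries, so that factors 1 + y l become powers of Q and only 1 + y k survives as a weight.\<close>

locale switch = colwin +
  fixes k l :: nat
  assumes k_n: "k < n" and l_n: "l < n" and kl: "k \<noteq> l" and yl: "y l \<le> Q ^ 2"
begin

definition tk :: real where "tk = real (t k)"
definition tl :: real where "tl = real (t l)"
text \<open>The numerator of \<open>f\<close> exceeds its denominator by p plus a difference of
  boundary counts; the -1 belongs to the moved entry.\<close>

definition p :: real where "p = tl - tk - 1"
definition a0 :: real where "a0 = lam * (1 - lam) * real m"
text \<open>The denominator of \<open>f\<close> is exactly b0 - (z G + gk G), see
  \<open>B_eq\<close>; \<open>a0\<close> is its leading approximation.\<close>

definition b0 :: real where "b0 = tk + 1 - tk * tl / real m"
definition hh :: real where "hh = real (card (col H k \<inter> col H l))"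
definition dlt :: "nat \<Rightarrow> real" where "dlt j = sv j + lam * real (degU H j)"
definition DD :: real where "DD = (\<Sum>j\<in>col H l. dlt j) - (\<Sum>j\<in>col H k. dlt j)"
text \<open>Equals -(a0 / n) * (1 - R / AA) with \<open>AA\<close> = a0 * n and R =
  \<open>Rsum m s\<close>. It is the mean centred codegree apart from forbidden rows, and it links
  codegrees to the first factor in the exponent.\<close>

definition S1 :: real where "S1 = Rsum m s / (real n * real n) - a0 / real n"

definition gk :: "(nat \<times> nat) set \<Rightarrow> real" where "gk G = real (card (col G k \<inter> col H l))"
definition gl :: "(nat \<times> nat) set \<Rightarrow> real" where "gl G = real (card (col G l \<inter> col H k))"
definition z :: "(nat \<times> nat) set \<Rightarrow> real" where "z G = zz k l G"
text \<open>The summand in \<open>switch_count\<close>: its mean is the ratio of the graph counts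
  after and before the move, up to graphs without a free entry in column k.\<close>

definition f :: "(nat \<times> nat) set \<Rightarrow> real" where
  "f G = real (card (free H G k l \<inter> col G l)) / (real (card (free H G k l \<inter> col G k)) + 1)"

lemma y0: "0 \<le> y k" "0 \<le> y l" "1 \<le> 1 + y k" by (simp_all add: y_nonneg)

lemma bd_yl: "bd 1 2 0 (y l)" using yl y0 by (simp add: bd_def)

lemma bd_absorb: "bd ((1 + y l) * g) a i x \<Longrightarrow> bd g (a + 3) i x"
proof -
  assume a: "bd ((1 + y l) * g) a i x"
  have "0 \<le> (1 + y l) * g" by (rule bd_nonneg[OF a])
  then have g: "0 \<le> g" using y0 by (simp add: zero_le_mult_iff)
  have "1 \<le> Q ^ 2" using Qpos by (intro one_le_power) auto
  then have "1 + y l \<le> 2 * Q ^ 2" using yl by linarith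
  also have "\<dots> \<le> Q * Q ^ 2" using Qpos by (intro mult_right_mono) auto
  finally have "1 + y l \<le> Q ^ 3" by (simp add: power3_eq_cube power2_eq_square mult_ac)
  then have "Q ^ a * r powi i * ((1 + y l) * g) \<le> Q ^ a * r powi i * (Q ^ 3 * g)"
    using Qpos r_pos g by (intro mult_left_mono mult_right_mono) auto
  then show ?thesis using a by (simp add: bd_def power_add mult_ac)
qed

lemma bd_y1: "bd 1 a i x \<Longrightarrow> bd (1 + y k) a i x" by (rule bd_weak) (use y0 in auto)

lemma lo_a0: "lo 3 2 a0"
  using lo_mult[OF lo_mult[OF lo_lam lo_lam1] lo_m] by (simp add: a0_def numeral_eq_Suc)

lemma bd_a0: "bd 1 1 2 a0"
proof -
  have "\<bar>lam * (1 - lam)\<bar> \<le> 1" using lam01 by (simp add: abs_mult mult_le_one)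
  from bd_mult[OF bd_one[OF this] bd_m] show ?thesis by (simp add: a0_def)
qed

lemma tau01: "0 \<le> tl / real m" "tl / real m \<le> 1" "0 \<le> tk / real m" "tk / real m \<le> 1"
  using tk_le[OF k_n] tk_le[OF l_n] m_pos by (auto simp: tk_def tl_def)

lemma bd_tau: "bd 1 2 (-1) (tk / real m - lam)" "bd 1 2 (-1) (tl / real m - lam)"
  unfolding tk_def tl_def by (rule bd_t_div[OF k_n], rule bd_t_div[OF l_n])

lemma bd_minv: "bd 1 1 (-2) (1 / real m)" using bd_div[OF bd_one[of 1] lo_m] by simp

lemma b0_a0: "bd 1 5 1 (b0 - a0)"
proof -
  have "b0 - a0 = (tk - lam * real m) * (1 - tl / real m) - lam * (real m * (tl / real m - lam)) + 1"
    using m_pos by (simp add: b0_def a0_def field_simps)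
  also have "bd 1 5 1 \<dots>"
  proof -
    have 1: "bd 1 1 1 ((tk - lam * real m) * (1 - tl / real m))"
      by (rule bd_weak[OF bd_mult[OF bd_t[OF k_n] bd_one[of "1 - tl / real m"]], folded tk_def]) (use tau01 in auto)
    have 2: "bd 1 3 1 (lam * (real m * (tl / real m - lam)))"
      by (rule bd_weak[OF bd_mult[OF bd_lam bd_mult[OF bd_m bd_tau(2)]]]) auto
    have 3: "bd 1 0 1 (1::real)" by (rule bd_weak[OF bd_one]) auto
    show ?thesis by (rule bd_weak[OF bd_add[OF bd_diff[OF 1 2] 3]]) auto
  qed
  finally show ?thesis .
qed

lemma lo_b0: "lo 4 2 b0" using lo_approx[OF lo_a0 b0_a0] by (simp add: numeral_eq_Suc)

lemma pos: "0 < a0" "0 < b0" "0 < real m" "0 < real n"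
  using lo_pos[OF lo_a0] lo_pos[OF lo_b0] m_pos n_pos by auto

lemma bd_p: "bd 1 3 1 p"
  unfolding p_def tk_def tl_def
  by (rule bd_weak[OF bd_diff[OF bd_tdiff[OF l_n k_n] bd_weak[OF bd_one[of 1], of 1 0 1]]]) auto

lemma bd_gkl: "bd 1 2 0 (gk G)" "bd (1 + y k) 0 0 (gl G)" "bd 1 1 1 (gl G)"
  "bd (1 + y k) 3 0 (gk G - gl G)" "bd 1 3 1 (gk G - gl G)"
proof -
  have 0: "0 \<le> gk G" "gk G \<le> y l" "0 \<le> gl G" "gl G \<le> y k"
    using gk_le[of G k l] gk_le[of G l k] by (auto simp: gk_def gl_def)
  show 1: "bd 1 2 0 (gk G)" by (rule bd_le[OF _ bd_yl]) (use 0 y0 in auto)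
  show 2: "bd (1 + y k) 0 0 (gl G)" by (rule bd_self) (use 0 y0 in auto)
  show 3: "bd 1 1 1 (gl G)" by (rule bd_le[OF _ bd_y[OF k_n]]) (use 0 y0 in auto)
  show "bd (1 + y k) 3 0 (gk G - gl G)" by (rule bd_weak[OF bd_diff[OF bd_y1[OF 1] 2]]) auto
  show "bd 1 3 1 (gk G - gl G)" by (rule bd_weak[OF bd_diff[OF bd_weak[OF 1, of 1 2 1] 3]]) auto
qed

lemma zz_commute: "G \<in> \<Omega> \<Longrightarrow> zz l k G = zz k l G"
  using colsum_cw[OF _ k_n, of G l] colsum_cw[OF _ l_n, of G k] by (simp add: Int_commute mult.commute)

lemma typ_z: "typical G \<Longrightarrow> bd 1 4 1 (z G)" unfolding z_def using typ_Z[OF _ kl k_n l_n] .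
lemma bd_z: "G \<in> \<Omega> \<Longrightarrow> bd 1 1 2 (z G)" unfolding z_def using bd_Z[OF _ l_n] .

lemma B_eq:
  assumes G: "G \<in> \<Omega>"
  shows "real (card (free H G k l \<inter> col G k)) + 1 = b0 - (z G + gk G)"
    and "real (card (free H G k l \<inter> col G l)) = b0 - (z G + gk G) + p + (gk G - gl G)"
proof -
  have c1: "real (t k) = real (card (free H G k l \<inter> col G k)) + real (card (col G k \<inter> col G l)) + gk G"
    unfolding gk_def by (rule card_col_split[OF G[unfolded \<Omega>_def] kl k_n])
  have c2: "real (t l) = real (card (free H G k l \<inter> col G l)) + real (card (col G k \<inter> col G l)) + gl G"
    unfolding gl_def using card_col_split[OF G[unfolded \<Omega>_def] kl[symmetric] l_n]
    by (simp add: free_commute[of H G l k] Int_commute)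
  have zG: "z G = real (card (col G k \<inter> col G l)) - tk * tl / real m"
    unfolding z_def colsum_cw[OF G k_n] tk_def tl_def by (simp add: Int_commute)
  show "real (card (free H G k l \<inter> col G k)) + 1 = b0 - (z G + gk G)"
    using c1 zG by (simp add: b0_def tk_def)
  show "real (card (free H G k l \<inter> col G l)) = b0 - (z G + gk G) + p + (gk G - gl G)"
    using c2 zG by (simp add: b0_def tk_def tl_def p_def)
qed

lemma f_eq: "G \<in> \<Omega> \<Longrightarrow> f G - 1 = (p + (gk G - gl G)) / (b0 - (z G + gk G))"
proof -
  assume G: "G \<in> \<Omega>"
  have "0 < b0 - (z G + gk G)" unfolding B_eq(1)[OF G, symmetric] by simp
  then show ?thesis unfolding f_def B_eq[OF G] by (simp add: divide_simps)
qed

text \<open>Third-order expansion of the reciprocal around \<open>b0\<close>.\<close>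

definition rem :: "(nat \<times> nat) set \<Rightarrow> real" where
  "rem G = f G - 1 - ((p + (gk G - gl G)) / b0 + (p * (z G + gk G) + (gk G - gl G) * z G) / (b0 * b0)
     + p * (z G * z G) / (b0 * b0 * b0))"

text \<open>Iterates 1 / (b - d) = 1 / b + d / (b * (b - d)) three times, so the remainder is
  exact.\<close>

lemma recip_expand:
  fixes b d P :: real
  assumes "b \<noteq> 0" "b - d \<noteq> 0"
  shows "P / (b - d) = P / b + P * d / (b * b) + P * (d * d) / (b * b * b) + P * (d * d * d) / (b * b * b * (b - d))"
proof -
  have "P * d ^ i / b ^ i / (b - d) = P * d ^ i / b ^ Suc i + P * d ^ Suc i / b ^ Suc i / (b - d)" for i
  proof -
    have "1 / (b - d) = 1 / b + d / b / (b - d)" using assms by (simp add: divide_simps)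
    then have "(P * d ^ i / b ^ i) * (1 / (b - d)) = (P * d ^ i / b ^ i) * (1 / b + d / b / (b - d))" by simp
    then show ?thesis by (simp add: distrib_left mult_ac)
  qed
  from this[of 0] this[of 1] this[of 2] show ?thesis
    by (simp add: power2_eq_square power3_eq_cube numeral_2_eq_2 mult_ac divide_divide_eq_left)
qed

lemma lo_b0s: "lo 8 4 (b0 * b0)" "lo 12 6 (b0 * b0 * b0)"
  using lo_mult[OF lo_b0 lo_b0] lo_mult[OF lo_mult[OF lo_b0 lo_b0] lo_b0] by simp_all

text \<open>b0 has order r^2, p and z order r, gk is bounded, and gk - gl is bounded by the weight 1
  + y k. Every term left out of the expansion is then of order r^-4 times at most one such weight,
  the precision needed per move.\<close>

lemma typ_rem:
  assumes G: "typical G"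
  shows "bd (1 + y k) 37 (-4) (rem G)"
proof -
  note G' = typ_\<Omega>[OF G]
  define g where "g = gk G - gl G"
  define d where "d = z G + gk G"
  have pd: "0 < b0 - d" unfolding d_def B_eq(1)[OF G', symmetric] by simp
  have d: "bd 1 5 1 d" unfolding d_def
    by (rule bd_weak[OF bd_add[OF typ_z[OF G] bd_weak[OF bd_gkl(1), of 1 2 1]]]) auto
  have "bd 1 5 1 (b0 - d - b0)" using bd_minus[OF d] by simp
  from lo_approx[OF lo_b0 this] have lod: "lo 5 2 (b0 - d)" by (simp add: numeral_eq_Suc)
  have g: "bd (1 + y k) 3 0 g" "bd 1 3 1 g" unfolding g_def by (rule bd_gkl(4), rule bd_gkl(5))
  have "rem G = (p + g) / (b0 - d) - ((p + g) / b0 + (p * d + g * z G) / (b0 * b0) + p * (z G * z G) / (b0 * b0 * b0))"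
    unfolding rem_def f_eq[OF G'] g_def d_def ..
  also have "\<dots> = g * gk G / (b0 * b0) + p * (2 * (z G * gk G) + gk G * gk G) / (b0 * b0 * b0) + g * (d * d) / (b0 * b0 * b0)
      + (p + g) * (d * d * d) / (b0 * b0 * b0 * (b0 - d))"
  proof -
    have e1: "(p + g) * d / (b0 * b0) = (p * d + g * z G) / (b0 * b0) + g * gk G / (b0 * b0)"
      unfolding add_divide_distrib[symmetric] by (simp add: d_def algebra_simps)
    have e2: "(p + g) * (d * d) / (b0 * b0 * b0) = p * (z G * z G) / (b0 * b0 * b0)
       + p * (2 * (z G * gk G) + gk G * gk G) / (b0 * b0 * b0) + g * (d * d) / (b0 * b0 * b0)"
      unfolding add_divide_distrib[symmetric] by (simp add: d_def algebra_simps)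
    have "(p + g) / (b0 - d) = (p + g) / b0 + (p + g) * d / (b0 * b0) + (p + g) * (d * d) / (b0 * b0 * b0) + (p + g) * (d * d * d) / (b0 * b0 * b0 * (b0 - d))"
      by (rule recip_expand) (use pos pd in auto)
    then show ?thesis unfolding e1 e2 by simp
  qed
  also have "bd (1 + y k) 37 (-4) \<dots>"
  proof -
    have 1: "bd (1 + y k) 13 (-4) (g * gk G / (b0 * b0))"
      by (rule bd_weak[OF bd_div[OF bd_mult[OF g(1) bd_gkl(1)] lo_b0s(1)]]) auto
    have 2: "bd 1 8 1 (2 * (z G * gk G) + gk G * gk G)"
      by (rule bd_weak[OF bd_add[OF bd_weak[OF bd_mult[OF bd_const[of 2] bd_mult[OF typ_z[OF G] bd_gkl(1)]], of 1 7 1]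
        bd_weak[OF bd_mult[OF bd_gkl(1) bd_gkl(1)], of 1 4 1]]]) auto
    have 3: "bd (1 + y k) 23 (-4) (p * (2 * (z G * gk G) + gk G * gk G) / (b0 * b0 * b0))"
      by (rule bd_y1, rule bd_weak[OF bd_div[OF bd_mult[OF bd_p 2] lo_b0s(2)]]) auto
    have 4: "bd (1 + y k) 25 (-4) (g * (d * d) / (b0 * b0 * b0))"
      by (rule bd_weak[OF bd_div[OF bd_mult[OF g(1) bd_mult[OF d d]] lo_b0s(2)]]) auto
    have 5: "bd (1 + y k) 36 (-4) ((p + g) * (d * d * d) / (b0 * b0 * b0 * (b0 - d)))"
      by (rule bd_y1, rule bd_weak[OF bd_div[OF bd_mult[OF bd_add[OF bd_p g(2)] bd_mult[OF bd_mult[OF d d] d]] lo_mult[OF lo_b0s(2) lod]]]) auto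
    show ?thesis by (rule bd_weak[OF bd_add[OF bd_add[OF bd_add[OF 1 3] 4] 5]]) auto
  qed
  finally show ?thesis .
qed

lemma bd_f: "G \<in> \<Omega> \<Longrightarrow> bd 1 1 2 (f G)"
proof (rule bd_le[OF _ bd_m])
  assume G: "G \<in> \<Omega>"
  have "real (card (free H G k l \<inter> col G l)) \<le> real m"
    using card_mono[of "{..<m}" "free H G k l \<inter> col G l"] col_sub[OF \<Omega>_sub[OF G], of l] by auto
  moreover have "f G \<le> real (card (free H G k l \<inter> col G l))" unfolding f_def by (simp add: divide_simps distrib_left)
  ultimately show "\<bar>f G\<bar> \<le> \<bar>real m\<bar>" by (simp add: f_def)
qed

lemma bd_rem: "G \<in> \<Omega> \<Longrightarrow> bd 1 60 10 (rem G)"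
proof -
  assume G: "G \<in> \<Omega>"
  note zb = bd_z[OF G]
  have 1: "bd 1 2 2 (f G - 1)" by (rule bd_weak[OF bd_diff[OF bd_f[OF G] bd_weak[OF bd_one[of 1], of 1 0 2]]]) auto
  have 2: "bd 1 8 2 ((p + (gk G - gl G)) / b0)"
    by (rule bd_weak[OF bd_div[OF bd_add[OF bd_p bd_gkl(5)] lo_b0]]) auto
  have d: "bd 1 3 2 (z G + gk G)" by (rule bd_weak[OF bd_add[OF zb bd_weak[OF bd_gkl(1), of 1 2 2]]]) auto
  have 3: "bd 1 20 2 ((p * (z G + gk G) + (gk G - gl G) * z G) / (b0 * b0))"
    by (rule bd_weak[OF bd_div[OF bd_add[OF bd_mult[OF bd_p d] bd_mult[OF bd_gkl(5) zb]] lo_b0s(1)]]) auto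
  have 4: "bd 1 20 2 (p * (z G * z G) / (b0 * b0 * b0))"
    by (rule bd_weak[OF bd_div[OF bd_mult[OF bd_p bd_mult[OF zb zb]] lo_b0s(2)]]) auto
  show ?thesis unfolding rem_def
    by (rule bd_weak[OF bd_diff[OF 1 bd_add[OF bd_add[OF 2 3] 4]]]) auto
qed

lemma EE_rem: "bd (1 + y k) 38 (-4) (EE rem)"
  by (rule bd_weak[OF bd_EE_typ[where b = 60 and j = 10 and a = 37 and i = "-4" and g = "1 + y k"]])
    (use typ_rem bd_rem y0 in auto)

text \<open>Boundary counts are sums of edge probabilities over rows of H. The refined values serve
  the first-order term, which is divided only by b0; the crude value of \<open>EE gk\<close>
  suffices where it is multiplied by p / b0^2, already of order r^-3.\<close>

lemma EE_gk:
  "bd (1 + y k) 27 (-2) (EE gk - (tk / real m) * (y l - hh) - (\<Sum>j\<in>col H l - col H k. dlt j) / real n)"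
  "bd 1 11 (-1) (EE gk - lam * (y l - hh))"
  "bd (1 + y k) 28 (-2) (EE gl - (tl / real m) * (y k - hh) - (\<Sum>j\<in>col H k - col H l. dlt j) / real n)"
proof -
  have gen: "EE (\<lambda>G. real (card (col G a \<inter> col H b))) = (\<Sum>j\<in>col H b - col H a. pr j a)" for a b
  proof -
    have "EE (\<lambda>G. real (card (col G a \<inter> col H b))) = EE (\<lambda>G. \<Sum>j\<in>col H b. of_bool (j \<in> col G a))"
      by (rule EE_cong) (use finite_colH in \<open>simp add: Int_commute\<close>)
    also have "\<dots> = (\<Sum>j\<in>col H b. pr j a)" by (simp only: EE_sum pr_def)
    also have "\<dots> = (\<Sum>j\<in>col H b - col H a. pr j a)"
      by (rule sum.mono_neutral_right) (use finite_colH pr_zero in auto)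
    finally show ?thesis .
  qed
  have cd: "real (card (col H b - col H a)) = y b - real (card (col H a \<inter> col H b))" for a b
    using card_Int_Diff[OF finite_colH, of b "col H a"] card_colH[of b] by (simp add: Int_commute)
  have jm: "j < m" if "j \<in> col H b" for j b using that col_sub[OF Hsub, of b] by auto
  have e: "pr j a - (real (t a) / real m + dlt j / real n)
      = pr j a - (real (s j) + lam * real (degU H j)) / real n - (real (t a) - lam * real m) / real m" for j a
    using pos by (simp add: dlt_def field_simps)
  have ex: "(\<Sum>j\<in>A. pr j a) - real (t a) / real m * real (card A) - (\<Sum>j\<in>A. dlt j) / real n
      = (\<Sum>j\<in>A. pr j a - (real (t a) / real m + dlt j / real n))" for A a
    by (simp add: sum_subtractf sum.distrib sum_divide_distrib algebra_simps)
  have cy: "real (card (col H b - col H a)) \<le> y b" for a b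
    using card_mono[OF finite_colH, of "col H b - col H a" b] card_colH[of b] by (simp add: of_nat_mono)
  show "bd (1 + y k) 27 (-2) (EE gk - (tk / real m) * (y l - hh) - (\<Sum>j\<in>col H l - col H k. dlt j) / real n)"
  proof -
    have "EE gk - (tk / real m) * (y l - hh) - (\<Sum>j\<in>col H l - col H k. dlt j) / real n
      = (\<Sum>j\<in>col H l - col H k. pr j k - (real (t k) / real m + dlt j / real n))"
      unfolding gk_def[abs_def] gen tk_def ex[symmetric] cd hh_def ..
    also have "bd (1 + y k) (25 + 2) (-2 + 0) \<dots>"
    proof (rule bd_sum)
      fix j assume "j \<in> col H l - col H k"
      then show "bd (1 + y k) 25 (-2) (pr j k - (real (t k) / real m + dlt j / real n))"
        unfolding e using prob_refined[OF k_n jm] by auto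
    qed (use bd_le[OF _ bd_yl, of "real (card (col H l - col H k))"] cy[of l k] y0 in auto)
    finally show ?thesis by simp
  qed
  show "bd 1 11 (-1) (EE gk - lam * (y l - hh))"
  proof -
    have "EE gk - lam * (y l - hh) = (\<Sum>j\<in>col H l - col H k. pr j k - lam)"
      unfolding gk_def[abs_def] gen hh_def cd[symmetric] by (simp add: sum_subtractf)
    also have "bd 1 (9 + 2) (-1 + 0) \<dots>"
    proof (rule bd_sum)
      fix j assume "j \<in> col H l - col H k"
      then show "bd 1 9 (-1) (pr j k - lam)" using prob_one[OF k_n jm] by auto
    qed (use bd_le[OF _ bd_yl, of "real (card (col H l - col H k))"] cy[of l k] y0 in auto)
    finally show ?thesis by simp
  qed
  show "bd (1 + y k) 28 (-2) (EE gl - (tl / real m) * (y k - hh) - (\<Sum>j\<in>col H k - col H l. dlt j) / real n)"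
  proof -
    have "EE gl - (tl / real m) * (y k - hh) - (\<Sum>j\<in>col H k - col H l. dlt j) / real n
      = (\<Sum>j\<in>col H k - col H l. pr j l - (real (t l) / real m + dlt j / real n))"
      unfolding gl_def[abs_def] gen tl_def ex[symmetric] cd hh_def Int_commute[of "col H l" "col H k"] ..
    also have "bd (real (card (col H k - col H l))) 28 (-2) \<dots>"
    proof (rule bd_sum_card)
      fix j assume "j \<in> col H k - col H l"
      then have "bd ((1 + y l) * 1) 25 (-2) (pr j l - (real (t l) / real m + dlt j / real n))"
        unfolding e using prob_refined[OF l_n jm] by auto
      from bd_absorb[OF this] show "bd 1 28 (-2) (pr j l - (real (t l) / real m + dlt j / real n))" by simp
    qed
    finally show ?thesis by (rule bd_weak) (use cy[of k l] y0 in auto)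
  qed
qed

end

lemma exp_quadratic:
  fixes x :: real
  assumes "\<bar>x\<bar> \<le> 1"
  shows "\<bar>exp x - 1 - x\<bar> \<le> x * x"
proof (cases "0 \<le> x")
  case True
  then show ?thesis using exp_bound[OF True] exp_ge_add_one_self[of x] assms unfolding power2_eq_square by linarith
next
  case False
  then have "0 < 1 - x" by simp
  have "1 - x \<le> exp (- x)" using exp_ge_add_one_self[of "- x"] by simp
  then have "exp x \<le> 1 / (1 - x)"
    using \<open>0 < 1 - x\<close> by (simp add: exp_minus divide_simps mult.commute)
  also have "\<dots> \<le> 1 + x + x * x"
  proof -
    have "(1 + x + x * x) * (1 - x) = 1 + (- x) * (x * x)" by (simp add: algebra_simps)
    moreover have "0 \<le> (- x) * (x * x)" by (rule mult_nonneg_nonneg) (use False in auto)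
    ultimately show ?thesis using \<open>0 < 1 - x\<close> by (simp add: pos_divide_le_eq)
  qed
  finally show ?thesis using exp_ge_add_one_self[of x] by linarith
qed

section \<open>Main terms of the mean switching ratio\<close>

context switch
begin

text \<open>Approximates the mean of z + gk: rows forbidden in both columns enter through the
  codegree, rows forbidden in l alone through the boundary count.\<close>

definition S0 :: real where "S0 = S1 + (lam * lam * hh + lam * (y l - hh))"
text \<open>The denominator of \<open>rho\<close> divided by m; it agrees with b0 - lam * y l up to
  order r^-1.\<close>

definition w :: real where "w = (tk + 1) * (real m + 1 - tl - y l) / real m"
text \<open>The factor by which the product of the column binomials changes under the move, see
  \<open>PP_mv\<close>.\<close>

definition rho :: real where "rho = (real m - y k - tk) * tl / ((tk + 1) * (real m - y l - tl + 1))"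
text \<open>The increment of the exponent \<open>phi\<close> under the move: the first term comes
  from the column variance, the second from Y.\<close>

definition kap0 :: real where "kap0 = p * S1 / (a0 * a0) + DD / (real n * a0)"

lemma hh_le: "0 \<le> hh" "hh \<le> y l"
  using card_mono[OF finite_colH, of "col H k \<inter> col H l" l] card_colH[of l] by (auto simp: hh_def)

lemma bd_hh: "bd 1 2 0 hh" "bd 1 2 0 (y l - hh)"
  by (rule bd_le[OF _ bd_yl], use hh_le in simp)+

lemma EE_f_expand:
  "EE f - 1 = (p + (EE gk - EE gl)) / b0 + (p * (EE z + EE gk) + (EE (\<lambda>G. gk G * z G) - EE (\<lambda>G. gl G * z G))) / (b0 * b0)
     + p * EE (\<lambda>G. z G * z G) / (b0 * b0 * b0) + EE rem"
proof -
  have "EE f - 1 = EE (\<lambda>G. (p + (gk G - gl G)) / b0 + (p * (z G + gk G) + (gk G * z G - gl G * z G)) / (b0 * b0)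
     + p * (z G * z G) / (b0 * b0 * b0) + rem G)"
  proof -
    have "EE f - 1 = EE (\<lambda>G. f G - 1)" by (simp add: EE_diff EE_const)
    also have "\<dots> = EE (\<lambda>G. (p + (gk G - gl G)) / b0 + (p * (z G + gk G) + (gk G * z G - gl G * z G)) / (b0 * b0)
     + p * (z G * z G) / (b0 * b0 * b0) + rem G)"
      by (rule EE_cong) (simp add: rem_def left_diff_distrib)
    finally show ?thesis .
  qed
  then show ?thesis by (simp only: EE_add EE_diff EE_cmult EE_divc EE_const)
qed

lemma mean_z: "bd (1 + y k) 43 (-1) (EE z - (S1 + lam * lam * hh))"
proof -
  have "bd (1 + y k + y l) 40 (-1) (EE z - (S1 + lam * lam * hh))"
    using mean_codegree[OF k_n l_n kl] by (simp add: z_def[abs_def] S1_def a0_def hh_def)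
  then have "bd ((1 + y l) * (1 + y k)) 40 (-1) (EE z - (S1 + lam * lam * hh))"
    by (rule bd_weak) (use y_prod_le[of k l] in \<open>simp_all add: mult.commute\<close>)
  from bd_absorb[OF this] show ?thesis by simp
qed

lemma mean_zz: "bd (1 + y k) 37 1 (EE (\<lambda>G. z G * z G) - a0 * a0 / real m)"
proof -
  have "a0 * a0 / real m = (lam * (1 - lam))\<^sup>2 * real m"
    using pos by (simp add: a0_def power2_eq_square)
  then show ?thesis using var_codegree[OF k_n l_n kl] by (simp add: z_def)
qed

lemma mean_gz: "bd (1 + y k) 23 0 (EE (\<lambda>G. gk G * z G) - EE (\<lambda>G. gl G * z G))"
proof -
  have 1: "bd (1 + y k) 22 0 (EE (\<lambda>G. gk G * z G))"
    using bd_absorb[OF cov_boundary[OF k_n l_n kl]] by (simp add: gk_def z_def)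
  have "EE (\<lambda>G. gl G * z G) = EE (\<lambda>G. real (card (col G l \<inter> col H k)) * zz l k G)"
    by (rule EE_cong) (simp add: gl_def z_def zz_commute)
  then have "bd ((1 + y l) * (1 + y k)) 19 0 (EE (\<lambda>G. gl G * z G))"
    using cov_boundary[OF l_n k_n kl[symmetric]] by (simp add: mult.commute)
  from bd_absorb[OF this] have 2: "bd (1 + y k) 22 0 (EE (\<lambda>G. gl G * z G))" by simp
  show ?thesis by (rule bd_weak[OF bd_diff[OF 1 2]]) auto
qed

text \<open>The expansion of EE f - 1 with all means replaced by their approximations. The last term
  is the second moment of the codegree, which is not negligible at this precision.\<close>

definition M :: real where
  "M = (p + (tk / real m * (y l - hh) - tl / real m * (y k - hh) + DD / real n)) / b0 + p * S0 / (b0 * b0)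
     + p * (a0 * a0 / real m) / (b0 * b0 * b0)"

lemma DD_eq: "DD = (\<Sum>j\<in>col H l - col H k. dlt j) - (\<Sum>j\<in>col H k - col H l. dlt j)"
  using sum.Int_Diff[OF finite_colH, of dlt l "col H k"] sum.Int_Diff[OF finite_colH, of dlt k "col H l"]
  by (simp add: DD_def Int_commute)

lemma EE_f_M: "bd (1 + y k) 59 (-4) (EE f - 1 - M)"
proof -
  define e1 where "e1 = EE gk - (tk / real m) * (y l - hh) - (\<Sum>j\<in>col H l - col H k. dlt j) / real n"
  define e2 where "e2 = EE gl - (tl / real m) * (y k - hh) - (\<Sum>j\<in>col H k - col H l. dlt j) / real n"
  define e3 where "e3 = EE z - (S1 + lam * lam * hh)"
  define e4 where "e4 = EE gk - lam * (y l - hh)"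
  define e5 where "e5 = EE (\<lambda>G. z G * z G) - a0 * a0 / real m"
  define e6 where "e6 = EE (\<lambda>G. gk G * z G) - EE (\<lambda>G. gl G * z G)"
  have b: "bd (1 + y k) 27 (-2) e1" "bd (1 + y k) 28 (-2) e2" "bd (1 + y k) 43 (-1) e3" "bd (1 + y k) 11 (-1) e4"
     "bd (1 + y k) 37 1 e5" "bd (1 + y k) 23 0 e6"
    unfolding e1_def e2_def e3_def e4_def e5_def e6_def
    using EE_gk mean_z mean_zz mean_gz by (auto intro: bd_y1)
  have c1: "p + (EE gk - EE gl) = (p + (tk / real m * (y l - hh) - tl / real m * (y k - hh) + DD / real n)) + (e1 - e2)"
    unfolding e1_def e2_def DD_eq by (simp add: diff_divide_distrib)
  have c2: "p * (EE z + EE gk) + (EE (\<lambda>G. gk G * z G) - EE (\<lambda>G. gl G * z G)) = p * S0 + p * (e3 + e4) + e6"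
    unfolding e3_def e4_def e6_def S0_def by (simp add: algebra_simps)
  have c3: "p * EE (\<lambda>G. z G * z G) = p * (a0 * a0 / real m) + p * e5"
    unfolding e5_def by (simp add: algebra_simps)
  have "EE f - 1 - M = (e1 - e2) / b0 + p * (e3 + e4) / (b0 * b0) + e6 / (b0 * b0) + p * e5 / (b0 * b0 * b0) + EE rem"
    unfolding EE_f_expand M_def c1 c2 c3 by (simp only: add_divide_distrib)
  also have "bd (1 + y k) 59 (-4) \<dots>"
  proof -
    have 1: "bd (1 + y k) 33 (-4) ((e1 - e2) / b0)"
      by (rule bd_weak[OF bd_div[OF bd_diff[OF b(1,2)] lo_b0]]) auto
    have 2: "bd (1 + y k) 55 (-4) (p * (e3 + e4) / (b0 * b0))"
      by (rule bd_weak[OF bd_div[OF bd_mult[OF bd_p bd_add[OF b(3,4)]] lo_b0s(1)]]) auto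
    have 3: "bd (1 + y k) 31 (-4) (e6 / (b0 * b0))"
      by (rule bd_weak[OF bd_div[OF b(6) lo_b0s(1)]]) auto
    have 4: "bd (1 + y k) 52 (-4) (p * e5 / (b0 * b0 * b0))"
      by (rule bd_weak[OF bd_div[OF bd_mult[OF bd_p b(5)] lo_b0s(2)]]) auto
    show ?thesis
      by (rule bd_weak[OF bd_add[OF bd_add[OF bd_add[OF bd_add[OF 1 2] 3] 4] EE_rem]]) auto
  qed
  finally show ?thesis .
qed

lemma bd_dlt: "j < m \<Longrightarrow> bd 1 2 1 (dlt j)"
  using bd_add[OF bd_s bd_mult[OF bd_lam bd_x, simplified], of j j] by (simp add: dlt_def numeral_2_eq_2)

lemma bd_DD: "bd (1 + y k) 5 1 DD" "bd 1 5 2 DD"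
proof -
  have dm: "bd 1 2 1 (dlt j)" if "j \<in> col H b" for j b
    using bd_dlt col_sub[OF Hsub, of b] that by auto
  have 1: "bd 1 4 1 (\<Sum>j\<in>col H l. dlt j)"
    by (rule bd_weak[OF bd_sum[where b = 2 and j = 0, OF dm]]) (use card_colH[of l] bd_yl in auto)
  have "bd (real (card (col H k))) 2 1 (\<Sum>j\<in>col H k. dlt j)" by (rule bd_sum_card[OF dm])
  then have 2: "bd (1 + y k) 2 1 (\<Sum>j\<in>col H k. dlt j)" by (rule bd_weak) (use card_colH[of k] in auto)
  have 3: "bd 1 3 2 (\<Sum>j\<in>col H k. dlt j)"
    by (rule bd_weak[OF bd_sum[where b = 1 and j = 1, OF dm]]) (use card_colH[of k] bd_y[OF k_n] in auto)
  show "bd (1 + y k) 5 1 DD" unfolding DD_def by (rule bd_weak[OF bd_diff[OF bd_y1[OF 1] 2]]) auto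
  show "bd 1 5 2 DD" unfolding DD_def by (rule bd_weak[OF bd_diff[OF bd_weak[OF 1, of 1 4 2] 3]]) auto
qed

lemma bd_S1: "bd 1 4 0 S1"
proof -
  have "bd 1 (2 + 1) (2 + 2) (Rsum m s)"
    unfolding Rsum_sv
    by (rule bd_sum) (use bd_mult[OF bd_s bd_s] bd_m in \<open>auto simp: numeral_2_eq_2\<close>)
  from bd_div[OF this lo_mult[OF lo_n lo_n]]
  have 1: "bd 1 3 0 (Rsum m s / (real n * real n))" by simp
  have 2: "bd 1 1 0 (a0 / real n)" using bd_div[OF bd_a0 lo_n] by simp
  show ?thesis unfolding S1_def by (rule bd_weak[OF bd_diff[OF 1 2]]) auto
qed

lemma bd_S0: "bd 1 6 0 S0"
proof -
  have 1: "bd 1 2 0 (lam * lam * hh)" by (rule bd_weak[OF bd_mult[OF bd_mult[OF bd_lam bd_lam] bd_hh(1)]]) auto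
  have 2: "bd 1 2 0 (lam * (y l - hh))" by (rule bd_weak[OF bd_mult[OF bd_lam bd_hh(2)]]) auto
  show ?thesis unfolding S0_def by (rule bd_weak[OF bd_add[OF bd_S1 bd_add[OF 1 2]]]) auto
qed

definition ew :: real where
  "ew = (tk / real m - tl / real m) + 1 / real m - (tk / real m - lam) * y l - y l / real m"

lemma w_eq: "w - b0 = ew - lam * y l"
  using pos(3) by (simp add: w_def b0_def ew_def field_simps)

lemma bd_ew: "bd 1 6 (-1) ew"
proof -
  have "tk / real m - tl / real m = (tk / real m - lam) - (tl / real m - lam)" by simp
  then have 1: "bd 1 3 (-1) (tk / real m - tl / real m)"
    using bd_weak[OF bd_diff[OF bd_tau], of 1 3 "-1"] by simp
  have 2: "bd 1 1 (-1) (1 / real m)" by (rule bd_weak[OF bd_minv]) auto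
  have 3: "bd 1 4 (-1) ((tk / real m - lam) * y l)" by (rule bd_weak[OF bd_mult[OF bd_tau(1) bd_yl]]) auto
  have 4: "bd 1 3 (-1) (y l / real m)" by (rule bd_weak[OF bd_div[OF bd_yl lo_m]]) auto
  show ?thesis unfolding ew_def by (rule bd_weak[OF bd_diff[OF bd_diff[OF bd_add[OF 1 2] 3] 4]]) auto
qed

lemma bd_wb: "bd 1 7 0 (w - b0)"
  unfolding w_eq
  by (rule bd_weak[OF bd_diff[OF bd_weak[OF bd_ew, of 1 6 0] bd_mult[OF bd_lam bd_yl, simplified]]]) auto

lemma lo_w: "lo 5 2 w" using lo_approx[OF lo_b0 bd_wb] by (simp add: numeral_eq_Suc)

lemma pos_w: "0 < w" by (rule lo_pos[OF lo_w])

lemma bd_inv: "bd 1 4 (-2) (1 / b0)" "bd 1 3 (-2) (1 / a0)" "bd 1 5 (-2) (1 / w)"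
  "bd 1 12 (-3) (1 / b0 - 1 / a0)" "bd 1 16 (-4) (1 / b0 - 1 / w)" "bd 1 16 (-3) (1 / a0 - 1 / w)"
proof -
  show 1: "bd 1 4 (-2) (1 / b0)" using bd_div[OF bd_one[of 1] lo_b0] by simp
  show 2: "bd 1 3 (-2) (1 / a0)" using bd_div[OF bd_one[of 1] lo_a0] by simp
  show 3: "bd 1 5 (-2) (1 / w)" using bd_div[OF bd_one[of 1] lo_w] by simp
  have "1 / b0 - 1 / a0 = (a0 - b0) / (b0 * a0)" using pos by (simp add: field_simps)
  then show "bd 1 12 (-3) (1 / b0 - 1 / a0)"
    using bd_div[OF bd_swap[OF b0_a0] lo_mult[OF lo_b0 lo_a0]] by simp
  have "1 / b0 - 1 / w = (w - b0) / (b0 * w)" using pos pos_w by (simp add: field_simps)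
  then show "bd 1 16 (-4) (1 / b0 - 1 / w)"
    using bd_div[OF bd_wb lo_mult[OF lo_b0 lo_w]] by simp
  have wa: "bd 1 8 1 (w - a0)"
    using bd_weak[OF bd_add[OF bd_weak[OF bd_wb, of 1 7 1] b0_a0], of 1 8 1] by simp
  have "1 / a0 - 1 / w = (w - a0) / (a0 * w)" using pos pos_w by (simp add: field_simps)
  then show "bd 1 16 (-3) (1 / a0 - 1 / w)"
    using bd_div[OF wa lo_mult[OF lo_a0 lo_w]] by simp
qed

lemma rho_eq: "rho - 1 = (p + p / real m + (tk / real m * y l - tl / real m * y k) + y l / real m) / w"
proof -
  define W where "W = (tk + 1) * (real m - y l - tl + 1)"
  have wW: "w = W / real m" unfolding w_def W_def by (simp add: algebra_simps)
  have W0: "W \<noteq> 0" using pos_w pos(3) unfolding wW by auto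
  have "rho - 1 = ((real m - y k - tk) * tl - W) / W" unfolding rho_def W_def[symmetric] using W0 by (simp add: diff_divide_distrib)
  also have "(real m - y k - tk) * tl - W = real m * (p + p / real m + (tk / real m * y l - tl / real m * y k) + y l / real m)"
    using pos(3) by (simp add: W_def p_def field_simps)
  finally show ?thesis unfolding wW using pos(3) by simp
qed

text \<open>Exact regrouping after which every summand has a visibly small factor. Up to the
  differences of the reciprocals of b0, a0 and w, four cancellations occur: p / b0 against p / w;
  the shift lam * y l of w against the boundary part of S0; the hh-terms of S0 against those of the
  boundary counts; and the codegree variance against the term p / (m * w) of
  \<open>rho\<close>.\<close>

lemma M_split:
  defines "ib \<equiv> 1 / b0" and "ia \<equiv> 1 / a0" and "iw \<equiv> 1 / w" and "im \<equiv> 1 / real m"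
  shows "M - kap0 - (rho - 1) = DD / real n * (ib - ia) + p * S0 * ((ib - ia) * (ib + ia))
    + p * im * ((ib - ia) + ib * ((a0 * ib - 1) * (a0 * ib + 1)))
    + (hh * (p * im) * (ib - ia) + hh * im * ib)
    + (p * ew * (ib * iw) + p * (lam * y l) * (ia * (ia - ib) + ib * (ia - iw)))
    + p * im * (ia - iw) + (tk * im * y l - tl * im * y k) * (ib - iw) - y l * im * iw"
proof -
  define dn where "dn = DD / real n"
  have a1: "a0 * ia = 1" using pos by (simp add: ia_def)
  have lm: "lam * (1 - lam) = a0 * im" using pos by (simp add: a0_def im_def)
  have bw: "ib - iw = (w - b0) * (ib * iw)" using pos pos_w by (simp add: ib_def iw_def field_simps)
  have Me: "M = (p + (tk * im * (y l - hh) - tl * im * (y k - hh) + dn)) * ib + p * S0 * (ib * ib) + p * (a0 * a0 * im) * (ib * ib * ib)"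
    by (simp add: M_def ib_def im_def dn_def)
  have ke: "kap0 = p * S1 * (ia * ia) + dn * ia" by (simp add: kap0_def ia_def dn_def)
  have re: "rho - 1 = (p + p * im + (tk * im * y l - tl * im * y k) + y l * im) * iw"
    unfolding rho_eq by (simp add: im_def iw_def)
  \<comment> \<open>A row forbidden in both columns counts lam^2 in the codegree but is missing from
    the boundary count, where it would give lam. The net amount is -lam * (1 - lam) = -a0 /
    m.\<close>
  have s: "S1 = S0 - lam * y l + a0 * im * hh" unfolding lm[symmetric] S0_def by (simp add: algebra_simps)
  have k2: "p * S1 * (ia * ia) = p * S0 * (ia * ia) - p * (lam * y l) * (ia * ia) + p * hh * im * ia"
  proof -
    have "p * S1 * (ia * ia) = p * S0 * (ia * ia) - p * (lam * y l) * (ia * ia) + p * hh * im * ia * (a0 * ia)"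
      unfolding s by (simp add: algebra_simps)
    then show ?thesis unfolding a1 by simp
  qed
  have t1: "tl = tk + p + 1" by (simp add: p_def)
  have pw: "p * (ib - iw) = p * ew * (ib * iw) - p * (lam * y l) * (ib * iw)"
    unfolding bw w_eq by (simp add: algebra_simps)
  have hq: "hh * (tl * im - tk * im) * ib = hh * (p * im) * ib + hh * im * ib"
    unfolding t1 by (simp add: algebra_simps)
  have "M - kap0 - (rho - 1) = p * (ib - iw) + (tk * im * y l - tl * im * y k) * (ib - iw) + hh * (tl * im - tk * im) * ib
     + dn * (ib - ia) + p * S0 * (ib * ib) - p * S1 * (ia * ia) + p * im * (a0 * a0 * (ib * ib * ib)) - p * im * iw - y l * im * iw"
    unfolding Me ke re by (simp add: algebra_simps)
  then show ?thesis unfolding pw hq k2 dn_def[symmetric] by (simp add: algebra_simps)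
qed

lemma M_approx: "bd (1 + y k) 40 (-4) (M - kap0 - (rho - 1))"
proof -
  let ?ib = "1 / b0" and ?ia = "1 / a0" and ?iw = "1 / w" and ?im = "1 / real m"
  note i = bd_inv
  have pm: "bd 1 4 (-1) (p * ?im)" by (rule bd_weak[OF bd_mult[OF bd_p bd_minv]]) auto
  have 1: "bd (1 + y k) 17 (-4) (DD / real n * (?ib - ?ia))"
    by (rule bd_weak[OF bd_mult[OF bd_div[OF bd_DD(1) lo_n] i(4)]]) auto
  have s2: "bd 1 5 (-2) (?ib + ?ia)" by (rule bd_weak[OF bd_add[OF i(1,2)]]) auto
  have 2: "bd (1 + y k) 26 (-4) (p * S0 * ((?ib - ?ia) * (?ib + ?ia)))"
    by (rule bd_y1, rule bd_weak[OF bd_mult[OF bd_mult[OF bd_p bd_S0] bd_mult[OF i(4) s2]]]) auto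
  have q1: "bd 1 9 (-1) (a0 * ?ib - 1)"
  proof -
    have "a0 * ?ib - 1 = (a0 - b0) / b0" using pos by (simp add: diff_divide_distrib)
    then show ?thesis using bd_div[OF bd_swap[OF b0_a0] lo_b0] by simp
  qed
  have q2: "bd 1 6 0 (a0 * ?ib + 1)"
    by (rule bd_weak[OF bd_add[OF bd_weak[OF bd_mult[OF bd_a0 i(1)], of 1 5 0] bd_one[of 1]]]) auto
  have q3: "bd 1 20 (-3) ((?ib - ?ia) + ?ib * ((a0 * ?ib - 1) * (a0 * ?ib + 1)))"
    by (rule bd_weak[OF bd_add[OF i(4) bd_weak[OF bd_mult[OF i(1) bd_mult[OF q1 q2]], of 1 19 "-3"]]]) auto
  have 3: "bd (1 + y k) 24 (-4) (p * ?im * ((?ib - ?ia) + ?ib * ((a0 * ?ib - 1) * (a0 * ?ib + 1))))"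
    by (rule bd_y1, rule bd_weak[OF bd_mult[OF pm q3]]) auto
  have 4: "bd (1 + y k) 19 (-4) (hh * (p * ?im) * (?ib - ?ia) + hh * ?im * ?ib)"
    by (rule bd_y1, rule bd_weak[OF bd_add[OF bd_weak[OF bd_mult[OF bd_mult[OF bd_hh(1) pm] i(4)], of 1 18 "-4"]
       bd_weak[OF bd_mult[OF bd_mult[OF bd_hh(1) bd_minv] i(1)], of 1 7 "-4"]]]) auto
  have q5: "bd 1 21 (-5) (?ia * (?ia - ?ib) + ?ib * (?ia - ?iw))"
    by (rule bd_weak[OF bd_add[OF bd_weak[OF bd_mult[OF i(2) bd_swap[OF i(4)]], of 1 15 "-5"] bd_weak[OF bd_mult[OF i(1,6)], of 1 20 "-5"]]]) auto
  have ly: "bd 1 2 0 (lam * y l)" by (rule bd_weak[OF bd_mult[OF bd_lam bd_yl]]) auto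
  have 5: "bd (1 + y k) 27 (-4) (p * ew * (?ib * ?iw) + p * (lam * y l) * (?ia * (?ia - ?ib) + ?ib * (?ia - ?iw)))"
    by (rule bd_y1, rule bd_weak[OF bd_add[OF bd_weak[OF bd_mult[OF bd_mult[OF bd_p bd_ew] bd_mult[OF i(1,3)]], of 1 18 "-4"]
       bd_weak[OF bd_mult[OF bd_mult[OF bd_p ly] q5], of 1 26 "-4"]]]) auto
  have 6: "bd (1 + y k) 20 (-4) (p * ?im * (?ia - ?iw))"
    by (rule bd_y1, rule bd_weak[OF bd_mult[OF pm i(6)]]) auto
  have q7: "bd (1 + y k) 3 0 (tk * ?im * y l - tl * ?im * y k)"
  proof -
    have a: "bd 1 2 0 (tk * ?im * y l)" by (rule bd_weak[OF bd_mult[OF bd_one bd_yl]]) (use tau01 in auto)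
    have b: "bd (1 + y k) 0 0 (tl * ?im * y k)"
      by (rule bd_weak[OF bd_mult[OF bd_one bd_self[of "1 + y k" "y k"]]]) (use tau01 y0 in auto)
    show ?thesis by (rule bd_weak[OF bd_diff[OF bd_y1[OF a] b]]) auto
  qed
  have 7: "bd (1 + y k) 19 (-4) ((tk * ?im * y l - tl * ?im * y k) * (?ib - ?iw))"
    by (rule bd_weak[OF bd_mult[OF q7 i(5)]]) auto
  have 8: "bd (1 + y k) 8 (-4) (y l * ?im * ?iw)"
    by (rule bd_y1, rule bd_weak[OF bd_mult[OF bd_mult[OF bd_yl bd_minv] i(3)]]) auto
  show ?thesis unfolding M_split
    by (rule bd_weak[OF bd_diff[OF bd_add[OF bd_add[OF bd_add[OF bd_add[OF bd_add[OF bd_add[OF 1 2] 3] 4] 5] 6] 7] 8]]) auto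
qed

lemma bd_kap0: "bd (1 + y k) 14 (-3) kap0" "bd 1 14 (-2) kap0"
proof -
  have a: "bd 1 13 (-3) (p * S1 / (a0 * a0))"
    by (rule bd_weak[OF bd_div[OF bd_mult[OF bd_p bd_S1] lo_mult[OF lo_a0 lo_a0]]]) auto
  have b: "bd (1 + y k) 8 (-3) (DD / (real n * a0))"
    by (rule bd_weak[OF bd_div[OF bd_DD(1) lo_mult[OF lo_n lo_a0]]]) auto
  have c: "bd 1 8 (-2) (DD / (real n * a0))"
    by (rule bd_weak[OF bd_div[OF bd_DD(2) lo_mult[OF lo_n lo_a0]]]) auto
  show "bd (1 + y k) 14 (-3) kap0" unfolding kap0_def by (rule bd_weak[OF bd_add[OF bd_y1[OF a] b]]) auto
  show "bd 1 14 (-2) kap0" unfolding kap0_def by (rule bd_weak[OF bd_add[OF bd_weak[OF a, of 1 13 "-2"] c]]) auto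
qed

lemma bd_rho: "bd 1 12 (-1) (rho - 1)"
proof -
  have a: "bd 1 4 1 (p / real m)" by (rule bd_weak[OF bd_div[OF bd_p lo_m]]) auto
  have b: "bd 1 2 1 (tk / real m * y l)" by (rule bd_weak[OF bd_mult[OF bd_one bd_yl]]) (use tau01 in auto)
  have c: "bd 1 1 1 (tl / real m * y k)" by (rule bd_weak[OF bd_mult[OF bd_one bd_y[OF k_n]]]) (use tau01 in auto)
  have d: "bd 1 3 1 (y l / real m)" by (rule bd_weak[OF bd_div[OF bd_yl lo_m]]) auto
  show ?thesis unfolding rho_eq
    by (rule bd_weak[OF bd_div[OF bd_add[OF bd_add[OF bd_add[OF bd_p a] bd_diff[OF b c]] d] lo_w]]) auto
qed

text \<open>EE f - 1 agrees with (rho - 1) + kap0 by the two preceding approximations. Passing to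
  the product costs (rho - 1) * kap0 and a term quadratic in kap0, both of order r^-4 since rho - 1
  has order r^-1 and kap0 has order r^-3 with weight 1 + y k.\<close>

lemma mean_switch: "bd (1 + y k) 66 (-4) (EE f - rho * exp kap0)"
proof -
  have k1: "\<bar>kap0\<bar> \<le> 1"
  proof -
    have "bd 1 0 (-2 + int 1) kap0" by (rule bd_trade[OF bd_kap0(2)]) simp
    then have "bd 1 0 0 kap0" by (rule bd_weak) auto
    then show ?thesis by (simp add: bd_def)
  qed
  have k2: "bd (1 + y k) 28 (-4) (exp kap0 - 1 - kap0)"
  proof (rule bd_le)
    show "\<bar>exp kap0 - 1 - kap0\<bar> \<le> \<bar>kap0 * kap0\<bar>" using exp_quadratic[OF k1] by simp
    show "bd (1 + y k) 28 (-4) (kap0 * kap0)" by (rule bd_weak[OF bd_mult[OF bd_kap0]]) auto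
  qed
  have r1: "bd 1 13 0 rho" using bd_weak[OF bd_add[OF bd_weak[OF bd_rho, of 1 12 0] bd_one[of 1]], of 1 13 0] by simp
  have "EE f - rho * exp kap0 = (EE f - 1 - M) + (M - kap0 - (rho - 1)) - (rho - 1) * kap0 - rho * (exp kap0 - 1 - kap0)"
    by (simp add: algebra_simps)
  also have "bd (1 + y k) 66 (-4) \<dots>"
    by (rule bd_weak[OF bd_diff[OF bd_diff[OF bd_add[OF EE_f_M M_approx]
       bd_weak[OF bd_mult[OF bd_rho bd_kap0(1)], of "1 + y k" 26 "-4"]] bd_weak[OF bd_mult[OF r1 k2], of "1 + y k" 41 "-4"]]]) auto
  finally show ?thesis .
qed

end

text \<open>Written without quotients and with real subtraction, so that it holds for every t: from
  t = M on both sides are 0.\<close>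

lemma choose_Suc_real: "(real t + 1) * real (M choose Suc t) = (real M - real t) * real (M choose t)"
proof (cases "t \<le> M")
  case True
  have "Suc t * (M choose Suc t) = (M - t) * (M choose t)"
  proof (cases M)
    case (Suc M')
    then show ?thesis using Suc_times_binomial[of t M'] binomial_absorb_comp[of M t] by simp
  qed simp
  then have "real (Suc t * (M choose Suc t)) = real ((M - t) * (M choose t))" by simp
  then show ?thesis using True by (simp add: of_nat_diff distrib_right)
next
  case False
  then show ?thesis by (simp add: binomial_eq_0)
qed

context colwin
begin

lemma free_col_card: "G \<in> \<Omega> \<Longrightarrow> k < n \<Longrightarrow> real (t k) + y k \<le> real m"
proof -
  assume G: "G \<in> \<Omega>" and k: "k < n"
  have "col G k \<inter> col H k = {}" using G by (auto simp: \<Omega>_def bip_graphs_def col_def)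
  then have "card (col G k \<union> col H k) = t k + card (col H k)"
    using \<Omega>_fin_col[OF G] finite_colH \<Omega>_col[OF G k] by (simp add: card_Un_disjoint)
  moreover have "card (col G k \<union> col H k) \<le> card {..<m}"
    using col_sub[OF \<Omega>_sub[OF G], of k] col_sub[OF Hsub, of k] by (intro card_mono) auto
  ultimately show ?thesis using card_colH[of k] by simp
qed

text \<open>If column k had no free entry the balance ratio would be -1, whereas it is of order r^-1
  in a typical graph.\<close>

lemma typ_nonempty: "typical G \<Longrightarrow> k \<noteq> l \<Longrightarrow> k < n \<Longrightarrow> l < n \<Longrightarrow> free H G k l \<inter> col G k \<noteq> {}"
proof
  assume G: "typical G" and kl: "k \<noteq> l" "k < n" "l < n" and e: "free H G k l \<inter> col G k = {}"
  have "bal H G k l = - real (card (free H G k l))"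
    using card_free_split[OF typ_\<Omega>[OF G, unfolded \<Omega>_def], of k l] e unfolding bal_def by simp
  moreover have "0 < real (card (free H G k l))" using lo_pos[OF typ_D(2)[OF G kl]] .
  ultimately have 1: "bal H G k l / real (card (free H G k l)) = - 1" by simp
  have "bd 1 6 (-1) (- 1)" using typ_bal[OF G kl] unfolding 1 .
  then have "1 \<le> Q ^ 6 / r" by (simp add: bd_def power_int_minus divide_inverse)
  then have "r \<le> Q ^ 6" using r_pos by (simp add: divide_simps)
  moreover have "Q ^ 6 < Q ^ 100" using Q16 by (intro power_strict_increasing) auto
  ultimately show False using r_ge by linarith
qed

end

section \<open>The normalized count and its change under one move\<close>

context dense
begin

definition NN :: "(nat \<Rightarrow> nat) \<Rightarrow> real" where "NN t = real (card (bip_graphs m n s t H))"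
definition PP :: "(nat \<Rightarrow> nat) \<Rightarrow> real" where "PP t = (\<Prod>k<n. real ((m - degV H k) choose t k))"
text \<open>This is 2 * A * m * n in the notation of the theorem.\<close>

definition AA :: real where "AA = lam * (1 - lam) * real m * real n"
definition phi :: "(nat \<Rightarrow> nat) \<Rightarrow> real" where
  "phi t = - (1/2) * (1 - Rsum m s / AA) * (1 - Rsum n t / AA) - Ysum m n s t H / AA"
definition Th :: "(nat \<Rightarrow> nat) \<Rightarrow> real" where "Th t = NN t / (PP t * exp (phi t))"

text \<open>Deviations are measured from lam * m, which does not change with t; it equals the
  average of t by \<open>win_avg\<close>.\<close>

definition win :: "real \<Rightarrow> (nat \<Rightarrow> nat) \<Rightarrow> bool" where
  "win c t \<longleftrightarrow> (\<Sum>k<n. t k) = (\<Sum>j<m. s j) \<and> (\<forall>k<n. \<bar>real (t k) - lam * real m\<bar> \<le> c)"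

lemma win_avg: "win c t \<Longrightarrow> avg_s n t = lam * real m"
proof -
  assume "win c t"
  then have "(\<Sum>k<n. real (t k)) = (\<Sum>j<m. real (s j))" unfolding win_def by (metis of_nat_sum)
  then show ?thesis using sum_s n_pos by (simp add: avg_s_def field_simps)
qed

lemma colwinI: "win (Q * r) t \<Longrightarrow> NN t \<noteq> 0 \<Longrightarrow> colwin m n s H Q t"
proof -
  assume w: "win (Q * r) t" and N: "NN t \<noteq> 0"
  show ?thesis
  proof unfold_locales
    show "(\<Sum>k<n. t k) = (\<Sum>j<m. s j)" using w by (simp add: win_def)
    show "\<bar>real (t k) - avg_s n t\<bar> \<le> Q * sqrt (real n)" if "k < n" for k
      using w that win_avg[OF w] by (simp add: win_def r_def)
    show "bip_graphs m n s t H \<noteq> {}" using N by (auto simp: NN_def)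
  qed
qed

lemma PP_pos: "win (Q * r) t \<Longrightarrow> NN t \<noteq> 0 \<Longrightarrow> 0 < PP t"
proof -
  assume w: "win (Q * r) t" and N: "NN t \<noteq> 0"
  interpret c: colwin m n s H Q t by (rule colwinI[OF w N])
  obtain G where G: "G \<in> c.\<Omega>" using c.\<Omega>_ne by auto
  show ?thesis unfolding PP_def
  proof (rule prod_pos)
    fix k assume "k \<in> {..<n}"
    then have "real (t k) + y k \<le> real m" using c.free_col_card[OF G] by simp
    then have "t k \<le> m - degV H k" unfolding y_def by linarith
    then show "0 < real ((m - degV H k) choose t k)" by simp
  qed
qed

definition mv :: "nat \<Rightarrow> nat \<Rightarrow> (nat \<Rightarrow> nat) \<Rightarrow> nat \<Rightarrow> nat"
  where "mv k l t = t(k := t k + 1, l := t l - 1)"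

lemma sum_mv:
  assumes "k \<noteq> l" "k < n" "l < n"
  shows "(\<Sum>i<n. g i (mv k l t i)) = (\<Sum>i<n. g i (t i)) + (g k (t k + 1) - g k (t k)) + (g l (t l - 1) - g l (t l) :: real)"
proof -
  have s: "(\<Sum>i<n. h i) = h k + (h l + (\<Sum>i\<in>{..<n} - {k} - {l}. h i))" for h :: "nat \<Rightarrow> real"
    using assms by (subst sum.remove[of _ k], simp, simp, subst sum.remove[of _ l]) auto
  have "(\<Sum>i\<in>{..<n} - {k} - {l}. g i (mv k l t i)) = (\<Sum>i\<in>{..<n} - {k} - {l}. g i (t i))"
    by (intro sum.cong) (auto simp: mv_def)
  then show ?thesis using assms unfolding s[of "\<lambda>i. g i (mv k l t i)"] s[of "\<lambda>i. g i (t i)"]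
    by (simp add: mv_def)
qed

lemma PP_mv:
  assumes kl: "k \<noteq> l" "k < n" "l < n" and tl: "0 < t l" and yk: "real (t k) + y k \<le> real m" and yl: "real (t l) + y l \<le> real m"
  shows "PP (mv k l t) = PP t * ((real m - y k - real (t k)) * real (t l) / ((real (t k) + 1) * (real m - y l - real (t l) + 1)))"
proof -
  have s: "(\<Prod>i<n. h i) = h k * (h l * (\<Prod>i\<in>{..<n} - {k} - {l}. h i))" for h :: "nat \<Rightarrow> real"
    using kl by (subst prod.remove[of _ k], simp, simp, subst prod.remove[of _ l]) auto
  define P0 where "P0 = (\<Prod>i\<in>{..<n} - {k} - {l}. real ((m - degV H i) choose t i))"
  have e: "(\<Prod>i\<in>{..<n} - {k} - {l}. real ((m - degV H i) choose mv k l t i)) = P0"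
    unfolding P0_def by (intro prod.cong) (auto simp: mv_def)
  have Mk: "real (m - degV H k) = real m - y k" "real (m - degV H l) = real m - y l"
    using yk yl by (auto simp: y_def of_nat_diff)
  obtain u where u: "t l = Suc u" using tl by (cases "t l") auto
  have 1: "real ((m - degV H k) choose (t k + 1)) = real ((m - degV H k) choose t k) * ((real m - y k - real (t k)) / (real (t k) + 1))"
    using choose_Suc_real[of "t k" "m - degV H k"] unfolding Mk by (simp add: field_simps)
  have p: "0 < real m - y l - real (t l) + 1" using yl by simp
  have 2: "real ((m - degV H l) choose (t l - 1)) = real ((m - degV H l) choose t l) * (real (t l) / (real m - y l - real (t l) + 1))"
    using choose_Suc_real[of u "m - degV H l"] p unfolding Mk u by (simp add: field_simps)
  have "PP (mv k l t) = real ((m - degV H k) choose (t k + 1)) * (real ((m - degV H l) choose (t l - 1)) * P0)"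
    unfolding PP_def s e using kl by (simp add: mv_def)
  moreover have "PP t = real ((m - degV H k) choose t k) * (real ((m - degV H l) choose t l) * P0)"
    unfolding PP_def s P0_def ..
  ultimately show ?thesis unfolding 1 2 by simp
qed

text \<open>Grouped by columns, Y is affine in t as long as the average is fixed. A move therefore
  changes it by the difference of two sums over forbidden rows.\<close>

lemma Ysum_eq:
  assumes "avg_s n t = lam * real m"
  shows "Ysum m n s t H = (\<Sum>i<n. (\<Sum>j\<in>col H i. real (s j) - lam * real n + lam * real (degU H j))
    * (real (t i) - lam * real m + lam * real (degV H i)))"
proof -
  let ?d = "\<lambda>j. real (s j) - lam * real n + lam * real (degU H j)"
  have "Ysum m n s t H = (\<Sum>(j,i)\<in>H. ?d j * (real (t i) - lam * real m + lam * real (degV H i)))"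
    unfolding Ysum_def assms avg_s_eq lam_def[symmetric] ..
  also have "\<dots> = (\<Sum>(i,j)\<in>(SIGMA i:{..<n}. col H i). ?d j * (real (t i) - lam * real m + lam * real (degV H i)))"
    by (rule sum.reindex_bij_witness[where i = "\<lambda>(i,j). (j,i)" and j = "\<lambda>(j,i). (i,j)"])
      (use Hsub in \<open>auto simp: col_def\<close>)
  also have "\<dots> = (\<Sum>i<n. \<Sum>j\<in>col H i. ?d j * (real (t i) - lam * real m + lam * real (degV H i)))"
    by (rule sum.Sigma[symmetric]) (use finite_colH in auto)
  finally show ?thesis by (simp only: sum_distrib_right)
qed

lemma Ysum_mv:
  assumes kl: "k \<noteq> l" "k < n" "l < n" and tl: "0 < t l" and w: "win c t" "win c (mv k l t)"
  shows "Ysum m n s (mv k l t) H = Ysum m n s t H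
    + (\<Sum>j\<in>col H k. real (s j) - lam * real n + lam * real (degU H j)) - (\<Sum>j\<in>col H l. real (s j) - lam * real n + lam * real (degU H j))"
  unfolding Ysum_eq[OF win_avg[OF w(1)]] Ysum_eq[OF win_avg[OF w(2)]]
  by (subst sum_mv[OF kl]) (use tl in \<open>simp add: of_nat_diff algebra_simps\<close>)

lemma Rsum_mv:
  assumes kl: "k \<noteq> l" "k < n" "l < n" and tl: "0 < t l" and w: "win c t" "win c (mv k l t)"
  shows "Rsum n (mv k l t) = Rsum n t - 2 * (real (t l) - real (t k) - 1)"
  unfolding Rsum_def win_avg[OF w(1)] win_avg[OF w(2)]
  by (subst sum_mv[OF kl]) (use tl in \<open>simp add: of_nat_diff power2_eq_square algebra_simps\<close>)

lemma AA_pos: "0 < AA" using lam01 m_pos n_pos by (simp add: AA_def)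

text \<open>NN t * EE f counts the graphs with the new column sums that can be moved back, which is
  all but a share of order r^-49. Dividing by the changes \<open>rho\<close> of the binomials and
  exp kap0 of the exponential factor leaves a ratio that \<open>mean_switch\<close> puts within
  order r^-4 * (1 + y k) of 1.\<close>

lemma Th_step:
  assumes kl: "k \<noteq> l" "k < n" "l < n" and yl: "y l \<le> Q ^ 2" and tl: "0 < t l"
    and w: "win (Q * r) t" "win (Q * r) (mv k l t)"
  shows "\<bar>Th (mv k l t) - Th t\<bar> \<le> Q ^ 69 * r powi (-4) * (1 + y k) * Th t"
proof (cases "NN t = 0")
  case True
  \<comment> \<open>A vector without graphs stays without graphs: otherwise a typical graph of the
    new vector could be moved back. Both values of \<open>Th\<close> are then 0.\<close>
  have "NN (mv k l t) = 0"
  proof (rule ccontr)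
    assume N: "NN (mv k l t) \<noteq> 0"
    interpret c: colwin m n s H Q "mv k l t" by (rule colwinI[OF w(2) N])
    obtain G where G: "c.typical G" using c.bad_typ_half by auto
    have "G \<in> {G \<in> bip_graphs m n s (mv k l t) H. free H G k l \<inter> col G k \<noteq> {}}"
      using c.typ_nonempty[OF G kl] c.typ_\<Omega>[OF G] by (simp add: c.\<Omega>_def)
    moreover have "finite {G \<in> bip_graphs m n s (mv k l t) H. free H G k l \<inter> col G k \<noteq> {}}"
      using finite_bip_graphs by simp
    ultimately have "real (card {G \<in> bip_graphs m n s (mv k l t) H. free H G k l \<inter> col G k \<noteq> {}}) \<noteq> 0" by auto
    moreover have "bip_graphs m n s t H = {}" using True finite_bip_graphs[of m n s t H] by (simp add: NN_def)
    ultimately show False using switch_count[where t = t and m = m and s = s and H = H, OF kl tl] unfolding mv_def by simp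
  qed
  then show ?thesis using True by (simp add: Th_def)
next
  case False
  interpret c: colwin m n s H Q t by (rule colwinI[OF w(1) False])
  interpret c: switch m n s H Q t k l by unfold_locales (use kl yl in auto)
  define E where "E = c.rho * exp c.kap0"
  have h1: "1 \<le> 1 + y k" by (simp add: y_nonneg)
  have bnds: "\<bar>c.rho - 1\<bar> \<le> 1 / 4" "\<bar>c.kap0\<bar> \<le> 1 / 4"
  proof -
    have small: "Q ^ a * r powi (-1) \<le> 1 / 4" if "a \<le> 99" for a
    proof -
      have "4 * Q ^ a \<le> Q * Q ^ a" using Q16 by (intro mult_right_mono) auto
      also have "\<dots> = Q ^ Suc a" by simp
      also have "\<dots> \<le> Q ^ 100" using that Qpos by (intro power_increasing) auto
      finally have "4 * Q ^ a \<le> r" using r_ge by linarith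
      then show ?thesis using r_pos by (simp add: power_int_minus divide_inverse[symmetric] divide_simps)
    qed
    show "\<bar>c.rho - 1\<bar> \<le> 1 / 4" using c.bd_rho small[of 12] by (simp add: bd_def)
    have "bd 1 14 (-1) c.kap0" by (rule bd_weak[OF c.bd_kap0(2)]) auto
    then show "\<bar>c.kap0\<bar> \<le> 1 / 4" using small[of 14] by (simp add: bd_def)
  qed
  have E: "1 / 2 \<le> E"
  proof -
    have "3 / 4 \<le> exp c.kap0" using exp_ge_add_one_self[of c.kap0] bnds(2) by linarith
    moreover have "3 / 4 \<le> c.rho" using bnds(1) by linarith
    ultimately have "(3 / 4) * (3 / 4) \<le> E" unfolding E_def by (intro mult_mono) auto
    then show ?thesis by simp
  qed
  have ms: "bd (1 + y k) 66 (-4) (c.EE c.f - E)" unfolding E_def by (rule c.mean_switch)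
  have Epos: "0 < c.EE c.f"
  proof -
    have "bd 1 68 (-3) (c.EE c.f - E)"
    proof -
      have "1 + y k \<le> Q ^ 2 * r"
      proof -
        have "y k \<le> Q * r" using bd_y[OF kl(2)] y_nonneg[of k] by (simp add: bd_def)
        moreover have "1 \<le> Q * r" using Qpos r_pos mult_mono[of 1 Q 1 r] by simp
        moreover have "2 * (Q * r) \<le> Q * (Q * r)" using Qpos r_pos by (intro mult_right_mono) auto
        ultimately show ?thesis by (simp add: power2_eq_square mult_ac)
      qed
      then have "Q ^ 66 * r powi (-4) * (1 + y k) \<le> Q ^ 66 * r powi (-4) * (Q ^ 2 * r)"
        using Qpos r_pos by (intro mult_left_mono) auto
      also have "\<dots> = Q ^ 68 * r powi (-3)"
      proof -
        have "r powi (-3) = r powi (-4) * r" using r_pos power_int_add[of r "-4" 1] by simp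
        moreover have "Q ^ 68 = Q ^ 66 * Q ^ 2" by (simp add: power_add[symmetric])
        ultimately show ?thesis by (simp only: mult_ac)
      qed
      finally show ?thesis using ms by (simp add: bd_def)
    qed
    then have "bd 1 0 (-2) (c.EE c.f - E)" using bd_trade[of 1 68 "-3" _ 0 1] by simp
    then have "\<bar>c.EE c.f - E\<bar> \<le> r powi (-2)" by (simp add: bd_def)
    also have "\<dots> \<le> 1 / 4"
    proof -
      have "2 \<le> r" using r_ge power_increasing[of 1 100 Q] Q16 by simp
      then have "2 * 2 \<le> r * r" by (intro mult_mono) auto
      then show ?thesis using r_pos by (simp add: power_int_minus power2_eq_square divide_simps)
    qed
    finally show ?thesis using E by linarith
  qed
  let ?B = "{G \<in> bip_graphs m n s (mv k l t) H. free H G k l \<inter> col G k \<noteq> {}}"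
  have cnt: "NN t * c.EE c.f = real (card ?B)"
    using switch_count[where t = t and m = m and s = s and H = H, OF kl tl] False
    unfolding c.EE_def mean_def c.\<Omega>_def c.f_def NN_def mv_def by simp
  have Np: "0 < NN t" using False by (simp add: NN_def)
  have "0 < real (card ?B)" unfolding cnt[symmetric] using Np Epos by simp
  moreover have "card ?B \<le> card (bip_graphs m n s (mv k l t) H)"
    by (rule card_mono[OF finite_bip_graphs]) auto
  ultimately have N': "NN (mv k l t) \<noteq> 0" unfolding NN_def by simp
  interpret d: colwin m n s H Q "mv k l t" by (rule colwinI[OF w(2) N'])
  \<comment> \<open>The share of new graphs without a free entry in column k, which
    \<open>switch_count\<close> does not see. All of them are atypical.\<close>
  define \<beta> where "\<beta> = 1 - real (card ?B) / NN (mv k l t)"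
  have N'p: "0 < NN (mv k l t)" using N' by (simp add: NN_def)
  have b0: "0 \<le> \<beta>" unfolding \<beta>_def using \<open>card ?B \<le> card (bip_graphs m n s (mv k l t) H)\<close> N'p
    by (simp add: divide_le_eq_1 NN_def)
  have b1: "\<beta> \<le> r powi (-49)"
  proof -
    have "\<beta> = d.EE (\<lambda>G. of_bool (free H G k l \<inter> col G k = {}))"
    proof -
      have "d.EE (\<lambda>G. of_bool (free H G k l \<inter> col G k \<noteq> {})) = real (card ?B) / NN (mv k l t)"
        unfolding d.EE_def mean_def d.\<Omega>_def NN_def
        by (subst sum_of_bool_eq) (simp_all add: finite_bip_graphs Int_def)
      moreover have "d.EE (\<lambda>G. of_bool (free H G k l \<inter> col G k = {})) = d.EE (\<lambda>G. 1 - of_bool (free H G k l \<inter> col G k \<noteq> {}))"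
        by (rule d.EE_cong) auto
      ultimately show ?thesis unfolding \<beta>_def by (simp only: d.EE_diff d.EE_const)
    qed
    also have "\<dots> \<le> d.bad (\<lambda>G. \<not> d.typical G)"
      unfolding d.bad_def by (rule d.EE_mono) (use d.typ_nonempty[OF _ kl] in auto)
    also have "\<dots> \<le> r powi (-49)" by (rule d.bad_typ)
    finally show ?thesis .
  qed
  have N'e: "NN (mv k l t) * (1 - \<beta>) = NN t * c.EE c.f" unfolding cnt \<beta>_def using N'p by simp
  have PPe: "PP (mv k l t) = PP t * c.rho"
  proof -
    obtain G where G: "G \<in> c.\<Omega>" using c.\<Omega>_ne by auto
    show ?thesis unfolding c.rho_def c.tk_def c.tl_def
      by (rule PP_mv[OF kl tl c.free_col_card[OF G kl(2)] c.free_col_card[OF G kl(3)]])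
  qed
  have phe: "phi (mv k l t) = phi t + c.kap0"
  proof -
    have Y: "Ysum m n s (mv k l t) H = Ysum m n s t H - c.DD"
      unfolding Ysum_mv[OF kl tl w] c.DD_def c.dlt_def by simp
    have R: "Rsum n (mv k l t) = Rsum n t - 2 * c.p"
      unfolding Rsum_mv[OF kl tl w] c.p_def c.tl_def c.tk_def ..
    have A: "AA = c.a0 * real n" by (simp add: AA_def c.a0_def)
    have k0: "c.kap0 = c.p * (Rsum m s / AA) / AA - c.p / AA + c.DD / AA"
      unfolding c.kap0_def c.S1_def A using c.pos by (simp add: field_simps)
    have "phi (mv k l t) - phi t = - (c.p / AA) * (1 - Rsum m s / AA) + c.DD / AA"
      unfolding phi_def Y R by (simp add: diff_divide_distrib algebra_simps)
    also have "\<dots> = c.kap0" unfolding k0 by (simp add: algebra_simps)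
    finally show ?thesis by simp
  qed
  have Pp: "0 < PP t" by (rule PP_pos[OF w(1) False])
  have Thp: "0 < Th t" unfolding Th_def using Np Pp by simp
  have ThE: "Th (mv k l t) * E * (1 - \<beta>) = Th t * c.EE c.f"
  proof -
    have "Th (mv k l t) * E = NN (mv k l t) / (PP t * exp (phi t))"
      unfolding Th_def PPe phe E_def exp_add using E unfolding E_def by auto
    then show ?thesis using N'e unfolding Th_def by simp
  qed
  define e where "e = Q ^ 66 * r powi (-4) * (1 + y k)"
  have e0: "0 \<le> e" unfolding e_def using Qpos r_pos h1 by simp
  have ee: "\<bar>c.EE c.f - E\<bar> \<le> e" using ms by (simp add: bd_def e_def)
  have rb: "\<beta> \<le> e" "\<beta> \<le> 1 / 2"
  proof -
    have "r powi (-49) \<le> r powi (-4)" using r_pos by (intro power_int_increasing) auto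
    also have "\<dots> \<le> e"
    proof -
      have "1 * r powi (-4) * 1 \<le> e" unfolding e_def
        using h1 Qpos r_pos one_le_power[OF Qpos(2), of 66] by (intro mult_mono) auto
      then show ?thesis by simp
    qed
    finally show "\<beta> \<le> e" using b1 by linarith
    have "2 \<le> r" using r_ge power_increasing[of 1 100 Q] Q16 by simp
    have "r powi (-49) \<le> r powi (-1)" using r_pos by (intro power_int_increasing) auto
    also have "\<dots> \<le> 1 / 2" using \<open>2 \<le> r\<close> by (simp add: power_int_minus divide_simps)
    finally show "\<beta> \<le> 1 / 2" using b1 by linarith
  qed
  define x where "x = Th (mv k l t) - Th t"
  have "x * (E * (1 - \<beta>)) = Th t * ((c.EE c.f - E) + E * \<beta>)"
    using ThE unfolding x_def by (simp add: algebra_simps)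
  then have "\<bar>x\<bar> * (E * (1 - \<beta>)) = Th t * \<bar>(c.EE c.f - E) + E * \<beta>\<bar>"
  proof -
    have "0 \<le> E * (1 - \<beta>)" using E rb(2) by (intro mult_nonneg_nonneg) auto
    then have "\<bar>x\<bar> * (E * (1 - \<beta>)) = \<bar>x * (E * (1 - \<beta>))\<bar>" unfolding abs_mult[of x] by simp
    also have "\<dots> = Th t * \<bar>(c.EE c.f - E) + E * \<beta>\<bar>"
      unfolding \<open>x * (E * (1 - \<beta>)) = Th t * ((c.EE c.f - E) + E * \<beta>)\<close> abs_mult using Thp by simp
    finally show ?thesis .
  qed
  also have "\<dots> \<le> Th t * (e + E * e)"
    using ee rb(1) b0 E Thp by (intro mult_left_mono order_trans[OF abs_triangle_ineq] add_mono) (auto simp: abs_mult)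
  \<comment> \<open>As 1 <= 2 * E, the term e is at most 2 * E * e. The common factor E is needed to
    cancel the one on the left.\<close>
  also have "\<dots> \<le> Th t * (3 * E * e)"
  proof (rule mult_left_mono)
    have "1 * e \<le> (2 * E) * e" using E e0 by (intro mult_right_mono) auto
    then show "e + E * e \<le> 3 * E * e" by (simp add: algebra_simps)
  qed (use Thp in simp)
  finally have "\<bar>x\<bar> * (E * (1 - \<beta>)) \<le> 3 * e * Th t * E" by (simp add: mult_ac)
  moreover have "\<bar>x\<bar> * (E * (1 / 2)) \<le> \<bar>x\<bar> * (E * (1 - \<beta>))"
    using E rb(2) by (intro mult_left_mono) auto
  ultimately have "\<bar>x\<bar> * (E * (1 / 2)) \<le> 3 * e * Th t * E" by linarith
  then have "\<bar>x\<bar> * (1 / 2) * E \<le> 3 * e * Th t * E" by (simp add: mult_ac)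
  then have "\<bar>x\<bar> * (1 / 2) \<le> 3 * e * Th t" using E by (simp add: mult_le_cancel_right)
  then have "\<bar>x\<bar> \<le> 6 * (e * Th t)" by simp
  also have "\<dots> \<le> Q * (e * Th t)" using Q16 e0 Thp by (intro mult_right_mono) auto
  also have "\<dots> \<le> (Q * Q * Q) * (e * Th t)"
  proof (rule mult_right_mono)
    have "Q * 1 \<le> Q * (Q * Q)" using Qpos mult_mono[of 1 Q 1 Q] by (intro mult_left_mono) auto
    then show "Q \<le> Q * Q * Q" by (simp add: mult_ac)
  qed (use e0 Thp in simp)
  also have "\<dots> = Q ^ 69 * r powi (-4) * (1 + y k) * Th t"
  proof -
    have "Q ^ 69 = Q * Q * Q * Q ^ 66" by (simp add: power_add[symmetric] power_Suc[symmetric] mult.assoc del: power_Suc)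
    then show ?thesis unfolding e_def by (simp only: mult_ac)
  qed
  finally show ?thesis unfolding x_def .
qed

end

section \<open>Connecting all column sums in the window\<close>

text \<open>Equality up to a factor exp e either way, stated without a quotient so that it remains
  meaningful when a count is 0. The exponents simply add along a path.\<close>

definition near :: "real \<Rightarrow> real \<Rightarrow> real \<Rightarrow> bool"
  where "near e a b \<longleftrightarrow> a \<le> b * exp e \<and> b \<le> a * exp e"

lemma near_sym: "near e a b \<Longrightarrow> near e b a" by (simp add: near_def)

lemma near_mono: "near e a b \<Longrightarrow> 0 \<le> a \<Longrightarrow> 0 \<le> b \<Longrightarrow> e \<le> e' \<Longrightarrow> near e' a b"
  unfolding near_def
  by (meson exp_le_cancel_iff mult_left_mono order_trans)

lemma near_trans: "near e a b \<Longrightarrow> near e' b c \<Longrightarrow> near (e + e') a c"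
proof -
  assume 1: "near e a b" "near e' b c"
  have "a \<le> b * exp e" using 1 by (simp add: near_def)
  also have "\<dots> \<le> (c * exp e') * exp e" using 1 by (intro mult_right_mono) (auto simp: near_def)
  finally have A: "a \<le> c * exp (e + e')" by (simp add: exp_add mult_ac)
  have "c \<le> b * exp e'" using 1 by (simp add: near_def)
  also have "\<dots> \<le> (a * exp e) * exp e'" using 1 by (intro mult_right_mono) (auto simp: near_def)
  finally show ?thesis using A by (simp add: near_def exp_add mult_ac)
qed

text \<open>The factor 2 and the bound on e come from (1 - e) * (1 + 2 * e) >= 1 for e <= 1 /
  2.\<close>

lemma nearI:
  assumes "\<bar>b - a\<bar> \<le> e * a" "0 \<le> a" "0 \<le> e" "e \<le> 1 / 2"
  shows "near (2 * e) a b"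
proof -
  have "b \<le> a * (1 + 2 * e)" using assms mult_nonneg_nonneg[of e a] by (simp add: algebra_simps)
  also have "\<dots> \<le> a * exp (2 * e)" using exp_ge_add_one_self[of "2 * e"] assms by (intro mult_left_mono) auto
  finally have 1: "b \<le> a * exp (2 * e)" .
  have ba: "a * (1 - e) \<le> b" using assms by (simp add: algebra_simps)
  have "e * e \<le> (1 / 2) * e" using assms by (intro mult_right_mono) auto
  then have "1 \<le> (1 - e) * (1 + 2 * e)" by (simp add: algebra_simps)
  also have "\<dots> \<le> (1 - e) * exp (2 * e)" using exp_ge_add_one_self[of "2 * e"] assms by (intro mult_left_mono) auto
  finally have "a * 1 \<le> a * ((1 - e) * exp (2 * e))" using assms by (intro mult_left_mono) auto
  also have "\<dots> = (a * (1 - e)) * exp (2 * e)" by simp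
  also have "\<dots> \<le> b * exp (2 * e)" using ba by (intro mult_right_mono) auto
  finally show ?thesis using 1 by (simp add: near_def)
qed

context dense
begin

definition cst :: "nat \<Rightarrow> real" where "cst k = 2 * (Q ^ 69 * r powi (-4) * (1 + y k))"

lemma bd_cst: "bd (1 + y k) 70 (-4) (cst k)"
proof -
  have "bd (1 + y k) 69 (-4) (Q ^ 69 * r powi (-4) * (1 + y k))"
    using y_nonneg[of k] Qpos r_pos by (simp add: bd_def)
  from bd_mult[OF bd_const[of 2] this] show ?thesis unfolding cst_def by simp
qed

lemma cst_nonneg: "0 \<le> cst k" using y_nonneg[of k] Qpos r_pos by (simp add: cst_def)

lemma Th_nonneg: "0 \<le> Th t"
  unfolding Th_def NN_def PP_def by (intro divide_nonneg_nonneg mult_nonneg_nonneg prod_nonneg) auto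

lemma Th_near_step:
  assumes kl: "k \<noteq> l" "k < n" "l < n" and yl: "y l \<le> Q ^ 2" and tl: "0 < t l"
    and w: "win (Q * r) t" "win (Q * r) (mv k l t)"
  shows "near (cst k) (Th t) (Th (mv k l t))"
  unfolding cst_def
proof (rule nearI[OF Th_step[OF assms] Th_nonneg])
  show "0 \<le> Q ^ 69 * r powi (-4) * (1 + y k)" using y_nonneg[of k] Qpos r_pos by simp
  have g: "bd 1 2 1 (1 + y k)"
    by (rule bd_weak[OF bd_add[OF bd_weak[OF bd_one[of 1], of 1 0 1] bd_y[OF kl(2)]]]) auto
  have "bd 1 69 (-4) (Q ^ 69 * r powi (-4))" using Qpos r_pos by (simp add: bd_def)
  from bd_mult[OF this g] have "bd 1 71 (-3) (Q ^ 69 * r powi (-4) * (1 + y k))" by simp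
  then have "bd 1 0 (-2) (Q ^ 69 * r powi (-4) * (1 + y k))" using bd_trade[of 1 71 "-3" _ 0 1] by simp
  then have "Q ^ 69 * r powi (-4) * (1 + y k) \<le> r powi (-2)" by (simp add: bd_def)
  also have "\<dots> \<le> 1 / 2"
  proof -
    have "2 \<le> r" using r_ge power_increasing[of 1 100 Q] Q16 by simp
    then have "2 * 1 \<le> r * r" using r_pos by (intro mult_mono) auto
    then show ?thesis using r_pos by (simp add: power_int_minus power2_eq_square divide_simps)
  qed
  finally show "Q ^ 69 * r powi (-4) * (1 + y k) \<le> 1 / 2" .
qed

text \<open>The average of y over the columns is at most Q, so not all values can exceed
  Q^2.\<close>

lemma reservoir: "\<exists>l<n. y l \<le> Q ^ 2"
proof (rule ccontr)
  assume "\<not> ?thesis"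
  then have "Q ^ 2 < y l" if "l < n" for l using that by auto
  then have "(\<Sum>l<n. Q ^ 2) < (\<Sum>l<n. y l)" using n_pos by (intro sum_strict_mono) auto
  then have "real n * (Q * Q) < Q * real n" using sum_y H_le by (simp add: power2_eq_square)
  moreover have "real n * (Q * 1) \<le> real n * (Q * Q)" using Qpos by (intro mult_left_mono) auto
  ultimately show False by (simp add: mult_ac)
qed

lemma win_pos: "win (Q * r) t \<Longrightarrow> k < n \<Longrightarrow> 0 < t k"
proof -
  assume w: "win (Q * r) t" and k: "k < n"
  have lm: "lo 2 2 (lam * real m)" using lo_mult[OF lo_lam lo_m] by (simp add: numeral_2_eq_2)
  have "bd 1 1 1 (real (t k) - lam * real m)" using w k by (simp add: win_def bd_def)
  from lo_pos[OF lo_approx[OF lm this]] show ?thesis by simp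
qed

lemma win_mono: "win c t \<Longrightarrow> c \<le> c' \<Longrightarrow> win c' t" unfolding win_def by force

lemma sum_mv_nat: "k \<noteq> l \<Longrightarrow> k < n \<Longrightarrow> l < n \<Longrightarrow> 0 < t l \<Longrightarrow> (\<Sum>i<n. mv k l t i) = (\<Sum>i<n. t i)"
proof -
  assume a: "k \<noteq> l" "k < n" "l < n" "0 < t l"
  have "real (\<Sum>i<n. mv k l t i) = real (\<Sum>i<n. t i)"
    using sum_mv[OF a(1-3), of "\<lambda>_ x. real x" t] a(4) by (simp add: of_nat_diff)
  then show ?thesis by linarith
qed

lemma win_mv:
  assumes "win c t" "k \<noteq> l" "k < n" "l < n" "0 < t l"
  shows "win (c + 1) (mv k l t)"
proof -
  have "\<bar>real (mv k l t i) - lam * real m\<bar> \<le> c + 1" if "i < n" for i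
  proof -
    have "\<bar>real (t i) - lam * real m\<bar> \<le> c" using assms(1) that by (simp add: win_def)
    moreover have "\<bar>real (mv k l t i) - real (t i)\<bar> \<le> 1" using assms(5) by (auto simp: mv_def of_nat_diff)
    ultimately show ?thesis by linarith
  qed
  then show ?thesis using assms sum_mv_nat[where t = t, OF assms(2-5)] by (simp add: win_def)
qed

text \<open>\<open>Th_step\<close> needs a giving column with few forbidden entries. A move from b
  to a is therefore replaced by two moves out of the reservoir l, into a from t and into b from the
  target, which end in the same vector. That vector may leave the smaller window by one unit, whence
  Q * r - 1.\<close>

lemma Th_near_move:
  assumes ab: "a \<noteq> b" "a < n" "b < n" and w: "win (Q * r - 1) t" "win (Q * r - 1) (mv a b t)"
  shows "near (cst a + cst b) (Th t) (Th (mv a b t))"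
proof -
  obtain l where l: "l < n" "y l \<le> Q ^ 2" using reservoir by auto
  have W: "win (Q * r) t" "win (Q * r) (mv a b t)" using win_mono[OF w(1)] win_mono[OF w(2)] by auto
  have tp: "0 < t i" "0 < mv a b t i" if "i < n" for i using win_pos[OF W(1) that] win_pos[OF W(2) that] .
  consider "b = l" | "a = l" | "a \<noteq> l" "b \<noteq> l" by blast
  then show ?thesis
  proof cases
    case 1
    have "near (cst a) (Th t) (Th (mv a b t))"
      by (rule Th_near_step[where t = t, OF ab _ tp(1)[OF ab(3)] W]) (use 1 l in auto)
    then show ?thesis by (rule near_mono[OF _ Th_nonneg Th_nonneg]) (use cst_nonneg[of b] in simp)
  next
    case 2
    have e: "mv b a (mv a b t) = t" using ab tp(1)[OF ab(3)] by (auto simp: mv_def fun_eq_iff)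
    have "near (cst b) (Th (mv a b t)) (Th (mv b a (mv a b t)))"
      by (rule Th_near_step[where t = "mv a b t", OF ab(1)[symmetric] ab(3,2) _ tp(2)[OF ab(2)] W(2)]) (use 2 l e W in auto)
    then have "near (cst b) (Th t) (Th (mv a b t))" unfolding e by (rule near_sym)
    then show ?thesis by (rule near_mono[OF _ Th_nonneg Th_nonneg]) (use cst_nonneg[of a] in simp)
  next
    case 3
    have e: "mv b l (mv a b t) = mv a l t" using ab tp(1)[OF ab(3)] 3 by (auto simp: mv_def fun_eq_iff)
    have W1: "win (Q * r) (mv a l t)" using win_mv[where t = t, OF w(1) 3(1) ab(2) l(1) tp(1)[OF l(1)]] by simp
    have 1: "near (cst a) (Th t) (Th (mv a l t))"
      by (rule Th_near_step[where t = t, OF 3(1) ab(2) l tp(1)[OF l(1)] W(1) W1])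
    have "near (cst b) (Th (mv a b t)) (Th (mv b l (mv a b t)))"
      by (rule Th_near_step[where t = "mv a b t", OF 3(2) ab(3) l tp(2)[OF l(1)] W(2)]) (use e W1 in auto)
    from near_trans[OF 1 near_sym[OF this[unfolded e]]] show ?thesis .
  qed
qed

lemma Th_cong:
  assumes "\<And>k. k < n \<Longrightarrow> t k = t' k"
  shows "Th t = Th t'"
proof -
  have 1: "bip_graphs m n s t H = bip_graphs m n s t' H" using assms by (auto simp: bip_graphs_def)
  have 2: "PP t = PP t'" unfolding PP_def by (intro prod.cong) (use assms in auto)
  have 3: "avg_s n t = avg_s n t'" unfolding avg_s_def using assms by (auto intro!: sum.cong)
  have 4: "Rsum n t = Rsum n t'" unfolding Rsum_def 3 by (intro sum.cong) (use assms in auto)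
  have 5: "Ysum m n s t H = Ysum m n s t' H" unfolding Ysum_def 3
    by (intro sum.cong) (use assms Hsub in auto)
  show ?thesis unfolding Th_def NN_def phi_def 1 2 4 5 ..
qed

text \<open>Induction on the sum of the coordinate differences. A unit taken from an excessive
  coordinate b and given to a deficient coordinate a keeps every coordinate between t and t', hence
  in the window, and reduces both differences by one, which pays exactly for cst a + cst b.\<close>

lemma Th_path:
  assumes "win (Q * r - 1) t" "win (Q * r - 1) t'"
  shows "near (\<Sum>k<n. \<bar>real (t k) - real (t' k)\<bar> * cst k) (Th t) (Th t')"
  using assms
proof (induction "\<Sum>k<n. nat \<bar>int (t k) - int (t' k)\<bar>" arbitrary: t rule: less_induct)
  case less
  have sums: "(\<Sum>k<n. t k) = (\<Sum>k<n. t' k)" using less.prems by (simp add: win_def)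
  show ?case
  proof (cases "\<forall>k<n. t k = t' k")
    case True
    then show ?thesis using Th_cong[of t t'] by (simp add: near_def)
  next
    case False
    have "\<exists>a<n. t a < t' a"
    proof (rule ccontr)
      assume "\<not> ?thesis"
      then have le: "\<And>k. k \<in> {..<n} \<Longrightarrow> t' k \<le> t k" by (meson lessThan_iff not_less)
      obtain k where "k < n" "t k \<noteq> t' k" using False by auto
      then have "(\<Sum>k<n. t' k) < (\<Sum>k<n. t k)"
        by (intro sum_strict_mono_ex1) (use le in \<open>auto intro!: bexI[of _ k] simp: le_neq_implies_less\<close>)
      then show False using sums by simp
    qed
    then obtain a where a: "a < n" "t a < t' a" by auto
    have "\<exists>b<n. t' b < t b"
    proof (rule ccontr)
      assume "\<not> ?thesis"
      then have le: "\<And>k. k \<in> {..<n} \<Longrightarrow> t k \<le> t' k" by (meson lessThan_iff not_less)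
      then have "(\<Sum>k<n. t k) < (\<Sum>k<n. t' k)"
        by (intro sum_strict_mono_ex1) (use a in \<open>auto intro!: bexI[of _ a]\<close>)
      then show False using sums by simp
    qed
    then obtain b where b: "b < n" "t' b < t b" by auto
    have ab: "a \<noteq> b" "a < n" "b < n" using a b by auto
    let ?u = "mv a b t"
    have tb: "0 < t b" using b by simp
    have wu: "win (Q * r - 1) ?u"
    proof -
      have "\<bar>real (?u i) - lam * real m\<bar> \<le> Q * r - 1" if i: "i < n" for i
      proof -
        have "\<bar>real (t i) - lam * real m\<bar> \<le> Q * r - 1" "\<bar>real (t' i) - lam * real m\<bar> \<le> Q * r - 1"
          using less.prems i by (auto simp: win_def)
        moreover have "(t i \<le> ?u i \<and> ?u i \<le> t' i) \<or> (t' i \<le> ?u i \<and> ?u i \<le> t i) \<or> ?u i = t i"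
          using a b by (auto simp: mv_def)
        ultimately show ?thesis by (smt (verit) of_nat_le_iff)
      qed
      then show ?thesis using less.prems(1) sum_mv_nat[where t = t, OF ab tb] by (simp add: win_def)
    qed
    have d: "(\<Sum>k<n. g k (?u k)) = (\<Sum>k<n. g k (t k)) + (g a (t a + 1) - g a (t a)) + (g b (t b - 1) - g b (t b) :: real)" for g
      by (rule sum_mv[OF ab])
    have "real (\<Sum>k<n. nat \<bar>int (?u k) - int (t' k)\<bar>) = (\<Sum>k<n. \<bar>real (?u k) - real (t' k)\<bar>)"
      by (simp add: of_nat_diff)
    also have "\<dots> = (\<Sum>k<n. \<bar>real (t k) - real (t' k)\<bar>) - 2"
      using d[of "\<lambda>k x. \<bar>real x - real (t' k)\<bar>"] a b by (simp add: of_nat_diff)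
    also have "(\<Sum>k<n. \<bar>real (t k) - real (t' k)\<bar>) = real (\<Sum>k<n. nat \<bar>int (t k) - int (t' k)\<bar>)"
      by (simp add: of_nat_diff)
    finally have dec: "(\<Sum>k<n. nat \<bar>int (?u k) - int (t' k)\<bar>) < (\<Sum>k<n. nat \<bar>int (t k) - int (t' k)\<bar>)" by linarith
    have IH: "near (\<Sum>k<n. \<bar>real (?u k) - real (t' k)\<bar> * cst k) (Th ?u) (Th t')"
      by (rule less.hyps[OF dec wu less.prems(2)])
    have "(\<Sum>k<n. \<bar>real (?u k) - real (t' k)\<bar> * cst k) = (\<Sum>k<n. \<bar>real (t k) - real (t' k)\<bar> * cst k) - cst a - cst b"
      using d[of "\<lambda>k x. \<bar>real x - real (t' k)\<bar> * cst k"] a b by (simp add: of_nat_diff algebra_simps)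
    with near_trans[OF Th_near_move[OF ab less.prems(1) wu] IH] show ?thesis by simp
  qed
qed

text \<open>Each coordinate has to move by at most order r at a cost r^-4 * (1 + y k) per unit, and
  the weights add up to order r^2.\<close>

theorem Th_const:
  assumes "win (Q * r - 1) t" "win (Q * r - 1) t'"
  shows "near (Q ^ 74 * r powi (-1)) (Th t) (Th t')"
proof -
  have "bd 1 (72 + 2) (-3 + 2) (\<Sum>k<n. \<bar>real (t k) - real (t' k)\<bar> * cst k)"
  proof (rule bd_sum_weighted[OF _ bd_sum_1y])
    fix k assume "k \<in> {..<n}"
    then have k: "k < n" by simp
    have "bd 1 1 1 (real (t k) - lam * real m)" "bd 1 1 1 (real (t' k) - lam * real m)"
      using assms k by (auto simp: win_def bd_def)
    from bd_diff[OF this] have "bd 1 2 1 \<bar>real (t k) - real (t' k)\<bar>" by (simp add: bd_abs numeral_2_eq_2)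
    from bd_mult[OF this bd_cst] show "bd (1 + y k) 72 (-3) (\<bar>real (t k) - real (t' k)\<bar> * cst k)" by simp
  qed
  then have "(\<Sum>k<n. \<bar>real (t k) - real (t' k)\<bar> * cst k) \<le> Q ^ 74 * r powi (-1)" by (simp add: bd_def)
  then show ?thesis by (rule near_mono[OF Th_path[OF assms] Th_nonneg Th_nonneg])
qed

end

section \<open>The model with fixed row sums only\<close>

lemma mean_insert:
  assumes "x \<notin> I" "finite I" "\<And>i. i \<in> insert x I \<Longrightarrow> finite (B i)"
  shows "mean (PiE (insert x I) B) f = mean (PiE I B) (\<lambda>S. mean (B x) (\<lambda>T. f (S(x := T))))"
proof -
  have inj: "inj_on (\<lambda>(y, g). g(x := y)) (B x \<times> PiE I B)" by (rule inj_combinator[OF assms(1)])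
  have fin: "finite (PiE I B)" "finite (B x)" using assms by (auto intro: finite_PiE)
  have "(\<Sum>S\<in>PiE (insert x I) B. f S) = (\<Sum>(T,S)\<in>B x \<times> PiE I B. f (S(x := T)))"
    unfolding PiE_insert_eq by (subst sum.reindex[OF inj]) (simp add: case_prod_unfold)
  also have "\<dots> = (\<Sum>T\<in>B x. \<Sum>S\<in>PiE I B. f (S(x := T)))" by (rule sum.cartesian_product[symmetric])
  also have "\<dots> = (\<Sum>S\<in>PiE I B. \<Sum>T\<in>B x. f (S(x := T)))" by (rule sum.swap)
  finally have "(\<Sum>S\<in>PiE (insert x I) B. f S) = (\<Sum>S\<in>PiE I B. \<Sum>T\<in>B x. f (S(x := T)))" .
  moreover have "card (PiE (insert x I) B) = card (B x) * card (PiE I B)"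
    unfolding PiE_insert_eq card_image[OF inj] by (simp add: card_cartesian_product)
  ultimately show ?thesis by (simp add: mean_def sum_divide_distrib)
qed

lemma nsub_var_le:
  assumes "finite F" "B \<le> card F"
  shows "mean (nsub F B) (\<lambda>S. ((\<Sum>i\<in>S. v i) - real B / real (card F) * (\<Sum>i\<in>F. v i))\<^sup>2) \<le> (\<Sum>i\<in>F. (v i)\<^sup>2)"
proof -
  define D where "D = real (card F)"
  define q where "q = real B / D"
  define c where "c = real B * (real B - 1) / (D * (D - 1))"
  define V where "V = (\<Sum>i\<in>F. v i)"
  define S2 where "S2 = (\<Sum>i\<in>F. v i * v i)"
  have fN: "finite (nsub F B)" "nsub F B \<noteq> {}" using finite_nsub[OF assms(1)] nsub_nonempty[OF assms] by auto
  have "mean (nsub F B) (\<lambda>S. ((\<Sum>i\<in>S. v i) - q * V)\<^sup>2)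
     = mean (nsub F B) (\<lambda>S. (\<Sum>i\<in>S. v i) * (\<Sum>i\<in>S. v i) - (2 * q * V) * (\<Sum>i\<in>S. v i) + (q * V)\<^sup>2)"
    by (intro mean_cong) (simp add: power2_eq_square algebra_simps)
  also have "\<dots> = (q * S2 + c * (V * V - S2)) - (2 * q * V) * (q * V) + (q * V)\<^sup>2"
    by (simp only: mean_add mean_diff mean_cmult mean_const[OF fN] mean_nsub_sum[OF assms] mean_nsub_sum_mult[OF assms]
        q_def c_def V_def S2_def D_def)
  also have "\<dots> = (q - c) * S2 - (q * q - c) * (V * V)" by (simp add: power2_eq_square algebra_simps)
  also have "\<dots> \<le> 1 * S2 - 0"
  proof (rule diff_mono)
    have BD: "real B \<le> D" using assms(2) by (simp add: D_def)
    have q01: "0 \<le> q" "q \<le> 1" using BD by (auto simp: q_def divide_le_eq_1)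
    have c0: "0 \<le> c"
    proof (cases "card F")
      case 0 then show ?thesis by (simp add: c_def D_def)
    next
      case (Suc d)
      then have "0 \<le> D * (D - 1)" by (simp add: D_def)
      moreover have "0 \<le> real B * (real B - 1)" by (cases B) auto
      ultimately show ?thesis by (simp add: c_def)
    qed
    have S0: "0 \<le> S2" unfolding S2_def by (rule sum_nonneg) simp
    show "(q - c) * S2 \<le> 1 * S2" using q01 c0 S0 by (intro mult_right_mono) auto
    have "c \<le> q * q"
    proof (cases "card F \<le> 1")
      case True
      then have z: "D * (D - 1) = 0" by (cases "card F") (auto simp: D_def)
      have "c = 0" unfolding c_def z by simp
      then show ?thesis by simp
    next
      case False
      then have D1: "1 < D" by (simp add: D_def)
      have "(real B - 1) / (D - 1) \<le> q" unfolding q_def using D1 BD by (simp add: divide_simps algebra_simps)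
      then have "q * ((real B - 1) / (D - 1)) \<le> q * q" using q01 by (intro mult_left_mono) auto
      then show ?thesis by (simp add: c_def q_def)
    qed
    then show "0 \<le> (q * q - c) * (V * V)" by simp
  qed
  finally show ?thesis unfolding q_def V_def S2_def D_def by (simp add: power2_eq_square)
qed

context dense
begin

definition Arow :: "nat \<Rightarrow> nat set" where "Arow j = {k. k < n \<and> (j,k) \<notin> H}"
definition Hrow :: "nat \<Rightarrow> nat set" where "Hrow j = {k. (j,k) \<in> H}"
definition BB :: "nat \<Rightarrow> nat set set" where "BB j = nsub (Arow j) (s j)"
text \<open>Rows are independent in this model. Only the first J rows are taken, so that moments can
  be computed by adding one row at a time.\<close>

definition PI :: "nat \<Rightarrow> (nat \<Rightarrow> nat set) set" where "PI J = PiE {..<J} BB"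
definition pj :: "nat \<Rightarrow> real" where "pj j = real (s j) / real (card (Arow j))"
text \<open>Centred by s j / n rather than by the inclusion probability \<open>pj j\<close>: every
  row then sums to 0 over the n columns and has a norm determined by s j. The price is a bias caused
  by H.\<close>

definition bb :: "nat \<Rightarrow> nat set \<Rightarrow> nat \<Rightarrow> real" where "bb j T k = of_bool (k \<in> T) - real (s j) / real n"
definition VV :: "nat \<Rightarrow> (nat \<Rightarrow> nat set) \<Rightarrow> nat \<Rightarrow> real" where "VV J S k = (\<Sum>j<J. bb j (S j) k)"
definition LL :: "nat \<Rightarrow> (nat \<Rightarrow> real) \<Rightarrow> (nat \<Rightarrow> nat set) \<Rightarrow> real" where "LL J v S = (\<Sum>k<n. v k * VV J S k)"
definition mu :: "nat \<Rightarrow> (nat \<Rightarrow> real) \<Rightarrow> real"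
  where "mu j v = pj j * (\<Sum>k\<in>Arow j. v k) - real (s j) / real n * (\<Sum>k<n. v k)"
definition mL :: "nat \<Rightarrow> (nat \<Rightarrow> real) \<Rightarrow> real" where "mL J v = (\<Sum>j<J. mu j v)"

lemma Hrow_sub: "Hrow j \<subseteq> {..<n}" using Hsub by (auto simp: Hrow_def)
lemma finite_Hrow: "finite (Hrow j)" using Hrow_sub finite_subset by blast
lemma card_Hrow: "real (card (Hrow j)) = real (degU H j)" by (simp add: Hrow_def degU_def)
lemma Arow_eq: "Arow j = {..<n} - Hrow j" by (auto simp: Arow_def Hrow_def)
lemma finite_Arow: "finite (Arow j)" by (simp add: Arow_eq)
lemma Arow_sub: "Arow j \<subseteq> {..<n}" by (auto simp: Arow_def)

lemma card_Arow: "card (Arow j) = n - degU H j"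
  unfolding Arow_eq using Hrow_sub finite_Hrow by (simp add: card_Diff_subset Hrow_def degU_def)

lemma degU_le: "degU H j \<le> n"
  using card_mono[OF finite_lessThan Hrow_sub, of j] by (simp add: Hrow_def degU_def)

lemma real_card_Arow: "real (card (Arow j)) = real n - real (degU H j)"
  using degU_le[of j] by (simp add: card_Arow of_nat_diff)

lemma s_le_Arow: "j < m \<Longrightarrow> s j \<le> card (Arow j)"
proof -
  assume j: "j < m"
  have 1: "lo 1 2 ((1 - lam) * real n)" using lo_mult[OF lo_lam1 lo_n] by simp
  have "bd 1 2 1 ((real n - real (degU H j) - real (s j)) - (1 - lam) * real n)"
  proof -
    have "(real n - real (degU H j) - real (s j)) - (1 - lam) * real n = - (real (degU H j) + (real (s j) - lam * real n))"
      by (simp add: algebra_simps)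
    also have "bd 1 2 1 \<dots>" by (rule bd_minus, rule bd_weak[OF bd_add[OF bd_x[OF j] bd_s[OF j]]]) auto
    finally show ?thesis .
  qed
  from lo_pos[OF lo_approx[OF 1 this]] have "real (s j) < real (card (Arow j))" by (simp add: real_card_Arow)
  then show ?thesis by simp
qed

lemma Arow_pos: "j < m \<Longrightarrow> 0 < card (Arow j)"
proof -
  assume j: "j < m"
  have "bd 1 1 1 (real (card (Arow j)) - real n)" using bd_minus[OF bd_x[OF j]] by (simp add: real_card_Arow)
  from lo_pos[OF lo_approx[OF lo_n this]] show ?thesis by simp
qed

lemma pj01: "j < m \<Longrightarrow> 0 \<le> pj j" "j < m \<Longrightarrow> pj j \<le> 1"
  using s_le_Arow by (auto simp: pj_def divide_le_eq_1)

lemma finite_BB: "finite (BB j)" unfolding BB_def by (rule finite_nsub[OF finite_Arow])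
lemma BB_ne: "j < m \<Longrightarrow> BB j \<noteq> {}" unfolding BB_def by (rule nsub_nonempty[OF finite_Arow s_le_Arow])
lemma BB_sub: "T \<in> BB j \<Longrightarrow> T \<subseteq> {..<n}" using Arow_sub by (auto simp: BB_def nsub_def)
lemma finite_PI: "finite (PI J)" unfolding PI_def by (intro finite_PiE finite_BB finite_lessThan)
lemma PI_ne: "J \<le> m \<Longrightarrow> PI J \<noteq> {}" unfolding PI_def by (simp add: PiE_eq_empty_iff BB_ne)
lemma PI_mem: "S \<in> PI J \<Longrightarrow> j < J \<Longrightarrow> S j \<in> BB j" by (auto simp: PI_def)

lemma mean_PI_Suc: "mean (PI (Suc J)) f = mean (PI J) (\<lambda>S. mean (BB J) (\<lambda>T. f (S(J := T))))"
  unfolding PI_def lessThan_Suc by (rule mean_insert) (auto simp: finite_BB)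

lemma VV_upd: "VV (Suc J) (S(J := T)) k = VV J S k + bb J T k" by (simp add: VV_def)

lemma LL_upd: "LL (Suc J) v (S(J := T)) = LL J v S + (\<Sum>k<n. v k * bb J T k)"
  by (simp add: LL_def VV_upd distrib_left sum.distrib)

lemma row_lin:
  assumes T: "T \<in> BB j"
  shows "(\<Sum>k<n. v k * bb j T k) = (\<Sum>k\<in>T. v k) - real (s j) / real n * (\<Sum>k<n. v k)"
proof -
  have "(\<Sum>k<n. v k * bb j T k) = (\<Sum>k<n. of_bool (k \<in> T) * v k) - real (s j) / real n * (\<Sum>k<n. v k)"
    by (simp add: bb_def right_diff_distrib sum_subtractf sum_distrib_left sum_divide_distrib mult_ac)
  also have "(\<Sum>k<n. of_bool (k \<in> T) * v k) = (\<Sum>k\<in>T. v k)"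
    by (rule sum_subset_of_bool[symmetric]) (use BB_sub[OF T] in auto)
  finally show ?thesis .
qed

lemma row_mean:
  assumes j: "j < m"
  shows "mean (BB j) (\<lambda>T. \<Sum>k<n. v k * bb j T k) = mu j v"
proof -
  have "mean (BB j) (\<lambda>T. \<Sum>k<n. v k * bb j T k) = mean (BB j) (\<lambda>T. (\<Sum>k\<in>T. v k) - real (s j) / real n * (\<Sum>k<n. v k))"
    by (rule mean_cong) (rule row_lin)
  also have "\<dots> = mu j v"
    unfolding mean_diff mean_const[OF finite_BB BB_ne[OF j]] mu_def pj_def
    unfolding BB_def by (simp add: mean_nsub_sum[OF finite_Arow s_le_Arow[OF j]])
  finally show ?thesis .
qed

lemma row_var:
  assumes j: "j < m"
  shows "mean (BB j) (\<lambda>T. ((\<Sum>k<n. v k * bb j T k) - mu j v)\<^sup>2) \<le> (\<Sum>k<n. (v k)\<^sup>2)"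
proof -
  have "mean (BB j) (\<lambda>T. ((\<Sum>k<n. v k * bb j T k) - mu j v)\<^sup>2)
     = mean (BB j) (\<lambda>T. ((\<Sum>k\<in>T. v k) - pj j * (\<Sum>k\<in>Arow j. v k))\<^sup>2)"
    by (rule mean_cong) (simp add: row_lin mu_def)
  also have "\<dots> \<le> (\<Sum>k\<in>Arow j. (v k)\<^sup>2)"
    unfolding BB_def pj_def by (rule nsub_var_le[OF finite_Arow s_le_Arow[OF j]])
  also have "\<dots> \<le> (\<Sum>k<n. (v k)\<^sup>2)" by (rule sum_mono2) (use Arow_sub in auto)
  finally show ?thesis .
qed

lemma mean_shift_sq:
  assumes "finite A" "A \<noteq> {}"
  shows "mean A (\<lambda>x. (a + f x)\<^sup>2) = (a + mean A f)\<^sup>2 + mean A (\<lambda>x. (f x - mean A f)\<^sup>2)"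
proof -
  have 1: "mean A (\<lambda>x. (a + f x)\<^sup>2) = a\<^sup>2 + 2 * a * mean A f + mean A (\<lambda>x. (f x)\<^sup>2)"
  proof -
    have "mean A (\<lambda>x. (a + f x)\<^sup>2) = mean A (\<lambda>x. a\<^sup>2 + 2 * a * f x + (f x)\<^sup>2)"
      by (rule mean_cong) (simp add: power2_eq_square algebra_simps)
    then show ?thesis by (simp only: mean_add mean_cmult mean_const[OF assms])
  qed
  have 2: "mean A (\<lambda>x. (f x - mean A f)\<^sup>2) = mean A (\<lambda>x. (f x)\<^sup>2) - (mean A f)\<^sup>2"
  proof -
    have "mean A (\<lambda>x. (f x - mean A f)\<^sup>2) = mean A (\<lambda>x. (f x)\<^sup>2 - 2 * mean A f * f x + (mean A f)\<^sup>2)"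
      by (rule mean_cong) (simp add: power2_eq_square algebra_simps)
    then show ?thesis by (simp only: mean_add mean_diff mean_cmult mean_const[OF assms]) (simp add: power2_eq_square)
  qed
  show ?thesis unfolding 1 2 by (simp add: power2_eq_square algebra_simps)
qed

lemma lin_mean: "J \<le> m \<Longrightarrow> mean (PI J) (LL J v) = mL J v"
proof (induction J)
  case 0
  then show ?case by (simp add: LL_def VV_def mL_def mean_def)
next
  case (Suc J)
  have "mean (PI (Suc J)) (LL (Suc J) v) = mean (PI J) (\<lambda>S. LL J v S + mu J v)"
    unfolding mean_PI_Suc LL_upd mean_add
    using Suc.prems by (simp add: mean_const[OF finite_BB BB_ne] row_mean)
  also have "\<dots> = mL J v + mu J v" using Suc by (simp add: mean_add mean_const[OF finite_PI PI_ne])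
  finally show ?case by (simp add: mL_def)
qed

text \<open>Given the earlier rows, a new row adds an independent deviation of variance at most the
  sum of squares of v, while its mean is absorbed into \<open>mL\<close>.\<close>

lemma lin_var: "J \<le> m \<Longrightarrow> mean (PI J) (\<lambda>S. (LL J v S - mL J v)\<^sup>2) \<le> real J * (\<Sum>k<n. (v k)\<^sup>2)"
proof (induction J)
  case 0
  then show ?case by (simp add: LL_def VV_def mL_def mean_def)
next
  case (Suc J)
  have J: "J < m" using Suc by simp
  have row: "mean (BB J) (\<lambda>T. (LL (Suc J) v (S(J := T)) - mL (Suc J) v)\<^sup>2)
      \<le> (LL J v S - mL J v)\<^sup>2 + (\<Sum>k<n. (v k)\<^sup>2)" for S
  proof -
    have "mean (BB J) (\<lambda>T. (LL (Suc J) v (S(J := T)) - mL (Suc J) v)\<^sup>2)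
       = mean (BB J) (\<lambda>T. ((LL J v S - mL (Suc J) v) + (\<Sum>k<n. v k * bb J T k))\<^sup>2)"
      unfolding LL_upd by (rule mean_cong) (simp add: algebra_simps)
    also have "\<dots> = (LL J v S - mL (Suc J) v + mu J v)\<^sup>2 + mean (BB J) (\<lambda>T. ((\<Sum>k<n. v k * bb J T k) - mu J v)\<^sup>2)"
      unfolding mean_shift_sq[OF finite_BB BB_ne[OF J]] row_mean[OF J] ..
    also have "LL J v S - mL (Suc J) v + mu J v = LL J v S - mL J v" by (simp add: mL_def)
    finally show ?thesis using row_var[OF J, of v] by linarith
  qed
  have "mean (PI (Suc J)) (\<lambda>S. (LL (Suc J) v S - mL (Suc J) v)\<^sup>2)
     \<le> mean (PI J) (\<lambda>S. (LL J v S - mL J v)\<^sup>2 + (\<Sum>k<n. (v k)\<^sup>2))"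
    unfolding mean_PI_Suc by (rule mean_mono) (rule row)
  also have "\<dots> \<le> real J * (\<Sum>k<n. (v k)\<^sup>2) + (\<Sum>k<n. (v k)\<^sup>2)"
    using Suc by (simp add: mean_add mean_const[OF finite_PI PI_ne])
  finally show ?case by (simp add: algebra_simps)
qed

lemma lin_sq: "J \<le> m \<Longrightarrow> mean (PI J) (\<lambda>S. (LL J v S)\<^sup>2) \<le> (mL J v)\<^sup>2 + real J * (\<Sum>k<n. (v k)\<^sup>2)"
proof -
  assume J: "J \<le> m"
  have "mean (PI J) (\<lambda>S. (0 + LL J v S)\<^sup>2) = (0 + mean (PI J) (LL J v))\<^sup>2 + mean (PI J) (\<lambda>S. (LL J v S - mean (PI J) (LL J v))\<^sup>2)"
    by (rule mean_shift_sq[OF finite_PI PI_ne[OF J]])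
  then show ?thesis using lin_var[OF J, of v] by (simp add: lin_mean[OF J])
qed

text \<open>Since s j / n = pj j * (1 - degU H j / n), the bias of a row is due to its forbidden
  positions alone.\<close>

lemma mu_eq: "j < m \<Longrightarrow> mu j v = pj j * (real (degU H j) / real n) * (\<Sum>k<n. v k) - pj j * (\<Sum>k\<in>Hrow j. v k)"
proof -
  assume j: "j < m"
  have 1: "(\<Sum>k\<in>Arow j. v k) = (\<Sum>k<n. v k) - (\<Sum>k\<in>Hrow j. v k)"
    unfolding Arow_eq by (rule sum_diff) (use Hrow_sub in auto)
  have a: "0 < real n - real (degU H j)" using Arow_pos[OF j] real_card_Arow[of j] by linarith
  have 2: "real (s j) / real n = pj j - pj j * (real (degU H j) / real n)"
    unfolding pj_def real_card_Arow using a n_pos by (simp add: divide_simps) (simp add: algebra_simps)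
  show ?thesis unfolding mu_def 1 2 by (simp add: algebra_simps)
qed

lemma sum_Hrow: "(\<Sum>j<m. \<Sum>k\<in>Hrow j. v k) = (\<Sum>k<n. y k * (v k :: real))"
proof -
  have "(\<Sum>j<m. \<Sum>k\<in>Hrow j. v k) = (\<Sum>(j,k)\<in>Sigma {..<m} Hrow. v k)"
    by (rule sum.Sigma) (auto simp: finite_Hrow)
  also have "\<dots> = (\<Sum>(k,j)\<in>Sigma {..<n} (col H). v k)"
    by (rule sum.reindex_bij_witness[where i = "\<lambda>(k,j). (j,k)" and j = "\<lambda>(j,k). (k,j)"])
      (use Hsub in \<open>auto simp: col_def Hrow_def\<close>)
  also have "\<dots> = (\<Sum>k<n. \<Sum>j\<in>col H k. v k)"
    by (rule sum.Sigma[symmetric]) (auto simp: finite_colH)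
  finally show ?thesis by (simp add: card_colH)
qed

lemma mL_bound:
  assumes J: "J \<le> m" and v: "\<And>k. k < n \<Longrightarrow> 0 \<le> v k"
  shows "\<bar>mL J v\<bar> \<le> real (card H) / real n * (\<Sum>k<n. v k) + (\<Sum>k<n. y k * v k)"
proof -
  have "\<bar>mu j v\<bar> \<le> real (degU H j) / real n * (\<Sum>k<n. v k) + (\<Sum>k\<in>Hrow j. v k)" if j: "j < m" for j
  proof -
    have p: "0 \<le> pj j" "pj j \<le> 1" using pj01[OF j] by auto
    have s0: "0 \<le> (\<Sum>k<n. v k)" "0 \<le> (\<Sum>k\<in>Hrow j. v k)" using v Hrow_sub[of j] by (auto intro!: sum_nonneg)
    have "pj j * (real (degU H j) / real n) * (\<Sum>k<n. v k) \<le> 1 * (real (degU H j) / real n) * (\<Sum>k<n. v k)"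
      using p s0 by (intro mult_right_mono) auto
    moreover have "pj j * (\<Sum>k\<in>Hrow j. v k) \<le> 1 * (\<Sum>k\<in>Hrow j. v k)" using p s0 by (intro mult_right_mono) auto
    moreover have "0 \<le> pj j * (real (degU H j) / real n) * (\<Sum>k<n. v k)" "0 \<le> pj j * (\<Sum>k\<in>Hrow j. v k)"
      using p s0 by auto
    ultimately show ?thesis unfolding mu_eq[OF j] by linarith
  qed
  then have "\<bar>mL J v\<bar> \<le> (\<Sum>j<J. real (degU H j) / real n * (\<Sum>k<n. v k) + (\<Sum>k\<in>Hrow j. v k))"
    unfolding mL_def using J by (intro order_trans[OF sum_abs] sum_mono) auto
  also have "\<dots> \<le> (\<Sum>j<m. real (degU H j) / real n * (\<Sum>k<n. v k) + (\<Sum>k\<in>Hrow j. v k))"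
  proof (rule sum_mono2)
    fix j
    have "0 \<le> (\<Sum>k<n. v k)" "0 \<le> (\<Sum>k\<in>Hrow j. v k)" using v Hrow_sub[of j] by (auto intro!: sum_nonneg)
    then show "0 \<le> real (degU H j) / real n * (\<Sum>k<n. v k) + (\<Sum>k\<in>Hrow j. v k)" by simp
  qed (use J in auto)
  also have "\<dots> = real (card H) / real n * (\<Sum>k<n. v k) + (\<Sum>j<m. \<Sum>k\<in>Hrow j. v k)"
    by (simp add: sum.distrib sum_distrib_right[symmetric] sum_divide_distrib[symmetric] sum_x)
  also have "(\<Sum>j<m. \<Sum>k\<in>Hrow j. v k) = (\<Sum>k<n. y k * v k)" by (rule sum_Hrow)
  finally show ?thesis .
qed

end

section \<open>The sum of squared column deviations under fixed row sums\<close>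

context dense
begin

text \<open>The squared column deviations without their diagonal part, which is deterministic by
  \<open>row_norm\<close>. Only products of different rows remain, so apart from the bias of H each
  new row has conditional mean 0.\<close>

definition DQ :: "nat \<Rightarrow> (nat \<Rightarrow> nat set) \<Rightarrow> real" where
  "DQ J S = (\<Sum>k<n. (VV J S k)\<^sup>2) - (\<Sum>j<J. real (s j) - (real (s j))\<^sup>2 / real n)"

lemma row_norm:
  assumes T: "T \<in> BB j"
  shows "(\<Sum>k<n. (bb j T k)\<^sup>2) = real (s j) - (real (s j))\<^sup>2 / real n"
proof -
  let ?q = "real (s j) / real n"
  have cT: "real (card T) = real (s j)" using T by (simp add: BB_def nsub_def)
  have "(\<Sum>k<n. (bb j T k)\<^sup>2) = (\<Sum>k<n. of_bool (k \<in> T) * (1 - 2 * ?q) + ?q\<^sup>2)"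
    by (intro sum.cong refl) (simp add: bb_def of_bool_def power2_eq_square algebra_simps)
  also have "\<dots> = (\<Sum>k<n. of_bool (k \<in> T) * (1 - 2 * ?q)) + real n * ?q\<^sup>2" by (simp add: sum.distrib)
  also have "(\<Sum>k<n. of_bool (k \<in> T) * (1 - 2 * ?q)) = (\<Sum>k\<in>T. 1 - 2 * ?q)"
    by (rule sum_subset_of_bool[symmetric]) (use BB_sub[OF T] in auto)
  also have "\<dots> = real (s j) * (1 - 2 * ?q)" by (simp add: cT)
  finally show ?thesis using n_pos by (simp add: power2_eq_square field_simps)
qed

lemma DQ_upd:
  assumes T: "T \<in> BB J"
  shows "DQ (Suc J) (S(J := T)) = DQ J S + 2 * (\<Sum>k<n. VV J S k * bb J T k)"
proof -
  have "(\<Sum>k<n. (VV (Suc J) (S(J := T)) k)\<^sup>2) = (\<Sum>k<n. (VV J S k)\<^sup>2 + 2 * (VV J S k * bb J T k) + (bb J T k)\<^sup>2)"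
    by (intro sum.cong refl) (simp add: VV_upd power2_eq_square algebra_simps)
  also have "\<dots> = (\<Sum>k<n. (VV J S k)\<^sup>2) + 2 * (\<Sum>k<n. VV J S k * bb J T k) + (\<Sum>k<n. (bb J T k)\<^sup>2)"
    by (simp add: sum.distrib sum_distrib_left)
  finally show ?thesis by (simp add: DQ_def row_norm[OF T])
qed

lemma sum_VV:
  assumes S: "S \<in> PI J"
  shows "(\<Sum>k<n. VV J S k) = 0"
proof -
  have "(\<Sum>k<n. VV J S k) = (\<Sum>j<J. \<Sum>k<n. 1 * bb j (S j) k)" unfolding VV_def by (subst sum.swap) simp
  also have "\<dots> = 0"
  proof (rule sum.neutral, safe)
    fix j assume "j < J"
    then have T: "S j \<in> BB j" by (rule PI_mem[OF S])
    then have "card (S j) = s j" by (simp add: BB_def nsub_def)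
    then show "(\<Sum>k<n. 1 * bb j (S j) k) = 0" unfolding row_lin[OF T] using n_pos by simp
  qed
  finally show ?thesis .
qed

abbreviation ind :: "nat \<Rightarrow> nat \<Rightarrow> real" where "ind J k \<equiv> of_bool (k \<in> Hrow J)"

lemma LL_ind: "LL J (ind J') S = (\<Sum>k\<in>Hrow J'. VV J S k)"
  unfolding LL_def by (rule sum_subset_of_bool[symmetric]) (use Hrow_sub in auto)

lemma mu_VV: "S \<in> PI J \<Longrightarrow> J < m \<Longrightarrow> mu J (VV J S) = - (pj J * LL J (ind J) S)"
  by (simp add: mu_eq sum_VV LL_ind)

lemma mL_ind: "J \<le> m \<Longrightarrow> j < m \<Longrightarrow> \<bar>mL J (ind j)\<bar> \<le> 2 * Q * r * real (degU H j)"
proof -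
  assume J: "J \<le> m" and j: "j < m"
  have s1: "(\<Sum>k<n. ind j k) = real (degU H j)"
  proof -
    have "{..<n} \<inter> Hrow j = Hrow j" using Hrow_sub by auto
    then show ?thesis using card_Hrow[of j] by simp
  qed
  have "(\<Sum>k<n. y k * ind j k) = (\<Sum>k<n. ind j k * y k)" by (simp add: mult.commute)
  also have "\<dots> = (\<Sum>k\<in>Hrow j. y k)" by (rule sum_subset_of_bool[symmetric]) (use Hrow_sub in auto)
  also have "\<dots> \<le> (\<Sum>k\<in>Hrow j. Q * r)"
    by (rule sum_mono) (use y_le Hrow_sub[of j] in \<open>auto simp: y_def r_def\<close>)
  also have "\<dots> = real (degU H j) * (Q * r)" using card_Hrow[of j] by simp
  finally have s2: "(\<Sum>k<n. y k * ind j k) \<le> real (degU H j) * (Q * r)" .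
  have "real (card H) / real n \<le> Q" using H_le n_pos by (simp add: divide_simps)
  also have "Q \<le> Q * r" using Qpos r_pos mult_left_mono[of 1 r Q] by simp
  finally have "real (card H) / real n * real (degU H j) \<le> Q * r * real (degU H j)" by (intro mult_right_mono) auto
  then show ?thesis using mL_bound[OF J, of "ind j"] s2 unfolding s1 by (simp add: mult_ac)
qed

lemma DQ_mean: "J \<le> m \<Longrightarrow> \<bar>mean (PI J) (DQ J)\<bar> \<le> (\<Sum>j<J. 4 * Q * r * real (degU H j))"
proof (induction J)
  case 0
  then show ?case by (simp add: DQ_def VV_def mean_def)
next
  case (Suc J)
  have J: "J < m" "J \<le> m" using Suc.prems by auto
  have "mean (PI (Suc J)) (DQ (Suc J)) = mean (PI J) (\<lambda>S. DQ J S + 2 * (- (pj J * LL J (ind J) S)))"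
    unfolding mean_PI_Suc
  proof (rule mean_cong)
    fix S assume S: "S \<in> PI J"
    have "mean (BB J) (\<lambda>T. DQ (Suc J) (S(J := T))) = mean (BB J) (\<lambda>T. DQ J S + 2 * (\<Sum>k<n. VV J S k * bb J T k))"
      by (rule mean_cong) (rule DQ_upd)
    also have "\<dots> = DQ J S + 2 * mu J (VV J S)"
      by (simp only: mean_add mean_cmult mean_const[OF finite_BB BB_ne[OF J(1)]] row_mean[OF J(1)])
    finally show "mean (BB J) (\<lambda>T. DQ (Suc J) (S(J := T))) = DQ J S + 2 * (- (pj J * LL J (ind J) S))"
      unfolding mu_VV[OF S J(1)] .
  qed
  also have "\<dots> = mean (PI J) (DQ J) - 2 * pj J * mL J (ind J)"
  proof -
    have "mean (PI J) (\<lambda>S. DQ J S + 2 * (- (pj J * LL J (ind J) S))) = mean (PI J) (\<lambda>S. DQ J S - (2 * pj J) * LL J (ind J) S)"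
      by (rule mean_cong) simp
    also have "\<dots> = mean (PI J) (DQ J) - (2 * pj J) * mean (PI J) (LL J (ind J))" by (simp only: mean_diff mean_cmult)
    finally show ?thesis by (simp add: lin_mean[OF J(2)])
  qed
  finally have e: "mean (PI (Suc J)) (DQ (Suc J)) = mean (PI J) (DQ J) - 2 * pj J * mL J (ind J)" .
  have "\<bar>2 * pj J * mL J (ind J)\<bar> \<le> 2 * 1 * (2 * Q * r * real (degU H J))"
    unfolding abs_mult using pj01[OF J(1)] mL_ind[OF J(2,1)] by (intro mult_mono) auto
  then show ?case unfolding e using Suc.IH[OF J(2)] by simp
qed

lemma LL_single: "k < n \<Longrightarrow> LL J (\<lambda>i. of_bool (i = k)) S = VV J S k"
  unfolding LL_def by (subst sum.remove[of _ k]) (auto intro!: sum.neutral)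

text \<open>Squared bias plus variance for the deviations summed over the forbidden positions of row
  j; \<open>WW\<close> is the analogous bound for the squared deviations of all columns.\<close>

definition GG :: "nat \<Rightarrow> real" where "GG j = (2 * Q * r * real (degU H j))\<^sup>2 + real m * real (degU H j)"
definition WW :: real where "WW = real n * ((2 * Q * r)\<^sup>2 + real m)"

lemma mean_ind_sq: "J \<le> m \<Longrightarrow> j < m \<Longrightarrow> mean (PI J) (\<lambda>S. (LL J (ind j) S)\<^sup>2) \<le> GG j"
proof -
  assume J: "J \<le> m" and j: "j < m"
  have "{..<n} \<inter> Hrow j = Hrow j" using Hrow_sub by auto
  then have s1: "(\<Sum>k<n. (ind j k)\<^sup>2) = real (degU H j)" using card_Hrow[of j] by (simp add: power2_eq_square)
  have "(mL J (ind j))\<^sup>2 \<le> (2 * Q * r * real (degU H j))\<^sup>2"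
    using mL_ind[OF J j] Qpos r_pos by (subst abs_le_square_iff[symmetric]) (simp add: abs_mult)
  moreover have "real J * real (degU H j) \<le> real m * real (degU H j)" using J by (intro mult_right_mono) auto
  ultimately show ?thesis using lin_sq[OF J, of "ind j"] unfolding s1 GG_def by linarith
qed

lemma mean_VV_sq: "J \<le> m \<Longrightarrow> mean (PI J) (\<lambda>S. \<Sum>k<n. (VV J S k)\<^sup>2) \<le> WW"
proof -
  assume J: "J \<le> m"
  have "mean (PI J) (\<lambda>S. (VV J S k)\<^sup>2) \<le> (2 * Q * r)\<^sup>2 + real m" if k: "k < n" for k
  proof -
    let ?v = "\<lambda>i. of_bool (i = k) :: real"
    have s1: "(\<Sum>i<n. ?v i) = 1" "(\<Sum>i<n. (?v i)\<^sup>2) = 1" "(\<Sum>i<n. y i * ?v i) = y k"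
      using k by (subst sum.remove[of _ k]; auto intro!: sum.neutral)+
    have "\<bar>mL J ?v\<bar> \<le> real (card H) / real n * 1 + y k"
      using mL_bound[OF J, of ?v] unfolding s1 by simp
    moreover have "real (card H) / real n \<le> Q" using H_le n_pos by (simp add: divide_simps)
    moreover have "Q \<le> Q * r" using Qpos r_pos mult_left_mono[of 1 r Q] by simp
    moreover have "y k \<le> Q * r" using y_le[OF k] by (simp add: y_def r_def)
    ultimately have "\<bar>mL J ?v\<bar> \<le> \<bar>2 * Q * r\<bar>" by linarith
    then have "(mL J ?v)\<^sup>2 \<le> (2 * Q * r)\<^sup>2" by (simp only: abs_le_square_iff)
    moreover have "mean (PI J) (\<lambda>S. (VV J S k)\<^sup>2) = mean (PI J) (\<lambda>S. (LL J ?v S)\<^sup>2)"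
      by (simp only: LL_single[OF k])
    ultimately show ?thesis using lin_sq[OF J, of ?v] J unfolding s1 by simp
  qed
  then have "(\<Sum>k<n. mean (PI J) (\<lambda>S. (VV J S k)\<^sup>2)) \<le> (\<Sum>k<n. (2 * Q * r)\<^sup>2 + real m)" by (intro sum_mono) auto
  then show ?thesis by (simp add: mean_sum WW_def)
qed

text \<open>Adding a row splits the second moment into the square of the conditional mean and a
  conditional variance. The variance is controlled by the squared column deviations, the conditional
  mean by the sum over the forbidden positions of that row. Growth by 1 + 1 / m per row stays below
  e over all m rows.\<close>

lemma DQ_sq: "J \<le> m \<Longrightarrow> mean (PI J) (\<lambda>S. (DQ J S)\<^sup>2) \<le> (1 + 1 / real m) ^ J * (\<Sum>j<J. (4 + 4 * real m) * GG j + 4 * WW)"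
proof (induction J)
  case 0
  then show ?case by (simp add: DQ_def VV_def mean_def)
next
  case (Suc J)
  have J: "J < m" "J \<le> m" using Suc.prems by auto
  let ?M = "real m"
  have M: "0 < ?M" using m_pos by simp
  have GG0: "0 \<le> GG j" for j unfolding GG_def by simp
  have WW0: "0 \<le> WW" unfolding WW_def by simp
  have row: "mean (BB J) (\<lambda>T. (DQ (Suc J) (S(J := T)))\<^sup>2)
      \<le> (1 + 1 / ?M) * (DQ J S)\<^sup>2 + (4 + 4 * ?M) * (LL J (ind J) S)\<^sup>2 + 4 * (\<Sum>k<n. (VV J S k)\<^sup>2)" if S: "S \<in> PI J" for S
  proof -
    define g where "g = mu J (VV J S)"
    define l where "l T = (\<Sum>k<n. VV J S k * bb J T k)" for T
    have ml: "mean (BB J) (\<lambda>T. 2 * l T) = 2 * g" unfolding l_def mean_cmult row_mean[OF J(1)] g_def ..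
    have "mean (BB J) (\<lambda>T. (DQ (Suc J) (S(J := T)))\<^sup>2) = mean (BB J) (\<lambda>T. (DQ J S + 2 * l T)\<^sup>2)"
      by (rule mean_cong) (simp add: DQ_upd l_def)
    also have "\<dots> = (DQ J S + 2 * g)\<^sup>2 + mean (BB J) (\<lambda>T. (2 * l T - 2 * g)\<^sup>2)"
      unfolding mean_shift_sq[OF finite_BB BB_ne[OF J(1)]] ml ..
    also have "mean (BB J) (\<lambda>T. (2 * l T - 2 * g)\<^sup>2) = 4 * mean (BB J) (\<lambda>T. (l T - g)\<^sup>2)"
      unfolding mean_cmult[symmetric] by (rule mean_cong) (simp add: power2_eq_square algebra_simps)
    also have "mean (BB J) (\<lambda>T. (l T - g)\<^sup>2) \<le> (\<Sum>k<n. (VV J S k)\<^sup>2)"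
      unfolding l_def g_def by (rule row_var[OF J(1)])
    also have "(DQ J S + 2 * g)\<^sup>2 \<le> (1 + 1 / ?M) * (DQ J S)\<^sup>2 + (4 + 4 * ?M) * g\<^sup>2"
    proof -
      \<comment> \<open>The cross term is split by the arithmetic-geometric inequality with weight 1
        / m, the largest rate whose compounding over m rows is bounded.\<close>
      have "0 \<le> (DQ J S - 2 * ?M * g)\<^sup>2 / ?M" using M by simp
      also have "\<dots> = (DQ J S)\<^sup>2 / ?M - 4 * (DQ J S * g) + 4 * ?M * g\<^sup>2"
        using M by (simp add: power2_eq_square field_simps)
      finally show ?thesis by (simp add: power2_eq_square algebra_simps)
    qed
    also have "g\<^sup>2 \<le> (LL J (ind J) S)\<^sup>2"
    proof -
      have "\<bar>g\<bar> \<le> 1 * \<bar>LL J (ind J) S\<bar>"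
        unfolding g_def mu_VV[OF S J(1)] abs_minus_cancel abs_mult using pj01[OF J(1)] by (intro mult_right_mono) auto
      then show ?thesis by (simp add: abs_le_square_iff)
    qed
    finally show ?thesis using M by (simp del: fun_upd_apply)
  qed
  have "mean (PI (Suc J)) (\<lambda>S. (DQ (Suc J) S)\<^sup>2)
     \<le> mean (PI J) (\<lambda>S. (1 + 1 / ?M) * (DQ J S)\<^sup>2 + (4 + 4 * ?M) * (LL J (ind J) S)\<^sup>2 + 4 * (\<Sum>k<n. (VV J S k)\<^sup>2))"
    unfolding mean_PI_Suc by (rule mean_mono) (rule row)
  also have "\<dots> = (1 + 1 / ?M) * mean (PI J) (\<lambda>S. (DQ J S)\<^sup>2) + (4 + 4 * ?M) * mean (PI J) (\<lambda>S. (LL J (ind J) S)\<^sup>2)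
      + 4 * mean (PI J) (\<lambda>S. \<Sum>k<n. (VV J S k)\<^sup>2)"
    by (simp only: mean_add mean_cmult)
  also have "\<dots> \<le> (1 + 1 / ?M) * ((1 + 1 / ?M) ^ J * (\<Sum>j<J. (4 + 4 * ?M) * GG j + 4 * WW)) + (4 + 4 * ?M) * GG J + 4 * WW"
    using Suc.IH[OF J(2)] mean_ind_sq[OF J(2,1)] mean_VV_sq[OF J(2)] M by (intro add_mono mult_left_mono) auto
  also have "\<dots> \<le> (1 + 1 / ?M) ^ Suc J * (\<Sum>j<Suc J. (4 + 4 * ?M) * GG j + 4 * WW)"
  proof -
    have "1 \<le> (1 + 1 / ?M) ^ Suc J" using M by (intro one_le_power) auto
    then have "1 * ((4 + 4 * ?M) * GG J + 4 * WW) \<le> (1 + 1 / ?M) ^ Suc J * ((4 + 4 * ?M) * GG J + 4 * WW)"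
      using GG0[of J] WW0 M by (intro mult_right_mono) auto
    then show ?thesis by (simp add: distrib_left mult.assoc)
  qed
  finally show ?case .
qed

lemma bd_DQ_mean: "bd 1 4 3 (mean (PI m) (DQ m))"
proof -
  have "\<bar>mean (PI m) (DQ m)\<bar> \<le> 4 * Q * r * real (card H)"
    using DQ_mean[of m] by (simp add: sum_distrib_left[symmetric] sum_x)
  also have "\<dots> \<le> \<bar>4 * (Q * r * real (card H))\<bar>" by simp
  finally show ?thesis
  proof (rule bd_le)
    have q: "bd 1 1 1 (Q * r)" using Qpos r_pos by (simp add: bd_def)
    show "bd 1 4 3 (4 * (Q * r * real (card H)))"
      by (rule bd_weak[OF bd_mult[OF bd_const[of 4] bd_mult[OF q bd_card_H]]]) auto
  qed
qed

lemma bd_DQ_sq: "bd 1 13 7 (mean (PI m) (\<lambda>S. (DQ m S)\<^sup>2))"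
proof -
  have M: "0 < real m" using m_pos by simp
  have e3: "(1 + 1 / real m) ^ m \<le> 3"
  proof -
    have "(1 + 1 / real m) ^ m \<le> exp (1 / real m) ^ m" using M by (intro power_mono) (auto simp: exp_ge_add_one_self)
    also have "\<dots> = exp 1" using M by (simp add: exp_of_nat_mult[symmetric])
    also have "\<dots> \<le> 3" using exp_le by simp
    finally show ?thesis .
  qed
  have GG0: "0 \<le> GG j" for j unfolding GG_def by simp
  have WW0: "0 \<le> WW" unfolding WW_def by simp
  let ?S = "\<Sum>j<m. (4 + 4 * real m) * GG j + 4 * WW"
  have S0: "0 \<le> ?S" using GG0 WW0 by (intro sum_nonneg) auto
  have Qr: "bd 1 2 1 (2 * Q * r)" using bd_mult[OF bd_const[of 2], of 1 1 1 "Q * r"] Qpos r_pos by (simp add: bd_def power2_eq_square)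
  have G: "bd (real (degU H j)) 6 3 (GG j)" if j: "j < m" for j
  proof -
    have x: "bd (real (degU H j)) 0 0 (real (degU H j))" by (rule bd_self) auto
    have 1: "bd (real (degU H j)) 5 3 ((2 * Q * r * real (degU H j))\<^sup>2)"
      unfolding power2_eq_square
      by (rule bd_weak[OF bd_mult[OF bd_mult[OF Qr x] bd_mult[OF Qr bd_x[OF j]]]]) auto
    have 2: "bd (real (degU H j)) 1 3 (real m * real (degU H j))" by (rule bd_weak[OF bd_mult[OF bd_m x]]) auto
    show ?thesis unfolding GG_def by (rule bd_weak[OF bd_add[OF 1 2]]) auto
  qed
  have SG: "bd 1 (6 + 1) (3 + 2) (\<Sum>j<m. GG j)"
    by (rule bd_sum_weighted[OF G]) (use bd_card_H sum_x in auto)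
  have QQ: "bd 1 4 2 (2 * Q * r * (2 * Q * r))" by (rule bd_weak[OF bd_mult[OF Qr Qr]]) auto
  have W: "bd 1 5 4 WW"
    unfolding WW_def power2_eq_square by (rule bd_weak[OF bd_mult[OF bd_n bd_add[OF QQ bd_m]]]) auto
  have m4: "bd 1 3 2 (4 + 4 * real m)"
    by (rule bd_weak[OF bd_add[OF bd_weak[OF bd_const[of 4], of 1 1 2] bd_mult[OF bd_const[of 4] bd_m, simplified]]]) auto
  have Se: "?S = (4 + 4 * real m) * (\<Sum>j<m. GG j) + real m * (4 * WW)" by (simp add: sum.distrib sum_distrib_left)
  have 1: "bd 1 10 7 ((4 + 4 * real m) * (\<Sum>j<m. GG j))" by (rule bd_weak[OF bd_mult[OF m4 SG]]) auto
  have 2: "bd 1 7 7 (real m * (4 * WW))" by (rule bd_weak[OF bd_mult[OF bd_m bd_mult[OF bd_const[of 4] W]]]) auto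
  have SB: "bd 1 11 7 ?S" unfolding Se by (rule bd_weak[OF bd_add[OF 1 2]]) auto
  have "0 \<le> mean (PI m) (\<lambda>S. (DQ m S)\<^sup>2)" by (rule mean_nonneg) simp
  moreover have "mean (PI m) (\<lambda>S. (DQ m S)\<^sup>2) \<le> 3 * ?S"
    by (rule order_trans[OF DQ_sq[OF order_refl]]) (intro mult_right_mono e3 S0)
  ultimately have "\<bar>mean (PI m) (\<lambda>S. (DQ m S)\<^sup>2)\<bar> \<le> \<bar>3 * ?S\<bar>" by linarith
  then show ?thesis by (rule bd_le) (rule bd_weak[OF bd_mult[OF bd_const[of 3] SB]], auto)
qed

end

section \<open>The exponent as a random variable\<close>

context dense
begin

definition CC :: "(nat \<Rightarrow> nat set) \<Rightarrow> real" where "CC S = (\<Sum>k<n. (VV m S k)\<^sup>2)"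
definition YY :: "(nat \<Rightarrow> real) \<Rightarrow> (nat \<Rightarrow> nat set) \<Rightarrow> real" where
  "YY dl S = (\<Sum>k<n. dl k * (VV m S k + lam * y k))"

lemma lo_AA: "lo 3 4 AA"
  using lo_mult[OF lo_mult[OF lo_mult[OF lo_lam lo_lam1] lo_m] lo_n] by (simp add: AA_def numeral_eq_Suc)

lemma bd_R: "bd 1 3 4 (Rsum m s)"
proof -
  have "bd 1 (2 + 1) (2 + 2) (Rsum m s)"
    unfolding Rsum_def avg_s_eq power2_eq_square
    by (rule bd_sum) (use bd_mult[OF bd_s bd_s] bd_m in \<open>auto simp: numeral_2_eq_2\<close>)
  then show ?thesis by simp
qed

lemma bd_Rn: "bd 1 3 2 (Rsum m s / real n)" using bd_div[OF bd_R lo_n] by simp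

text \<open>The diagonal part of the squared column deviations is \<open>AA\<close> up to R / n.
  This is why C is close to 2 * A * m * n in a random graph and the factor 1 - C / (2 * A * m * n)
  is small on average.\<close>

lemma sum_row_norm: "(\<Sum>j<m. real (s j) - (real (s j))\<^sup>2 / real n) = AA - Rsum m s / real n"
proof -
  have R: "Rsum m s = (\<Sum>j<m. (real (s j))\<^sup>2) - real m * (lam * real n)\<^sup>2"
  proof -
    have "Rsum m s = (\<Sum>j<m. (real (s j))\<^sup>2 - 2 * (lam * real n) * real (s j) + (lam * real n)\<^sup>2)"
      unfolding Rsum_def avg_s_eq by (intro sum.cong) (auto simp: power2_eq_square algebra_simps)
    also have "\<dots> = (\<Sum>j<m. (real (s j))\<^sup>2) - 2 * (lam * real n) * (lam * real m * real n) + real m * (lam * real n)\<^sup>2"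
      by (simp only: sum.distrib sum_subtractf sum_distrib_left[symmetric] sum_s) simp
    finally show ?thesis by (simp add: power2_eq_square algebra_simps)
  qed
  have "(\<Sum>j<m. real (s j) - (real (s j))\<^sup>2 / real n) = lam * real m * real n - (\<Sum>j<m. (real (s j))\<^sup>2) / real n"
    by (simp only: sum_subtractf sum_divide_distrib[symmetric] sum_s)
  then show ?thesis unfolding R AA_def using n_pos by (simp add: diff_divide_distrib power2_eq_square algebra_simps)
qed

lemma CC_DQ: "CC S - AA = DQ m S - Rsum m s / real n"
  unfolding CC_def DQ_def sum_row_norm by simp

lemma CC_mean: "bd 1 5 3 (mean (PI m) (\<lambda>S. CC S - AA))"
  unfolding CC_DQ mean_diff mean_const[OF finite_PI PI_ne[OF order_refl]]
  by (rule bd_weak[OF bd_diff[OF bd_DQ_mean bd_weak[OF bd_Rn, of 1 3 3]]]) auto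

lemma CC_sq: "bd 1 15 7 (mean (PI m) (\<lambda>S. (CC S - AA)\<^sup>2))"
proof -
  let ?R = "Rsum m s / real n"
  have "mean (PI m) (\<lambda>S. (CC S - AA)\<^sup>2) \<le> mean (PI m) (\<lambda>S. 2 * (DQ m S)\<^sup>2 + 2 * ?R\<^sup>2)"
  proof (rule mean_mono)
    fix S
    have "(a - b)\<^sup>2 \<le> 2 * a\<^sup>2 + 2 * b\<^sup>2" for a b :: real
      using zero_le_power2[of "a + b"] by (simp add: power2_eq_square algebra_simps)
    then show "(CC S - AA)\<^sup>2 \<le> 2 * (DQ m S)\<^sup>2 + 2 * ?R\<^sup>2" unfolding CC_DQ .
  qed
  also have "\<dots> = 2 * mean (PI m) (\<lambda>S. (DQ m S)\<^sup>2) + 2 * ?R\<^sup>2"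
    by (simp only: mean_add mean_cmult mean_const[OF finite_PI PI_ne[OF order_refl]])
  finally have le: "mean (PI m) (\<lambda>S. (CC S - AA)\<^sup>2) \<le> 2 * mean (PI m) (\<lambda>S. (DQ m S)\<^sup>2) + 2 * ?R\<^sup>2" .
  have "0 \<le> mean (PI m) (\<lambda>S. (CC S - AA)\<^sup>2)" by (rule mean_nonneg) simp
  with le have "\<bar>mean (PI m) (\<lambda>S. (CC S - AA)\<^sup>2)\<bar> \<le> \<bar>2 * mean (PI m) (\<lambda>S. (DQ m S)\<^sup>2) + 2 * ?R\<^sup>2\<bar>" by linarith
  then show ?thesis
  proof (rule bd_le)
    have 1: "bd 1 14 7 (2 * mean (PI m) (\<lambda>S. (DQ m S)\<^sup>2))" by (rule bd_weak[OF bd_mult[OF bd_const[of 2] bd_DQ_sq]]) auto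
    have 2: "bd 1 7 7 (2 * ?R\<^sup>2)"
      unfolding power2_eq_square by (rule bd_weak[OF bd_mult[OF bd_const[of 2] bd_mult[OF bd_Rn bd_Rn]]]) auto
    show "bd 1 15 7 (2 * mean (PI m) (\<lambda>S. (DQ m S)\<^sup>2) + 2 * ?R\<^sup>2)" by (rule bd_weak[OF bd_add[OF 1 2]]) auto
  qed
qed

lemma bd_pj: "j < m \<Longrightarrow> bd 1 4 (-1) (pj j - lam)"
proof -
  assume j: "j < m"
  have a: "0 < real n - real (degU H j)" using Arow_pos[OF j] real_card_Arow[of j] by linarith
  have "bd 1 1 1 ((real n - real (degU H j)) - real n)" using bd_minus[OF bd_x[OF j]] by simp
  from lo_approx[OF lo_n this] have l: "lo 1 2 (real n - real (degU H j))" by simp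
  have "pj j - lam = ((real (s j) - lam * real n) + lam * real (degU H j)) / (real n - real (degU H j))"
    unfolding pj_def real_card_Arow using a by (simp add: divide_simps algebra_simps)
  also have "bd 1 4 (-1) \<dots>"
    by (rule bd_weak[OF bd_div[OF bd_add[OF bd_s[OF j] bd_mult[OF bd_lam bd_x[OF j], simplified]] l]]) auto
  finally show ?thesis .
qed

lemma YY_LL: "YY dl S = LL m dl S + lam * (\<Sum>k<n. dl k * y k)"
  by (simp add: YY_def LL_def distrib_left sum.distrib sum_distrib_left mult_ac)

text \<open>Forbidden positions are never chosen, so the linear part has mean -lam * y k in column k
  to leading order. The term lam * y k in \<open>YY\<close> cancels this, which is the purpose of
  the shift of \<eta>_k in the theorem; without it the mean would be of the order of
  \<open>AA\<close>.\<close>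

lemma YY_mean:
  assumes dl: "\<And>k. k < n \<Longrightarrow> bd (y k) 2 1 (dl k)"
  shows "bd 1 9 3 (mean (PI m) (YY dl))"
proof -
  have e: "mean (PI m) (YY dl) = mL m dl + lam * (\<Sum>k<n. dl k * y k)"
    unfolding YY_LL[abs_def] mean_add mean_const[OF finite_PI PI_ne[OF order_refl]] by (simp add: lin_mean)
  have mu': "mu j dl = pj j * (real (degU H j) / real n) * (\<Sum>k<n. dl k) - (pj j - lam) * (\<Sum>k\<in>Hrow j. dl k)
     - lam * (\<Sum>k\<in>Hrow j. dl k)" if "j < m" for j
    unfolding mu_eq[OF that] by (simp add: algebra_simps)
  have "mL m dl = (\<Sum>j<m. pj j * (real (degU H j) / real n) * (\<Sum>k<n. dl k)) - (\<Sum>j<m. (pj j - lam) * (\<Sum>k\<in>Hrow j. dl k))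
     - lam * (\<Sum>j<m. \<Sum>k\<in>Hrow j. dl k)"
    unfolding mL_def by (simp add: mu' sum_subtractf sum_distrib_left)
  also have "(\<Sum>j<m. \<Sum>k\<in>Hrow j. dl k) = (\<Sum>k<n. dl k * y k)" unfolding sum_Hrow by (simp add: mult.commute)
  finally have e2: "mean (PI m) (YY dl)
    = (\<Sum>j<m. pj j * (real (degU H j) / real n) * (\<Sum>k<n. dl k)) - (\<Sum>j<m. (pj j - lam) * (\<Sum>k\<in>Hrow j. dl k))"
    unfolding e by simp
  have sy: "bd 1 1 2 (\<Sum>k<n. y k)" using bd_card_H by (simp add: sum_y)
  have sd: "bd 1 3 3 (\<Sum>k<n. dl k)" using bd_sum_weighted[OF dl sy] by simp
  have 1: "bd 1 4 3 (\<Sum>j<m. pj j * (real (degU H j) / real n) * (\<Sum>k<n. dl k))"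
  proof -
    have "bd 1 (3 + 1) (1 + 2) (\<Sum>j<m. pj j * (real (degU H j) / real n) * (\<Sum>k<n. dl k))"
    proof (rule bd_sum_weighted[where g = "\<lambda>j. real (degU H j)"])
      fix j assume "j \<in> {..<m}"
      then have p: "bd 1 0 0 (pj j)" using pj01[of j] by (intro bd_one) auto
      show "bd (real (degU H j)) 3 1 (pj j * (real (degU H j) / real n) * (\<Sum>k<n. dl k))"
        by (rule bd_weak[OF bd_mult[OF bd_mult[OF p bd_div[OF bd_self[of "real (degU H j)" "real (degU H j)"] lo_n]] sd]]) auto
    qed (use bd_card_H sum_x in auto)
    then show ?thesis by simp
  qed
  have 2: "bd 1 8 3 (\<Sum>j<m. (pj j - lam) * (\<Sum>k\<in>Hrow j. dl k))"
  proof -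
    have dy: "bd 1 (3 + 1) (2 + 2) (\<Sum>k<n. y k * \<bar>dl k\<bar>)"
    proof (rule bd_sum_weighted[OF _ sy])
      fix k assume "k \<in> {..<n}"
      then have k: "k < n" by simp
      show "bd (y k) 3 2 (y k * \<bar>dl k\<bar>)"
        using bd_mult[OF bd_y[OF k] bd_abs[THEN iffD2, OF dl[OF k]]] by (simp add: numeral_eq_Suc)
    qed
    have "bd 1 (4 + 4) (-1 + 4) (\<Sum>j<m. (pj j - lam) * (\<Sum>k\<in>Hrow j. dl k))"
    proof (rule bd_sum_weighted[where g = "\<lambda>j. \<Sum>k\<in>Hrow j. \<bar>dl k\<bar>"])
      fix j assume "j \<in> {..<m}"
      then have j: "j < m" by simp
      have "bd (\<Sum>k\<in>Hrow j. \<bar>dl k\<bar>) 0 0 (\<Sum>k\<in>Hrow j. dl k)" by (rule bd_self) (auto intro: sum_nonneg sum_abs)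
      from bd_mult[OF bd_pj[OF j] this]
      show "bd (\<Sum>k\<in>Hrow j. \<bar>dl k\<bar>) 4 (-1) ((pj j - lam) * (\<Sum>k\<in>Hrow j. dl k))" by simp
    qed (use dy sum_Hrow in simp)
    then show ?thesis by simp
  qed
  show ?thesis unfolding e2 by (rule bd_weak[OF bd_diff[OF 1 2]]) auto
qed

lemma YY_sq:
  assumes dl: "\<And>k. k < n \<Longrightarrow> bd (y k) 2 1 (dl k)"
  shows "bd 1 20 7 (mean (PI m) (\<lambda>S. (YY dl S)\<^sup>2))"
proof -
  have e: "mean (PI m) (YY dl) = mL m dl + lam * (\<Sum>k<n. dl k * y k)"
    unfolding YY_LL[abs_def] mean_add mean_const[OF finite_PI PI_ne[OF order_refl]] by (simp add: lin_mean)
  have "mean (PI m) (\<lambda>S. (0 + YY dl S)\<^sup>2) = (0 + mean (PI m) (YY dl))\<^sup>2 + mean (PI m) (\<lambda>S. (YY dl S - mean (PI m) (YY dl))\<^sup>2)"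
    by (rule mean_shift_sq[OF finite_PI PI_ne[OF order_refl]])
  also have "mean (PI m) (\<lambda>S. (YY dl S - mean (PI m) (YY dl))\<^sup>2) = mean (PI m) (\<lambda>S. (LL m dl S - mL m dl)\<^sup>2)"
    unfolding e YY_LL by simp
  also have "\<dots> \<le> real m * (\<Sum>k<n. (dl k)\<^sup>2)" by (rule lin_var) simp
  finally have le: "mean (PI m) (\<lambda>S. (YY dl S)\<^sup>2) \<le> (mean (PI m) (YY dl))\<^sup>2 + real m * (\<Sum>k<n. (dl k)\<^sup>2)" by simp
  have "0 \<le> mean (PI m) (\<lambda>S. (YY dl S)\<^sup>2)" by (rule mean_nonneg) simp
  with le have "\<bar>mean (PI m) (\<lambda>S. (YY dl S)\<^sup>2)\<bar> \<le> \<bar>(mean (PI m) (YY dl))\<^sup>2 + real m * (\<Sum>k<n. (dl k)\<^sup>2)\<bar>" by linarith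
  then show ?thesis
  proof (rule bd_le)
    have 1: "bd 1 18 7 ((mean (PI m) (YY dl))\<^sup>2)"
      unfolding power2_eq_square by (rule bd_weak[OF bd_mult[OF YY_mean[OF dl] YY_mean[OF dl]]]) auto
    have sy: "bd 1 1 2 (\<Sum>k<n. y k)" using bd_card_H by (simp add: sum_y)
    have "bd 1 (5 + 1) (3 + 2) (\<Sum>k<n. (dl k)\<^sup>2)"
    proof (rule bd_sum_weighted[OF _ sy])
      fix k assume "k \<in> {..<n}"
      then have k: "k < n" by simp
      have yk: "0 \<le> y k" "y k \<le> Q * r" using bd_y[OF k] y_nonneg[of k] by (auto simp: bd_def)
      have "bd 1 3 2 (dl k)"
      proof -
        have "\<bar>dl k\<bar> \<le> Q ^ 2 * r * y k" using dl[OF k] by (simp add: bd_def)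
        also have "\<dots> \<le> Q ^ 2 * r * (Q * r)" using yk Qpos r_pos by (intro mult_left_mono) auto
        finally show ?thesis by (simp add: bd_def power2_eq_square power3_eq_cube mult_ac)
      qed
      from bd_mult[OF dl[OF k] this] show "bd (y k) 5 3 ((dl k)\<^sup>2)" by (simp add: power2_eq_square)
    qed
    from bd_mult[OF bd_m this] have 2: "bd 1 7 7 (real m * (\<Sum>k<n. (dl k)\<^sup>2))" by simp
    show "bd 1 20 7 ((mean (PI m) (YY dl))\<^sup>2 + real m * (\<Sum>k<n. (dl k)\<^sup>2))" by (rule bd_weak[OF bd_add[OF 1 2]]) auto
  qed
qed

text \<open>With ka = (1 - R / AA) / 2 and dl k the sum of \<delta>_j over the forbidden rows of
  column k, this is the exponent \<open>phi\<close> of the random column sums.\<close>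

definition FF :: "real \<Rightarrow> (nat \<Rightarrow> real) \<Rightarrow> (nat \<Rightarrow> nat set) \<Rightarrow> real" where
  "FF ka dl S = ka * ((CC S - AA) / AA) - YY dl S / AA"

lemma FF_mean:
  assumes dl: "\<And>k. k < n \<Longrightarrow> bd (y k) 2 1 (dl k)" and ka: "bd 1 9 0 ka"
  shows "bd 1 20 (-1) (mean (PI m) (FF ka dl))"
proof -
  have "mean (PI m) (FF ka dl) = ka * (mean (PI m) (\<lambda>S. CC S - AA) / AA) - mean (PI m) (YY dl) / AA"
    unfolding FF_def[abs_def] by (simp only: mean_diff mean_cmult mean_divc)
  also have "bd 1 20 (-1) \<dots>"
    by (rule bd_weak[OF bd_diff[OF bd_weak[OF bd_mult[OF ka bd_div[OF CC_mean lo_AA]], of 1 17 "-1"]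
       bd_weak[OF bd_div[OF YY_mean[OF dl] lo_AA], of 1 12 "-1"]]]) auto
  finally show ?thesis .
qed

lemma FF_sq:
  assumes dl: "\<And>k. k < n \<Longrightarrow> bd (y k) 2 1 (dl k)" and ka: "bd 1 9 0 ka"
  shows "bd 1 45 (-1) (mean (PI m) (\<lambda>S. (FF ka dl S)\<^sup>2))"
proof -
  let ?c = "mean (PI m) (\<lambda>S. (CC S - AA)\<^sup>2)" and ?y = "mean (PI m) (\<lambda>S. (YY dl S)\<^sup>2)"
  have "mean (PI m) (\<lambda>S. (FF ka dl S)\<^sup>2) \<le> mean (PI m) (\<lambda>S. 2 * (ka * ka) * ((CC S - AA)\<^sup>2 / (AA * AA)) + 2 * ((YY dl S)\<^sup>2 / (AA * AA)))"
  proof (rule mean_mono)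
    fix S
    define u where "u = ka * ((CC S - AA) / AA)"
    define v where "v = YY dl S / AA"
    have "0 \<le> (u + v)\<^sup>2" by simp
    then have "(u - v)\<^sup>2 \<le> 2 * u\<^sup>2 + 2 * v\<^sup>2" by (simp add: power2_eq_square algebra_simps)
    then show "(FF ka dl S)\<^sup>2 \<le> 2 * (ka * ka) * ((CC S - AA)\<^sup>2 / (AA * AA)) + 2 * ((YY dl S)\<^sup>2 / (AA * AA))"
      unfolding FF_def u_def v_def by (simp add: power_mult_distrib power_divide power2_eq_square mult_ac)
  qed
  also have "\<dots> = 2 * (ka * ka) * (?c / (AA * AA)) + 2 * (?y / (AA * AA))" by (simp only: mean_add mean_cmult mean_divc)
  finally have le: "mean (PI m) (\<lambda>S. (FF ka dl S)\<^sup>2) \<le> 2 * (ka * ka) * (?c / (AA * AA)) + 2 * (?y / (AA * AA))" .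
  have "0 \<le> mean (PI m) (\<lambda>S. (FF ka dl S)\<^sup>2)" by (rule mean_nonneg) simp
  with le have "\<bar>mean (PI m) (\<lambda>S. (FF ka dl S)\<^sup>2)\<bar> \<le> \<bar>2 * (ka * ka) * (?c / (AA * AA)) + 2 * (?y / (AA * AA))\<bar>" by linarith
  then show ?thesis
  proof (rule bd_le)
    have 1: "bd 1 40 (-1) (2 * (ka * ka) * (?c / (AA * AA)))"
      by (rule bd_weak[OF bd_mult[OF bd_mult[OF bd_const[of 2] bd_mult[OF ka ka]] bd_div[OF CC_sq lo_mult[OF lo_AA lo_AA]]]]) auto
    have 2: "bd 1 27 (-1) (2 * (?y / (AA * AA)))"
      by (rule bd_weak[OF bd_mult[OF bd_const[of 2] bd_div[OF YY_sq[OF dl] lo_mult[OF lo_AA lo_AA]]]]) auto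
    show "bd 1 45 (-1) (2 * (ka * ka) * (?c / (AA * AA)) + 2 * (?y / (AA * AA)))" by (rule bd_weak[OF bd_add[OF 1 2]]) auto
  qed
qed

text \<open>One row at a time: the entry is a Bernoulli variable, and exp c - 1 <= c + c^2 for
  \<bar>c\<bar> <= 1. A row in which column k is forbidden contributes a deterministic
  factor.\<close>

lemma exp_VV:
  assumes k: "k < n" and c: "\<bar>c\<bar> \<le> 1"
  shows "J \<le> m \<Longrightarrow> mean (PI J) (\<lambda>S. exp (c * VV J S k)) \<le> exp (c * mL J (\<lambda>i. of_bool (i = k)) + c\<^sup>2 * real J)"
proof (induction J)
  case 0
  then show ?case by (simp add: VV_def mL_def mean_def PI_def)
next
  case (Suc J)
  have J: "J < m" "J \<le> m" using Suc.prems by auto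
  let ?v = "\<lambda>i. of_bool (i = k) :: real"
  have sv: "(\<Sum>i<n. ?v i) = 1" using k by (subst sum.remove[of _ k]) (auto intro!: sum.neutral)
  have sA: "(\<Sum>i\<in>Arow J. ?v i) = of_bool (k \<in> Arow J)"
    using finite_Arow by (simp add: of_bool_def)
  have row: "mean (BB J) (\<lambda>T. exp (c * bb J T k)) \<le> exp (c * mu J ?v + c\<^sup>2)"
  proof (cases "k \<in> Arow J")
    case True
    let ?e = "exp (- (c * (real (s J) / real n)))"
    have p: "0 \<le> pj J" "pj J \<le> 1" using pj01[OF J(1)] by auto
    have "mean (BB J) (\<lambda>T. exp (c * bb J T k)) = mean (BB J) (\<lambda>T. ?e * (1 + (exp c - 1) * of_bool (k \<in> T)))"
      by (rule mean_cong) (auto simp: bb_def right_diff_distrib exp_diff exp_minus field_simps)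
    also have "\<dots> = ?e * (1 + (exp c - 1) * pj J)"
      unfolding mean_cmult mean_add mean_const[OF finite_BB BB_ne[OF J(1)]] pj_def
      unfolding BB_def mean_nsub_mem[OF finite_Arow s_le_Arow[OF J(1)] True] ..
    also have "\<dots> \<le> ?e * exp ((exp c - 1) * pj J)" by (intro mult_left_mono exp_ge_add_one_self) auto
    also have "\<dots> \<le> ?e * exp (c * pj J + c\<^sup>2)"
    proof -
      have "exp c - 1 \<le> c + c * c" using exp_quadratic[OF c] by linarith
      then have "(exp c - 1) * pj J \<le> (c + c * c) * pj J" using p by (intro mult_right_mono) auto
      also have "\<dots> \<le> c * pj J + c\<^sup>2" using p mult_left_mono[of "pj J" 1 "c * c"] by (simp add: power2_eq_square algebra_simps)
      finally show ?thesis by simp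
    qed
    also have "\<dots> = exp (c * mu J ?v + c\<^sup>2)"
      unfolding mu_def sv sA using True by (simp add: exp_add[symmetric] algebra_simps)
    finally show ?thesis .
  next
    case False
    have "mean (BB J) (\<lambda>T. exp (c * bb J T k)) = mean (BB J) (\<lambda>T. exp (c * mu J ?v))"
      by (rule mean_cong) (use False in \<open>auto simp: mu_def sv sA bb_def BB_def nsub_def\<close>)
    also have "\<dots> = exp (c * mu J ?v)" by (rule mean_const[OF finite_BB BB_ne[OF J(1)]])
    finally show ?thesis by simp
  qed
  have "mean (PI (Suc J)) (\<lambda>S. exp (c * VV (Suc J) S k)) = mean (PI J) (\<lambda>S. exp (c * VV J S k) * mean (BB J) (\<lambda>T. exp (c * bb J T k)))"
    unfolding mean_PI_Suc VV_upd by (simp add: distrib_left exp_add mean_cmult)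
  also have "\<dots> = mean (PI J) (\<lambda>S. exp (c * VV J S k)) * mean (BB J) (\<lambda>T. exp (c * bb J T k))" by (rule mean_multc)
  also have "\<dots> \<le> exp (c * mL J ?v + c\<^sup>2 * real J) * exp (c * mu J ?v + c\<^sup>2)"
    by (rule mult_mono[OF Suc.IH[OF J(2)] row]) (auto intro!: mean_nonneg)
  also have "\<dots> = exp (c * mL (Suc J) ?v + c\<^sup>2 * real (Suc J))"
    by (simp add: mL_def exp_add[symmetric] algebra_simps)
  finally show ?case .
qed

text \<open>Markov's inequality with c = 1 / r and c = -1 / r. Then c^2 * m = m / n, and the bias
  divided by r is covered by the first two terms of the exponent.\<close>

lemma tail_VV:
  assumes k: "k < n"
  shows "mean (PI m) (\<lambda>S. of_bool (u * r < \<bar>VV m S k\<bar>)) \<le> 2 * exp (real (card H) / real n + y k / r + real m / real n - u)"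
proof -
  let ?v = "\<lambda>i. of_bool (i = k) :: real"
  have sv: "(\<Sum>i<n. ?v i) = 1" "(\<Sum>i<n. y i * ?v i) = y k"
    using k by (subst sum.remove[of _ k]; auto intro!: sum.neutral)+
  have ml: "\<bar>mL m ?v\<bar> \<le> real (card H) / real n + y k" using mL_bound[OF order_refl, of ?v] unfolding sv by simp
  have one: "mean (PI m) (\<lambda>S. of_bool (u < c * VV m S k)) \<le> exp (real (card H) / real n + y k / r + real m / real n - u)"
    if c: "c = 1 / r \<or> c = - (1 / r)" for c
  proof -
    have c1: "\<bar>c\<bar> = 1 / r" using c r_pos by auto
    have c2: "c\<^sup>2 = 1 / real n" using c r_sq by (auto simp: power_divide)
    have "mean (PI m) (\<lambda>S. of_bool (u < c * VV m S k)) \<le> exp (- u) * mean (PI m) (\<lambda>S. exp (c * VV m S k))"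
      by (rule mean_markov_exp)
    also have "\<dots> \<le> exp (- u) * exp (c * mL m ?v + c\<^sup>2 * real m)"
      by (rule mult_left_mono[OF exp_VV[OF k]]) (use c1 r_pos in auto)
    also have "\<dots> = exp (c * mL m ?v + real m / real n - u)" unfolding c2 by (simp add: exp_add[symmetric])
    also have "\<dots> \<le> exp (real (card H) / real n + y k / r + real m / real n - u)"
    proof -
      have "c * mL m ?v \<le> \<bar>c\<bar> * \<bar>mL m ?v\<bar>" by (metis abs_ge_self abs_mult)
      also have "\<dots> \<le> 1 / r * (real (card H) / real n + y k)" unfolding c1 using ml r_pos by (intro mult_left_mono) auto
      also have "\<dots> \<le> real (card H) / real n + y k / r"
        using r_pos mult_right_mono[of "1 / r" 1 "real (card H) / real n"] by (simp add: distrib_left)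
      finally show ?thesis by simp
    qed
    finally show ?thesis .
  qed
  have "mean (PI m) (\<lambda>S. of_bool (u * r < \<bar>VV m S k\<bar>))
     \<le> mean (PI m) (\<lambda>S. of_bool (u < 1 / r * VV m S k) + of_bool (u < - (1 / r) * VV m S k))"
    by (rule mean_mono) (use r_pos in \<open>auto simp: field_simps abs_if\<close>)
  then show ?thesis unfolding mean_add using one[of "1 / r"] one[of "- (1 / r)"] by simp
qed

end

section \<open>Graphs with prescribed row sums and with a prescribed number of edges\<close>

definition ct :: "(nat \<times> nat) set \<Rightarrow> nat \<Rightarrow> nat" where "ct U k = card (col U k)"
definition rs :: "(nat \<times> nat) set \<Rightarrow> nat \<Rightarrow> nat" where "rs U j = card {k. (j,k) \<in> U}"

lemma sum_ct: "U \<subseteq> {..<m} \<times> {..<n} \<Longrightarrow> (\<Sum>k<n. ct U k) = card U"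
proof -
  assume U: "U \<subseteq> {..<m} \<times> {..<n}"
  have "card U = card (SIGMA k:{..<n}. col U k)"
    by (rule bij_betw_same_card[of "\<lambda>(j,k). (k,j)"], rule bij_betw_byWitness[where f' = "\<lambda>(k,j). (j,k)"])
      (use U in \<open>auto simp: col_def\<close>)
  then show ?thesis using finite_col[OF U] by (simp add: ct_def)
qed

lemma sum_rs: "U \<subseteq> {..<m} \<times> {..<n} \<Longrightarrow> (\<Sum>j<m. rs U j) = card U"
proof -
  assume U: "U \<subseteq> {..<m} \<times> {..<n}"
  have "card U = card (SIGMA j:{..<m}. {k. (j,k) \<in> U})"
    by (rule bij_betw_same_card[of "\<lambda>x. x"], rule bij_betw_byWitness[where f' = "\<lambda>x. x"]) (use U in auto)
  then show ?thesis using finite_row[OF U] by (simp add: rs_def)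
qed

lemma mean_bij: "bij_betw h A B \<Longrightarrow> mean B g = mean A (\<lambda>x. g (h x))"
  using sum.reindex_bij_betw[of h A B g] bij_betw_same_card[of h A B] by (simp add: mean_def)

text \<open>Complements of uniform subsets are uniform, so lower tails follow from upper
  tails.\<close>

lemma mean_nsub_compl:
  assumes "finite F" "B \<le> card F"
  shows "mean (nsub F B) g = mean (nsub F (card F - B)) (\<lambda>S. g (F - S))"
proof (rule mean_bij, rule bij_betw_byWitness[where f' = "\<lambda>S. F - S"])
  have "card (F - S) = card F - card S" if "S \<subseteq> F" for S
    using that assms(1) by (meson card_Diff_subset finite_subset)
  then show "(\<lambda>S. F - S) ` nsub F (card F - B) \<subseteq> nsub F B" "(\<lambda>S. F - S) ` nsub F B \<subseteq> nsub F (card F - B)"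
    using assms(2) by (auto simp: nsub_def)
qed (auto simp: nsub_def)

text \<open>The weights 1 / r on R have squares with sum at most 1 and turn a deviation c * r of the
  count into c.\<close>

lemma mean_nsub_part_upper:
  assumes F: "finite F" "B \<le> card F" and R: "R \<subseteq> F" "real (card R) \<le> r * r" and r: "1 \<le> r"
  shows "mean (nsub F B) (\<lambda>S. of_bool (real B / real (card F) * real (card R) + c * r < real (card (S \<inter> R)))) \<le> exp (1 - c)"
proof -
  let ?w = "\<lambda>i. of_bool (i \<in> R) / r"
  have sw: "(\<Sum>i\<in>S. ?w i) = real (card (S \<inter> R)) / r" if "S \<subseteq> F" for S
    using finite_subset[OF that F(1)] by (simp add: sum_divide_distrib[symmetric])
  have FR: "F \<inter> R = R" using R by auto
  have "mean (nsub F B) (\<lambda>S. of_bool (real B / real (card F) * real (card R) + c * r < real (card (S \<inter> R))))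
      = mean (nsub F B) (\<lambda>S. of_bool (real B / real (card F) * (\<Sum>i\<in>F. ?w i) + c < (\<Sum>i\<in>S. ?w i)))"
  proof (rule mean_cong)
    fix S assume "S \<in> nsub F B"
    then have S: "S \<subseteq> F" by (simp add: nsub_def)
    have "real B / real (card F) * (real (card R) / r) + c = (real B / real (card F) * real (card R) + c * r) / r"
      using r by (simp add: add_divide_distrib)
    then show "of_bool (real B / real (card F) * real (card R) + c * r < real (card (S \<inter> R)))
      = (of_bool (real B / real (card F) * (\<Sum>i\<in>F. ?w i) + c < (\<Sum>i\<in>S. ?w i)) :: real)"
      unfolding sw[OF S] sw[OF subset_refl] FR using r by (simp add: divide_less_cancel)
  qed
  also have "\<dots> \<le> exp ((\<Sum>i\<in>F. (?w i)\<^sup>2) - c)"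
    by (rule mean_nsub_tail[OF F]) (use r in \<open>auto simp: of_bool_def\<close>)
  also have "(\<Sum>i\<in>F. (?w i)\<^sup>2) = real (card R) / (r * r)"
  proof -
    have "(\<Sum>i\<in>F. (?w i)\<^sup>2) = (\<Sum>i\<in>F. of_bool (i \<in> R)) / (r * r)"
      unfolding sum_divide_distrib by (intro sum.cong) (auto simp: power2_eq_square)
    then show ?thesis using F(1) FR by simp
  qed
  also have "exp (real (card R) / (r * r) - c) \<le> exp (1 - c)" using R(2) r by (simp add: divide_le_eq_1)
  finally show ?thesis .
qed

context dense
begin

definition Kc :: "(nat \<times> nat) set" where "Kc = {..<m} \<times> {..<n} - H"
definition RG :: "(nat \<times> nat) set set" where "RG = {U. U \<subseteq> Kc \<and> (\<forall>j<m. rs U j = s j)}"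
definition grf :: "(nat \<Rightarrow> nat set) \<Rightarrow> (nat \<times> nat) set" where "grf S = {(j,k). j < m \<and> k \<in> S j}"

lemma Kc_sub: "Kc \<subseteq> {..<m} \<times> {..<n}" by (auto simp: Kc_def)
lemma finite_Kc: "finite Kc" by (simp add: Kc_def)
lemma finite_RG: "finite RG" by (rule finite_subset[of _ "Pow Kc"]) (auto simp: RG_def finite_Kc)

lemma card_Kc: "card Kc = m * n - card H"
  unfolding Kc_def using card_Diff_subset[OF finite_H Hsub] by (simp add: card_cartesian_product)

lemma grf_bij: "bij_betw grf (PI m) RG"
proof (rule bij_betw_byWitness[where f' = "\<lambda>U. \<lambda>j\<in>{..<m}. {k. (j,k) \<in> U}"])
  show "\<forall>S\<in>PI m. (\<lambda>j\<in>{..<m}. {k. (j,k) \<in> grf S}) = S"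
    by (auto simp: PI_def grf_def fun_eq_iff PiE_def extensional_def)
  show "\<forall>U\<in>RG. grf (\<lambda>j\<in>{..<m}. {k. (j,k) \<in> U}) = U"
    by (auto simp: RG_def grf_def Kc_def)
  show "grf ` PI m \<subseteq> RG"
  proof (rule image_subsetI)
    fix S assume S: "S \<in> PI m"
    have 1: "S j \<subseteq> Arow j" "card (S j) = s j" if "j < m" for j using PI_mem[OF S that] by (auto simp: BB_def nsub_def)
    have "{k. (j,k) \<in> grf S} = S j" if "j < m" for j using that by (auto simp: grf_def)
    then show "grf S \<in> RG" unfolding RG_def rs_def Kc_def using 1 by (fastforce simp: grf_def Arow_def)
  qed
  show "(\<lambda>U. \<lambda>j\<in>{..<m}. {k. (j,k) \<in> U}) ` RG \<subseteq> PI m"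
    by (auto simp: PI_def RG_def BB_def nsub_def rs_def Kc_def Arow_def)
qed

lemma mean_RG: "mean RG g = mean (PI m) (\<lambda>S. g (grf S))" by (rule mean_bij[OF grf_bij])

lemma RG_ne: "RG \<noteq> {}" using bij_betw_imp_surj_on[OF grf_bij] PI_ne[OF order_refl] by auto

lemma card_RG: "real (card RG) = (\<Prod>j<m. real ((n - degU H j) choose s j))"
proof -
  have "card RG = card (PI m)" using bij_betw_same_card[OF grf_bij] by simp
  also have "\<dots> = (\<Prod>j<m. card (BB j))" unfolding PI_def by (rule card_PiE) simp
  finally show ?thesis by (simp add: BB_def card_nsub[OF finite_Arow] card_Arow)
qed

lemma ct_grf: "S \<in> PI m \<Longrightarrow> real (ct (grf S) k) = lam * real m + VV m S k"
proof -
  have "{j \<in> {..<m}. k \<in> S j} = col (grf S) k" by (auto simp: grf_def col_def)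
  then have "real (ct (grf S) k) = (\<Sum>j<m. of_bool (k \<in> S j))" by (simp add: ct_def Int_def)
  then show ?thesis using sum_s n_pos
    by (simp add: VV_def bb_def sum_subtractf sum_divide_distrib[symmetric])
qed

lemma RG_sub: "U \<in> RG \<Longrightarrow> U \<subseteq> {..<m} \<times> {..<n}" using Kc_sub by (auto simp: RG_def)

lemma RG_card: "U \<in> RG \<Longrightarrow> card U = (\<Sum>j<m. s j)"
  using sum_rs[OF RG_sub[of U]] by (simp add: RG_def)

lemma RG_sum_ct: "U \<in> RG \<Longrightarrow> (\<Sum>k<n. ct U k) = (\<Sum>j<m. s j)"
  using sum_ct[OF RG_sub] RG_card by simp

lemma ct_out: "U \<subseteq> {..<m} \<times> {..<n} \<Longrightarrow> n \<le> k \<Longrightarrow> ct U k = 0"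
proof -
  assume "U \<subseteq> {..<m} \<times> {..<n}" "n \<le> k"
  then have "col U k = {}" by (auto simp: col_def)
  then show ?thesis by (simp add: ct_def)
qed

text \<open>\<open>ct U\<close> vanishes from n on, so T has to do so as well; column sums can then
  be compared as functions, and the graphs counted by \<open>NN T\<close> form a fibre of
  \<open>ct\<close>.\<close>

lemma bip_RG: "(\<And>k. n \<le> k \<Longrightarrow> T k = 0) \<Longrightarrow> bip_graphs m n s T H = {U \<in> RG. ct U = T}"
proof -
  assume T: "\<And>k. n \<le> k \<Longrightarrow> T k = 0"
  have "(\<forall>k<n. card {j. (j,k) \<in> U} = T k) \<longleftrightarrow> ct U = T" if "U \<subseteq> {..<m} \<times> {..<n}" for U
  proof -
    have "ct U = T \<longleftrightarrow> (\<forall>k. ct U k = T k)" by (simp add: fun_eq_iff)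
    also have "\<dots> \<longleftrightarrow> (\<forall>k<n. ct U k = T k)" using ct_out[OF that] T by (metis not_less)
    finally show ?thesis by (simp add: ct_def col_def)
  qed
  then show ?thesis unfolding bip_graphs_def RG_def Kc_def rs_def by blast
qed

lemma card_cols:
  assumes T: "\<And>k. n \<le> k \<Longrightarrow> T k = 0"
  shows "real (card {U. U \<subseteq> Kc \<and> ct U = T}) = PP T"
proof -
  let ?B = "\<lambda>k. nsub ({..<m} - col H k) (T k)"
  have cT: "ct U = T \<longleftrightarrow> (\<forall>k<n. card (col U k) = T k)" if "U \<subseteq> Kc" for U
    using ct_out[of U] that Kc_sub T unfolding fun_eq_iff ct_def by (metis not_less subset_trans)
  have "bij_betw (\<lambda>U. \<lambda>k\<in>{..<n}. col U k) {U. U \<subseteq> Kc \<and> ct U = T} (PiE {..<n} ?B)"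
  proof (rule bij_betw_byWitness[where f' = "\<lambda>F. {(j,k). k < n \<and> j \<in> F k}"])
    show "\<forall>U\<in>{U. U \<subseteq> Kc \<and> ct U = T}. {(j,k). k < n \<and> j \<in> (\<lambda>k\<in>{..<n}. col U k) k} = U"
      using Kc_sub by (auto simp: col_def)
    show "\<forall>F\<in>PiE {..<n} ?B. (\<lambda>k\<in>{..<n}. col {(j,k). k < n \<and> j \<in> F k} k) = F"
      by (auto simp: fun_eq_iff PiE_def extensional_def col_def)
    show "(\<lambda>U. \<lambda>k\<in>{..<n}. col U k) ` {U. U \<subseteq> Kc \<and> ct U = T} \<subseteq> PiE {..<n} ?B"
      by (auto simp: nsub_def ct_def Kc_def col_def)
    show "(\<lambda>F. {(j,k). k < n \<and> j \<in> F k}) ` PiE {..<n} ?B \<subseteq> {U. U \<subseteq> Kc \<and> ct U = T}"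
    proof (rule image_subsetI)
      fix F assume F: "F \<in> PiE {..<n} ?B"
      let ?U = "{(j,k). k < n \<and> j \<in> F k}"
      have 1: "F k \<subseteq> {..<m} - col H k" "card (F k) = T k" if "k < n" for k
        using F that by (auto simp: nsub_def PiE_def Pi_def)
      have U: "?U \<subseteq> Kc" using 1(1) by (fastforce simp: Kc_def col_def)
      have "col ?U k = F k" if "k < n" for k using that by (auto simp: col_def)
      then show "?U \<in> {U. U \<subseteq> Kc \<and> ct U = T}" using U 1(2) by (simp add: cT)
    qed
  qed
  then have "card {U. U \<subseteq> Kc \<and> ct U = T} = card (PiE {..<n} ?B)" by (rule bij_betw_same_card)
  also have "\<dots> = (\<Prod>k<n. (m - degV H k) choose T k)"
    using col_sub[OF Hsub] finite_colH
    by (simp add: card_PiE card_nsub card_Diff_subset degV_col)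
  finally show ?thesis by (simp add: PP_def)
qed

text \<open>The exponent as a function of the column sums, with \<open>ka\<close> and
  \<open>dl\<close> as free parameters: in the edge model the statistic belonging to s is evaluated
  on graphs with other row sums.\<close>

definition gph :: "real \<Rightarrow> (nat \<Rightarrow> real) \<Rightarrow> (nat \<Rightarrow> nat) \<Rightarrow> real" where
  "gph ka dl T = ka * (((\<Sum>k<n. (real (T k) - lam * real m)\<^sup>2) - AA) / AA)
    - (\<Sum>k<n. dl k * (real (T k) - lam * real m + lam * y k)) / AA"

lemma gph_grf: "S \<in> PI m \<Longrightarrow> gph ka dl (ct (grf S)) = FF ka dl S"
  by (simp add: gph_def FF_def CC_def YY_def ct_grf)

lemma RG_gph_tail:
  assumes dl: "\<And>k. k < n \<Longrightarrow> bd (y k) 2 1 (dl k)" and ka: "bd 1 9 0 ka"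
  shows "mean RG (\<lambda>U. of_bool (1 < \<bar>gph ka dl (ct U)\<bar>)) \<le> Q ^ 45 * r powi (-1)"
    and "mean RG (\<lambda>U. (gph ka dl (ct U))\<^sup>2) \<le> Q ^ 45 * r powi (-1)"
    and "\<bar>mean RG (\<lambda>U. gph ka dl (ct U))\<bar> \<le> Q ^ 45 * r powi (-1)"
proof -
  have "mean RG (\<lambda>U. (gph ka dl (ct U))\<^sup>2) = mean (PI m) (\<lambda>S. (FF ka dl S)\<^sup>2)"
    unfolding mean_RG by (rule mean_cong) (simp add: gph_grf)
  then show 2: "mean RG (\<lambda>U. (gph ka dl (ct U))\<^sup>2) \<le> Q ^ 45 * r powi (-1)"
    using FF_sq[OF dl ka] by (simp add: bd_def)
  have "mean RG (\<lambda>U. of_bool (1 < \<bar>gph ka dl (ct U)\<bar>)) \<le> mean RG (\<lambda>U. (gph ka dl (ct U))\<^sup>2)"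
  proof (rule mean_mono)
    fix U
    show "of_bool (1 < \<bar>gph ka dl (ct U)\<bar>) \<le> (gph ka dl (ct U))\<^sup>2"
      using one_le_power[of "\<bar>gph ka dl (ct U)\<bar>" 2] by (cases "1 < \<bar>gph ka dl (ct U)\<bar>") auto
  qed
  then show "mean RG (\<lambda>U. of_bool (1 < \<bar>gph ka dl (ct U)\<bar>)) \<le> Q ^ 45 * r powi (-1)" using 2 by linarith
  have "mean RG (\<lambda>U. gph ka dl (ct U)) = mean (PI m) (FF ka dl)"
    unfolding mean_RG by (rule mean_cong) (simp add: gph_grf)
  then show "\<bar>mean RG (\<lambda>U. gph ka dl (ct U))\<bar> \<le> Q ^ 45 * r powi (-1)"
    using bd_weak[OF FF_mean[OF dl ka], of 1 45 "-1"] by (simp add: bd_def)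
qed

end

text \<open>The data obey sharper bounds, in terms of \<open>q\<close>, than the window, in terms of \<open>Q\<close>.\<close>

locale normal = dense +
  fixes q :: real
  assumes q1: "1 \<le> q" and qQ: "64 * q ^ 2 \<le> Q"
    and m_leq: "real m \<le> q * real n" and n_leq: "real n \<le> q * real m"
    and H_leq: "real (card H) \<le> q * real n"
    and x_leq: "\<And>j. j < m \<Longrightarrow> real (degU H j) \<le> q * r"
    and y_leq: "\<And>k. k < n \<Longrightarrow> y k \<le> q * r"
begin

lemma q_le_Q: "64 * q \<le> Q"
proof -
  have "q * 1 \<le> q * q" using q1 by (intro mult_left_mono) auto
  then show ?thesis using qQ by (simp add: power2_eq_square)
qed

text \<open>The fourth root of the assumption \<open>tail\<close>. A quarter of Q is what remains in
  the tail exponents after the lower-order terms are paid for.\<close>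

lemma exp_quarter: "exp (- (Q / 4)) \<le> r powi (-15)"
proof -
  have "exp (- (Q / 4)) ^ 4 = exp (- Q)" by (simp add: exp_of_nat_mult[symmetric])
  also have "\<dots> \<le> (r powi (-15)) ^ 4"
  proof -
    have "(r powi (-15)) ^ 4 = inverse (r ^ 60)"
      by (simp add: power_int_minus power_inverse power_mult[symmetric])
    moreover have "exp (- Q) * r ^ 60 \<le> 1" using tail by (simp add: r_def)
    ultimately show ?thesis using r_pos by (simp add: inverse_eq_divide pos_le_divide_eq)
  qed
  finally have "exp (- (Q / 4)) ^ Suc 3 \<le> (r powi (-15)) ^ Suc 3" by (simp add: eval_nat_numeral)
  then show ?thesis by (rule power_le_imp_le_base) (use r_pos in simp)
qed

lemma win_RG: "U \<in> RG \<Longrightarrow> win c (ct U) \<longleftrightarrow> (\<forall>k<n. \<bar>real (ct U k) - lam * real m\<bar> \<le> c)"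
  by (simp add: win_def RG_sum_ct)

lemma small_tail: "x \<le> r\<^sup>2 * Q \<Longrightarrow> x * (4 * r powi (-15)) \<le> r powi (-1)"
proof -
  assume x: "x \<le> r\<^sup>2 * Q"
  have Qr: "Q \<le> r" using r_ge power_increasing[of 1 100 Q] Qpos by simp
  have "x * (4 * r powi (-15)) \<le> (r\<^sup>2 * r) * (r * r powi (-15))"
  proof (rule mult_mono)
    have "r\<^sup>2 * Q \<le> r\<^sup>2 * r" using Qr by (intro mult_left_mono) auto
    then show "x \<le> r\<^sup>2 * r" using x by linarith
    show "4 * r powi (-15) \<le> r * r powi (-15)" using Q16 Qr r_pos by (intro mult_right_mono) auto
  qed (use r_pos in auto)
  also have "\<dots> = r powi (-11)"
    using r_pos power_int_add[of r 4 "-15"] by (simp add: power2_eq_square power4_eq_xxxx mult_ac)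
  also have "\<dots> \<le> r powi (-1)" using r_pos by (intro power_int_increasing) auto
  finally show ?thesis .
qed

text \<open>Union bound over the columns with deviation Q / 2 * r. The three bias terms in
  \<open>tail_VV\<close> are at most q each, and 64 * q <= Q leaves an exponent of at most -Q /
  4.\<close>

lemma RG_win_tail: "mean RG (\<lambda>U. of_bool (\<not> win (Q * r - 1) (ct U))) \<le> r powi (-1)"
proof -
  have r1: "Q / 2 * r \<le> Q * r - 1"
  proof -
    have "2 * 1 \<le> Q * r" using Qpos r_pos by (intro mult_mono) auto
    then show ?thesis by simp
  qed
  have "mean RG (\<lambda>U. of_bool (\<not> win (Q * r - 1) (ct U))) = mean (PI m) (\<lambda>S. of_bool (\<not> win (Q * r - 1) (ct (grf S))))"
    by (rule mean_RG)
  also have "\<dots> \<le> mean (PI m) (\<lambda>S. \<Sum>k<n. of_bool (Q / 2 * r < \<bar>VV m S k\<bar>))"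
  proof (rule mean_mono)
    fix S assume S: "S \<in> PI m"
    have U: "grf S \<in> RG" using bij_betwE[OF grf_bij] S by auto
    show "of_bool (\<not> win (Q * r - 1) (ct (grf S))) \<le> (\<Sum>k<n. of_bool (Q / 2 * r < \<bar>VV m S k\<bar>) :: real)"
    proof (cases "win (Q * r - 1) (ct (grf S))")
      case False
      then obtain k where k: "k < n" "Q * r - 1 < \<bar>VV m S k\<bar>" unfolding win_RG[OF U] ct_grf[OF S] by auto
      then have "of_bool (Q / 2 * r < \<bar>VV m S k\<bar>) = (1::real)" using r1 by simp
      then show ?thesis using False k member_le_sum[of k "{..<n}" "\<lambda>k. of_bool (Q / 2 * r < \<bar>VV m S k\<bar>) :: real"] by simp
    qed (simp add: sum_nonneg)
  qed
  also have "\<dots> \<le> (\<Sum>k<n. 2 * r powi (-15))"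
    unfolding mean_sum
  proof (rule sum_mono)
    fix k assume "k \<in> {..<n}"
    then have k: "k < n" by simp
    have "real (card H) / real n \<le> q" "y k / r \<le> q" "real m / real n \<le> q"
      using H_leq y_leq[OF k] m_leq n_pos r_pos by (simp_all add: divide_le_eq)
    then have "real (card H) / real n + y k / r + real m / real n - Q / 2 \<le> - (Q / 4)" using q_le_Q q1 by linarith
    then have "2 * exp (real (card H) / real n + y k / r + real m / real n - Q / 2) \<le> 2 * exp (- (Q / 4))" by simp
    then show "mean (PI m) (\<lambda>S. of_bool (Q / 2 * r < \<bar>VV m S k\<bar>)) \<le> 2 * r powi (-15)"
      using tail_VV[OF k, of "Q / 2"] exp_quarter by linarith
  qed
  also have "\<dots> = real n * (2 * r powi (-15))" by simp
  also have "\<dots> \<le> real n * (4 * r powi (-15))" using r_pos by (intro mult_left_mono) auto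
  also have "\<dots> \<le> r powi (-1)"
    by (rule small_tail) (use r_sq Qpos mult_left_mono[of 1 Q "r\<^sup>2"] in auto)
  finally show ?thesis .
qed

end

section \<open>Uniform edge sets and the determination of the constant\<close>

lemma sum_fibres_le:
  fixes g :: "'a \<Rightarrow> real"
  assumes A: "finite A"
    and le: "\<And>\<sigma>. \<sigma> \<in> f ` A \<Longrightarrow> (\<Sum>x\<in>{x \<in> A. f x = \<sigma>}. g x) \<le> p * real (card {x \<in> A. f x = \<sigma>})"
  shows "(\<Sum>x\<in>A. g x) \<le> p * real (card A)"
proof -
  have "(\<Sum>x\<in>A. g x) = (\<Sum>\<sigma>\<in>f ` A. \<Sum>x\<in>{x \<in> A. f x = \<sigma>}. g x)" by (rule sum.image_gen[OF A])
  also have "\<dots> \<le> (\<Sum>\<sigma>\<in>f ` A. \<Sum>x\<in>{x \<in> A. f x = \<sigma>}. p)" 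
  proof (rule sum_mono)
    fix \<sigma> assume "\<sigma> \<in> f ` A"
    then show "(\<Sum>x\<in>{x \<in> A. f x = \<sigma>}. g x) \<le> (\<Sum>x\<in>{x \<in> A. f x = \<sigma>}. p)" using le[of \<sigma>] by (simp add: mult.commute)
  qed
  also have "\<dots> = (\<Sum>x\<in>A. p)" by (rule sum.image_gen[OF A, symmetric])
  finally show ?thesis by (simp add: mult.commute)
qed

lemma near_scale: "near e a b \<Longrightarrow> 0 \<le> c \<Longrightarrow> near e (c * a) (c * b)"
  unfolding near_def by (simp add: mult.assoc mult_left_mono)

lemma near_of_abs:
  assumes "\<bar>u - 1\<bar> \<le> d" "d \<le> 1/2"
  shows "near (2 * d) u 1"
proof -
  have d: "0 \<le> d" using assms by linarith
  have e: "1 + 2 * d \<le> exp (2 * d)" by (rule exp_ge_add_one_self)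
  have "d * d \<le> 1/2 * d" using assms d by (intro mult_right_mono) auto
  then have "1 \<le> (1 - d) * (1 + 2 * d)" by (simp add: algebra_simps)
  also have "\<dots> \<le> u * exp (2 * d)" using assms d e by (intro mult_mono) auto
  finally have "1 \<le> u * exp (2 * d)" .
  moreover have "u \<le> exp (2 * d)" using assms e d by linarith
  ultimately show ?thesis unfolding near_def by simp
qed

context normal
begin

definition UU :: "(nat \<times> nat) set set" where "UU = nsub Kc (\<Sum>j<m. s j)"

lemma finite_UU: "finite UU" by (simp add: UU_def finite_nsub finite_Kc)

lemma RG_UU: "RG \<subseteq> UU" using RG_card by (auto simp: UU_def nsub_def RG_def)

lemma UU_ne: "UU \<noteq> {}" using RG_UU RG_ne by auto

lemma E_le: "(\<Sum>j<m. s j) \<le> card Kc"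
proof -
  obtain U where "U \<in> UU" using UU_ne by auto
  then show ?thesis using card_mono[OF finite_Kc, of U] by (simp add: UU_def nsub_def)
qed

lemma UU_sub: "U \<in> UU \<Longrightarrow> U \<subseteq> {..<m} \<times> {..<n}" using Kc_sub by (auto simp: UU_def nsub_def)

lemma m_ge: "64 * q \<le> real m"
proof -
  have "Q * 1 \<le> r * r" using r_ge power_increasing[of 1 100 Q] Qpos r_pos by (intro mult_mono) auto
  then have "64 * (q * q) \<le> q * real m" using qQ n_leq r_sq by (simp add: power2_eq_square)
  then have "q * (64 * q) \<le> q * real m" by (simp add: mult_ac)
  then show ?thesis using q1 by (simp only: mult_le_cancel_left_pos)
qed

text \<open>The mean degree of row j in a uniform edge set differs from lam * n by lam * n * (h - m
  * x) / (m * n - h), where h is the size of H and x the degree of j in H. As h is at most m * n /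
  2, this is at most 2 * (h / m + x), of order q^2 * r; hence the requirement 64 * q^2 <= Q.\<close>

lemma row_centre:
  assumes j: "j < m"
  shows "\<bar>real (\<Sum>j<m. s j) / real (card Kc) * real (n - degU H j) - lam * real n\<bar> \<le> Q / 2 * r"
proof -
  let ?h = "real (card H)" and ?x = "real (degU H j)" and ?m = "real m" and ?n = "real n"
  have xn: "degU H j \<le> n"
  proof -
    have "{k. (j,k) \<in> H} \<subseteq> {..<n}" using Hsub by auto
    then show ?thesis unfolding degU_def using card_mono[of "{..<n}"] by fastforce
  qed
  have hm: "card H \<le> m * n" using card_mono[OF _ Hsub] by simp
  have "q * ?n \<le> ?m / 2 * ?n" using m_ge q1 by (intro mult_right_mono) auto
  then have D: "?m * ?n / 2 \<le> ?m * ?n - ?h" using H_leq by simp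
  have mn: "0 < ?m * ?n" using m_pos n_pos by simp
  have Dp: "0 < ?m * ?n - ?h" using D mn by linarith
  have E: "real (\<Sum>j<m. s j) = lam * ?m * ?n" using sum_s by simp
  have "lam * ?m * ?n / (?m * ?n - ?h) * (?n - ?x) - lam * ?n = lam * (?n * (?h - ?m * ?x) / (?m * ?n - ?h))"
    using Dp by (simp add: field_simps)
  also have "\<bar>\<dots>\<bar> \<le> 1 * (2 * (?h / ?m + ?x))"
    unfolding abs_mult
  proof (rule mult_mono)
    show "\<bar>lam\<bar> \<le> 1" using lam01 by simp
    have "\<bar>?n * (?h - ?m * ?x) / (?m * ?n - ?h)\<bar> = ?n * \<bar>?h - ?m * ?x\<bar> / (?m * ?n - ?h)" using Dp by (simp add: abs_mult)
    also have "\<dots> \<le> ?n * (?h + ?m * ?x) / (?m * ?n / 2)"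
      using mn D by (intro frac_le mult_left_mono mult_nonneg_nonneg) (auto simp: abs_if)
    also have "\<dots> = 2 * (?h / ?m + ?x)" using m_pos n_pos by (simp add: field_simps)
    finally show "\<bar>?n * (?h - ?m * ?x) / (?m * ?n - ?h)\<bar> \<le> 2 * (?h / ?m + ?x)" .
  qed auto
  also have "\<dots> \<le> 4 * (q\<^sup>2 * r)"
  proof -
    have "?h \<le> q * (q * ?m)" using H_leq n_leq q1 mult_left_mono[OF n_leq, of q] by linarith
    then have "?h / ?m \<le> q\<^sup>2 * 1" using m_pos by (simp add: divide_le_eq power2_eq_square mult_ac)
    also have "\<dots> \<le> q\<^sup>2 * r" using r_pos by (intro mult_left_mono) auto
    finally have 1: "?h / ?m \<le> q\<^sup>2 * r" .
    have "?x \<le> q * 1 * r" using x_leq[OF j] by simp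
    also have "\<dots> \<le> q * q * r" using q1 r_pos by (intro mult_mono) auto
    finally show ?thesis using 1 by (simp add: power2_eq_square)
  qed
  also have "\<dots> = (4 * q\<^sup>2) * r" by simp
  also have "\<dots> \<le> Q / 2 * r" using qQ r_pos zero_le_power2[of q] by (intro mult_right_mono; linarith)
  finally show ?thesis unfolding E card_Kc using xn hm by (simp add: of_nat_diff)
qed

lemma row_tail:
  assumes j: "j < m"
  shows "mean UU (\<lambda>U. of_bool (Q * r < \<bar>real (rs U j) - lam * real n\<bar>)) \<le> 4 * r powi (-15)"
proof -
  let ?R = "{j} \<times> Arow j" and ?E = "\<Sum>j<m. s j" and ?D = "card Kc"
  let ?c = "real ?E / real ?D * real (card ?R)"
  have cR: "card ?R = n - degU H j" using card_Arow[of j] by (simp add: card_cartesian_product)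
  have R: "?R \<subseteq> Kc" using j by (auto simp: Kc_def Arow_def)
  have Rn: "real (card ?R) \<le> r * r" unfolding cR r_sq by simp
  have rsR: "rs U j = card (U \<inter> ?R)" if "U \<subseteq> Kc" for U
    unfolding rs_def
    by (rule bij_betw_same_card[of "\<lambda>k. (j,k)"], rule bij_betw_byWitness[where f' = snd])
      (use that in \<open>auto simp: Kc_def Arow_def\<close>)
  have up: "mean UU (\<lambda>U. of_bool (?c + Q / 2 * r < real (card (U \<inter> ?R)))) \<le> exp (1 - Q / 2)"
    unfolding UU_def by (rule mean_nsub_part_upper[OF finite_Kc E_le R Rn r_pos(2)])
  \<comment> \<open>A low count in U is a high count in the complement, which is a uniform set of
    the complementary size.\<close>
  have "mean UU (\<lambda>U. of_bool (real (card (U \<inter> ?R)) < ?c - Q / 2 * r))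
    = mean (nsub Kc (?D - ?E)) (\<lambda>S. of_bool (real (card ((Kc - S) \<inter> ?R)) < ?c - Q / 2 * r))"
    unfolding UU_def by (rule mean_nsub_compl[OF finite_Kc E_le])
  also have "\<dots> = mean (nsub Kc (?D - ?E))
      (\<lambda>S. of_bool (real (?D - ?E) / real ?D * real (card ?R) + Q / 2 * r < real (card (S \<inter> ?R))))"
  proof (rule mean_cong)
    fix S assume "S \<in> nsub Kc (?D - ?E)"
    then have S: "S \<subseteq> Kc" by (simp add: nsub_def)
    have fR: "finite ?R" using finite_subset[OF R finite_Kc] .
    have "(Kc - S) \<inter> ?R = ?R - (S \<inter> ?R)" using R by auto
    then have "card ((Kc - S) \<inter> ?R) = card ?R - card (S \<inter> ?R)" using fR by (simp add: card_Diff_subset)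
    then have 1: "real (card ((Kc - S) \<inter> ?R)) = real (card ?R) - real (card (S \<inter> ?R))"
      using card_mono[OF fR, of "S \<inter> ?R"] by (simp add: of_nat_diff)
    have Dp: "0 < ?D \<or> card ?R = 0" using card_mono[OF finite_Kc R] by linarith
    have "real (?D - ?E) / real ?D * real (card ?R) = real (card ?R) - ?c"
      using Dp E_le by (auto simp: of_nat_diff field_simps)
    then show "of_bool (real (card ((Kc - S) \<inter> ?R)) < ?c - Q / 2 * r)
      = (of_bool (real (?D - ?E) / real ?D * real (card ?R) + Q / 2 * r < real (card (S \<inter> ?R))) :: real)"
      unfolding 1 by (simp add: algebra_simps)
  qed
  also have "\<dots> \<le> exp (1 - Q / 2)"
    by (rule mean_nsub_part_upper[OF finite_Kc _ R Rn r_pos(2)]) simp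
  finally have dn: "mean UU (\<lambda>U. of_bool (real (card (U \<inter> ?R)) < ?c - Q / 2 * r)) \<le> exp (1 - Q / 2)" .
  have "mean UU (\<lambda>U. of_bool (Q * r < \<bar>real (rs U j) - lam * real n\<bar>))
    \<le> mean UU (\<lambda>U. of_bool (?c + Q / 2 * r < real (card (U \<inter> ?R))) + of_bool (real (card (U \<inter> ?R)) < ?c - Q / 2 * r))"
  proof (rule mean_mono)
    fix U assume "U \<in> UU"
    then have U: "U \<subseteq> Kc" by (simp add: UU_def nsub_def)
    have "\<bar>?c - lam * real n\<bar> \<le> Q / 2 * r" using row_centre[OF j] by (simp only: cR)
    moreover have "Q * r = Q / 2 * r + Q / 2 * r" by simp
    ultimately show "of_bool (Q * r < \<bar>real (rs U j) - lam * real n\<bar>)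
      \<le> (of_bool (?c + Q / 2 * r < real (card (U \<inter> ?R))) + of_bool (real (card (U \<inter> ?R)) < ?c - Q / 2 * r) :: real)"
      unfolding rsR[OF U] of_bool_def by (smt (verit))
  qed
  also have "\<dots> \<le> 2 * exp (1 - Q / 2)" unfolding mean_add using up dn by linarith
  also have "\<dots> \<le> 2 * exp (- (Q / 4))" using Q16 by simp
  also have "\<dots> \<le> 2 * r powi (-15)" using exp_quarter by simp
  also have "\<dots> \<le> 4 * r powi (-15)" using r_pos by (intro mult_right_mono) auto
  finally show ?thesis .
qed

definition rwin :: "(nat \<Rightarrow> nat) \<Rightarrow> bool" where "rwin \<sigma> \<longleftrightarrow> (\<forall>j<m. \<bar>real (\<sigma> j) - lam * real n\<bar> \<le> Q * r)"

lemma rwin_tail: "mean UU (\<lambda>U. of_bool (\<not> rwin (rs U))) \<le> r powi (-1)"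
proof -
  have "mean UU (\<lambda>U. of_bool (\<not> rwin (rs U)))
    \<le> mean UU (\<lambda>U. \<Sum>j<m. of_bool (Q * r < \<bar>real (rs U j) - lam * real n\<bar>))"
  proof (rule mean_mono)
    fix U
    show "of_bool (\<not> rwin (rs U)) \<le> (\<Sum>j<m. of_bool (Q * r < \<bar>real (rs U j) - lam * real n\<bar>) :: real)"
    proof (cases "rwin (rs U)")
      case False
      then obtain j where "j < m" "Q * r < \<bar>real (rs U j) - lam * real n\<bar>" unfolding rwin_def by auto
      then show ?thesis using False
          member_le_sum[of j "{..<m}" "\<lambda>j. of_bool (Q * r < \<bar>real (rs U j) - lam * real n\<bar>) :: real"] by simp
    qed (simp add: sum_nonneg)
  qed
  also have "\<dots> \<le> (\<Sum>j<m. 4 * r powi (-15))" unfolding mean_sum using row_tail by (intro sum_mono) auto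
  also have "\<dots> = real m * (4 * r powi (-15))" by simp
  also have "\<dots> \<le> r powi (-1)" by (rule small_tail) (use m_le r_sq in \<open>simp add: mult.commute\<close>)
  finally show ?thesis .
qed

text \<open>Average and density depend only on the number of edges, and the bounds in terms of q do
  not involve the row sums. All results for s thus apply to \<sigma> as soon as \<sigma> lies in the
  row window.\<close>

lemma normal_rows:
  assumes E: "(\<Sum>j<m. \<sigma> j) = (\<Sum>j<m. s j)" and w: "rwin \<sigma>"
  shows "normal m n \<sigma> H Q q"
proof -
  have "(\<Sum>j<m. real (\<sigma> j)) = (\<Sum>j<m. real (s j))" using E by (simp flip: of_nat_sum)
  then have av: "avg_s m \<sigma> = avg_s m s" by (simp add: avg_s_def)
  then have de: "dens m n \<sigma> = dens m n s" by (simp add: dens_def)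
  interpret c: dense m n \<sigma> H Q
  proof
    show "\<bar>real (\<sigma> j) - avg_s m \<sigma>\<bar> \<le> Q * sqrt (real n)" if "j < m" for j
      using w that unfolding av avg_s_eq rwin_def r_def by simp
  qed (use Hsub Q16 m_le n_le dens_lo dens_hi x_le y_le H_le big tail in \<open>auto simp: de\<close>)
  show ?thesis by unfold_locales (use q1 qQ m_leq n_leq H_leq x_leq y_leq in auto)
qed

text \<open>Conditioned on its row sums \<sigma>, a uniform edge set is the row model for \<sigma>,
  where the tail bounds are known with the same density and the same parameters \<open>ka\<close>
  and \<open>dl\<close>. Row sums outside the window are covered by
  \<open>rwin_tail\<close>.\<close>

lemma UU_tail:
  assumes dl: "\<And>k. k < n \<Longrightarrow> bd (y k) 2 1 (dl k)" and ka: "bd 1 9 0 ka"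
  shows "mean UU (\<lambda>U. of_bool (\<not> (win (Q * r - 1) (ct U) \<and> \<bar>gph ka dl (ct U)\<bar> \<le> 1))) \<le> Q ^ 46 * r powi (-1)"
proof -
  let ?b = "\<lambda>U. of_bool (\<not> (win (Q * r - 1) (ct U) \<and> \<bar>gph ka dl (ct U)\<bar> \<le> 1)) :: real"
  let ?p = "r powi (-1) + Q ^ 45 * r powi (-1)"
  let ?W = "{U \<in> UU. rwin (rs U)}"
  have fW: "finite ?W" using finite_UU by simp
  have "(\<Sum>U\<in>?W. ?b U) \<le> ?p * real (card ?W)"
  proof (rule sum_fibres_le[where f = rs, OF fW])
    fix \<sigma> assume "\<sigma> \<in> rs ` ?W"
    then obtain U0 where U0: "U0 \<in> UU" "rwin (rs U0)" and \<sigma>: "\<sigma> = rs U0" by auto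
    have E: "(\<Sum>j<m. \<sigma> j) = (\<Sum>j<m. s j)"
      using sum_rs[OF UU_sub[OF U0(1)]] U0(1) by (simp add: \<sigma> UU_def nsub_def)
    interpret c: normal m n \<sigma> H Q q by (rule normal_rows[OF E]) (use U0 \<sigma> in simp)
    have "(\<Sum>j<m. real (\<sigma> j)) = (\<Sum>j<m. real (s j))" using E by (simp flip: of_nat_sum)
    then have lam: "c.lam = lam" by (simp add: c.lam_def lam_def dens_def avg_s_def)
    have AA: "c.AA = AA" by (simp add: c.AA_def AA_def lam)
    have gph: "c.gph ka dl T = gph ka dl T" for T by (simp add: c.gph_def gph_def lam AA)
    have win: "c.win C T = win C T" for C T by (simp add: c.win_def win_def lam E)
    \<comment> \<open>The fibres of \<open>rs\<close> compare functions on all natural numbers; from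
      m on both sides are 0.\<close>
    have rs0: "rs U j = 0" if "U \<subseteq> Kc" "m \<le> j" for U j
    proof -
      have "{k. (j,k) \<in> U} = {}" using that by (auto simp: Kc_def)
      then show ?thesis by (simp add: rs_def)
    qed
    have eq: "{U \<in> ?W. rs U = \<sigma>} = c.RG"
    proof (intro equalityI subsetI)
      fix U assume "U \<in> {U \<in> ?W. rs U = \<sigma>}"
      then show "U \<in> c.RG" by (auto simp: c.RG_def UU_def nsub_def)
    next
      fix U assume U: "U \<in> c.RG"
      then have "U \<in> UU" using c.RG_card[OF U] E by (auto simp: UU_def nsub_def c.RG_def)
      moreover have "rs U = \<sigma>"
      proof
        fix j show "rs U j = \<sigma> j"
          using U[unfolded c.RG_def] rs0[of U j] rs0[of U0 j] U0(1) by (cases "j < m") (auto simp: \<sigma> UU_def nsub_def)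
      qed
      ultimately show "U \<in> {U \<in> ?W. rs U = \<sigma>}" using U0 \<sigma> by simp
    qed
    have "mean c.RG ?b \<le> mean c.RG (\<lambda>U. of_bool (\<not> c.win (Q * r - 1) (ct U)) + of_bool (1 < \<bar>c.gph ka dl (ct U)\<bar>))"
      by (rule mean_mono) (auto simp: gph win)
    also have "\<dots> \<le> ?p" unfolding mean_add using c.RG_win_tail c.RG_gph_tail(1)[OF dl ka] by linarith
    finally show "(\<Sum>U\<in>{U \<in> ?W. rs U = \<sigma>}. ?b U) \<le> ?p * real (card {U \<in> ?W. rs U = \<sigma>})"
      unfolding eq mean_def using c.RG_ne c.finite_RG by (simp add: pos_divide_le_eq card_gt_0_iff)
  qed
  also have "\<dots> \<le> ?p * real (card UU)"
    using r_pos Qpos finite_UU by (intro mult_left_mono) (auto intro!: card_mono)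
  finally have 1: "(\<Sum>U\<in>?W. ?b U) \<le> ?p * real (card UU)" .
  have cU: "0 < real (card UU)" using UU_ne finite_UU by (simp add: card_gt_0_iff)
  have "mean UU ?b \<le> mean UU (\<lambda>U. of_bool (\<not> rwin (rs U)) + of_bool (rwin (rs U)) * ?b U)"
    by (rule mean_mono) auto
  also have "\<dots> \<le> r powi (-1) + ?p"
  proof -
    have "(\<Sum>U\<in>UU. of_bool (rwin (rs U)) * ?b U) = (\<Sum>U\<in>?W. ?b U)"
      unfolding sum.inter_filter[OF finite_UU] by (rule sum.cong) auto
    then have "mean UU (\<lambda>U. of_bool (rwin (rs U)) * ?b U) \<le> ?p"
      unfolding mean_def using 1 cU by (simp add: pos_divide_le_eq)
    then show ?thesis unfolding mean_add using rwin_tail by linarith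
  qed
  also have "\<dots> = (2 + Q ^ 45) * r powi (-1)" by (simp add: algebra_simps)
  also have "\<dots> \<le> Q ^ 46 * r powi (-1)"
  proof (rule mult_right_mono)
    have "1 \<le> Q ^ 45" using Qpos by (intro one_le_power) auto
    then have "2 + Q ^ 45 \<le> 3 * Q ^ 45" by simp
    also have "\<dots> \<le> Q * Q ^ 45" using Q16 by (intro mult_right_mono) auto
    finally show "2 + Q ^ 45 \<le> Q ^ 46" by (simp add: eval_nat_numeral)
  qed (use r_pos in simp)
  finally show ?thesis .
qed

text \<open>Over the good column sums T, the sum of PP T is nearly the number of edge sets and the
  sum of Th T * PP T nearly the number of graphs with row sums s. Since Th T is nearly Th t
  throughout, Th t is the quotient of these two numbers. Good means in the window and with exponent
  at most 1 in absolute value, where the exponential is controlled by its quadratic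
  remainder.\<close>

lemma normal_count:
  assumes w: "win (Q * r - 1) t"
  shows "\<exists>err. \<bar>err\<bar> \<le> Q ^ 75 * r powi (-1) \<and>
    NN t = real (card RG) * PP t / real (card Kc choose (\<Sum>j<m. s j)) * exp (phi t + err)"
proof -
  define ka where "ka = 1/2 * (1 - Rsum m s / AA)"
  define dl where "dl k = (\<Sum>j\<in>col H k. real (s j) - lam * real n + lam * real (degU H j))" for k
  let ?g = "\<lambda>U. gph ka dl (ct U)"
  let ?good = "\<lambda>U. win (Q * r - 1) (ct U) \<and> \<bar>?g U\<bar> \<le> 1"
  define d where "d = Q ^ 46 * r powi (-1)"
  define e where "e = Q ^ 74 * r powi (-1)"
  have ka: "bd 1 9 0 ka"
  proof -
    have "bd 1 6 0 (Rsum m s / AA)" using bd_div[OF bd_R lo_AA] by simp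
    then have 1: "\<bar>Rsum m s / AA\<bar> \<le> Q ^ 6" by (simp add: bd_def)
    have "1 \<le> Q ^ 6" using Qpos by (intro one_le_power) auto
    moreover have "\<bar>1/2 * (1 - z)\<bar> \<le> B" if "1 \<le> B" "\<bar>z\<bar> \<le> B" for z B :: real using that by (simp add: abs_le_iff field_simps)
    ultimately have "\<bar>ka\<bar> \<le> Q ^ 6" using 1 unfolding ka_def by blast
    also have "\<dots> \<le> Q ^ 9" using Qpos by (intro power_increasing) auto
    finally show ?thesis by (simp add: bd_def)
  qed
  have dl: "bd (y k) 2 1 (dl k)" if k: "k < n" for k
  proof -
    have "\<bar>dl k\<bar> \<le> (\<Sum>j\<in>col H k. 2 * (Q * r))"
      unfolding dl_def
    proof (rule order_trans[OF sum_abs], rule sum_mono)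
      fix j assume "j \<in> col H k"
      then have j: "j < m" using col_sub[OF Hsub] by auto
      have "\<bar>real (s j) - lam * real n\<bar> \<le> Q * r" using s_dev[OF j] by (simp add: avg_s_eq r_def)
      moreover have "lam * real (degU H j) \<le> 1 * (Q * r)"
        using x_le[OF j] lam01 by (intro mult_mono) (auto simp: r_def)
      moreover have "0 \<le> lam * real (degU H j)" using lam01 by simp
      ultimately show "\<bar>real (s j) - lam * real n + lam * real (degU H j)\<bar> \<le> 2 * (Q * r)" by linarith
    qed
    also have "\<dots> = (2 * Q) * r * y k" by (simp add: card_colH)
    also have "\<dots> \<le> Q^2 * r * y k"
      using Q16 r_pos by (intro mult_right_mono) (auto simp: power2_eq_square y_def)
    finally show ?thesis by (simp add: bd_def)
  qed
  have phi: "phi T = gph ka dl T" if "win c T" for c T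
    using AA_pos unfolding phi_def gph_def Ysum_eq[OF win_avg[OF that]] Rsum_def[of n] win_avg[OF that] ka_def dl_def y_def
    by (simp add: field_simps)
  have rp: "0 < r powi (-1)" using r_pos by simp
  have d2: "d \<le> 1/2" and de: "e + 4 * d \<le> Q ^ 75 * r powi (-1)"
  proof -
    have "2 * Q ^ 46 \<le> Q * Q ^ 46" using Qpos by (intro mult_right_mono) auto
    also have "\<dots> = Q ^ 47" by (simp add: eval_nat_numeral)
    also have "\<dots> \<le> Q ^ 100" using Qpos by (intro power_increasing) auto
    finally have "2 * Q ^ 46 \<le> r" using r_ge by linarith
    then show "d \<le> 1/2" using r_pos by (simp add: d_def field_simps)
    have "Q ^ 46 \<le> Q ^ 74" using Qpos by (intro power_increasing) auto
    then have "Q ^ 74 + 4 * Q ^ 46 \<le> 5 * Q ^ 74" by simp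
    also have "\<dots> \<le> Q * Q ^ 74" using Q16 by (intro mult_right_mono) auto
    also have "\<dots> = Q ^ 75" by (simp add: eval_nat_numeral)
    finally have "(Q ^ 74 + 4 * Q ^ 46) * r powi (-1) \<le> Q ^ 75 * r powi (-1)" using rp by (intro mult_right_mono) auto
    then show "e + 4 * d \<le> Q ^ 75 * r powi (-1)" by (simp add: d_def e_def algebra_simps)
  qed
  have cU: "0 < real (card UU)" using UU_ne finite_UU by (simp add: card_gt_0_iff)
  have cR: "0 < real (card RG)" using RG_ne finite_RG by (simp add: card_gt_0_iff)

  define G where "G = real (card {U \<in> UU. ?good U})"
  \<comment> \<open>Weighted by exp (- phi), the graphs with column sums T contribute exactly Th T *
    PP T.\<close>
  define X where "X = (\<Sum>U\<in>{U \<in> RG. ?good U}. exp (- phi (ct U)))"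
  have GU: "near (2 * d) G (real (card UU))"
  proof -
    have "mean UU (\<lambda>U. of_bool (?good U)) = mean UU (\<lambda>U. 1 - of_bool (\<not> ?good U))" by (rule mean_cong) simp
    also have "\<dots> = 1 - mean UU (\<lambda>U. of_bool (\<not> ?good U))" unfolding mean_diff mean_const[OF finite_UU UU_ne] ..
    finally have "\<bar>mean UU (\<lambda>U. of_bool (?good U)) - 1\<bar> \<le> d"
      using UU_tail[OF dl ka] mean_nonneg[of UU "\<lambda>U. of_bool (\<not> ?good U)"] by (simp add: d_def)
    then have 1: "near (2 * d) (mean UU (\<lambda>U. of_bool (?good U))) 1" using d2 by (rule near_of_abs)
    have "real (card UU) * mean UU (\<lambda>U. of_bool (?good U)) = G"
      using cU finite_UU by (simp add: mean_def G_def Int_def)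
    then show ?thesis using near_scale[OF 1, of "real (card UU)"] cU by simp
  qed
  have XR: "near (2 * d) X (real (card RG))"
  proof -
    \<comment> \<open>The error in exp (- phi) = 1 - phi, cut off to good graphs. On these it is at
      most phi^2; as the mean of phi is small by itself, the mean of the exponential is close to
      1.\<close>
    let ?f = "\<lambda>U. of_bool (?good U) * exp (- phi (ct U)) - 1 + ?g U"
    have "\<bar>mean RG ?f\<bar> \<le> mean RG (\<lambda>U. \<bar>?f U\<bar>)" by (rule mean_abs_le)
    also have "\<dots> \<le> mean RG (\<lambda>U. 2 * (?g U)\<^sup>2 + 2 * of_bool (\<not> win (Q * r - 1) (ct U)))"
    proof (rule mean_mono)
      fix U
      let ?x = "?g U"
      have sq: "\<bar>?x\<bar> * \<bar>?x\<bar> = ?x\<^sup>2" by (simp add: power2_eq_square)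
      consider "?good U" | "1 < \<bar>?x\<bar>" | "\<bar>?x\<bar> \<le> 1" "\<not> win (Q * r - 1) (ct U)" by linarith
      then show "\<bar>?f U\<bar> \<le> 2 * ?x\<^sup>2 + 2 * of_bool (\<not> win (Q * r - 1) (ct U))"
      proof cases
        case 1
        then have "\<bar>exp (- ?x) - 1 - (- ?x)\<bar> \<le> (- ?x) * (- ?x)" by (intro exp_quadratic) simp
        moreover have "phi (ct U) = ?x" using phi[of "Q * r - 1" "ct U"] 1 by simp
        ultimately show ?thesis using 1 by (simp add: power2_eq_square)
      next
        case 2
        then have "1 * \<bar>?x\<bar> \<le> \<bar>?x\<bar> * \<bar>?x\<bar>" by (intro mult_right_mono) auto
        then have "\<bar>- 1 + ?x\<bar> \<le> 2 * ?x\<^sup>2" using 2 sq by linarith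
        then show ?thesis using 2 by simp
      next
        case 3
        then have "\<bar>- 1 + ?x\<bar> \<le> 2 + 2 * ?x\<^sup>2" using zero_le_power2[of ?x] by linarith
        then show ?thesis using 3 by simp
      qed
    qed
    also have "\<dots> \<le> 2 * (Q ^ 45 * r powi (-1)) + 2 * r powi (-1)"
      unfolding mean_add mean_cmult using RG_gph_tail(2)[OF dl ka] RG_win_tail by linarith
    finally have f: "\<bar>mean RG ?f\<bar> \<le> 2 * (Q ^ 45 * r powi (-1)) + 2 * r powi (-1)" .
    have "mean RG ?f = mean RG (\<lambda>U. of_bool (?good U) * exp (- phi (ct U))) - 1 + mean RG ?g"
      unfolding mean_add mean_diff mean_const[OF finite_RG RG_ne] ..
    then have "\<bar>mean RG (\<lambda>U. of_bool (?good U) * exp (- phi (ct U))) - 1\<bar> \<le> 3 * (Q ^ 45 * r powi (-1)) + 2 * r powi (-1)"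
      using f RG_gph_tail(3)[OF dl ka] by linarith
    also have "\<dots> = (3 * Q ^ 45 + 2) * r powi (-1)" by (simp add: algebra_simps)
    also have "\<dots> \<le> d" unfolding d_def
    proof (rule mult_right_mono)
      have "1 \<le> Q ^ 45" using Qpos by (intro one_le_power) auto
      then have "3 * Q ^ 45 + 2 \<le> 5 * Q ^ 45" by simp
      also have "\<dots> \<le> Q * Q ^ 45" using Q16 by (intro mult_right_mono) auto
      finally show "3 * Q ^ 45 + 2 \<le> Q ^ 46" by (simp add: eval_nat_numeral)
    qed (use rp in simp)
    finally have 1: "near (2 * d) (mean RG (\<lambda>U. of_bool (?good U) * exp (- phi (ct U)))) 1" using d2 by (rule near_of_abs)
    have "(\<Sum>U\<in>RG. of_bool (?good U) * exp (- phi (ct U))) = X"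
      unfolding X_def sum.inter_filter[OF finite_RG] by (rule sum.cong) auto
    then have "real (card RG) * mean RG (\<lambda>U. of_bool (?good U) * exp (- phi (ct U))) = X"
      using cR by (simp add: mean_def)
    then show ?thesis using near_scale[OF 1, of "real (card RG)"] cR by simp
  qed

  \<comment> \<open>As \<open>RG\<close> is contained in \<open>UU\<close> and goodness depends on
    the column sums only, these vectors cover the good graphs of both models.\<close>
  define TT where "TT = ct ` {U \<in> UU. ?good U}"
  have fTT: "finite TT" using finite_UU by (simp add: TT_def)
  have T: "PP T = real (card {U \<in> {U \<in> UU. ?good U}. ct U = T})"
    "(\<Sum>U\<in>{U \<in> {U \<in> RG. ?good U}. ct U = T}. exp (- phi (ct U))) = Th T * PP T"
    "win (Q * r - 1) T" "0 \<le> PP T" if TT: "T \<in> TT" for T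
  proof -
    obtain U0 where U0: "U0 \<in> UU" "?good U0" "T = ct U0" using TT by (auto simp: TT_def)
    have T0: "\<And>k. n \<le> k \<Longrightarrow> T k = 0" using ct_out[OF UU_sub[OF U0(1)]] U0(3) by simp
    have sT: "(\<Sum>k<n. T k) = (\<Sum>j<m. s j)" using U0 by (simp add: win_def)
    have "{U \<in> {U \<in> UU. ?good U}. ct U = T} = {U. U \<subseteq> Kc \<and> ct U = T}"
    proof (intro equalityI subsetI)
      fix U assume U: "U \<in> {U. U \<subseteq> Kc \<and> ct U = T}"
      then have "card U = (\<Sum>j<m. s j)" using sum_ct[of U m n] Kc_sub sT by auto
      then show "U \<in> {U \<in> {U \<in> UU. ?good U}. ct U = T}" using U U0 by (simp add: UU_def nsub_def)
    qed (simp add: UU_def nsub_def)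
    then show P: "PP T = real (card {U \<in> {U \<in> UU. ?good U}. ct U = T})" using card_cols[OF T0] by simp
    have "U0 \<in> {U \<in> {U \<in> UU. ?good U}. ct U = T}" using U0 by simp
    then have Pp: "0 < PP T" unfolding P of_nat_0_less_iff card_gt_0_iff
      by (intro conjI) (blast, simp add: finite_UU)
    have "{U \<in> {U \<in> RG. ?good U}. ct U = T} = bip_graphs m n s T H" 
    proof -
      have "bip_graphs m n s T H = {U \<in> RG. ct U = T}" by (rule bip_RG) (rule T0)
      then show ?thesis using U0(2,3) by auto
    qed
    moreover have "(\<Sum>U\<in>{U \<in> {U \<in> RG. ?good U}. ct U = T}. exp (- phi (ct U)))
      = (\<Sum>U\<in>{U \<in> {U \<in> RG. ?good U}. ct U = T}. exp (- phi T))" by (rule sum.cong) auto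
    ultimately have "(\<Sum>U\<in>{U \<in> {U \<in> RG. ?good U}. ct U = T}. exp (- phi (ct U))) = NN T * exp (- phi T)"
      by (simp only: NN_def sum_constant)
    then show "(\<Sum>U\<in>{U \<in> {U \<in> RG. ?good U}. ct U = T}. exp (- phi (ct U))) = Th T * PP T"
      using Pp by (simp add: Th_def exp_minus field_simps)
    show "win (Q * r - 1) T" "0 \<le> PP T" using U0 Pp by auto
  qed
  have G: "G = (\<Sum>T\<in>TT. PP T)"
  proof -
    have "G = (\<Sum>U\<in>{U \<in> UU. ?good U}. 1)" by (simp add: G_def)
    also have "\<dots> = (\<Sum>T\<in>TT. \<Sum>U\<in>{U \<in> {U \<in> UU. ?good U}. ct U = T}. 1)"
      unfolding TT_def by (rule sum.image_gen) (simp add: finite_UU)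
    also have "\<dots> = (\<Sum>T\<in>TT. PP T)" by (rule sum.cong) (simp_all add: T(1))
    finally show ?thesis .
  qed
  have X: "X = (\<Sum>T\<in>TT. Th T * PP T)"
  proof -
    have "X = (\<Sum>T\<in>TT. \<Sum>U\<in>{U \<in> {U \<in> RG. ?good U}. ct U = T}. exp (- phi (ct U)))"
      unfolding X_def by (rule sum.group[symmetric]) (use finite_RG fTT RG_UU in \<open>auto simp: TT_def\<close>)
    also have "\<dots> = (\<Sum>T\<in>TT. Th T * PP T)" by (rule sum.cong[OF refl T(2)])
    finally show ?thesis .
  qed
  have th0: "0 \<le> Th t" by (rule Th_nonneg)
  have "near e (Th t * G) X"
  proof -
    have n: "near e (Th t) (Th T)" if "T \<in> TT" for T
      unfolding e_def by (rule Th_const[OF w T(3)[OF that]])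
    have "Th t * G \<le> X * exp e"
      unfolding G X sum_distrib_left sum_distrib_right
    proof (rule sum_mono)
      fix T assume TT: "T \<in> TT"
      have "Th t * PP T \<le> (Th T * exp e) * PP T" using n[OF TT] T(4)[OF TT] by (intro mult_right_mono) (auto simp: near_def)
      then show "Th t * PP T \<le> Th T * PP T * exp e" by (simp add: mult_ac)
    qed
    moreover have "X \<le> Th t * G * exp e"
      unfolding G X sum_distrib_left sum_distrib_right
    proof (rule sum_mono)
      fix T assume TT: "T \<in> TT"
      have "Th T * PP T \<le> (Th t * exp e) * PP T" using n[OF TT] T(4)[OF TT] by (intro mult_right_mono) (auto simp: near_def)
      then show "Th T * PP T \<le> Th t * PP T * exp e" by (simp add: mult_ac)
    qed
    ultimately show ?thesis by (simp add: near_def)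
  qed
  \<comment> \<open>One loss of 2 * d for each of the two models, and e for the variation of
    \<open>Th\<close>.\<close>
  then have "near (2 * d + (e + 2 * d)) (Th t * real (card UU)) (real (card RG))"
    by (intro near_trans[OF near_scale[OF near_sym[OF GU] th0]] near_trans[OF _ XR])
  then have N: "near (e + 4 * d) (Th t * real (card UU)) (real (card RG))" by (simp add: algebra_simps)
  have cUU: "card UU = card Kc choose (\<Sum>j<m. s j)" by (simp add: UU_def card_nsub finite_Kc)
  show ?thesis
  \<comment> \<open>If a column binomial vanishes there is no graph, both sides are 0, and the error
    term can be taken as 0.\<close>
  proof (cases "PP t = 0")
    case True
    have "win (Q * r) t" using w by (rule win_mono) simp
    then have "NN t = 0" using PP_pos True by force
    then show ?thesis using True rp Qpos by (intro exI[of _ 0]) simp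
  next
    case False
    \<comment> \<open>Being close to the positive number \<open>card RG\<close> excludes Th t = 0.
      So graphs with column sums t exist, and the error can be defined as a logarithm.\<close>
    have "0 < Th t * real (card UU) * exp (e + 4 * d)" using N cR by (auto simp: near_def)
    then have tp: "0 < Th t" using th0 by (cases "Th t = 0") auto
    let ?z = "Th t * real (card UU) / real (card RG)"
    have z: "0 < ?z" using tp cU cR by simp
    have "?z \<le> exp (e + 4 * d)" "1 \<le> ?z * exp (e + 4 * d)"
      using N cR by (auto simp: near_def divide_le_eq le_divide_eq mult.commute)
    then have "ln ?z \<le> e + 4 * d" "0 \<le> ln ?z + (e + 4 * d)"
      using z ln_mono[of ?z "exp (e + 4 * d)"] ln_mono[of 1 "?z * exp (e + 4 * d)"] ln_mult_pos[OF z exp_gt_zero[of "e + 4 * d"]]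
      unfolding ln_exp ln_one by linarith+
    then have "\<bar>ln ?z\<bar> \<le> Q ^ 75 * r powi (-1)" using de by linarith
    moreover have "NN t = real (card RG) * PP t / real (card Kc choose (\<Sum>j<m. s j)) * exp (phi t + ln ?z)"
      unfolding exp_add exp_ln[OF z] cUU[symmetric] using False cU cR by (simp add: Th_def)
    ultimately show ?thesis by blast
  qed
qed

end

section \<open>The asymptotic formula\<close>

text \<open>The estimate for fixed m and n. The data are measured by q and the window by Q; the gap
  between them makes the window typical in both random models. L takes the place of a * ln
  n.\<close>

lemma bip_graphs_count:
  fixes q Q L :: real
  assumes H: "H \<subseteq> {..<m} \<times> {..<n}" and E: "(\<Sum>j<m. s j) = (\<Sum>k<n. t k)"
    and q: "64 \<le> q" "64 * q\<^sup>2 \<le> Q" "Q ^ 100 \<le> sqrt (real n)" "exp (- Q) * sqrt (real n) ^ 60 \<le> 1"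
    and mn: "real m \<le> q * real n" "real n \<le> q * real m" "real (card H) \<le> q * real n"
    and row: "\<And>j. j < m \<Longrightarrow> \<bar>real (s j) - avg_s m s\<bar> \<le> q * sqrt (real n) \<and> real (degU H j) \<le> q * sqrt (real n)"
    and col: "\<And>k. k < n \<Longrightarrow> \<bar>real (t k) - avg_s n t\<bar> \<le> q * sqrt (real n) \<and> real (degV H k) \<le> q * sqrt (real n)"
    and L: "0 \<le> L" "4 * (1 + L) \<le> Q" "(1 - 2 * dens m n s)\<^sup>2 \<le> 8 * Acoef m n s * L"
  shows "\<exists>err. \<bar>err\<bar> \<le> Q ^ 75 / sqrt (real n) \<and> real (card (bip_graphs m n s t H))
      = (\<Prod>j<m. real ((n - degU H j) choose s j)) * (\<Prod>k<n. real ((m - degV H k) choose t k))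
        / real ((m * n - Xtot H) choose (\<Sum>j<m. s j))
        * exp (- (1/2) * (1 - Rsum m s / (2 * Acoef m n s * m * n)) * (1 - Rsum n t / (2 * Acoef m n s * m * n))
               - Ysum m n s t H / (2 * Acoef m n s * m * n) + err)"
proof -
  let ?l = "dens m n s"
  have q64: "q * 64 \<le> Q"
  proof -
    have "q * 1 \<le> q * q" using q(1) by (intro mult_left_mono) auto
    then show ?thesis using q(2) unfolding power2_eq_square by linarith
  qed
  then have Q16: "16 \<le> Q" and qleQ: "q \<le> Q" using q by linarith+
  have l: "1 / Q \<le> ?l" "1 / Q \<le> 1 - ?l"
  proof -
    let ?z = "?l * (1 - ?l)"
    \<comment> \<open>With z = lam * (1 - lam), (1 - 2 * lam)^2 = 1 - 4 * z and 8 * A = 4 * z. The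
      hypothesis thus reads 4 * (1 + L) * z >= 1, and Q >= 4 * (1 + L) keeps the density away from 0
      and 1.\<close>
    have "1 - 4 * ?z \<le> 4 * ?z * L" using L(3) by (simp add: Acoef_def power2_eq_square algebra_simps)
    then have z: "1 \<le> (4 * (1 + L)) * ?z" by (simp add: algebra_simps)
    have zp: "0 < ?z"
    proof (rule ccontr)
      assume "\<not> 0 < ?z"
      then have "(4 * (1 + L)) * ?z \<le> 0" using L(1) by (intro mult_nonneg_nonpos[of "4 * (1 + L)"]) (simp, simp only: not_less)
      then show False using z by linarith
    qed
    then have "(4 * (1 + L)) * ?z \<le> Q * ?z" using L(2) by (intro mult_right_mono) auto
    then have z1: "1 / Q \<le> ?z" using z Q16 by (simp add: divide_le_eq mult.commute)
    have "0 < ?l" "0 < 1 - ?l" using zp by (auto simp: zero_less_mult_iff)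
    then have "?z \<le> ?l" "?z \<le> 1 - ?l" using mult_left_mono[of "1 - ?l" 1 ?l] mult_right_mono[of ?l 1 "1 - ?l"] by auto
    then show "1 / Q \<le> ?l" "1 / Q \<le> 1 - ?l" using order_trans[OF z1] by auto
  qed
  have w: "x \<le> Q * sqrt (real n)" if "x \<le> q * sqrt (real n)" for x
    using that mult_right_mono[OF qleQ, of "sqrt (real n)"] by simp
  have wn: "x \<le> Q * real k" if "x \<le> q * real k" for x k
    using that mult_right_mono[OF qleQ, of "real k"] by simp
  interpret dense m n s H Q
    by unfold_locales (use H Q16 l q(3,4) mn row col in \<open>auto intro: w wn\<close>)
  interpret normal m n s H Q q
    by unfold_locales (use q mn row col in \<open>auto simp: r_def y_def\<close>)
  have sE: "(\<Sum>k<n. t k) = (\<Sum>j<m. s j)" using E by simp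
  have av: "avg_s n t = lam * real m"
    using sE sum_s n_pos by (simp add: avg_s_def flip: of_nat_sum)
  have "q * r \<le> Q * r - 1"
  proof -
    have "1 * 1 \<le> q * r" using q r_pos by (intro mult_mono) auto
    moreover have "(q * 64) * r \<le> Q * r" by (rule mult_right_mono[OF q64]) (use r_pos in simp)
    ultimately show ?thesis by linarith
  qed
  then have "win (Q * r - 1) t" unfolding win_def using sE col unfolding av r_def[symmetric] by force
  from normal_count[OF this] obtain err where err: "\<bar>err\<bar> \<le> Q ^ 75 * r powi (-1)"
    and N: "NN t = real (card RG) * PP t / real (card Kc choose (\<Sum>j<m. s j)) * exp (phi t + err)" by auto
  have AA: "2 * Acoef m n s * m * n = AA" by (simp add: AA_def Acoef_def lam_def)
  have "\<bar>err\<bar> \<le> Q ^ 75 / sqrt (real n)" using err by (simp add: r_def divide_inverse)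
  then show ?thesis using N unfolding NN_def PP_def card_RG card_Kc phi_def AA Xtot_def by blast
qed

text \<open>Take q = z^3 and Q = z^7 with z = n^\<epsilon>. Once z >= K, an implicit constant costs
  at most one factor z: the bound K * z^2 * n on the size of H requires the third power in q, and 64
  * q^2 = 64 * z^6 <= z^7 the seventh in Q.\<close>

lemma asymptotic_step:
  fixes \<epsilon> K a b :: real and n :: nat
  defines "z \<equiv> real n powr \<epsilon>"
  assumes ep: "0 < \<epsilon>" "1400 * \<epsilon> \<le> 1/2 - b" "0 < b" "0 < a"
    and K: "64 \<le> K" "30 / \<epsilon> \<le> K" "4 * (1 + a / \<epsilon>) \<le> K" and zK: "K \<le> z" and n: "0 < n"
    and H: "H \<subseteq> {..<m} \<times> {..<n}" and E: "(\<Sum>j<m. s j) = (\<Sum>k<n. t k)"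
    and row: "\<forall>j<m. \<bar>real (s j) - avg_s m s\<bar> \<le> K * real n powr (1/2 + \<epsilon>) \<and> real (degU H j) \<le> K * real n powr (1/2 + \<epsilon>)"
    and col: "\<forall>k<n. \<bar>real (t k) - avg_s n t\<bar> \<le> K * real n powr (1/2 + \<epsilon>) \<and> real (degV H k) \<le> K * real n powr (1/2 + \<epsilon>)"
    and X: "real (Xtot H) \<le> K * real n powr (1 + 2 * \<epsilon>)"
    and nm: "real n \<le> real m powr (1 + \<epsilon>)" and mn: "real m \<le> real n powr (1 + \<epsilon>)"
    and A: "(1 - 2 * dens m n s)\<^sup>2 * (1 + 5 * real m / (6 * real n) + 5 * real n / (6 * real m))
            \<le> 8 * Acoef m n s * (a * ln (real n))"
  shows "\<exists>err. \<bar>err\<bar> \<le> real n powr (- b) \<and> real (card (bip_graphs m n s t H))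
      = (\<Prod>j<m. real ((n - degU H j) choose s j)) * (\<Prod>k<n. real ((m - degV H k) choose t k))
        / real ((m * n - Xtot H) choose (\<Sum>j<m. s j))
        * exp (- (1/2) * (1 - Rsum m s / (2 * Acoef m n s * m * n)) * (1 - Rsum n t / (2 * Acoef m n s * m * n))
               - Ysum m n s t H / (2 * Acoef m n s * m * n) + err)"
proof -
  let ?x = "real n"
  have x1: "1 \<le> ?x" using n by simp
  have z64: "64 \<le> z" using K zK by linarith
  then have z1: "1 \<le> z" by simp
  have zp: "z ^ i = ?x powr (real i * \<epsilon>)" for i using n by (simp add: z_def powr_realpow[symmetric] powr_powr mult.commute)
  have ph: "?x powr (1/2 + \<epsilon>) = z * sqrt ?x" using n by (simp add: powr_add z_def powr_half_sqrt)
  have p1: "?x powr (1 + \<epsilon>) = z * ?x" using n by (simp add: powr_add z_def)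
  have p2: "?x powr (1 + 2 * \<epsilon>) = z\<^sup>2 * ?x" using n by (simp add: powr_add zp)
  have z3: "z \<le> z ^ 3" "z\<^sup>2 \<le> z ^ 3" "z\<^sup>2 \<le> z ^ 7" using z1 power_increasing[of 1 3 z] power_increasing[of 2 3 z] power_increasing[of 2 7 z] by auto
  have Kz: "K * (z ^ i * v) \<le> z ^ Suc i * v" if "0 \<le> v" for i v
    using mult_right_mono[OF zK, of "z ^ i * v"] z1 that by simp
  have dev: "u \<le> z ^ 3 * sqrt ?x" if "u \<le> K * ?x powr (1/2 + \<epsilon>)" for u
  proof -
    have "K * ?x powr (1/2 + \<epsilon>) \<le> z\<^sup>2 * sqrt ?x" using Kz[of "sqrt ?x" 1] unfolding ph by (simp add: power2_eq_square)
    also have "\<dots> \<le> z ^ 3 * sqrt ?x" using z3 by (intro mult_right_mono) auto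
    finally show ?thesis using that by linarith
  qed
  have lnx: "ln ?x \<le> z / \<epsilon>" using ln_powr_bound[OF x1 ep(1)] by (simp add: z_def)
  have e2: "\<epsilon> \<le> 1" using ep by linarith
  have "\<exists>err. \<bar>err\<bar> \<le> (z ^ 7) ^ 75 / sqrt ?x \<and> real (card (bip_graphs m n s t H))
      = (\<Prod>j<m. real ((n - degU H j) choose s j)) * (\<Prod>k<n. real ((m - degV H k) choose t k))
        / real ((m * n - Xtot H) choose (\<Sum>j<m. s j))
        * exp (- (1/2) * (1 - Rsum m s / (2 * Acoef m n s * m * n)) * (1 - Rsum n t / (2 * Acoef m n s * m * n))
               - Ysum m n s t H / (2 * Acoef m n s * m * n) + err)"
  proof (rule bip_graphs_count[where q = "z ^ 3" and L = "a * ln ?x"])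
    show "64 \<le> z ^ 3" using z64 z3 by linarith
    have "64 * z ^ 6 \<le> z * z ^ 6" using z64 by (intro mult_right_mono) auto
    also have "\<dots> = z ^ 7" by (simp add: eval_nat_numeral)
    finally show "64 * (z ^ 3)\<^sup>2 \<le> z ^ 7" by (simp add: power_mult[symmetric])
    have "(z ^ 7) ^ 100 = ?x powr (700 * \<epsilon>)" using zp[of 700] by (simp add: power_mult[symmetric])
    also have "\<dots> \<le> ?x powr (1/2)" using ep x1 by (intro powr_mono) auto
    finally show "(z ^ 7) ^ 100 \<le> sqrt ?x" by (simp add: powr_half_sqrt)
    \<comment> \<open>The required exp (- Q) * n^30 <= 1 means 30 * ln n <= z^7. From ln n <= z /
      \<epsilon> and z >= 30 / \<epsilon> even z^2 suffices.\<close>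
    have "30 * ln ?x \<le> 30 / \<epsilon> * z" using lnx by simp
    also have "\<dots> \<le> z * z" using K zK z1 by (intro mult_right_mono) auto
    finally have 30: "30 * ln ?x \<le> z ^ 7" using z3 by (simp add: power2_eq_square)
    have "sqrt ?x ^ 60 = ((sqrt ?x)\<^sup>2) ^ 30" unfolding power_mult[symmetric] by simp
    also have "\<dots> = exp (30 * ln ?x)" using n by (simp add: exp_of_nat_mult[of 30, simplified])
    finally have "exp (- (z ^ 7)) * sqrt ?x ^ 60 = exp (- (z ^ 7) + 30 * ln ?x)" by (simp only: exp_add)
    also have "\<dots> \<le> 1" using 30 by simp
    finally show "exp (- (z ^ 7)) * sqrt ?x ^ 60 \<le> 1" .
    have "z * ?x \<le> z ^ 3 * ?x" using z3 by (intro mult_right_mono) auto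
    then show "real m \<le> z ^ 3 * ?x" using mn unfolding p1 by linarith
    have m0: "0 < real m" using nm n by (cases "m = 0") auto
    \<comment> \<open>In n <= m^\<epsilon> * m the first factor is at most z^2, because m <= z * n
      gives m^\<epsilon> <= z^\<epsilon> * z.\<close>
    have "real m powr \<epsilon> \<le> (z * ?x) powr \<epsilon>" using mn m0 ep unfolding p1 by (intro powr_mono2) auto
    also have "\<dots> = z powr \<epsilon> * z" using z1 by (simp add: powr_mult z_def)
    also have "\<dots> \<le> z powr 1 * z" using z1 e2 by (intro mult_right_mono powr_mono) auto
    also have "\<dots> \<le> z ^ 3" using z1 z3 by (simp add: power2_eq_square)
    finally have "real m powr \<epsilon> * real m \<le> z ^ 3 * real m" by (intro mult_right_mono) auto
    moreover have "real m powr (1 + \<epsilon>) = real m powr \<epsilon> * real m" using m0 by (simp add: powr_add)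
    ultimately show "?x \<le> z ^ 3 * real m" using nm by linarith
    show "real (card H) \<le> z ^ 3 * ?x" using X Kz[of ?x 2] unfolding p2 Xtot_def by (simp add: eval_nat_numeral)
    show "0 \<le> a * ln ?x" using ep x1 by simp
    have "4 * (1 + a * ln ?x) \<le> 4 * (z + a * (z / \<epsilon>))" using lnx ep z1 by (intro mult_left_mono add_mono) auto
    also have "\<dots> = 4 * (1 + a / \<epsilon>) * z" by (simp add: algebra_simps)
    also have "\<dots> \<le> z * z" using K zK z1 by (intro mult_right_mono) auto
    finally show "4 * (1 + a * ln ?x) \<le> z ^ 7" using z3 by (simp add: power2_eq_square)
    have "(1 - 2 * dens m n s)\<^sup>2 * 1 \<le> (1 - 2 * dens m n s)\<^sup>2 * (1 + 5 * real m / (6 * ?x) + 5 * ?x / (6 * real m))"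
      by (intro mult_left_mono) auto
    then show "(1 - 2 * dens m n s)\<^sup>2 \<le> 8 * Acoef m n s * (a * ln ?x)" using A by linarith
  qed (use H E row col dev in auto)
  moreover have "(z ^ 7) ^ 75 / sqrt ?x \<le> ?x powr (- b)"
  proof -
    have "(z ^ 7) ^ 75 / sqrt ?x = ?x powr (525 * \<epsilon> - 1/2)"
      using zp[of 525] by (simp add: power_mult[symmetric] powr_diff powr_half_sqrt)
    also have "\<dots> \<le> ?x powr (- b)" using ep x1 by (intro powr_mono) auto
    finally show ?thesis .
  qed
  ultimately show ?thesis by (meson order_trans)
qed

theorem theorem2p1:
  fixes a b :: real
  assumes "a > 0" and "b > 0" and "a + b < 1/2"
  shows "\<exists>\<epsilon>0>0. \<forall>\<epsilon>. 0 < \<epsilon> \<and> \<epsilon> < \<epsilon>0 \<longrightarrow>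
    (\<forall>(m :: nat \<Rightarrow> nat) (n :: nat \<Rightarrow> nat) (s :: nat \<Rightarrow> nat \<Rightarrow> nat) (t :: nat \<Rightarrow> nat \<Rightarrow> nat)
       (H :: nat \<Rightarrow> (nat \<times> nat) set).
      filterlim m at_top sequentially \<and> filterlim n at_top sequentially
      \<and> (\<forall>N. \<forall>j<m N. s N j > 0) \<and> (\<forall>N. \<forall>k<n N. t N k > 0)
      \<and> (\<forall>N. (\<Sum>j<m N. s N j) = (\<Sum>k<n N. t N k))
      \<and> (\<forall>N. H N \<subseteq> {..<m N} \<times> {..<n N})
      \<and> (\<exists>c. \<forall>\<^sub>F N in sequentially.
            (\<forall>j<m N. \<bar>real (s N j) - avg_s (m N) (s N)\<bar> \<le> c * real (n N) powr (1/2 + \<epsilon>)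
                    \<and> real (degU (H N) j) \<le> c * real (n N) powr (1/2 + \<epsilon>))
          \<and> (\<forall>k<n N. \<bar>real (t N k) - avg_s (n N) (t N)\<bar> \<le> c * real (n N) powr (1/2 + \<epsilon>)
                    \<and> real (degV (H N) k) \<le> c * real (n N) powr (1/2 + \<epsilon>)))
      \<and> (\<lambda>N. real (Xtot (H N))) \<in> O[sequentially](\<lambda>N. real (n N) powr (1 + 2 * \<epsilon>))
      \<and> (\<lambda>N. real (n N)) \<in> o[sequentially](\<lambda>N. real (m N) powr (1 + \<epsilon>))
      \<and> (\<lambda>N. real (m N)) \<in> o[sequentially](\<lambda>N. real (n N) powr (1 + \<epsilon>))
      \<and> (\<forall>\<^sub>F N in sequentially.
            (1 - 2 * dens (m N) (n N) (s N))\<^sup>2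
              * (1 + 5 * real (m N) / (6 * real (n N)) + 5 * real (n N) / (6 * real (m N)))
            \<le> 8 * Acoef (m N) (n N) (s N) * (a * ln (real (n N))))
    \<longrightarrow> (\<exists>err :: nat \<Rightarrow> real. err \<in> O[sequentially](\<lambda>N. real (n N) powr (- b)) \<and>
         (\<forall>\<^sub>F N in sequentially.
           (let mm = m N; nn = n N; A = Acoef mm nn (s N);
                R = Rsum mm (s N); C = Rsum nn (t N); Y = Ysum mm nn (s N) (t N) (H N)
            in real (card (bip_graphs mm nn (s N) (t N) (H N)))
               = (\<Prod>j<mm. real ((nn - degU (H N) j) choose s N j))
                 * (\<Prod>k<nn. real ((mm - degV (H N) k) choose t N k))
                 / real ((mm * nn - Xtot (H N)) choose (\<Sum>j<mm. s N j))
                 * exp (- (1/2) * (1 - R / (2 * A * mm * nn)) * (1 - C / (2 * A * mm * nn))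
                        - Y / (2 * A * mm * nn) + err N)))))"
proof -
  \<comment> \<open>This makes 1400 * \<epsilon> <= 1/2 - b, which gives 525 * \<epsilon> - 1/2 <=
    -b for the error Q^75 / sqrt n and 700 * \<epsilon> <= 1/2 for Q^100 <= sqrt n.\<close>
  define e0 where "e0 = (1/2 - b) / 1400"
  have e0: "0 < e0" using assms by (simp add: e0_def)
  show ?thesis
  proof (intro exI[of _ e0] conjI e0 allI impI, elim conjE)
    fix \<epsilon> :: real and m n :: "nat \<Rightarrow> nat" and s t :: "nat \<Rightarrow> nat \<Rightarrow> nat" and H :: "nat \<Rightarrow> (nat \<times> nat) set"
    assume ep: "0 < \<epsilon>" "\<epsilon> < e0"
      and ntop: "filterlim n at_top sequentially"
      and E: "\<forall>N. (\<Sum>j<m N. s N j) = (\<Sum>k<n N. t N k)"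
      and H: "\<forall>N. H N \<subseteq> {..<m N} \<times> {..<n N}"
      and dev: "\<exists>c. \<forall>\<^sub>F N in sequentially.
            (\<forall>j<m N. \<bar>real (s N j) - avg_s (m N) (s N)\<bar> \<le> c * real (n N) powr (1/2 + \<epsilon>)
                    \<and> real (degU (H N) j) \<le> c * real (n N) powr (1/2 + \<epsilon>))
          \<and> (\<forall>k<n N. \<bar>real (t N k) - avg_s (n N) (t N)\<bar> \<le> c * real (n N) powr (1/2 + \<epsilon>)
                    \<and> real (degV (H N) k) \<le> c * real (n N) powr (1/2 + \<epsilon>))"
      and X: "(\<lambda>N. real (Xtot (H N))) \<in> O[sequentially](\<lambda>N. real (n N) powr (1 + 2 * \<epsilon>))"
      and nm: "(\<lambda>N. real (n N)) \<in> o[sequentially](\<lambda>N. real (m N) powr (1 + \<epsilon>))"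
      and mn: "(\<lambda>N. real (m N)) \<in> o[sequentially](\<lambda>N. real (n N) powr (1 + \<epsilon>))"
      and A: "\<forall>\<^sub>F N in sequentially.
            (1 - 2 * dens (m N) (n N) (s N))\<^sup>2
              * (1 + 5 * real (m N) / (6 * real (n N)) + 5 * real (n N) / (6 * real (m N)))
            \<le> 8 * Acoef (m N) (n N) (s N) * (a * ln (real (n N)))"
    obtain c where c: "\<forall>\<^sub>F N in sequentially.
            (\<forall>j<m N. \<bar>real (s N j) - avg_s (m N) (s N)\<bar> \<le> c * real (n N) powr (1/2 + \<epsilon>)
                    \<and> real (degU (H N) j) \<le> c * real (n N) powr (1/2 + \<epsilon>))
          \<and> (\<forall>k<n N. \<bar>real (t N k) - avg_s (n N) (t N)\<bar> \<le> c * real (n N) powr (1/2 + \<epsilon>)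
                    \<and> real (degV (H N) k) \<le> c * real (n N) powr (1/2 + \<epsilon>))" using dev by blast
    obtain C where C: "\<forall>\<^sub>F N in sequentially. norm (real (Xtot (H N))) \<le> C * norm (real (n N) powr (1 + 2 * \<epsilon>))"
      using landau_o.bigE[OF X] by blast
    have nm1: "\<forall>\<^sub>F N in sequentially. norm (real (n N)) \<le> 1 * norm (real (m N) powr (1 + \<epsilon>))"
      by (rule landau_o.smallD[OF nm]) simp
    have mn1: "\<forall>\<^sub>F N in sequentially. norm (real (m N)) \<le> 1 * norm (real (n N) powr (1 + \<epsilon>))"
      by (rule landau_o.smallD[OF mn]) simp
    \<comment> \<open>Dominates the implicit constants c and C of the hypotheses together with the
      three lower bounds required by \<open>asymptotic_step\<close>.\<close>
    define K where "K = 64 + \<bar>c\<bar> + \<bar>C\<bar> + 30 / \<epsilon> + 4 * (1 + a / \<epsilon>)"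
    have ae: "0 < 30 / \<epsilon>" "0 < a / \<epsilon>" using ep assms by auto
    have "64 \<le> 64 + \<bar>c\<bar> + \<bar>C\<bar> + u + 4 * (1 + v)" "u \<le> 64 + \<bar>c\<bar> + \<bar>C\<bar> + u + 4 * (1 + v)"
      "4 * (1 + v) \<le> 64 + \<bar>c\<bar> + \<bar>C\<bar> + u + 4 * (1 + v)" "c \<le> 64 + \<bar>c\<bar> + \<bar>C\<bar> + u + 4 * (1 + v)"
      "C \<le> 64 + \<bar>c\<bar> + \<bar>C\<bar> + u + 4 * (1 + v)" if "0 < u" "0 < v" for u v
      using that abs_ge_self[of c] abs_ge_self[of C] abs_ge_zero[of c] abs_ge_zero[of C] by auto
    from this[OF ae] have K: "64 \<le> K" "30 / \<epsilon> \<le> K" "4 * (1 + a / \<epsilon>) \<le> K" "c \<le> K" "C \<le> K" unfolding K_def .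
    have zK: "\<forall>\<^sub>F N in sequentially. K \<le> real (n N) powr \<epsilon>"
    proof -
      have "\<forall>\<^sub>F N in sequentially. K powr (1 / \<epsilon>) \<le> real (n N)"
        using filterlim_compose[OF filterlim_real_sequentially ntop] by (simp add: filterlim_at_top)
      then show ?thesis
      proof eventually_elim
        case (elim N)
        then have "(K powr (1 / \<epsilon>)) powr \<epsilon> \<le> real (n N) powr \<epsilon>" using ep by (intro powr_mono2) auto
        then show ?case using ep K(1) by (simp add: powr_powr)
      qed
    qed
    have n0: "\<forall>\<^sub>F N in sequentially. 0 < n N" using ntop[unfolded filterlim_at_top, rule_format, of 1] by (rule eventually_mono) simp
    let ?F = "\<lambda>N err. real (card (bip_graphs (m N) (n N) (s N) (t N) (H N)))
      = (\<Prod>j<m N. real ((n N - degU (H N) j) choose s N j)) * (\<Prod>k<n N. real ((m N - degV (H N) k) choose t N k))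
        / real ((m N * n N - Xtot (H N)) choose (\<Sum>j<m N. s N j))
        * exp (- (1/2) * (1 - Rsum (m N) (s N) / (2 * Acoef (m N) (n N) (s N) * m N * n N))
                 * (1 - Rsum (n N) (t N) / (2 * Acoef (m N) (n N) (s N) * m N * n N))
               - Ysum (m N) (n N) (s N) (t N) (H N) / (2 * Acoef (m N) (n N) (s N) * m N * n N) + err)"
    have ex: "\<forall>\<^sub>F N in sequentially. \<exists>err. \<bar>err\<bar> \<le> real (n N) powr (- b) \<and> ?F N err"
      using c C nm1 mn1 zK n0 A
    proof eventually_elim
      case (elim N)
      have w: "u \<le> K * real (n N) powr i" if "u \<le> c * real (n N) powr i \<or> u \<le> C * real (n N) powr i" for u i
        using that mult_right_mono[OF K(4), of "real (n N) powr i"] mult_right_mono[OF K(5), of "real (n N) powr i"] by auto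
      have "1400 * \<epsilon> \<le> 1/2 - b" using ep by (simp add: e0_def)
      then show ?case
        by (rule asymptotic_step[OF ep(1) _ assms(2,1) K(1-3)])
          (use elim H E w in auto)
    qed
    \<comment> \<open>For the finitely many N without a suitable value the choice is arbitrary,
      which does not affect an eventual statement.\<close>
    define err where "err N = (SOME e. \<bar>e\<bar> \<le> real (n N) powr (- b) \<and> ?F N e)" for N
    have err: "\<forall>\<^sub>F N in sequentially. \<bar>err N\<bar> \<le> real (n N) powr (- b) \<and> ?F N (err N)"
      using ex
    proof eventually_elim
      case (elim N)
      then show ?case unfolding err_def by (rule someI_ex)
    qed
    have "err \<in> O[sequentially](\<lambda>N. real (n N) powr (- b))"
      using err by (intro bigoI[of _ 1]) (auto elim: eventually_mono)
    moreover have "\<forall>\<^sub>F N in sequentially. ?F N (err N)" using err by (rule eventually_mono) blast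
    ultimately show "\<exists>err. err \<in> O[sequentially](\<lambda>N. real (n N) powr (- b)) \<and>
         (\<forall>\<^sub>F N in sequentially.
           (let mm = m N; nn = n N; A = Acoef mm nn (s N);
                R = Rsum mm (s N); C = Rsum nn (t N); Y = Ysum mm nn (s N) (t N) (H N)
            in real (card (bip_graphs mm nn (s N) (t N) (H N)))
               = (\<Prod>j<mm. real ((nn - degU (H N) j) choose s N j))
                 * (\<Prod>k<nn. real ((mm - degV (H N) k) choose t N k))
                 / real ((mm * nn - Xtot (H N)) choose (\<Sum>j<mm. s N j))
                 * exp (- (1/2) * (1 - R / (2 * A * mm * nn)) * (1 - C / (2 * A * mm * nn))
                        - Y / (2 * A * mm * nn) + err N)))"
      unfolding Let_def by (intro exI[of _ err] conjI)
  qed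
qed

end
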